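(* The following limits exist: $$c_-:=\lim_{k\to\infty}\frac{\beta_k^-}{k^2},\qquad c_{\mathrm{typ}}:=\lim_{k\to\infty}\frac{\beta_k^{\mathrm{typ}}}{k^2},\qquad c_+:=\lim_{k\to\infty}\frac{\beta_k^+}{k^2}.$$ Moreover, $$c_-<c_{\mathrm{typ}}<\tfrac12<c_+.$$ Quantitatively, $$\tfrac14\le c_-\le0.48867,\qquad 0.48934\le c_{\mathrm{typ}}\le0.49967,\qquad 0.50547\le c_+\le0.50568.$$
   Context: $\Pi_k$ is the set of permutations of $[k]=\{1,\dots,k\}$. Let $X_1,X_2,\dots$ be i.i.d. uniform on $[0,1]$. For $\pi\in\Pi_k$, $\mathrm{OA}(\pi)$ is the set of sequences of stopping times $1\le\tau_1<\dots<\tau_k$ with respect to the natural filtration $\sigma(X_1,\dots,X_t)$ such that almost surely $(X_{\tau_1},\dots,X_{\tau_k})$ is order-isomorphic to $\pi$, i.e. $\pi(i)<\pi(j)\Leftrightarrow X_{\tau_i}<X_{\tau_j}$ for all $i,j\in[k]$. Define $\beta(\pi):=\inf_{(\tau_1,\dots,\tau_k)\in\mathrm{OA}(\pi)}\mathbb E[\tau_k]$ and $$\beta_k^-:=\min_{\pi\in\Pi_k}\beta(\pi),\qquad \beta_k^{\mathrm{typ}}:=\mathbb E_{\pi\sim\mathrm{Unif}(\Pi_k)}[\beta(\pi)],\qquad \beta_k^+:=\max_{\pi\in\Pi_k}\beta(\pi).$$ *)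

theory Defs
  imports "HOL-Probability.Probability"
begin

(* The observations are X 1, X 2, ...; X 0 is never used. The time index is enat because a
   stopping time that is finite almost surely may be infinite on a null event: for instance
   "the first t > 1 with X t > X 1" is infinite for the outcomes on which it never happens. *)

definition natural_filtration ::
    "'a measure \<Rightarrow> (nat \<Rightarrow> 'a \<Rightarrow> real) \<Rightarrow> enat \<Rightarrow> 'a measure" where
  "natural_filtration M X t =
     sigma (space M) {X i -` A \<inter> space M | i A. 1 \<le> i \<and> enat i \<le> t \<and> A \<in> sets borel}"

definition perms :: "nat \<Rightarrow> (nat \<Rightarrow> nat) set" where
  "perms k = {\<pi>. \<pi> permutes {1..k}}"

(* Only \<tau> 1, ..., \<tau> k matter. The relation 1 \<le> \<tau> 1 < ... < \<tau> k is read almost surely,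
   like every relation between random variables; by finiteness the_enat below is the inverse of
   the embedding of the natural numbers. *)

definition OA ::
    "'a measure \<Rightarrow> (nat \<Rightarrow> 'a \<Rightarrow> real) \<Rightarrow> nat \<Rightarrow> (nat \<Rightarrow> nat) \<Rightarrow> (nat \<Rightarrow> 'a \<Rightarrow> enat) set" where
  "OA M X k \<pi> = {\<tau>.
     (\<forall>i\<in>{1..k}. stopping_time (natural_filtration M X) (\<tau> i)) \<and>
     (AE \<omega> in M.
        (\<forall>i\<in>{1..k}. 1 \<le> \<tau> i \<omega> \<and> \<tau> i \<omega> < \<infinity>) \<and>
        strict_mono_on {1..k} (\<lambda>i. \<tau> i \<omega>) \<and>
        (\<forall>i\<in>{1..k}. \<forall>j\<in>{1..k}.
           \<pi> i < \<pi> j \<longleftrightarrow> X (the_enat (\<tau> i \<omega>)) \<omega> < X (the_enat (\<tau> j \<omega>)) \<omega>))}"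

definition beta ::
    "'a measure \<Rightarrow> (nat \<Rightarrow> 'a \<Rightarrow> real) \<Rightarrow> nat \<Rightarrow> (nat \<Rightarrow> nat) \<Rightarrow> ennreal" where
  "beta M X k \<pi> = (INF \<tau>\<in>OA M X k \<pi>. \<integral>\<^sup>+ \<omega>. ennreal_of_enat (\<tau> k \<omega>) \<partial>M)"

definition beta_minus :: "'a measure \<Rightarrow> (nat \<Rightarrow> 'a \<Rightarrow> real) \<Rightarrow> nat \<Rightarrow> ennreal" where
  "beta_minus M X k = Min (beta M X k ` perms k)"

definition beta_typ :: "'a measure \<Rightarrow> (nat \<Rightarrow> 'a \<Rightarrow> real) \<Rightarrow> nat \<Rightarrow> ennreal" where
  "beta_typ M X k = (\<integral>\<^sup>+ \<pi>. beta M X k \<pi> \<partial>measure_pmf (pmf_of_set (perms k)))"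

definition beta_plus :: "'a measure \<Rightarrow> (nat \<Rightarrow> 'a \<Rightarrow> real) \<Rightarrow> nat \<Rightarrow> ennreal" where
  "beta_plus M X k = Max (beta M X k ` perms k)"

end

theory Submission
  imports Defs "HOL-Real_Asymp.Real_Asymp"
begin

text \<open>The value of a pattern is a square: \<open>\<beta>(\<pi>) = S(\<pi>)\<^sup>2\<close>, where \<open>S\<close> is computed along the binary search tree that
arises by inserting \<open>\<pi>(1), \<pi>(2), \<dots>\<close>. Once some letters have received their values, each gap between neighbouring values
waits for its own block of letters, and the gaps do not interact. By scaling, a block costs \<open>S\<^sup>2 / l\<close> in a gap of length
\<open>l\<close>. If the first letter of a block is put at the fraction \<open>x\<close> of a unit gap, the two remaining blocks cost
\<open>s\<^sup>2 / x + t\<^sup>2 / (1 - x)\<close>, and optimal stopping accepts exactly those \<open>x\<close> for which this is at most the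
present cost \<open>v\<close>; since one observation costs 1, \<open>v\<close> solves \<open>\<integral> (v - s\<^sup>2 / x - t\<^sup>2 / (1 - x))\<^sup>+ dx = 1\<close>.
Write \<open>v = (s + t + T)\<^sup>2\<close>. The set where the integrand exceeds a level is an interval whose length is explicit, so
a layer-cake computation turns the equation into \<open>J(T) = 1\<close> for the integral \<open>J\<close> of \<open>toll_density s t\<close>
(\<open>nn_integral_join_root\<close>). The solution \<open>T = toll s t\<close> lies between 0 and 1, decreases in \<open>s\<close> and
\<open>t\<close>, and \<open>join_root s t = s + t + toll s t\<close> increases. That the value is indeed \<open>S\<^sup>2\<close> follows
from the potential \<open>cost_to_go\<close>, the sum of \<open>S\<^sup>2 / l\<close> over the gaps: one observation lowers it in expectation by at most 1
(\<open>opt_value_le\<close>), and by exactly 1 under the threshold strategy (\<open>threshold_value\<close>).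

Hence the theorem is about trees with tolls in \<open>[0, 1]\<close>. The smallest root \<open>min_root k\<close> of a tree with \<open>k\<close>
nodes is subadditive up to a shift, the largest one superadditive, so Fekete's lemma yields both extreme limits. A random
permutation gives a random search tree, for which the mean of \<open>S\<close> satisfies the quicksort recurrence with toll
\<open>mean_toll\<close>; its solution grows linearly with the rate \<open>typ_rate\<close>, and the variance is of smaller order.
So \<open>c_typ = typ_rate\<^sup>2\<close>.

It remains to estimate three linear rates. For large arguments the toll is close to \<open>\<kappa> (1/s + 1/t)\<^sup>1\<^sup>/\<^sup>3\<close>
with \<open>\<kappa>\<^sup>3 = 9/128\<close>; two-sided refinements of this (\<open>toll_le_test\<close>, \<open>toll_ge_test\<close>) reduce an inequality between a toll
and a rational number to an inequality between integers.
The smallest rate is at least 1/2, as the toll at an empty subtree is at least 7/10, and at most .699045, as one sees by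
adding two nodes at a time to a large tree. The largest rate is bounded below by a path of 13 nodes followed by ten
doublings, and above by the potential \<open>s + \<lambda> s\<^sup>-\<^sup>1\<^sup>/\<^sup>3\<close>, which is subadditive under \<open>join_root\<close> for
a suitable \<open>\<lambda>\<close>. For the typical rate, which is a weighted sum of mean tolls, monotonicity of the toll turns upper bounds
for roots into lower bounds for mean tolls and vice versa: the initial terms come from integer tables, the tail of
the lower bound from balanced pairs, and the tail of the upper bound from the approximation by cube roots, which
leads to a Beta integral.\<close>

section \<open>The toll of a pair\<close>
text \<open>The derivative of \<open>\<integral> ((s+t+T)\<^sup>2 - s\<^sup>2/x - t\<^sup>2/(1-x))\<^sup>+ dx\<close> with respect to \<open>T\<close>: twice
\<open>s+t+T\<close> times the length of the interval on which the integrand is positive.\<close>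

definition toll_density :: "real \<Rightarrow> real \<Rightarrow> real \<Rightarrow> real" where
  "toll_density s t x = 2 * sqrt (x * (x + 2* s) * (x + 2* t) * (x + 2*(s+t))) / (x + (s+t))"

text \<open>The lower bound \<open>2x\<close> makes the integral of the density at least \<open>T\<^sup>2\<close>; it gives strict monotonicity in
\<open>T\<close>, hence uniqueness of the toll, and \<open>toll \<le> 1\<close>.\<close>

lemma toll_density_ge:
  assumes "0 \<le> s" "0 \<le> t" "0 \<le> x"
  shows "2 * x \<le> toll_density s t x"
proof (cases "x = 0")
  case True then show ?thesis using assms by (simp add: toll_density_def)
next
  case False
  then have x: "0 < x" using assms by simp
  have "x * (x + (s+t)) = sqrt ((x * (x + (s+t)))\<^sup>2)" using assms x by simp
  also have "\<dots> \<le> sqrt (x * (x + 2* s) * (x + 2* t) * (x + 2*(s+t)))"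
  proof (rule real_sqrt_le_mono)
    have a: "x * (x + 2*(s+t)) \<le> (x + 2* s) * (x + 2* t)"
      using assms by (simp add: algebra_simps)
    have "(x * (x + (s+t)))\<^sup>2 \<le> (x * (x + 2*(s+t)))\<^sup>2"
      using assms x by (intro power_mono mult_left_mono) auto
    also have "\<dots> = x * (x * (x + 2*(s+t))) * (x + 2*(s+t))" by (simp add: power2_eq_square)
    also have "\<dots> \<le> x * ((x + 2* s) * (x + 2* t)) * (x + 2*(s+t))"
      using assms x a by (intro mult_right_mono mult_left_mono) auto
    finally show "(x * (x + (s+t)))\<^sup>2 \<le> x * (x + 2* s) * (x + 2* t) * (x + 2*(s+t))"
      by (simp add: mult.assoc)
  qed
  finally show ?thesis
    using assms x by (simp add: toll_density_def pos_le_divide_eq mult.assoc)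
qed

lemma continuous_on_toll_density:
  assumes "0 \<le> s" "0 \<le> t"
  shows "continuous_on {0..} (toll_density s t)"
proof (cases "s + t = 0")
  case True
  then have "s = 0" "t = 0" using assms by auto
  have e: "toll_density s t x = 2 * x" if "x \<in> {0..}" for x
  proof -
    have "x * x * x * x = (x * x)\<^sup>2" by (simp add: power2_eq_square mult.assoc)
    then have "sqrt (x * x * x * x) = x * x" by (simp add: real_sqrt_abs)
    then show ?thesis using that \<open>s = 0\<close> \<open>t = 0\<close>
      by (simp add: toll_density_def)
  qed
  have "continuous_on {0..} (\<lambda>x::real. 2 * x)" by (intro continuous_intros)
  then show ?thesis by (simp add: e cong: continuous_on_cong_simp)
next
  case False
  then have "0 < s + t" using assms by simp
  then have nz: "x + (s + t) \<noteq> 0" if "x \<in> {0..}" for x using that by auto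
  show ?thesis unfolding toll_density_def
    using nz by (intro continuous_intros) blast
qed

definition toll_integral :: "real \<Rightarrow> real \<Rightarrow> real \<Rightarrow> real" where
  "toll_integral s t T = integral {0..T} (toll_density s t)"

lemma toll_density_integrable:
  assumes "0 \<le> s" "0 \<le> t" "0 \<le> a"
  shows "toll_density s t integrable_on {a..b}"
  by (rule integrable_continuous_interval, rule continuous_on_subset[OF continuous_on_toll_density])
     (use assms in auto)

lemma toll_integral_diff_ge:
  assumes "0 \<le> s" "0 \<le> t" "0 \<le> x" "x \<le> y"
  shows "y\<^sup>2 - x\<^sup>2 \<le> toll_integral s t y - toll_integral s t x"
proof -
  have "toll_integral s t x + integral {x..y} (toll_density s t) = toll_integral s t y"
    unfolding toll_integral_def using assms
    by (intro Henstock_Kurzweil_Integration.integral_combine toll_density_integrable) auto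
  moreover have "integral {x..y} (\<lambda>u. 2 * u) \<le> integral {x..y} (toll_density s t)"
    using assms by (intro integral_le toll_density_integrable toll_density_ge
        integrable_continuous_interval continuous_intros) auto
  moreover have I: "((\<lambda>u. 2 * u) has_integral (y\<^sup>2 - x\<^sup>2)) {x..y}"
    using assms by (intro fundamental_theorem_of_calculus)
      (auto intro!: derivative_eq_intros simp: has_real_derivative_iff_has_vector_derivative[symmetric])
  have "integral {x..y} (\<lambda>u. 2 * u) = y\<^sup>2 - x\<^sup>2" using I by (rule integral_unique)
  ultimately show ?thesis by linarith
qed

lemma toll_integral_0 [simp]: "toll_integral s t 0 = 0"
  by (simp add: toll_integral_def)

lemma toll_unique: 
  assumes "0 \<le> s" "0 \<le> t"
  shows "\<exists>!T. 0 \<le> T \<and> toll_integral s t T = 1"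
proof -
  have c: "continuous_on {0..1} (toll_integral s t)"
    unfolding toll_integral_def
    by (rule indefinite_integral_continuous_1) (use assms in \<open>simp add: toll_density_integrable\<close>)
  have "1 \<le> toll_integral s t 1" using toll_integral_diff_ge[OF assms, of 0 1] by simp
  then obtain T where T: "0 \<le> T" "T \<le> 1" "toll_integral s t T = 1"
    using IVT'[of "toll_integral s t" 0 1 1] c by auto
  moreover have "T' = T''" if "0 \<le> T'" "toll_integral s t T' = 1" "0 \<le> T''" "toll_integral s t T'' = 1" for T' T''
  proof -
    have *: "\<not> a < b" if "0 \<le> a" "toll_integral s t a = 1" "0 \<le> b" "toll_integral s t b = 1" for a b
    proof
      assume "a < b"
      then have "a\<^sup>2 < b\<^sup>2" using that by (intro power_strict_mono) auto
      with toll_integral_diff_ge[OF assms, of a b] that \<open>a < b\<close> show False by simp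
    qed
    show ?thesis using *[of T' T''] *[of T'' T'] that by force
  qed
  ultimately show ?thesis by blast
qed

definition toll :: "real \<Rightarrow> real \<Rightarrow> real" where
  "toll s t = (THE T. 0 \<le> T \<and> toll_integral s t T = 1)"

lemma
  assumes "0 \<le> s" "0 \<le> t"
  shows toll_nonneg: "0 \<le> toll s t" and toll_integral_toll: "toll_integral s t (toll s t) = 1"
  using theI'[OF toll_unique[OF assms]] by (auto simp: toll_def)

lemma toll_le:
  assumes "0 \<le> s" "0 \<le> t" "0 \<le> x" "1 \<le> toll_integral s t x"
  shows "toll s t \<le> x"
proof (rule ccontr)
  assume n: "\<not> ?thesis"
  then have "x\<^sup>2 < (toll s t)\<^sup>2" using assms by (intro power_strict_mono) auto
  with toll_integral_diff_ge[OF assms(1,2,3), of "toll s t"] toll_integral_toll[OF assms(1,2)] assms n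
  show False by simp
qed

lemma toll_ge:
  assumes "0 \<le> s" "0 \<le> t" "toll_integral s t x \<le> 1"
  shows "x \<le> toll s t"
proof (rule ccontr)
  assume n: "\<not> ?thesis"
  have T: "0 \<le> toll s t" using assms toll_nonneg by simp
  then have "(toll s t)\<^sup>2 < x\<^sup>2" using n by (intro power_strict_mono) auto
  with toll_integral_diff_ge[OF assms(1,2) T, of x] toll_integral_toll[OF assms(1,2)] assms n
  show False by simp
qed

lemma toll_le_1: "0 \<le> s \<Longrightarrow> 0 \<le> t \<Longrightarrow> toll s t \<le> 1"
  using toll_integral_diff_ge[of s t 0 1] by (intro toll_le) auto

lemma toll_density_commute: "toll_density s t = toll_density t s"
  by (rule ext) (simp add: toll_density_def algebra_simps)

lemma toll_commute: "toll s t = toll t s"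
  by (simp add: toll_def toll_integral_def toll_density_commute[of s t])

text \<open>Comparing densities with a function of known integral is how all estimates of tolls are obtained.\<close>

lemma toll_integral_le:
  assumes "0 \<le> s" "0 \<le> t" "0 \<le> T" "(g has_integral I) {0..T}" "\<And>x. 0 < x \<Longrightarrow> x \<le> T \<Longrightarrow> toll_density s t x \<le> g x"
    "toll_density s t 0 \<le> g 0"
  shows "toll_integral s t T \<le> I"
proof -
  have "(toll_density s t has_integral toll_integral s t T) {0..T}"
    unfolding toll_integral_def using assms by (intro integrable_integral toll_density_integrable) auto
  then show ?thesis using assms(4)
    by (rule has_integral_le) (use assms in \<open>metis atLeastAtMost_iff less_eq_real_def\<close>)
qed

lemma toll_integral_ge:
  assumes "0 \<le> s" "0 \<le> t" "0 \<le> T" "(g has_integral I) {0..T}" "\<And>x. 0 \<le> x \<Longrightarrow> x \<le> T \<Longrightarrow> g x \<le> toll_density s t x"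
  shows "I \<le> toll_integral s t T"
proof -
  have "(toll_density s t has_integral toll_integral s t T) {0..T}"
    unfolding toll_integral_def using assms by (intro integrable_integral toll_density_integrable) auto
  with assms(4) show ?thesis
    by (rule has_integral_le) (use assms in auto)
qed

text \<open>The density increases with \<open>s\<close>, so its integral reaches 1 earlier.\<close>

lemma toll_antimono_left:
  assumes "0 \<le> s" "s \<le> s'" "0 \<le> t"
  shows "toll s' t \<le> toll s t"
proof (rule toll_le)
  define T where "T = toll s t"
  have T: "0 \<le> T" using assms toll_nonneg[of s t] by (simp add: T_def)
  have d: "toll_density s t x \<le> toll_density s' t x" if x: "0 \<le> x" for x
  proof (cases "x = 0 \<or> s' = s")
    case True then show ?thesis by (auto simp: toll_density_def)
  next
    case False
    then have x0: "0 < x" "s < s'" using x assms by auto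
    let ?f = "\<lambda>s. (x + 2* s) * (x + 2*(s+t)) / (x + (s+t))\<^sup>2"
    have f: "?f s \<le> ?f s'"
    proof -
      have nz: "x + (u + t) > 0" if "s \<le> u" for u using that x0 assms by simp
      have "\<exists>D. (?f has_real_derivative D) (at u) \<and> 0 \<le> D" if u: "s \<le> u" "u \<le> s'" for u
      proof -
        define P where "P = x + (u + t)"
        have P: "0 < P" using nz u by (simp add: P_def)
        have "(?f has_real_derivative
           ((2 * (x + 2*(u+t)) + 2 * (x + 2* u)) * P\<^sup>2 - (x + 2* u) * (x + 2*(u+t)) * (2 * P)) / (P\<^sup>2 * P\<^sup>2)) (at u)"
          unfolding P_def using P[unfolded P_def]
          by (auto intro!: derivative_eq_intros simp: algebra_simps)
        moreover have "(2 * (x + 2*(u+t)) + 2 * (x + 2* u)) * P\<^sup>2 - (x + 2* u) * (x + 2*(u+t)) * (2 * P)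
            = 2 * P * ((x + t)\<^sup>2 + 2 * u * (x+t) + t\<^sup>2)"
          unfolding P_def by (simp add: algebra_simps power2_eq_square)
        moreover have "0 \<le> 2 * P * ((x + t)\<^sup>2 + 2 * u * (x+t) + t\<^sup>2)"
          using assms u x0 P by (intro mult_nonneg_nonneg add_nonneg_nonneg) auto
        ultimately show ?thesis by (intro exI conjI) (assumption, simp)
      qed
      then show ?thesis using x0 by (intro DERIV_nonneg_imp_nondecreasing[of s s' ?f]) auto
    qed
    have e: "toll_density u t x = 2 * sqrt (x * (x + 2* t) * ?f u)" if "0 \<le> u" for u
    proof -
      have "x * (x + 2 * t) * ?f u = x * (x + 2 * u) * (x + 2 * t) * (x + 2 * (u+t)) / (x + (u+t))\<^sup>2"
        by (simp add: mult_ac)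
      then have "sqrt (x * (x + 2 * t) * ?f u) = sqrt (x * (x + 2 * u) * (x + 2 * t) * (x + 2 * (u+t))) / sqrt ((x + (u+t))\<^sup>2)"
        by (simp only: real_sqrt_divide)
      then show ?thesis using that x0 assms by (simp add: toll_density_def)
    qed
    have "sqrt (x * (x + 2* t) * ?f s) \<le> sqrt (x * (x + 2* t) * ?f s')"
      using x0 assms f by (intro real_sqrt_le_mono mult_left_mono) auto
    then show ?thesis using assms by (simp add: e)
  qed
  have "(toll_density s t has_integral 1) {0..T}"
    using toll_integral_toll[of s t] toll_density_integrable[of s t 0 T] assms
    unfolding T_def toll_integral_def by (metis integrable_integral order_refl)
  then show "1 \<le> toll_integral s' t (toll s t)"
    using assms T d unfolding T_def[symmetric] by (intro toll_integral_ge) auto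
qed (use assms toll_nonneg in auto)

lemma toll_antimono:
  assumes "0 \<le> s" "s \<le> s'" "0 \<le> t" "t \<le> t'"
  shows "toll s' t' \<le> toll s t"
proof -
  have "toll s' t' \<le> toll s t'" using assms by (intro toll_antimono_left) auto
  also have "\<dots> \<le> toll s t" using toll_antimono_left[of t t' s] assms by (simp add: toll_commute)
  finally show ?thesis .
qed

text \<open>For a fixed sum the density depends on the arguments only through \<open>(x + 2s) (x + 2t)\<close>, which is largest for
\<open>s = t\<close>.\<close>

lemma toll_balanced_le:
  assumes "0 \<le> s" "0 \<le> t"
  shows "toll ((s+t)/2) ((s+t)/2) \<le> toll s t"
proof (rule toll_le)
  have T: "0 \<le> toll s t" using assms toll_nonneg by auto
  have i: "(toll_density s t has_integral 1) {0..toll s t}"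
    using toll_integral_toll[OF assms] toll_density_integrable[OF assms, of 0 "toll s t"]
    unfolding toll_integral_def by (metis integrable_integral order_refl)
  show "1 \<le> toll_integral ((s+t)/2) ((s+t)/2) (toll s t)"
  proof (rule toll_integral_ge[OF _ _ T i])
    fix x assume x: "0 \<le> x" "x \<le> toll s t"
    have m: "x + 2 * ((s+t)/2) = x + (s+t)" "x + 2 * ((s+t)/2 + (s+t)/2) = x + 2 * (s+t)"
      by (simp_all add: field_simps)
    have "(x + 2* s) * (x + 2* t) \<le> (x + (s+t)) * (x + (s+t))"
      using zero_le_square[of "s - t"] by (simp add: algebra_simps)
    then have "x * (x + 2*(s+t)) * ((x + 2* s) * (x + 2* t)) \<le> x * (x + 2*(s+t)) * ((x + (s+t)) * (x + (s+t)))"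
      using x assms by (intro mult_left_mono) auto
    then have "sqrt (x * (x + 2* s) * (x + 2* t) * (x + 2*(s+t))) \<le> sqrt (x * (x + 2*((s+t)/2)) * (x + 2*((s+t)/2)) * (x + 2*((s+t)/2+(s+t)/2)))"
      unfolding m by (simp add: mult_ac)
    then show "toll_density s t x \<le> toll_density ((s+t)/2) ((s+t)/2) x"
      using x assms unfolding toll_density_def by (auto intro!: divide_right_mono)
  qed (use assms in auto)
qed (use assms toll_nonneg in auto)

text \<open>If the two subtrees of a node have values \<open>s\<^sup>2\<close> and \<open>t\<^sup>2\<close> in a unit gap, the whole tree has the value
\<open>(join_root s t)\<^sup>2\<close>.\<close>

definition join_root :: "real \<Rightarrow> real \<Rightarrow> real" where
  "join_root s t = s + t + toll s t"

lemma join_root_commute: "join_root s t = join_root t s"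
  by (simp add: join_root_def toll_commute)

text \<open>The split at \<open>x\<close> costs at least \<open>(s + t)\<^sup>2\<close>, with equality at \<open>x = s / (s + t)\<close>; this is why the
toll is measured from \<open>s + t\<close>.\<close>

lemma split_cost_ge:
  fixes s t x :: real
  assumes "0 < x" "x < 1"
  shows "s\<^sup>2 / x + t\<^sup>2 / (1 - x) - (s+t)\<^sup>2 = (s * (1 - x) - t * x)\<^sup>2 / (x * (1 - x))"
proof -
  have "s\<^sup>2 / x + t\<^sup>2 / (1 - x) - (s+t)\<^sup>2 = (s\<^sup>2 * (1-x) + t\<^sup>2 * x - (s+t)\<^sup>2 * (x * (1-x))) / (x * (1-x))"
    using assms by (simp add: field_simps)
  also have "s\<^sup>2 * (1-x) + t\<^sup>2 * x - (s+t)\<^sup>2 * (x * (1-x)) = (s * (1 - x) - t * x)\<^sup>2"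
    by (simp add: algebra_simps power2_eq_square)
  finally show ?thesis .
qed

text \<open>The condition is quadratic in \<open>x\<close>, so the set is the interval between its two roots.\<close>

lemma split_cost_length:
  assumes st: "0 \<le> s" "0 \<le> t" and g: "0 < g" "s + t \<le> g"
  shows "emeasure lborel {x. 0 < x \<and> x < 1 \<and> s\<^sup>2 / x + t\<^sup>2 / (1 - x) \<le> g\<^sup>2}
       = ennreal (sqrt ((g\<^sup>2 - (s+t)\<^sup>2) * (g\<^sup>2 - (s-t)\<^sup>2)) / g\<^sup>2)" (is "emeasure _ ?A = _")
proof -
  define B where "B = g\<^sup>2 + s\<^sup>2 - t\<^sup>2"
  define D where "D = (g\<^sup>2 - (s+t)\<^sup>2) * (g\<^sup>2 - (s-t)\<^sup>2)"
  have D1: "D = B\<^sup>2 - 4 * g\<^sup>2 * s\<^sup>2" and D2: "D = (2 * g\<^sup>2 - B)\<^sup>2 - 4 * g\<^sup>2 * t\<^sup>2"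
    unfolding D_def B_def by (simp_all add: algebra_simps power2_eq_square)
  have gs: "(s+t)\<^sup>2 \<le> g\<^sup>2" using st g by (intro power_mono) auto
  have "(s-t)\<^sup>2 \<le> (s+t)\<^sup>2" using st by (simp add: power2_eq_square algebra_simps)
  with gs have D0: "0 \<le> D" unfolding D_def by (intro mult_nonneg_nonneg) auto
  have "s\<^sup>2 \<le> g\<^sup>2" "t\<^sup>2 \<le> g\<^sup>2" using st g by (auto intro!: power_mono)
  then have B: "0 \<le> B" "0 \<le> 2 * g\<^sup>2 - B"
    using zero_le_power2[of s] zero_le_power2[of t] unfolding B_def by linarith+
  have r: "sqrt D \<le> B" "sqrt D \<le> 2 * g\<^sup>2 - B"
    using B by (auto intro!: real_le_lsqrt simp: D1) (auto intro!: real_le_lsqrt simp: D2[unfolded D1])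
  define l u where "l = (B - sqrt D) / (2 * g\<^sup>2)" and "u = (B + sqrt D) / (2 * g\<^sup>2)"
  have lu: "0 \<le> l" "l \<le> u" "u \<le> 1"
    using r g D0 by (auto simp: l_def u_def divide_simps)
  have iff: "s\<^sup>2 / x + t\<^sup>2 / (1 - x) \<le> g\<^sup>2 \<longleftrightarrow> l \<le> x \<and> x \<le> u" if x: "0 < x" "x < 1" for x
  proof -
    have "s\<^sup>2 / x + t\<^sup>2 / (1 - x) \<le> g\<^sup>2 \<longleftrightarrow> (s\<^sup>2 * (1-x) + t\<^sup>2 * x) / (x * (1-x)) \<le> g\<^sup>2"
      using x by (simp add: field_simps)
    also have "\<dots> \<longleftrightarrow> s\<^sup>2 * (1-x) + t\<^sup>2 * x \<le> g\<^sup>2 * (x * (1-x))"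
      using x by (simp add: pos_divide_le_eq)
    also have "\<dots> \<longleftrightarrow> 4 * g\<^sup>2 * (s\<^sup>2 * (1-x) + t\<^sup>2 * x) \<le> 4 * g\<^sup>2 * (g\<^sup>2 * (x * (1-x)))"
      by (rule mult_le_cancel_left_pos[symmetric]) (use g in simp)
    also have "\<dots> \<longleftrightarrow> (2 * g\<^sup>2 * x - B)\<^sup>2 \<le> D"
      unfolding D1 B_def by (simp add: algebra_simps power2_eq_square)
    also have "\<dots> \<longleftrightarrow> \<bar>2 * g\<^sup>2 * x - B\<bar> \<le> sqrt D"
      by (subst real_sqrt_le_iff[symmetric]) (simp only: real_sqrt_abs)
    also have "\<dots> \<longleftrightarrow> l \<le> x \<and> x \<le> u"
      proof -
      have "l \<le> x \<longleftrightarrow> B - sqrt D \<le> x * (2 * g\<^sup>2)" "x \<le> u \<longleftrightarrow> x * (2 * g\<^sup>2) \<le> B + sqrt D"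
        using g by (simp_all add: l_def u_def pos_divide_le_eq pos_le_divide_eq)
      then show ?thesis by (auto simp: abs_le_iff mult.commute)
    qed
    finally show ?thesis .
  qed
  have A: "?A = {l..u} - {0, 1}" using iff lu by auto
  have "emeasure lborel ({l..u} - {0, 1}) = emeasure lborel {l..u}"
    by (rule emeasure_Diff_null_set) (auto intro!: finite_imp_null_set_lborel)
  also have "\<dots> = ennreal (u - l)" using lu by simp
  also have "u - l = sqrt D / g\<^sup>2" by (simp add: u_def l_def diff_divide_distrib[symmetric])
  finally show ?thesis by (simp add: A D_def)
qed

lemma toll_density_eq:
  assumes st: "0 \<le> s" "0 \<le> t" and x: "0 < x"
  shows "toll_density s t x = 2 * (s+t+x) * (sqrt (((s+t+x)\<^sup>2 - (s+t)\<^sup>2) * ((s+t+x)\<^sup>2 - (s-t)\<^sup>2)) / (s+t+x)\<^sup>2)"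
proof -
  define P where "P = s+t+x"
  have P: "0 < P" "x + (s+t) = P" using assms by (simp_all add: P_def)
  define Q where "Q = x * (x + 2 * s) * (x + 2 * t) * (x + 2 * (s+t))"
  have N: "(P\<^sup>2 - (s+t)\<^sup>2) * (P\<^sup>2 - (s-t)\<^sup>2) = Q"
    unfolding P_def Q_def by (simp add: algebra_simps power2_eq_square)
  have "toll_density s t x = 2 * sqrt Q / P" by (simp only: toll_density_def Q_def P)
  also have "\<dots> = 2 * P * (sqrt Q / P\<^sup>2)" using P(1) by (simp add: power2_eq_square)
  finally show ?thesis unfolding N[symmetric] P_def .
qed

text \<open>Layer-cake: the positive part of \<open>\<lambda>\<^sup>2 - f(x)\<close> is the integral of \<open>2 \<sigma>\<close> over the levels
\<open>\<sigma>\<close> with \<open>f(x) \<le> \<sigma>\<^sup>2 \<le> \<lambda>\<^sup>2\<close>; exchange the integrals and insert the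
lengths of the level sets.\<close>

lemma nn_integral_split_cost:
  assumes st: "0 \<le> s" "0 \<le> t" and T: "0 \<le> T"
  shows "(\<integral>\<^sup>+ x\<in>{0<..<1}. ennreal ((s+t+T)\<^sup>2 - (s\<^sup>2 / x + t\<^sup>2 / (1 - x))) \<partial>lborel) = ennreal (toll_integral s t T)"
proof -
  define f where "f x = s\<^sup>2 / x + t\<^sup>2 / (1 - x)" for x
  define K where "K x \<tau> = (ennreal (2 * (s+t+\<tau>)) * indicator {0..T} \<tau>) * indicator {x. 0 < x \<and> x < 1 \<and> f x \<le> (s+t+\<tau>)\<^sup>2} x" for x \<tau>
  have K[measurable]: "case_prod K \<in> borel_measurable (lborel \<Otimes>\<^sub>M lborel)"
    unfolding K_def f_def indicator_def by measurable
  have 1: "(\<integral>\<^sup>+ \<tau>. K x \<tau> \<partial>lborel) = ennreal ((s+t+T)\<^sup>2 - f x) * indicator {0<..<1} x" for x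
  proof (cases "0 < x \<and> x < 1")
    case True
    have fx: "(s+t)\<^sup>2 \<le> f x"
      using split_cost_ge[of x s t] True unfolding f_def
      by (metis diff_ge_0_iff_ge divide_nonneg_pos mult_pos_pos diff_gt_0_iff_gt zero_le_power2)
    define c where "c = sqrt (f x) - (s+t)"
    have c0: "0 \<le> c" using real_sqrt_le_mono[OF fx] st by (simp add: c_def)
    have fc: "f x = (s+t+c)\<^sup>2" using fx by (simp add: c_def order_trans[OF zero_le_power2])
    have iff: "f x \<le> (s+t+\<tau>)\<^sup>2 \<longleftrightarrow> c \<le> \<tau>" if "0 \<le> \<tau>" for \<tau>
      unfolding fc using that c0 st by (subst power_mono_iff) auto
    have "(\<integral>\<^sup>+ \<tau>. K x \<tau> \<partial>lborel) = (\<integral>\<^sup>+ \<tau>. ennreal (2 * (s+t+\<tau>)) * indicator {c..T} \<tau> \<partial>lborel)"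
      unfolding K_def using True c0 by (intro nn_integral_cong) (auto simp: indicator_def iff)
    also have "\<dots> = ennreal ((s+t+T)\<^sup>2 - (s+t+c)\<^sup>2)"
    proof (cases "c \<le> T")
      case True
      show ?thesis
        by (rule nn_integral_FTC_Icc) (use True c0 st in \<open>auto intro!: derivative_eq_intros\<close>)
    next
      case False
      then have "(s+t+T)\<^sup>2 \<le> (s+t+c)\<^sup>2" using st T by (intro power_mono) auto
      then show ?thesis using False by (simp add: ennreal_neg)
    qed
    finally show ?thesis using True by (simp add: fc)
  qed (auto simp: K_def)
  have 2: "(\<integral>\<^sup>+ x. K x \<tau> \<partial>lborel) = ennreal (indicator {0..T} \<tau> * toll_density s t \<tau>)" for \<tau>
  proof (cases "0 \<le> \<tau> \<and> \<tau> \<le> T \<and> 0 < s + t + \<tau>")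
    case True
    have m: "{x. 0 < x \<and> x < 1 \<and> f x \<le> (s+t+\<tau>)\<^sup>2} \<in> sets lborel" unfolding f_def by measurable
    define L where "L = sqrt (((s+t+\<tau>)\<^sup>2 - (s+t)\<^sup>2) * ((s+t+\<tau>)\<^sup>2 - (s-t)\<^sup>2)) / (s+t+\<tau>)\<^sup>2"
    have L: "emeasure lborel {x. 0 < x \<and> x < 1 \<and> f x \<le> (s+t+\<tau>)\<^sup>2} = ennreal L"
      unfolding f_def L_def by (rule split_cost_length) (use True st in auto)
    have "(\<integral>\<^sup>+ x. K x \<tau> \<partial>lborel) = ennreal (2 * (s+t+\<tau>)) * ennreal L"
      unfolding K_def L[symmetric] using True m by (simp add: nn_integral_cmult_indicator)
    also have "\<dots> = ennreal (2 * (s+t+\<tau>) * L)"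
      by (rule ennreal_mult'[symmetric]) (use True in simp)
    also have "\<dots> = ennreal (toll_density s t \<tau>)"
    proof (cases "\<tau> = 0")
      case False
      then have "toll_density s t \<tau> = 2 * (s+t+\<tau>) * L" unfolding L_def using True st by (intro toll_density_eq) auto
      then show ?thesis by simp
    qed (simp add: toll_density_def L_def)
    finally show ?thesis using True by simp
  next
    case False
    then show ?thesis
    proof (cases "0 \<le> \<tau> \<and> \<tau> \<le> T")
      case True
      then have "\<tau> = 0" "s + t + \<tau> = 0" using False st by auto
      then show ?thesis by (simp add: K_def toll_density_def)
    qed (auto simp: K_def)
  qed
  have "(\<integral>\<^sup>+ x\<in>{0<..<1}. ennreal ((s+t+T)\<^sup>2 - f x) \<partial>lborel) = (\<integral>\<^sup>+ x. \<integral>\<^sup>+ \<tau>. K x \<tau> \<partial>lborel \<partial>lborel)"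
    by (simp add: 1)
  also have "\<dots> = (\<integral>\<^sup>+ \<tau>. \<integral>\<^sup>+ x. K x \<tau> \<partial>lborel \<partial>lborel)"
    by (rule lborel_pair.Fubini'[symmetric]) (use K in simp)
  also have "\<dots> = (\<integral>\<^sup>+ \<tau>. ennreal (indicator {0..T} \<tau> * toll_density s t \<tau>) \<partial>lborel)"
    by (simp add: 2)
  also have "\<dots> = ennreal (toll_integral s t T)"
  proof (rule nn_integral_has_integral_lborel)
    show "(\<lambda>\<tau>. indicator {0..T} \<tau> * toll_density s t \<tau>) \<in> borel_measurable borel"
      unfolding toll_density_def by measurable
    show "0 \<le> indicator {0..T} \<tau> * toll_density s t \<tau>" for \<tau>
      using toll_density_ge[OF st, of \<tau>] by (auto simp: indicator_def)
    have "(toll_density s t has_integral toll_integral s t T) {0..T}"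
      unfolding toll_integral_def using st by (intro integrable_integral toll_density_integrable) auto
    then have "((\<lambda>x. if x \<in> {0..T} then toll_density s t x else 0) has_integral toll_integral s t T) UNIV"
      by (simp only: has_integral_restrict_UNIV)
    then show "((\<lambda>\<tau>. indicator {0..T} \<tau> * toll_density s t \<tau>) has_integral toll_integral s t T) UNIV"
      by (rule has_integral_eq[rotated]) (auto simp: indicator_def)
  qed
  finally show ?thesis unfolding f_def .
qed

lemma join_root_nonneg: "0 \<le> s \<Longrightarrow> 0 \<le> t \<Longrightarrow> 0 \<le> join_root s t"
  using toll_nonneg[of s t] by (simp add: join_root_def)

lemma nn_integral_join_root:
  assumes "0 \<le> s" "0 \<le> t"
  shows "(\<integral>\<^sup>+ x\<in>{0<..<1}. ennreal ((join_root s t)\<^sup>2 - (s\<^sup>2 / x + t\<^sup>2 / (1 - x))) \<partial>lborel) = 1"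
  using nn_integral_split_cost[OF assms toll_nonneg[OF assms]] toll_integral_toll[OF assms]
  by (simp add: join_root_def)

text \<open>The toll decreases in its arguments, so monotonicity is read off from the optimality equation: a larger split cost has
a smaller excess.\<close>

lemma join_root_mono:
  assumes "0 \<le> s" "s \<le> s'" "0 \<le> t" "t \<le> t'"
  shows "join_root s t \<le> join_root s' t'"
proof -
  have st': "0 \<le> s'" "0 \<le> t'" using assms by auto
  define T where "T = join_root s' t' - (s + t)"
  have T: "0 \<le> T" "s + t + T = join_root s' t'" using toll_nonneg[OF st'] assms by (auto simp: T_def join_root_def)
  have "1 = (\<integral>\<^sup>+ x\<in>{0<..<1}. ennreal ((join_root s' t')\<^sup>2 - (s'\<^sup>2 / x + t'\<^sup>2 / (1 - x))) \<partial>lborel)"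
    using nn_integral_join_root[OF st'] by simp
  also have "\<dots> \<le> (\<integral>\<^sup>+ x\<in>{0<..<1}. ennreal ((s+t+T)\<^sup>2 - (s\<^sup>2 / x + t\<^sup>2 / (1 - x))) \<partial>lborel)"
    unfolding T(2) using assms
    by (intro nn_integral_mono)
       (auto simp: indicator_def intro!: ennreal_leI diff_left_mono add_mono divide_right_mono power_mono)
  also have "\<dots> = ennreal (toll_integral s t T)" using assms T(1) by (intro nn_integral_split_cost) auto
  finally have "1 \<le> toll_integral s t T" by simp
  then have "toll s t \<le> T" using assms T by (intro toll_le) auto
  then show ?thesis by (simp add: T_def join_root_def)
qed

section \<open>The cost still to be paid\<close>
text \<open>The list is the order in which the letters of a block are observed; its head is the root of the search tree.\<close>

function bst_root :: "nat list \<Rightarrow> real" where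
  "bst_root [] = 0"
| "bst_root (r # rs) = join_root (bst_root (filter (\<lambda>x. x < r) rs)) (bst_root (filter (\<lambda>x. r < x) rs))"
  by pat_completeness auto
termination by (relation "Wellfounded.measure length") (auto simp: le_imp_less_Suc)

lemma bst_root_nonneg: "0 \<le> bst_root xs"
  by (induction xs rule: bst_root.induct) (auto simp: join_root_nonneg)

text \<open>The letters of the first list have received their values \<open>y\<close>, those of the second are still to come, and
\<open>lo\<close> and \<open>hi\<close> are the letters at the ends of the current gap.\<close>

function remaining_cost :: "nat list \<Rightarrow> nat list \<Rightarrow> nat \<Rightarrow> nat \<Rightarrow> (nat \<Rightarrow> real) \<Rightarrow> real" where
  "remaining_cost [] rs lo hi y = (bst_root rs)\<^sup>2 / (y hi - y lo)"
| "remaining_cost (p # ps) rs lo hi y =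
     remaining_cost (filter (\<lambda>x. x < p) ps) (filter (\<lambda>x. x < p) rs) lo p y
   + remaining_cost (filter (\<lambda>x. p < x) ps) (filter (\<lambda>x. p < x) rs) p hi y"
  by pat_completeness auto
termination by (relation "Wellfounded.measure (\<lambda>(ps, rs, lo, hi, y). length ps)") (auto simp: le_imp_less_Suc)

lemma remaining_cost_cong:
  assumes "\<And>q. q \<in> {lo, hi} \<union> set ps \<Longrightarrow> y q = z q"
  shows "remaining_cost ps rs lo hi y = remaining_cost ps rs lo hi z"
  using assms
proof (induction ps rs lo hi y rule: remaining_cost.induct)
  case (2 p ps rs lo hi y)
  have "remaining_cost (filter (\<lambda>x. x < p) ps) (filter (\<lambda>x. x < p) rs) lo p y
      = remaining_cost (filter (\<lambda>x. x < p) ps) (filter (\<lambda>x. x < p) rs) lo p z"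
    by (rule 2(1)) (use 2(3) in auto)
  moreover have "remaining_cost (filter (\<lambda>x. p < x) ps) (filter (\<lambda>x. p < x) rs) p hi y
      = remaining_cost (filter (\<lambda>x. p < x) ps) (filter (\<lambda>x. p < x) rs) p hi z"
    by (rule 2(2)) (use 2(3) in auto)
  ultimately show ?case by simp
qed simp

lemma remaining_cost_nonneg:
  assumes "strict_mono_on ({lo, hi} \<union> set ps) y" "\<And>p. p \<in> set ps \<Longrightarrow> lo < p \<and> p < hi" "lo < hi"
  shows "0 \<le> remaining_cost ps rs lo hi y"
  using assms
proof (induction ps rs lo hi y rule: remaining_cost.induct)
  case (1 rs lo hi y)
  then have "y lo < y hi" by (auto simp: strict_mono_on_def)
  then show ?case by simp
next
  case (2 p ps rs lo hi y)
  have p: "lo < p" "p < hi" using 2(4) by auto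
  have "0 \<le> remaining_cost (filter (\<lambda>x. x < p) ps) (filter (\<lambda>x. x < p) rs) lo p y"
    by (rule 2(1)) (use 2(3,4) p in \<open>auto intro: monotone_on_subset\<close>)
  moreover have "0 \<le> remaining_cost (filter (\<lambda>x. p < x) ps) (filter (\<lambda>x. p < x) rs) p hi y"
    by (rule 2(2)) (use 2(3,4) p in \<open>auto intro: monotone_on_subset\<close>)
  ultimately show ?case by simp
qed

text \<open>Placing the next letter \<open>r\<close> changes a single summand, the one of the gap \<open>(l, u)\<close> that contains \<open>r\<close>;
its block is split at \<open>r\<close>.\<close>

lemma remaining_cost_split:
  assumes "\<And>p. p \<in> insert r (set ps) \<Longrightarrow> lo < p \<and> p < hi" "r \<notin> set ps"
  shows "\<exists>l u C rs'. l \<in> {lo, hi} \<union> set ps \<and> u \<in> {lo, hi} \<union> set ps \<and> l < r \<and> r < u \<and>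
     (\<forall>q\<in>{lo, hi} \<union> set ps. q \<le> l \<or> u \<le> q) \<and>
     remaining_cost ps (r # rs) lo hi y = C + (bst_root (r # rs'))\<^sup>2 / (y u - y l) \<and>
     (\<forall>x. remaining_cost (ps @ [r]) rs lo hi (y(r := x)) =
        C + ((bst_root (filter (\<lambda>x. x < r) rs'))\<^sup>2 / (x - y l) + (bst_root (filter (\<lambda>x. r < x) rs'))\<^sup>2 / (y u - x)))"
  using assms
proof (induction ps "r # rs" lo hi y arbitrary: rs rule: remaining_cost.induct)
  case (1 lo hi y)
  then show ?case by (intro exI[of _ lo] exI[of _ hi] exI[of _ 0] exI[of _ rs]) auto
next
  case (2 p ps lo hi y)
  have p: "lo < p" "p < hi" "lo < r" "r < hi" "r \<noteq> p" using 2(3,4) by auto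
  show ?case
  proof (cases "r < p")
    case True
    then have e: "filter (\<lambda>x. x < p) (r # rs) = r # filter (\<lambda>x. x < p) rs" by simp
    have H: "\<And>q. q \<in> insert r (set (filter (\<lambda>x. x < p) ps)) \<Longrightarrow> lo < q \<and> q < p" "r \<notin> set (filter (\<lambda>x. x < p) ps)"
      using True p 2(3,4) by auto
    have "\<exists>l u C rs'. l \<in> {lo, p} \<union> set (filter (\<lambda>x. x < p) ps) \<and> u \<in> {lo, p} \<union> set (filter (\<lambda>x. x < p) ps) \<and> l < r \<and> r < u \<and>
       (\<forall>q\<in>{lo, p} \<union> set (filter (\<lambda>x. x < p) ps). q \<le> l \<or> u \<le> q) \<and>
       remaining_cost (filter (\<lambda>x. x < p) ps) (r # (filter (\<lambda>x. x < p) rs)) lo p y = C + (bst_root (r # rs'))\<^sup>2 / (y u - y l) \<and>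
       (\<forall>x. remaining_cost ((filter (\<lambda>x. x < p) ps) @ [r]) (filter (\<lambda>x. x < p) rs) lo p (y(r := x)) =
        C + ((bst_root (filter (\<lambda>x. x < r) rs'))\<^sup>2 / (x - y l) + (bst_root (filter (\<lambda>x. r < x) rs'))\<^sup>2 / (y u - x)))"
      (is "\<exists>l u C rs'. ?P l u C rs'")
      by (rule 2(1)[OF e H])
    then obtain l u C rs' where "?P l u C rs'" by (elim exE) (rule that)
    then have *: "l \<in> {lo, p} \<union> set (filter (\<lambda>x. x < p) ps)" "u \<in> {lo, p} \<union> set (filter (\<lambda>x. x < p) ps)"
      "l < r" "r < u" "\<forall>q\<in>{lo, p} \<union> set (filter (\<lambda>x. x < p) ps). q \<le> l \<or> u \<le> q"
      "remaining_cost (filter (\<lambda>x. x < p) ps) (r # (filter (\<lambda>x. x < p) rs)) lo p y = C + (bst_root (r # rs'))\<^sup>2 / (y u - y l)"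
      and x: "\<And>x. remaining_cost ((filter (\<lambda>x. x < p) ps) @ [r]) (filter (\<lambda>x. x < p) rs) lo p (y(r := x)) =
        C + ((bst_root (filter (\<lambda>x. x < r) rs'))\<^sup>2 / (x - y l) + (bst_root (filter (\<lambda>x. r < x) rs'))\<^sup>2 / (y u - x))"
      by (elim conjE; blast)+
    define D where "D = remaining_cost (filter (\<lambda>x. p < x) ps) (filter (\<lambda>x. p < x) rs) p hi y"
    have D: "remaining_cost (filter (\<lambda>x. p < x) ps) (filter (\<lambda>x. p < x) rs) p hi (y(r := x)) = D" for x
      unfolding D_def by (rule remaining_cost_cong) (use 2(4) p True in auto)
    have ru: "u \<le> p" using *(2) p by auto
    show ?thesis
    proof (intro exI conjI)
      show "remaining_cost (p # ps) (r # rs) lo hi y = (C + D) + (bst_root (r # rs'))\<^sup>2 / (y u - y l)"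
        using *(6) True by (simp add: D_def del: bst_root.simps)
      show "\<forall>x. remaining_cost ((p # ps) @ [r]) rs lo hi (y(r := x)) = (C + D) +
         ((bst_root (filter (\<lambda>x. x < r) rs'))\<^sup>2 / (x - y l) + (bst_root (filter (\<lambda>x. r < x) rs'))\<^sup>2 / (y u - x))"
        using x D True by (simp del: bst_root.simps fun_upd_apply)
      show "\<forall>q\<in>{lo, hi} \<union> set (p # ps). q \<le> l \<or> u \<le> q"
      proof
        fix q assume "q \<in> {lo, hi} \<union> set (p # ps)"
        then have "q \<in> {lo, p} \<union> set (filter (\<lambda>x. x < p) ps) \<or> p \<le> q" using p by auto
        then show "q \<le> l \<or> u \<le> q" using *(5) ru by (meson order_trans)
      qed
    qed (use * p in auto)
  next
    case False
    then have pr: "p < r" using p by auto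
    then have e: "filter (\<lambda>x. p < x) (r # rs) = r # filter (\<lambda>x. p < x) rs" by simp
    have H: "\<And>q. q \<in> insert r (set (filter (\<lambda>x. p < x) ps)) \<Longrightarrow> p < q \<and> q < hi" "r \<notin> set (filter (\<lambda>x. p < x) ps)"
      using pr p 2(3,4) by auto
    have "\<exists>l u C rs'. l \<in> {p, hi} \<union> set (filter (\<lambda>x. p < x) ps) \<and> u \<in> {p, hi} \<union> set (filter (\<lambda>x. p < x) ps) \<and> l < r \<and> r < u \<and>
       (\<forall>q\<in>{p, hi} \<union> set (filter (\<lambda>x. p < x) ps). q \<le> l \<or> u \<le> q) \<and>
       remaining_cost (filter (\<lambda>x. p < x) ps) (r # (filter (\<lambda>x. p < x) rs)) p hi y = C + (bst_root (r # rs'))\<^sup>2 / (y u - y l) \<and>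
       (\<forall>x. remaining_cost ((filter (\<lambda>x. p < x) ps) @ [r]) (filter (\<lambda>x. p < x) rs) p hi (y(r := x)) =
        C + ((bst_root (filter (\<lambda>x. x < r) rs'))\<^sup>2 / (x - y l) + (bst_root (filter (\<lambda>x. r < x) rs'))\<^sup>2 / (y u - x)))"
      (is "\<exists>l u C rs'. ?P l u C rs'")
      by (rule 2(2)[OF e H])
    then obtain l u C rs' where "?P l u C rs'" by (elim exE) (rule that)
    then have *: "l \<in> {p, hi} \<union> set (filter (\<lambda>x. p < x) ps)" "u \<in> {p, hi} \<union> set (filter (\<lambda>x. p < x) ps)"
      "l < r" "r < u" "\<forall>q\<in>{p, hi} \<union> set (filter (\<lambda>x. p < x) ps). q \<le> l \<or> u \<le> q"
      "remaining_cost (filter (\<lambda>x. p < x) ps) (r # (filter (\<lambda>x. p < x) rs)) p hi y = C + (bst_root (r # rs'))\<^sup>2 / (y u - y l)"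
      and x: "\<And>x. remaining_cost ((filter (\<lambda>x. p < x) ps) @ [r]) (filter (\<lambda>x. p < x) rs) p hi (y(r := x)) =
        C + ((bst_root (filter (\<lambda>x. x < r) rs'))\<^sup>2 / (x - y l) + (bst_root (filter (\<lambda>x. r < x) rs'))\<^sup>2 / (y u - x))"
      by (elim conjE; blast)+
    define D where "D = remaining_cost (filter (\<lambda>x. x < p) ps) (filter (\<lambda>x. x < p) rs) lo p y"
    have D: "remaining_cost (filter (\<lambda>x. x < p) ps) (filter (\<lambda>x. x < p) rs) lo p (y(r := x)) = D" for x
      unfolding D_def by (rule remaining_cost_cong) (use 2(4) p pr in auto)
    have ru: "p \<le> l" using *(1) p by auto
    show ?thesis
    proof (intro exI conjI)
      show "remaining_cost (p # ps) (r # rs) lo hi y = (C + D) + (bst_root (r # rs'))\<^sup>2 / (y u - y l)"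
        using *(6) pr by (simp add: D_def del: bst_root.simps)
      show "\<forall>x. remaining_cost ((p # ps) @ [r]) rs lo hi (y(r := x)) = (C + D) +
         ((bst_root (filter (\<lambda>x. x < r) rs'))\<^sup>2 / (x - y l) + (bst_root (filter (\<lambda>x. r < x) rs'))\<^sup>2 / (y u - x))"
        using x D pr by (simp del: bst_root.simps fun_upd_apply)
      show "\<forall>q\<in>{lo, hi} \<union> set (p # ps). q \<le> l \<or> u \<le> q"
      proof
        fix q assume "q \<in> {lo, hi} \<union> set (p # ps)"
        then have "q \<in> {p, hi} \<union> set (filter (\<lambda>x. p < x) ps) \<or> q \<le> p" using p by auto
        then show "q \<le> l \<or> u \<le> q" using *(5) ru by (meson order_trans)
      qed
    qed (use * p in auto)
  qed
qed

text \<open>The new value fits the pattern exactly if it falls into the gap.\<close>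

lemma strict_mono_on_insert_between:
  fixes y :: "nat \<Rightarrow> real"
  assumes "strict_mono_on I y" "l \<in> I" "u \<in> I" "l < r" "r < u" "\<forall>q\<in>I. q \<le> l \<or> u \<le> q"
  shows "strict_mono_on (insert r I) (y(r := x)) \<longleftrightarrow> y l < x \<and> x < y u"
proof
  assume m: "strict_mono_on (insert r I) (y(r := x))"
  show "y l < x \<and> x < y u"
    using strict_mono_onD[OF m, of l r] strict_mono_onD[OF m, of r u] assms by auto
next
  assume x: "y l < x \<and> x < y u"
  have le: "y q \<le> y l" if "q \<in> I" "q \<le> l" for q
    using strict_mono_onD[OF assms(1), of q l] that assms(2) by (cases "q = l") auto
  have ge: "y u \<le> y q" if "q \<in> I" "u \<le> q" for q
    using strict_mono_onD[OF assms(1), of u q] that assms(3) by (cases "q = u") auto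
  have r: "r \<notin> I" using assms by auto
  show "strict_mono_on (insert r I) (y(r := x))"
  proof (rule strict_mono_onI)
    fix a b assume ab: "a \<in> insert r I" "b \<in> insert r I" "a < b"
    consider "a \<in> I" "b \<in> I" | "a = r" "b \<in> I" | "a \<in> I" "b = r" using ab by auto
    then show "(y(r := x)) a < (y(r := x)) b"
    proof cases
      case 1 then show ?thesis using strict_mono_onD[OF assms(1), of a b] ab r by auto
    next
      case 2
      then have "u \<le> b" using assms ab by (metis leD le_less_trans less_imp_le)
      then show ?thesis using ge[of b] 2 x r by force
    next
      case 3
      then have "a \<le> l" using assms ab by (metis leD le_less_trans less_imp_le order_trans)
      then show ?thesis using le[of a] 3 x r by force
    qed
  qed
qed

text \<open>The optimality equation, scaled from the unit interval to a gap: the factor \<open>1 / (u - l)\<close> of the costs cancels against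
the length of the gap. So a single observation has expected gain exactly 1 in every gap.\<close>

lemma nn_integral_gap:
  fixes l u :: real
  assumes "0 \<le> l" "l < u" "u \<le> 1" "0 \<le> a" "0 \<le> b"
  shows "(\<integral>\<^sup>+ x. ennreal ((join_root a b)\<^sup>2 / (u - l) - (a\<^sup>2 / (x - l) + b\<^sup>2 / (u - x))) * indicator {l<..<u} x \<partial>lborel) = 1"
proof -
  have L: "0 < u - l" using assms by simp
  have "(\<integral>\<^sup>+ x. ennreal ((join_root a b)\<^sup>2 / (u - l) - (a\<^sup>2 / (x - l) + b\<^sup>2 / (u - x))) * indicator {l<..<u} x \<partial>lborel)
      = ennreal \<bar>u - l\<bar> * (\<integral>\<^sup>+ x. ennreal ((join_root a b)\<^sup>2 / (u - l) - (a\<^sup>2 / (l + (u - l) * x - l) + b\<^sup>2 / (u - (l + (u - l) * x)))) * indicator {l<..<u} (l + (u - l) * x) \<partial>lborel)"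
    by (rule nn_integral_real_affine) (use L in auto)
  also have "\<dots> = ennreal (u - l) * (\<integral>\<^sup>+ x. ennreal (1 / (u - l)) * (ennreal ((join_root a b)\<^sup>2 - (a\<^sup>2 / x + b\<^sup>2 / (1 - x))) * indicator {0<..<1} x) \<partial>lborel)"
  proof -
    have i: "indicator {l<..<u} (l + (u - l) * x) = (indicator {0<..<1} x :: ennreal)" for x
    proof -
      have "l + (u - l) * x < u \<longleftrightarrow> (u - l) * x < (u - l) * 1" by (simp add: algebra_simps)
      also have "\<dots> \<longleftrightarrow> x < 1" using L by (subst mult_less_cancel_left_pos) auto
      finally show ?thesis using L by (simp add: indicator_def zero_less_mult_iff)
    qed
    have e: "(join_root a b)\<^sup>2 / (u - l) - (a\<^sup>2 / (l + (u - l) * x - l) + b\<^sup>2 / (u - (l + (u - l) * x)))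
       = 1 / (u - l) * ((join_root a b)\<^sup>2 - (a\<^sup>2 / x + b\<^sup>2 / (1 - x)))" if "0 < x" "x < 1" for x
    proof -
      have "u - (l + (u - l) * x) = (u - l) * (1 - x)" "l + (u - l) * x - l = (u - l) * x" by (simp_all add: algebra_simps)
      then show ?thesis using L that by (simp add: diff_divide_distrib add_divide_distrib mult.commute)
    qed
    show ?thesis unfolding i abs_of_pos[OF L]
    proof (rule arg_cong[where f = "\<lambda>z. ennreal (u - l) * z"], rule nn_integral_cong)
      fix x :: real
      show "ennreal ((join_root a b)\<^sup>2 / (u - l) - (a\<^sup>2 / (l + (u - l) * x - l) + b\<^sup>2 / (u - (l + (u - l) * x)))) * indicator {0<..<1} x
        = ennreal (1 / (u - l)) * (ennreal ((join_root a b)\<^sup>2 - (a\<^sup>2 / x + b\<^sup>2 / (1 - x))) * indicator {0<..<1} x)"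
      proof (cases "0 < x \<and> x < 1")
        case True
        then have "ennreal ((join_root a b)\<^sup>2 / (u - l) - (a\<^sup>2 / (l + (u - l) * x - l) + b\<^sup>2 / (u - (l + (u - l) * x))))
          = ennreal (1 / (u - l)) * ennreal ((join_root a b)\<^sup>2 - (a\<^sup>2 / x + b\<^sup>2 / (1 - x)))"
          by (subst e) (use L in \<open>auto intro: ennreal_mult' simp del: times_divide_eq_left\<close>)
        then show ?thesis using True by simp
      qed auto
    qed
  qed
  also have "\<dots> = ennreal (u - l) * (ennreal (1 / (u - l)) * 1)"
    using nn_integral_join_root[OF assms(4,5)] by (subst nn_integral_cmult) auto
  also have "\<dots> = 1" using L by (simp add: ennreal_mult''[symmetric])
  finally show ?thesis .
qed

section \<open>Observing one more variable\<close>
locale iid_uniform = prob_space M for M :: "'a measure" +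
  fixes X :: "nat \<Rightarrow> 'a \<Rightarrow> real"
  assumes indep: "indep_vars (\<lambda>_. borel) X {1..}"
    and uniform: "1 \<le> i \<Longrightarrow> distr M borel (X i) = uniform_measure lborel {0..1}"
begin

abbreviation "Filt t \<equiv> natural_filtration M X t"

lemma X_measurable [measurable]: "1 \<le> i \<Longrightarrow> X i \<in> borel_measurable M"
  using indep by (auto simp: indep_vars_def)

lemma space_Filt [simp]: "space (Filt t) = space M"
  and sets_Filt: "sets (Filt t) = sigma_sets (space M) {X i -` A \<inter> space M | i A. 1 \<le> i \<and> enat i \<le> t \<and> A \<in> sets borel}"
  unfolding natural_filtration_def by (auto intro!: space_measure_of sets_measure_of)

lemma sets_Filt_mono: "s \<le> t \<Longrightarrow> sets (Filt s) \<subseteq> sets (Filt t)"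
  unfolding sets_Filt by (rule sigma_sets_mono') (auto intro: order_trans)

lemma measurable_Filt_mono: "s \<le> t \<Longrightarrow> f \<in> measurable (Filt s) N \<Longrightarrow> f \<in> measurable (Filt t) N"
  using sets_Filt_mono[of s t] by (auto simp: measurable_def)

lemma subalgebra_Filt: "subalgebra M (Filt t)"
  unfolding subalgebra_def
proof
  show "sets (Filt t) \<subseteq> sets M" unfolding sets_Filt
    by (rule sets.sigma_sets_subset) (auto intro: measurable_sets)
qed simp

lemma measurable_Filt_M: "f \<in> measurable (Filt t) N \<Longrightarrow> f \<in> measurable M N"
  using measurable_from_subalg[OF subalgebra_Filt] .

lemma X_measurable_Filt: "1 \<le> i \<Longrightarrow> enat i \<le> t \<Longrightarrow> X i \<in> borel_measurable (Filt t)"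
  by (intro measurableI) (auto simp: sets_Filt intro!: sigma_sets.Basic)

lemma AE_X: "AE \<omega> in M. \<forall>t\<ge>1. 0 < X t \<omega> \<and> X t \<omega> < 1"
proof -
  have "AE \<omega> in M. 1 \<le> t \<longrightarrow> 0 < X t \<omega> \<and> X t \<omega> < 1" for t
  proof (cases "1 \<le> t")
    case True
    have "AE x in lborel. x \<in> {0..1} \<longrightarrow> 0 < x \<and> x < (1::real)"
      using AE_lborel_singleton[of 0] AE_lborel_singleton[of 1] by eventually_elim auto
    then have "AE x in distr M borel (X t). 0 < x \<and> x < 1"
      unfolding uniform[OF True] by (intro AE_uniform_measureI) auto
    then show ?thesis using True by (simp add: AE_distr_iff)
  qed simp
  then show ?thesis by (simp add: AE_all_countable)
qed

text \<open>The past and the next observation are generated by disjoint families of variables.\<close>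

lemma indep_Filt_next:
  assumes "A \<in> sets (Filt (enat t))" "B \<in> sets borel"
  shows "prob (A \<inter> (X (Suc t) -` B \<inter> space M)) = prob A * prob (X (Suc t) -` B \<inter> space M)"
proof -
  define E where "E i = {X i -` A \<inter> space M | A. A \<in> sets borel}" for i
  define I where "I b = (if b then {1..t} else {Suc t})" for b
  have E: "indep_sets E (\<Union>j\<in>UNIV. I j)"
  proof (rule indep_sets_mono_index)
    show "(\<Union>j\<in>UNIV. I j) \<subseteq> {1..}" by (auto simp: I_def split: if_splits)
    show "indep_sets E {1..}" using indep unfolding indep_vars_def2 E_def by simp
  qed
  have "indep_sets (\<lambda>j. sigma_sets (space M) (\<Union>i\<in>I j. E i)) UNIV"
  proof (rule indep_sets_collect_sigma[OF E])
    show "Int_stable (E i)" for i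
      unfolding E_def Int_stable_def
    proof safe
      fix A B :: "real set" assume "A \<in> sets borel" "B \<in> sets borel"
      then show "\<exists>C. X i -` A \<inter> space M \<inter> (X i -` B \<inter> space M) = X i -` C \<inter> space M \<and> C \<in> sets borel"
        by (intro exI[of _ "A \<inter> B"]) auto
    qed
    show "disjoint_family_on I UNIV" by (auto simp: disjoint_family_on_def I_def)
  qed
  moreover have "(\<Union>i\<in>I True. E i) = {X i -` A \<inter> space M | i A. 1 \<le> i \<and> enat i \<le> enat t \<and> A \<in> sets borel}"
    by (fastforce simp: I_def E_def)
  then have "A \<in> sigma_sets (space M) (\<Union>i\<in>I True. E i)" using assms by (simp add: sets_Filt)
  moreover have "X (Suc t) -` B \<inter> space M \<in> sigma_sets (space M) (\<Union>i\<in>I False. E i)"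
    using assms by (intro sigma_sets.Basic) (auto simp: I_def E_def)
  ultimately have "prob (\<Inter>j\<in>UNIV. case_bool A (X (Suc t) -` B \<inter> space M) j)
     = (\<Prod>j\<in>UNIV. prob (case_bool A (X (Suc t) -` B \<inter> space M) j))"
    by (intro indep_setsD) (auto split: bool.splits)
  then show ?thesis by (simp add: UNIV_bool Int_commute mult.commute)
qed

text \<open>Given the past, the next observation is uniform. Boundary values of \<open>x\<close> are a null set and are dropped, because the
costs are not meaningful there.\<close>

lemma nn_integral_next:
  assumes h[measurable]: "h \<in> borel_measurable (Filt (enat t) \<Otimes>\<^sub>M borel)"
  shows "(\<integral>\<^sup>+ \<omega>. h (\<omega>, X (Suc t) \<omega>) \<partial>M) = (\<integral>\<^sup>+ \<omega>. \<integral>\<^sup>+ x. h (\<omega>, x) * indicator {0<..<1} x \<partial>lborel \<partial>M)"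
proof -
  define R where "R = restr_to_subalg M (Filt (enat t))"
  define U :: "real measure" where "U = uniform_measure lborel {0..1}"
  have sR: "sets R = sets (Filt (enat t))" unfolding R_def by (rule sets_restr_to_subalg[OF subalgebra_Filt])
  interpret R: prob_space R unfolding R_def by (rule prob_space_restr_to_subalg[OF subalgebra_Filt prob_space_axioms])
  interpret U: prob_space U unfolding U_def by (rule prob_space_uniform_measure) auto
  have Xm[measurable]: "X (Suc t) \<in> borel_measurable M" by (rule X_measurable) simp
  have idm: "(\<lambda>\<omega>. \<omega>) \<in> measurable M (Filt (enat t))"
    using subalgebra_Filt[of "enat t"] by (auto simp: measurable_def subalgebra_def)
  have pm: "(\<lambda>\<omega>. (\<omega>, X (Suc t) \<omega>)) \<in> measurable M (Filt (enat t) \<Otimes>\<^sub>M borel)"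
    using idm by measurable
  have D: "R \<Otimes>\<^sub>M U = distr M (Filt (enat t) \<Otimes>\<^sub>M borel) (\<lambda>\<omega>. (\<omega>, X (Suc t) \<omega>))"
  proof (rule pair_measure_eqI)
    show "sets (R \<Otimes>\<^sub>M U) = sets (distr M (Filt (enat t) \<Otimes>\<^sub>M borel) (\<lambda>\<omega>. (\<omega>, X (Suc t) \<omega>)))"
      by (simp, rule sets_pair_measure_cong) (auto simp: sR U_def)
    fix A B assume A: "A \<in> sets R" and B: "B \<in> sets U"
    then have A': "A \<in> sets (Filt (enat t))" and B': "B \<in> sets borel" by (auto simp: sR U_def)
    have AM: "A \<in> sets M" using A' subalgebra_Filt[of "enat t"] by (auto simp: subalgebra_def)
    have "(\<lambda>\<omega>. (\<omega>, X (Suc t) \<omega>)) -` (A \<times> B) \<inter> space M = A \<inter> (X (Suc t) -` B \<inter> space M)"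
      using sets.sets_into_space[OF AM] by auto
    then have "emeasure (distr M (Filt (enat t) \<Otimes>\<^sub>M borel) (\<lambda>\<omega>. (\<omega>, X (Suc t) \<omega>))) (A \<times> B)
        = ennreal (prob (A \<inter> (X (Suc t) -` B \<inter> space M)))"
      using pm A' B' by (simp add: emeasure_distr emeasure_eq_measure)
    also have "\<dots> = emeasure M A * emeasure M (X (Suc t) -` B \<inter> space M)"
      unfolding indep_Filt_next[OF A' B'] by (simp add: emeasure_eq_measure ennreal_mult'')
    also have "emeasure M (X (Suc t) -` B \<inter> space M) = emeasure (distr M borel (X (Suc t))) B"
      using B' by (simp add: emeasure_distr)
    also have "\<dots> = emeasure U B" by (subst uniform) (auto simp: U_def)
    also have "emeasure M A = emeasure R A"
      unfolding R_def by (rule emeasure_restr_to_subalg[OF subalgebra_Filt A', symmetric])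
    finally show "emeasure R A * emeasure U B = emeasure (distr M (Filt (enat t) \<Otimes>\<^sub>M borel) (\<lambda>\<omega>. (\<omega>, X (Suc t) \<omega>))) (A \<times> B)"
      by simp
  qed unfold_locales
  have hU[measurable]: "h \<in> borel_measurable (R \<Otimes>\<^sub>M U)"
    using h by (subst measurable_cong_sets[OF sets_pair_measure_cong refl]) (auto simp: sR U_def)
  have sec: "(\<lambda>x. h (\<omega>, x)) \<in> borel_measurable borel" if "\<omega> \<in> space M" for \<omega>
    by (rule measurable_Pair2[OF h]) (use that in simp)
  have "(\<integral>\<^sup>+ \<omega>. h (\<omega>, X (Suc t) \<omega>) \<partial>M) = (\<integral>\<^sup>+ z. h z \<partial>(R \<Otimes>\<^sub>M U))"
    unfolding D using pm h by (simp add: nn_integral_distr)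
  also have "\<dots> = (\<integral>\<^sup>+ \<omega>. \<integral>\<^sup>+ x. h (\<omega>, x) \<partial>U \<partial>R)"
    by (rule U.nn_integral_fst[symmetric]) (rule hU)
  also have "\<dots> = (\<integral>\<^sup>+ \<omega>. \<integral>\<^sup>+ x. h (\<omega>, x) \<partial>U \<partial>M)"
  proof -
    have "(\<lambda>\<omega>. \<integral>\<^sup>+ x. h (\<omega>, x) \<partial>U) \<in> borel_measurable R"
      by (rule U.borel_measurable_nn_integral_fst) (rule hU)
    then have "(\<lambda>\<omega>. \<integral>\<^sup>+ x. h (\<omega>, x) \<partial>U) \<in> borel_measurable (Filt (enat t))"
      using measurable_cong_sets[OF sR refl] by blast
    then show ?thesis unfolding R_def by (intro nn_integral_subalgebra2 subalgebra_Filt)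
  qed
  also have "\<dots> = (\<integral>\<^sup>+ \<omega>. \<integral>\<^sup>+ x. h (\<omega>, x) * indicator {0<..<1} x \<partial>lborel \<partial>M)"
  proof (rule nn_integral_cong)
    fix \<omega> assume "\<omega> \<in> space M"
    then have "(\<integral>\<^sup>+ x. h (\<omega>, x) \<partial>U) = (\<integral>\<^sup>+ x. h (\<omega>, x) * indicator {0..1} x \<partial>lborel)"
      unfolding U_def using sec by (subst nn_integral_uniform_measure) (auto simp: divide_ennreal_def)
    also have "\<dots> = (\<integral>\<^sup>+ x. h (\<omega>, x) * indicator {0<..<1} x \<partial>lborel)"
    proof (rule nn_integral_cong_AE)
      show "AE x in lborel. h (\<omega>, x) * indicator {0..1} x = h (\<omega>, x) * indicator {0<..<1} x"
        using AE_lborel_singleton[of 0] AE_lborel_singleton[of 1] by eventually_elim (auto simp: indicator_def)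
    qed
    finally show "(\<integral>\<^sup>+ x. h (\<omega>, x) \<partial>U) = (\<integral>\<^sup>+ x. h (\<omega>, x) * indicator {0<..<1} x \<partial>lborel)" .
  qed
  finally show ?thesis .
qed

end

text \<open>Writes an expected time as a sum of probabilities.\<close>

lemma suminf_indicator_enat:
  "(\<Sum>t. indicator {t. enat t < n} t) = ennreal_of_enat n"
proof (cases n)
  case (enat m)
  have "(\<Sum>t. indicator {t. enat t < n} t :: ennreal) = (\<Sum>t<m. indicator {t. enat t < n} t)"
    by (rule suminf_finite) (auto simp: enat)
  also have "\<dots> = (\<Sum>t<m. 1)" by (rule sum.cong) (auto simp: enat)
  finally show ?thesis by (simp add: enat ennreal_of_nat_eq_real_of_nat)
next
  case infinity
  have "(\<Sum>t. indicator {t. enat t < n} t) = (\<Sum>t::nat. 1 :: ennreal)" by (simp add: infinity)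
  also have "\<dots> = top"
  proof (rule ccontr)
    assume "(\<Sum>t::nat. 1 :: ennreal) \<noteq> top"
    then obtain m :: nat where m: "(\<Sum>t::nat. 1 :: ennreal) < of_nat m" using ennreal_Ex_less_of_nat top.not_eq_extremum by blast
    have "(\<Sum>t<m. 1 :: ennreal) \<le> (\<Sum>t::nat. 1)" by (rule sum_le_suminf) auto
    then show False using m by simp
  qed
  finally show ?thesis by (simp add: infinity)
qed

lemma remaining_cost_measurable:
  assumes "\<And>q. q \<in> {lo, hi} \<union> set ps \<Longrightarrow> (\<lambda>\<omega>. y \<omega> q) \<in> borel_measurable N"
  shows "(\<lambda>\<omega>. remaining_cost ps rs lo hi (y \<omega>)) \<in> borel_measurable N"
  using assms
proof (induction ps arbitrary: rs lo hi rule: length_induct)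
  case (1 ps)
  show ?case
  proof (cases ps)
    case Nil
    have "(\<lambda>\<omega>. (bst_root rs)\<^sup>2 / (y \<omega> hi - y \<omega> lo)) \<in> borel_measurable N"
      by (intro borel_measurable_divide borel_measurable_diff borel_measurable_const 1(2)) auto
    then show ?thesis by (simp add: Nil)
  next
    case (Cons p qs)
    have "(\<lambda>\<omega>. remaining_cost (filter (\<lambda>x. x < p) qs) (filter (\<lambda>x. x < p) rs) lo p (y \<omega>)) \<in> borel_measurable N"
      using 1 Cons by (auto simp: le_imp_less_Suc)
    moreover have "(\<lambda>\<omega>. remaining_cost (filter (\<lambda>x. p < x) qs) (filter (\<lambda>x. p < x) rs) p hi (y \<omega>)) \<in> borel_measurable N"
      using 1 Cons by (auto simp: le_imp_less_Suc)
    ultimately show ?thesis by (simp add: Cons)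
  qed
qed

section \<open>The optimal strategy for a fixed pattern\<close>
lemma pred_strict_mono_on_finite:
  fixes y :: "'b \<Rightarrow> nat \<Rightarrow> real"
  assumes "finite I" "\<And>q. q \<in> I \<Longrightarrow> (\<lambda>\<omega>. y \<omega> q) \<in> borel_measurable N"
  shows "Measurable.pred N (\<lambda>\<omega>. strict_mono_on I (y \<omega>))"
proof -
  have "Measurable.pred N (\<lambda>\<omega>. \<forall>a\<in>I. \<forall>b\<in>I. a < b \<longrightarrow> y \<omega> a < y \<omega> b)"
  proof (intro pred_intros_finite assms(1))
    fix a b assume "a \<in> I" "b \<in> I"
    then have "(\<lambda>\<omega>. y \<omega> a) \<in> borel_measurable N" "(\<lambda>\<omega>. y \<omega> b) \<in> borel_measurable N"
      using assms by auto
    then show "Measurable.pred N (\<lambda>\<omega>. a < b \<longrightarrow> y \<omega> a < y \<omega> b)" by measurable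
  qed
  moreover have "strict_mono_on I f \<longleftrightarrow> (\<forall>a\<in>I. \<forall>b\<in>I. a < b \<longrightarrow> f a < f b)" for f :: "nat \<Rightarrow> real"
    unfolding monotone_on_def by blast
  ultimately show ?thesis by (simp only:)
qed

text \<open>The values of the letters are recorded in a function \<open>y\<close> on \<open>{0..k+1}\<close>, in which the letters 0 and \<open>k+1\<close>
stand for the ends 0 and 1 of the unit interval.\<close>

locale pattern =
  fixes k :: nat and \<pi> :: "nat \<Rightarrow> nat"
  assumes perm: "\<pi> permutes {1..k}"
begin

definition picked :: "nat \<Rightarrow> nat list" where "picked i = map \<pi> [1..<Suc i]"
definition pending :: "nat \<Rightarrow> nat list" where "pending i = map \<pi> [Suc i..<Suc k]"
definition known :: "nat \<Rightarrow> nat set" where "known i = {0, Suc k} \<union> set (picked i)"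
definition cost_to_go :: "nat \<Rightarrow> (nat \<Rightarrow> real) \<Rightarrow> real" where
  "cost_to_go i y = remaining_cost (picked i) (pending i) 0 (Suc k) y"
definition consistent :: "nat \<Rightarrow> (nat \<Rightarrow> real) \<Rightarrow> bool" where
  "consistent i y \<longleftrightarrow> y 0 = 0 \<and> y (Suc k) = 1 \<and> strict_mono_on (known i) y"
text \<open>The values of \<open>ennreal\<close> are truncated at 0, so this is the positive part of the decrease of the cost.\<close>

definition gain :: "nat \<Rightarrow> (nat \<Rightarrow> real) \<Rightarrow> real \<Rightarrow> ennreal" where
  "gain i y x = (if consistent i y \<and> consistent (Suc i) (y(\<pi> (Suc i) := x))
     then ennreal (cost_to_go i y - cost_to_go (Suc i) (y(\<pi> (Suc i) := x))) else 0)"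

lemma perm_range: "j \<in> {1..k} \<Longrightarrow> \<pi> j \<in> {1..k}"
  using permutes_in_image[OF perm] by blast

lemma perm_eq_iff: "\<pi> i = \<pi> j \<longleftrightarrow> i = j"
  using permutes_inj[OF perm] by (auto dest: injD)

lemma picked_Suc: "picked (Suc i) = picked i @ [\<pi> (Suc i)]"
  by (simp add: picked_def)

lemma pending_Suc: "i < k \<Longrightarrow> pending i = \<pi> (Suc i) # pending (Suc i)"
  unfolding pending_def by (subst upt_conv_Cons) (simp_all del: upt_Suc)

lemma set_picked: "set (picked i) = \<pi> ` {1..i}"
  by (auto simp: picked_def)

lemma known_Suc: "known (Suc i) = insert (\<pi> (Suc i)) (known i)"
  by (auto simp: known_def picked_Suc)

lemma picked_bounds: "i \<le> k \<Longrightarrow> p \<in> set (picked i) \<Longrightarrow> 0 < p \<and> p < Suc k"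
  using perm_range by (fastforce simp: set_picked)

lemma known_le: "i \<le> k \<Longrightarrow> q \<in> known i \<Longrightarrow> q \<le> Suc k"
  using picked_bounds by (fastforce simp: known_def)

lemma finite_known: "finite (known i)"
  by (simp add: known_def)

lemma cost_to_go_nonneg: "i \<le> k \<Longrightarrow> consistent i y \<Longrightarrow> 0 \<le> cost_to_go i y"
  unfolding cost_to_go_def consistent_def known_def
  by (intro remaining_cost_nonneg) (use picked_bounds in auto)

lemma cost_to_go_cong: "(\<And>q. q \<in> known i \<Longrightarrow> y q = z q) \<Longrightarrow> cost_to_go i y = cost_to_go i z"
  unfolding cost_to_go_def known_def by (intro remaining_cost_cong) auto

lemma consistent_cong: "(\<And>q. q \<in> known i \<Longrightarrow> y q = z q) \<Longrightarrow> consistent i y = consistent i z"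
  unfolding consistent_def by (auto simp: known_def monotone_on_def)

lemma gain_cong:
  assumes "\<And>q. q \<in> known i \<Longrightarrow> y q = z q"
  shows "gain i y x = gain i z x"
proof -
  have u: "(y(\<pi> (Suc i) := x)) q = (z(\<pi> (Suc i) := x)) q" if "q \<in> known (Suc i)" for q
    using assms that by (auto simp: known_Suc)
  show ?thesis unfolding gain_def
    by (simp only: consistent_cong[OF assms] cost_to_go_cong[OF assms] consistent_cong[OF u] cost_to_go_cong[OF u])
qed

lemma cost_to_go_0: "cost_to_go 0 y = (bst_root (map \<pi> [1..<Suc k]))\<^sup>2 / (y (Suc k) - y 0)"
  by (simp add: cost_to_go_def picked_def pending_def)

lemma cost_to_go_end: "cost_to_go k y = 0"
proof -
  have "remaining_cost ps [] lo hi y = 0" for ps lo hi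
    by (induction ps arbitrary: lo hi rule: length_induct) (case_tac xs, auto simp: le_imp_less_Suc)
  then show ?thesis by (simp add: cost_to_go_def pending_def)
qed

text \<open>Only the gap of the next letter contributes.\<close>

lemma nn_integral_gain:
  assumes i: "i < k" and y: "consistent i y"
  shows "(\<integral>\<^sup>+ x. gain i y x * indicator {0<..<1} x \<partial>lborel) = 1"
proof -
  let ?r = "\<pi> (Suc i)"
  have r: "?r \<notin> set (picked i)" by (auto simp: set_picked perm_eq_iff)
  have b: "0 < p \<and> p < Suc k" if "p \<in> insert ?r (set (picked i))" for p
    using that picked_bounds[of i p] perm_range[of "Suc i"] i by auto
  obtain l u C rs where *: "l \<in> known i" "u \<in> known i" "l < ?r" "?r < u"
     "\<forall>q\<in>known i. q \<le> l \<or> u \<le> q"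
     "cost_to_go i y = C + (bst_root (?r # rs))\<^sup>2 / (y u - y l)"
     "\<forall>x. cost_to_go (Suc i) (y(?r := x)) =
        C + ((bst_root (filter (\<lambda>x. x < ?r) rs))\<^sup>2 / (x - y l) + (bst_root (filter (\<lambda>x. ?r < x) rs))\<^sup>2 / (y u - x))"
    using remaining_cost_split[where r = ?r and ps = "picked i" and lo = 0 and hi = "Suc k" and rs = "pending (Suc i)" and y = y, OF b r]
    unfolding known_def cost_to_go_def picked_Suc pending_Suc[OF i] by auto
  have sm: "strict_mono_on (known i) y" and y01: "y 0 = 0" "y (Suc k) = 1" using y by (auto simp: consistent_def)
  have cons: "consistent (Suc i) (y(?r := x)) \<longleftrightarrow> y l < x \<and> x < y u" for x
    using strict_mono_on_insert_between[OF sm *(1-5)] b[of ?r] y01 by (auto simp: consistent_def known_Suc)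
  have lu: "0 \<le> y l" "y l < y u" "y u \<le> 1"
  proof -
    show "y l < y u" using strict_mono_onD[OF sm, of l u] * by auto
    show "0 \<le> y l" using strict_mono_onD[OF sm, of 0 l] * y01 by (cases "l = 0") (auto simp: known_def)
    have "u \<le> Suc k" using known_le[of i u] * i by auto
    then show "y u \<le> 1" using strict_mono_onD[OF sm, of u "Suc k"] * y01 by (cases "u = Suc k") (auto simp: known_def)
  qed
  let ?a = "bst_root (filter (\<lambda>x. x < ?r) rs)" and ?b = "bst_root (filter (\<lambda>x. ?r < x) rs)"
  have "(\<integral>\<^sup>+ x. gain i y x * indicator {0<..<1} x \<partial>lborel) =
    (\<integral>\<^sup>+ x. ennreal ((join_root ?a ?b)\<^sup>2 / (y u - y l) - (?a\<^sup>2 / (x - y l) + ?b\<^sup>2 / (y u - x))) * indicator {y l<..<y u} x \<partial>lborel)"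
  proof (rule nn_integral_cong)
    fix x
    have "cost_to_go i y - cost_to_go (Suc i) (y(?r := x)) = (join_root ?a ?b)\<^sup>2 / (y u - y l) - (?a\<^sup>2 / (x - y l) + ?b\<^sup>2 / (y u - x))"
      using *(6,7) by simp
    then show "gain i y x * indicator {0<..<1} x = ennreal ((join_root ?a ?b)\<^sup>2 / (y u - y l) - (?a\<^sup>2 / (x - y l) + ?b\<^sup>2 / (y u - x))) * indicator {y l<..<y u} x"
      using lu y by (auto simp: gain_def cons indicator_def)
  qed
  also have "\<dots> = 1" by (rule nn_integral_gap) (use lu bst_root_nonneg in auto)
  finally show ?thesis .
qed

lemma nn_integral_gain_le: "i < k \<Longrightarrow> (\<integral>\<^sup>+ x. gain i y x * indicator {0<..<1} x \<partial>lborel) \<le> 1"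
  using nn_integral_gain[of i y] by (cases "consistent i y") (auto simp: gain_def)

lemma cost_to_go_measurable:
  assumes "\<And>q. q \<in> known i \<Longrightarrow> (\<lambda>\<omega>. y \<omega> q) \<in> borel_measurable N"
  shows "(\<lambda>\<omega>. cost_to_go i (y \<omega>)) \<in> borel_measurable N"
  unfolding cost_to_go_def by (rule remaining_cost_measurable) (use assms in \<open>auto simp: known_def\<close>)

lemma pred_consistent:
  assumes y: "\<And>q. q \<in> known i \<Longrightarrow> (\<lambda>\<omega>. y \<omega> q) \<in> borel_measurable N"
  shows "Measurable.pred N (\<lambda>\<omega>. consistent i (y \<omega>))"
proof -
  have [measurable]: "Measurable.pred N (\<lambda>\<omega>. strict_mono_on (known i) (y \<omega>))"
    by (rule pred_strict_mono_on_finite[OF finite_known y])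
  have [measurable]: "(\<lambda>\<omega>. y \<omega> 0) \<in> borel_measurable N" "(\<lambda>\<omega>. y \<omega> (Suc k)) \<in> borel_measurable N"
    by (auto intro!: y simp: known_def)
  show ?thesis unfolding consistent_def by measurable
qed

lemma upd_measurable:
  assumes "\<And>q. q \<in> known i \<Longrightarrow> (\<lambda>\<omega>. y \<omega> q) \<in> borel_measurable N" "x \<in> borel_measurable N" "q \<in> known (Suc i)"
  shows "(\<lambda>\<omega>. ((y \<omega>)(\<pi> (Suc i) := x \<omega>)) q) \<in> borel_measurable N"
  using assms by (cases "q = \<pi> (Suc i)") (auto simp: known_Suc)

lemma gain_measurable:
  assumes y: "\<And>q. q \<in> known i \<Longrightarrow> (\<lambda>\<omega>. y \<omega> q) \<in> borel_measurable N" and x: "x \<in> borel_measurable N"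
  shows "(\<lambda>\<omega>. gain i (y \<omega>) (x \<omega>)) \<in> borel_measurable N"
proof -
  note [measurable] = cost_to_go_measurable[OF y] pred_consistent[OF y]
    cost_to_go_measurable[OF upd_measurable[OF y x]] pred_consistent[OF upd_measurable[OF y x]]
  show ?thesis unfolding gain_def by measurable
qed

end

locale online_pattern = iid_uniform M X + pattern k \<pi>
  for M :: "'a measure" and X :: "nat \<Rightarrow> 'a \<Rightarrow> real" and k \<pi>
begin

abbreviation "opt_value \<equiv> (bst_root (map \<pi> [1..<Suc k]))\<^sup>2"

text \<open>The past decides the event and the current state, so the next observation may be integrated out first.\<close>

lemma gain_next:
  assumes A: "Measurable.pred (Filt (enat t)) A"
    and y: "\<And>q. q \<in> known i \<Longrightarrow> (\<lambda>\<omega>. y \<omega> q) \<in> borel_measurable (Filt (enat t))"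
  shows "(\<integral>\<^sup>+ \<omega>. indicator {\<omega>. A \<omega>} \<omega> * gain i (y \<omega>) (X (Suc t) \<omega>) \<partial>M)
       = (\<integral>\<^sup>+ \<omega>. indicator {\<omega>. A \<omega>} \<omega> * (\<integral>\<^sup>+ x. gain i (y \<omega>) x * indicator {0<..<1} x \<partial>lborel) \<partial>M)"
proof -
  let ?N = "Filt (enat t) \<Otimes>\<^sub>M borel :: ('a \<times> real) measure"
  have f: "fst \<in> measurable ?N (Filt (enat t))" "snd \<in> borel_measurable ?N" by auto
  have yN: "(\<lambda>z. y (fst z) q) \<in> borel_measurable ?N" if "q \<in> known i" for q
    using measurable_compose[OF f(1) y[OF that]] .
  have AN: "Measurable.pred ?N (\<lambda>z. A (fst z))" using measurable_compose[OF f(1) A] .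
  have g[measurable]: "(\<lambda>z. gain i (y (fst z)) (snd z)) \<in> borel_measurable ?N"
    by (rule gain_measurable[OF yN f(2)])
  define h where "h z = (if A (fst z) then gain i (y (fst z)) (snd z) else 0)" for z
  have h: "h \<in> borel_measurable ?N" unfolding h_def using AN by measurable
  have "(\<integral>\<^sup>+ \<omega>. indicator {\<omega>. A \<omega>} \<omega> * gain i (y \<omega>) (X (Suc t) \<omega>) \<partial>M) = (\<integral>\<^sup>+ \<omega>. h (\<omega>, X (Suc t) \<omega>) \<partial>M)"
    by (intro nn_integral_cong) (auto simp: h_def)
  also have "\<dots> = (\<integral>\<^sup>+ \<omega>. \<integral>\<^sup>+ x. h (\<omega>, x) * indicator {0<..<1} x \<partial>lborel \<partial>M)"
    by (rule nn_integral_next[OF h])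
  also have "\<dots> = (\<integral>\<^sup>+ \<omega>. indicator {\<omega>. A \<omega>} \<omega> * (\<integral>\<^sup>+ x. gain i (y \<omega>) x * indicator {0<..<1} x \<partial>lborel) \<partial>M)"
  proof (rule nn_integral_cong)
    fix \<omega>
    show "(\<integral>\<^sup>+ x. h (\<omega>, x) * indicator {0<..<1} x \<partial>lborel)
      = indicator {\<omega>. A \<omega>} \<omega> * (\<integral>\<^sup>+ x. gain i (y \<omega>) x * indicator {0<..<1} x \<partial>lborel)"
      by (cases "A \<omega>") (simp_all add: h_def)
  qed
  finally show ?thesis .
qed

text \<open>Between \<open>\<tau>\<^sub>i\<close> and \<open>\<tau>\<^sub>i\<^sub>+\<^sub>1\<close> every observation has expected gain at most 1, whatever the strategy does, and the cost
drops at the accepted one by at most its gain. Hence the cost drops in expectation by at most the expected waiting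
time; it starts at the optimal value and ends at 0.\<close>

lemma opt_value_le:
  assumes OA: "\<tau> \<in> OA M X k \<pi>"
  shows "ennreal opt_value \<le> (\<integral>\<^sup>+ \<omega>. ennreal_of_enat (\<tau> k \<omega>) \<partial>M)"
proof -
  \<comment> \<open>Y is the final state and Z its part known at time t; both are sums over times so that measurability is immediate.\<close>
  define Y where "Y \<omega> r = (if r = 0 then 0 else if r = Suc k then 1 else (\<Sum>m. if \<tau> (inv \<pi> r) \<omega> = enat (Suc m) then X (Suc m) \<omega> else 0))" for \<omega> r
  define Z where "Z t \<omega> r = (if r = 0 then 0 else if r = Suc k then 1
     else \<Sum>m\<in>{1..t}. if \<tau> (inv \<pi> r) \<omega> = enat m then X m \<omega> else 0)" for t \<omega> r
  define sg where "sg i \<omega> = (if i = 0 then 0 else \<tau> i \<omega>)" for i \<omega>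
  \<comment> \<open>The event that the first i letters, but not the next one, have been found by time t.\<close>
  define A where "A i t \<omega> \<longleftrightarrow> (\<forall>j\<in>{1..i}. \<tau> j \<omega> \<le> enat t) \<and> \<not> \<tau> (Suc i) \<omega> \<le> enat t" for i t \<omega>
  have st: "stopping_time (natural_filtration M X) (\<tau> i)" if "i \<in> {1..k}" for i
    using OA that by (auto simp: OA_def)
  have pst: "Measurable.pred (Filt t) (\<lambda>\<omega>. \<tau> i \<omega> \<le> t)" if "i \<in> {1..k}" for i t
    using st[OF that] by (auto simp: stopping_time_def)
  have pst': "Measurable.pred (Filt (enat t)) (\<lambda>\<omega>. \<tau> i \<omega> \<le> enat m)" if "i \<in> {1..k}" "m \<le> t" for i t m
    using measurable_Filt_mono[OF _ pst[OF that(1), of "enat m"], of "enat t"] that by simp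
  have inv: "inv \<pi> r \<in> {1..k}" "\<pi> (inv \<pi> r) = r" if "r \<in> {1..k}" for r
    using that permutes_in_image[OF permutes_inv[OF perm]] permutes_inverses[OF perm] by auto
  have inv\<pi>: "inv \<pi> (\<pi> j) = j" for j using permutes_inverses[OF perm] by auto
  have Am: "Measurable.pred (Filt (enat t)) (A i t)" if "i < k" for i t
    unfolding A_def using that by (intro pred_intros_logic pred_intros_finite pst) auto
  have Zm: "(\<lambda>\<omega>. Z t \<omega> q) \<in> borel_measurable (Filt (enat t))" if "q \<in> known i" "i \<le> k" for t q i
  proof (cases "q \<in> {1..k}")
    case True
    have "(\<lambda>\<omega>. \<Sum>m\<in>{1..t}. if \<tau> (inv \<pi> q) \<omega> = enat m then X m \<omega> else 0) \<in> borel_measurable (Filt (enat t))"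
    proof (rule borel_measurable_sum)
      fix m assume m: "m \<in> {1..t}"
      have "\<tau> (inv \<pi> q) \<omega> = enat m \<longleftrightarrow> \<tau> (inv \<pi> q) \<omega> \<le> enat m \<and> \<not> \<tau> (inv \<pi> q) \<omega> \<le> enat (m - 1)" for \<omega>
        using m by (cases "\<tau> (inv \<pi> q) \<omega>") auto
      moreover have "Measurable.pred (Filt (enat t)) (\<lambda>\<omega>. \<tau> (inv \<pi> q) \<omega> \<le> enat m \<and> \<not> \<tau> (inv \<pi> q) \<omega> \<le> enat (m - 1))"
        using m inv(1)[OF True] by (intro pred_intros_logic pst') auto
      ultimately have [measurable]: "Measurable.pred (Filt (enat t)) (\<lambda>\<omega>. \<tau> (inv \<pi> q) \<omega> = enat m)" by simp
      have [measurable]: "X m \<in> borel_measurable (Filt (enat t))" using m by (intro X_measurable_Filt) auto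
      show "(\<lambda>\<omega>. if \<tau> (inv \<pi> q) \<omega> = enat m then X m \<omega> else 0) \<in> borel_measurable (Filt (enat t))"
        by measurable
    qed
    then show ?thesis using True by (simp add: Z_def)
  next
    case False
    then have "q = 0 \<or> q = Suc k" using that known_le[of i q] by (auto simp: Suc_le_eq not_le)
    then show ?thesis by (auto simp: Z_def)
  qed
  define good where "good \<omega> \<longleftrightarrow> (\<forall>t\<ge>1. 0 < X t \<omega> \<and> X t \<omega> < 1) \<and>
    (\<forall>i\<in>{1..k}. 1 \<le> \<tau> i \<omega> \<and> \<tau> i \<omega> < \<infinity>) \<and> strict_mono_on {1..k} (\<lambda>i. \<tau> i \<omega>) \<and>
    (\<forall>i\<in>{1..k}. \<forall>j\<in>{1..k}. \<pi> i < \<pi> j \<longleftrightarrow> X (the_enat (\<tau> i \<omega>)) \<omega> < X (the_enat (\<tau> j \<omega>)) \<omega>)" for \<omega>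
  \<comment> \<open>Everything that holds almost surely is collected into one event.\<close>
  have AEg: "AE \<omega> in M. good \<omega>"
  proof -
    have "AE \<omega> in M. (\<forall>i\<in>{1..k}. 1 \<le> \<tau> i \<omega> \<and> \<tau> i \<omega> < \<infinity>) \<and> strict_mono_on {1..k} (\<lambda>i. \<tau> i \<omega>) \<and>
      (\<forall>i\<in>{1..k}. \<forall>j\<in>{1..k}. \<pi> i < \<pi> j \<longleftrightarrow> X (the_enat (\<tau> i \<omega>)) \<omega> < X (the_enat (\<tau> j \<omega>)) \<omega>)"
      using OA by (simp add: OA_def)
    with AE_X show ?thesis unfolding good_def by eventually_elim auto
  qed
  have mono: "\<tau> i \<omega> < \<tau> j \<omega>" if "good \<omega>" "1 \<le> i" "i < j" "j \<le> k" for \<omega> i j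
    using that strict_mono_onD[of "{1..k}" "\<lambda>i. \<tau> i \<omega>" i j] by (auto simp: good_def)
  have fin: "\<exists>m\<ge>1. \<tau> i \<omega> = enat m" if "good \<omega>" "1 \<le> i" "i \<le> k" for \<omega> i
  proof -
    have "1 \<le> \<tau> i \<omega> \<and> \<tau> i \<omega> < \<infinity>"
      using that unfolding good_def by (metis atLeastAtMost_iff)
    then show ?thesis by (cases "\<tau> i \<omega>") (auto simp: one_enat_def)
  qed
  have YX: "Y \<omega> (\<pi> j) = X (the_enat (\<tau> j \<omega>)) \<omega>" if g: "good \<omega>" and j: "j \<in> {1..k}" for \<omega> j
  proof -
    obtain m where m: "1 \<le> m" "\<tau> j \<omega> = enat m" using fin[OF g, of j] j by auto
    then obtain m' where m': "m = Suc m'" by (cases m) auto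
    have "(\<Sum>n. if \<tau> j \<omega> = enat (Suc n) then X (Suc n) \<omega> else 0) = (\<Sum>n\<in>{m'}. if \<tau> j \<omega> = enat (Suc n) then X (Suc n) \<omega> else 0)"
      by (rule suminf_finite) (auto simp: m m')
    then show ?thesis using perm_range[OF j] m m' by (simp add: Y_def inv\<pi>)
  qed
  have Ycons: "consistent i (Y \<omega>)" if g: "good \<omega>" and i: "i \<le> k" for i \<omega>
  proof -
    have "strict_mono_on (known i) (Y \<omega>)"
    proof (rule strict_mono_onI)
      fix a b assume ab: "a \<in> known i" "b \<in> known i" "a < b"
      have Yj: "Y \<omega> (\<pi> j) = X (the_enat (\<tau> j \<omega>)) \<omega>" if "j \<in> {1..i}" for j
        using YX[OF g, of j] that i by simp
      have Y01: "0 < Y \<omega> (\<pi> j) \<and> Y \<omega> (\<pi> j) < 1" if "j \<in> {1..i}" for j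
        using fin[OF g, of j] that i g by (auto simp: Yj good_def)
      have k1: "q = 0 \<or> q = Suc k \<or> (\<exists>j\<in>{1..i}. q = \<pi> j)" if "q \<in> known i" for q
        using that by (auto simp: known_def set_picked)
      have "b \<le> Suc k" using known_le[OF i ab(2)] .
      have o: "Y \<omega> (\<pi> j) < Y \<omega> (\<pi> j')" if "j \<in> {1..i}" "j' \<in> {1..i}" "\<pi> j < \<pi> j'" for j j'
        using g i that unfolding good_def by (auto simp: Yj)
      show "Y \<omega> a < Y \<omega> b"
        using k1[OF ab(1)] k1[OF ab(2)] ab(3) \<open>b \<le> Suc k\<close> Y01 o
        by (auto simp: Y_def[of \<omega> 0] Y_def[of \<omega> "Suc k"]) 
    qed
    then show ?thesis by (simp add: consistent_def Y_def)
  qed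
  have Aiff: "A i t \<omega> \<longleftrightarrow> sg i \<omega> \<le> enat t \<and> enat t < sg (Suc i) \<omega>" if g: "good \<omega>" and i: "i < k" for i t \<omega>
  proof -
    have "(\<forall>j\<in>{1..i}. \<tau> j \<omega> \<le> enat t) \<longleftrightarrow> sg i \<omega> \<le> enat t"
    proof (cases "i = 0")
      case False
      have "\<tau> j \<omega> \<le> \<tau> i \<omega>" if "j \<in> {1..i}" for j
        using mono[OF g, of j i] that i by (cases "j = i") auto
      note le = this
      have "\<tau> i \<omega> \<le> enat t" if "\<forall>j\<in>{1..i}. \<tau> j \<omega> \<le> enat t" using that False by simp
      note a = this
      have b: "\<tau> j \<omega> \<le> enat t" if "\<tau> i \<omega> \<le> enat t" "j \<in> {1..i}" for j
        using le[OF that(2)] that(1) by (rule order_trans)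
      have "sg i \<omega> = \<tau> i \<omega>" using False by (simp add: sg_def)
      then show ?thesis using a b by metis
    qed (simp add: sg_def)
    then show ?thesis by (auto simp: A_def sg_def)
  qed
  have ZY: "Z t \<omega> q = Y \<omega> q" if g: "good \<omega>" and i: "i < k" and A: "A i t \<omega>" and q: "q \<in> known i" for i t \<omega> q
  proof (cases "q \<in> {0, Suc k}")
    case False
    then obtain j where j: "j \<in> {1..i}" "q = \<pi> j" using q by (auto simp: known_def set_picked)
    then obtain m where m: "1 \<le> m" "\<tau> j \<omega> = enat m" using fin[OF g, of j] i by auto
    have "\<tau> j \<omega> \<le> enat t" using A j unfolding A_def by blast
    then have "m \<le> t" using m by simp
    then have "(\<Sum>m'\<in>{1..t}. if \<tau> j \<omega> = enat m' then X m' \<omega> else 0) = X m \<omega>"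
      using m by (simp add: eq_commute[of m])
    then show ?thesis using False j m YX[OF g, of j] i by (simp add: Z_def inv\<pi>)
  qed (auto simp: Z_def Y_def)
  have step: "AE \<omega> in M. ennreal (cost_to_go i (Y \<omega>)) \<le> ennreal (cost_to_go (Suc i) (Y \<omega>))
     + (\<Sum>t. indicator {\<omega>. A i t \<omega>} \<omega> * gain i (Z t \<omega>) (X (Suc t) \<omega>))" if i: "i < k" for i
    using AEg
  proof eventually_elim
    fix \<omega> assume g: "good \<omega>"
    obtain m where m: "1 \<le> m" "\<tau> (Suc i) \<omega> = enat m" using fin[OF g, of "Suc i"] i by auto
    define t where "t = m - 1"
    have t: "m = Suc t" using m by (simp add: t_def)
    have "sg i \<omega> < enat (Suc t)" using mono[OF g, of i "Suc i"] i m t by (auto simp: sg_def zero_enat_def)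
    then have A: "A i t \<omega>" using Aiff[OF g i, of t] m t by (cases "sg i \<omega>") (auto simp: sg_def)
    have Y: "(Y \<omega>)(\<pi> (Suc i) := X (Suc t) \<omega>) = Y \<omega>"
      using YX[OF g, of "Suc i"] i m t by (intro ext) auto
    have "gain i (Z t \<omega>) (X (Suc t) \<omega>) = gain i (Y \<omega>) (X (Suc t) \<omega>)"
      by (rule gain_cong) (rule ZY[OF g i A])
    also have "\<dots> = ennreal (cost_to_go i (Y \<omega>) - cost_to_go (Suc i) (Y \<omega>))"
      unfolding gain_def Y using Ycons[OF g, of i] Ycons[OF g, of "Suc i"] i by simp
    finally have G: "gain i (Z t \<omega>) (X (Suc t) \<omega>) = ennreal (cost_to_go i (Y \<omega>) - cost_to_go (Suc i) (Y \<omega>))" .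
    have "ennreal (cost_to_go i (Y \<omega>)) = ennreal (cost_to_go (Suc i) (Y \<omega>) + (cost_to_go i (Y \<omega>) - cost_to_go (Suc i) (Y \<omega>)))" by simp
    also have "\<dots> \<le> ennreal (cost_to_go (Suc i) (Y \<omega>)) + gain i (Z t \<omega>) (X (Suc t) \<omega>)"
      unfolding G using cost_to_go_nonneg[OF _ Ycons[OF g], of "Suc i"] i
      by (cases "0 \<le> cost_to_go i (Y \<omega>) - cost_to_go (Suc i) (Y \<omega>)") (auto simp: ennreal_plus[symmetric] ennreal_neg intro: ennreal_leI simp del: ennreal_plus)
    also have "gain i (Z t \<omega>) (X (Suc t) \<omega>) = (\<Sum>t\<in>{t}. indicator {\<omega>. A i t \<omega>} \<omega> * gain i (Z t \<omega>) (X (Suc t) \<omega>))"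
      using A by simp
    also have "\<dots> \<le> (\<Sum>t. indicator {\<omega>. A i t \<omega>} \<omega> * gain i (Z t \<omega>) (X (Suc t) \<omega>))"
      by (rule sum_le_suminf) auto
    finally show "ennreal (cost_to_go i (Y \<omega>)) \<le> ennreal (cost_to_go (Suc i) (Y \<omega>))
     + (\<Sum>t. indicator {\<omega>. A i t \<omega>} \<omega> * gain i (Z t \<omega>) (X (Suc t) \<omega>))" by (simp add: add_left_mono)
  qed
  have sgm: "Measurable.pred M (\<lambda>\<omega>. enat t < sg i \<omega>)" if "i \<le> k" for i t
  proof (cases "i = 0")
    case False
    have "Measurable.pred (Filt (enat t)) (\<lambda>\<omega>. \<not> \<tau> i \<omega> \<le> enat t)"
      using False that by (intro pred_intros_logic pst) auto
    then show ?thesis using False measurable_Filt_M by (simp add: sg_def not_le)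
  qed (simp add: sg_def zero_enat_def)
  have Ym: "(\<lambda>\<omega>. cost_to_go i (Y \<omega>)) \<in> borel_measurable M" if "i \<le> k" for i
  proof (rule cost_to_go_measurable)
    fix q assume q: "q \<in> known i"
    show "(\<lambda>\<omega>. Y \<omega> q) \<in> borel_measurable M"
    proof (cases "q \<in> {1..k}")
      case True
      have pe: "Measurable.pred M (\<lambda>\<omega>. \<tau> (inv \<pi> q) \<omega> \<le> enat m)" for m
        using measurable_Filt_M[OF pst[OF inv(1)[OF True]]] .
      have "(\<lambda>\<omega>. if \<tau> (inv \<pi> q) \<omega> = enat (Suc m) then X (Suc m) \<omega> else 0) \<in> borel_measurable M" for m
      proof -
        have "\<tau> (inv \<pi> q) \<omega> = enat (Suc m) \<longleftrightarrow> \<tau> (inv \<pi> q) \<omega> \<le> enat (Suc m) \<and> \<not> \<tau> (inv \<pi> q) \<omega> \<le> enat m" for \<omega>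
          by (cases "\<tau> (inv \<pi> q) \<omega>") auto
        then have [measurable]: "Measurable.pred M (\<lambda>\<omega>. \<tau> (inv \<pi> q) \<omega> = enat (Suc m))"
          using pe[of "Suc m"] pe[of m] by simp
        have [measurable]: "X (Suc m) \<in> borel_measurable M" by (rule X_measurable) simp
        show ?thesis by measurable
      qed
      then have "(\<lambda>\<omega>. \<Sum>m. if \<tau> (inv \<pi> q) \<omega> = enat (Suc m) then X (Suc m) \<omega> else 0) \<in> borel_measurable M"
        by (rule borel_measurable_suminf)
      then show ?thesis using True by (simp add: Y_def)
    next
      case False
      then have "q = 0 \<or> q = Suc k" using q known_le[OF that q] by (auto simp: Suc_le_eq not_le)
      then show ?thesis by (auto simp: Y_def)
    qed
  qed
  have Tm: "(\<lambda>\<omega>. indicator {\<omega>. A i t \<omega>} \<omega> * gain i (Z t \<omega>) (X (Suc t) \<omega>)) \<in> borel_measurable M" if i: "i < k" for i t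
  proof -
    have [measurable]: "Measurable.pred M (A i t)" using measurable_Filt_M[OF Am[OF i]] .
    have [measurable]: "(\<lambda>\<omega>. gain i (Z t \<omega>) (X (Suc t) \<omega>)) \<in> borel_measurable M"
    proof (intro gain_measurable X_measurable)
      show "(\<lambda>\<omega>. Z t \<omega> q) \<in> borel_measurable M" if "q \<in> known i" for q
        using measurable_Filt_M[OF Zm[OF that]] i by simp
    qed simp
    have [measurable]: "(indicator {\<omega>. A i t \<omega>} :: 'a \<Rightarrow> ennreal) \<in> borel_measurable M"
      unfolding indicator_def by measurable
    show ?thesis by measurable
  qed
  define W where "W i = (\<Sum>t. \<integral>\<^sup>+ \<omega>. indicator {\<omega>. enat t < sg i \<omega>} \<omega> \<partial>M)" for i
  have im: "(indicator {\<omega>. enat t < sg i \<omega>} :: 'a \<Rightarrow> ennreal) \<in> borel_measurable M" if "i \<le> k" for i t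
    using sgm[OF that, of t] unfolding indicator_def by measurable
  have main: "ennreal opt_value \<le> (\<integral>\<^sup>+ \<omega>. ennreal (cost_to_go i (Y \<omega>)) \<partial>M) + W i" if "i \<le> k" for i
    using that
  proof (induction i)
    case 0
    have "(\<integral>\<^sup>+ \<omega>. ennreal (cost_to_go 0 (Y \<omega>)) \<partial>M) = ennreal opt_value"
      by (simp add: cost_to_go_0 Y_def emeasure_space_1 del: upt_Suc)
    then show ?case by simp
  next
    case (Suc i)
    then have i: "i < k" by simp
    have "(\<integral>\<^sup>+ \<omega>. ennreal (cost_to_go i (Y \<omega>)) \<partial>M)
       \<le> (\<integral>\<^sup>+ \<omega>. ennreal (cost_to_go (Suc i) (Y \<omega>)) + (\<Sum>t. indicator {\<omega>. A i t \<omega>} \<omega> * gain i (Z t \<omega>) (X (Suc t) \<omega>)) \<partial>M)"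
      by (rule nn_integral_mono_AE[OF step[OF i]])
    also have "\<dots> = (\<integral>\<^sup>+ \<omega>. ennreal (cost_to_go (Suc i) (Y \<omega>)) \<partial>M) + (\<Sum>t. \<integral>\<^sup>+ \<omega>. indicator {\<omega>. A i t \<omega>} \<omega> * gain i (Z t \<omega>) (X (Suc t) \<omega>) \<partial>M)"
      using Ym[OF Suc.prems] Tm[OF i] by (subst nn_integral_add) (auto simp: nn_integral_suminf)
    also have "(\<Sum>t. \<integral>\<^sup>+ \<omega>. indicator {\<omega>. A i t \<omega>} \<omega> * gain i (Z t \<omega>) (X (Suc t) \<omega>) \<partial>M)
        \<le> (\<Sum>t. \<integral>\<^sup>+ \<omega>. indicator {\<omega>. A i t \<omega>} \<omega> \<partial>M)"
    proof (rule suminf_le)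
      fix t
      have "(\<integral>\<^sup>+ \<omega>. indicator {\<omega>. A i t \<omega>} \<omega> * gain i (Z t \<omega>) (X (Suc t) \<omega>) \<partial>M)
        = (\<integral>\<^sup>+ \<omega>. indicator {\<omega>. A i t \<omega>} \<omega> * (\<integral>\<^sup>+ x. gain i (Z t \<omega>) x * indicator {0<..<1} x \<partial>lborel) \<partial>M)"
        by (rule gain_next[OF Am[OF i] Zm]) (use i in auto)
      also have "\<dots> \<le> (\<integral>\<^sup>+ \<omega>. indicator {\<omega>. A i t \<omega>} \<omega> \<partial>M)"
        using nn_integral_gain_le[OF i] by (intro nn_integral_mono) (auto simp: indicator_def)
      finally show "(\<integral>\<^sup>+ \<omega>. indicator {\<omega>. A i t \<omega>} \<omega> * gain i (Z t \<omega>) (X (Suc t) \<omega>) \<partial>M) \<le> (\<integral>\<^sup>+ \<omega>. indicator {\<omega>. A i t \<omega>} \<omega> \<partial>M)" .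
    qed auto
    finally have 1: "(\<integral>\<^sup>+ \<omega>. ennreal (cost_to_go i (Y \<omega>)) \<partial>M) \<le>
       (\<integral>\<^sup>+ \<omega>. ennreal (cost_to_go (Suc i) (Y \<omega>)) \<partial>M) + (\<Sum>t. \<integral>\<^sup>+ \<omega>. indicator {\<omega>. A i t \<omega>} \<omega> \<partial>M)"
      by (simp add: add_left_mono)
    have "(\<integral>\<^sup>+ \<omega>. indicator {\<omega>. A i t \<omega>} \<omega> \<partial>M) + (\<integral>\<^sup>+ \<omega>. indicator {\<omega>. enat t < sg i \<omega>} \<omega> \<partial>M)
       = (\<integral>\<^sup>+ \<omega>. indicator {\<omega>. enat t < sg (Suc i) \<omega>} \<omega> \<partial>M)" for t
    proof -
      have [measurable]: "Measurable.pred M (A i t)" using measurable_Filt_M[OF Am[OF i]] .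
      have Ai: "(indicator {\<omega>. A i t \<omega>} :: 'a \<Rightarrow> ennreal) \<in> borel_measurable M"
        unfolding indicator_def by measurable
      have "(\<integral>\<^sup>+ \<omega>. indicator {\<omega>. A i t \<omega>} \<omega> \<partial>M) + (\<integral>\<^sup>+ \<omega>. indicator {\<omega>. enat t < sg i \<omega>} \<omega> \<partial>M)
        = (\<integral>\<^sup>+ \<omega>. indicator {\<omega>. A i t \<omega>} \<omega> + indicator {\<omega>. enat t < sg i \<omega>} \<omega> \<partial>M)"
        using i by (intro nn_integral_add[symmetric] Ai im) auto
      also have "\<dots> = (\<integral>\<^sup>+ \<omega>. indicator {\<omega>. enat t < sg (Suc i) \<omega>} \<omega> \<partial>M)"
      proof (rule nn_integral_cong_AE)
        show "AE \<omega> in M. indicator {\<omega>. A i t \<omega>} \<omega> + indicator {\<omega>. enat t < sg i \<omega>} \<omega> = (indicator {\<omega>. enat t < sg (Suc i) \<omega>} \<omega> :: ennreal)"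
          using AEg
        proof eventually_elim
          fix \<omega> assume g: "good \<omega>"
          have "sg i \<omega> < sg (Suc i) \<omega>"
            using mono[OF g, of i "Suc i"] fin[OF g, of "Suc i"] i by (auto simp: sg_def zero_enat_def)
          then show "indicator {\<omega>. A i t \<omega>} \<omega> + indicator {\<omega>. enat t < sg i \<omega>} \<omega> = (indicator {\<omega>. enat t < sg (Suc i) \<omega>} \<omega> :: ennreal)"
            using Aiff[OF g i, of t] by (auto simp: indicator_def)
        qed
      qed
      finally show ?thesis .
    qed
    then have 2: "(\<Sum>t. \<integral>\<^sup>+ \<omega>. indicator {\<omega>. A i t \<omega>} \<omega> \<partial>M) + W i = W (Suc i)"
      unfolding W_def by (subst suminf_add) auto
    have "ennreal opt_value \<le> (\<integral>\<^sup>+ \<omega>. ennreal (cost_to_go i (Y \<omega>)) \<partial>M) + W i" using Suc by simp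
    also have "\<dots> \<le> ((\<integral>\<^sup>+ \<omega>. ennreal (cost_to_go (Suc i) (Y \<omega>)) \<partial>M) + (\<Sum>t. \<integral>\<^sup>+ \<omega>. indicator {\<omega>. A i t \<omega>} \<omega> \<partial>M)) + W i"
      by (rule add_right_mono[OF 1])
    also have "\<dots> = (\<integral>\<^sup>+ \<omega>. ennreal (cost_to_go (Suc i) (Y \<omega>)) \<partial>M) + W (Suc i)"
      unfolding add.assoc 2 ..
    finally show ?case .
  qed
  have "W k = (\<integral>\<^sup>+ \<omega>. (\<Sum>t. indicator {\<omega>. enat t < sg k \<omega>} \<omega>) \<partial>M)"
    unfolding W_def by (subst nn_integral_suminf) (use im in auto)
  also have "\<dots> = (\<integral>\<^sup>+ \<omega>. ennreal_of_enat (sg k \<omega>) \<partial>M)"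
  proof (rule nn_integral_cong)
    fix \<omega>
    have "(\<Sum>t. indicator {\<omega>. enat t < sg k \<omega>} \<omega> :: ennreal) = (\<Sum>t. indicator {t. enat t < sg k \<omega>} t)"
      by (intro suminf_cong) (simp add: indicator_def)
    then show "(\<Sum>t. indicator {\<omega>. enat t < sg k \<omega>} \<omega>) = ennreal_of_enat (sg k \<omega>)"
      by (simp only: suminf_indicator_enat)
  qed
  also have "\<dots> \<le> (\<integral>\<^sup>+ \<omega>. ennreal_of_enat (\<tau> k \<omega>) \<partial>M)"
    by (intro nn_integral_mono) (auto simp: sg_def)
  finally have "W k \<le> (\<integral>\<^sup>+ \<omega>. ennreal_of_enat (\<tau> k \<omega>) \<partial>M)" .
  moreover have "ennreal opt_value \<le> W k" using main[of k] by (simp add: cost_to_go_end)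
  ultimately show ?thesis by (rule order_trans[rotated])
qed

text \<open>The optimal rule: take the observation if it fits and does not increase the cost to go.\<close>

definition accepts :: "nat \<Rightarrow> (nat \<Rightarrow> real) \<Rightarrow> real \<Rightarrow> bool" where
  "accepts i y x \<longleftrightarrow> i < k \<and> consistent (Suc i) (y(\<pi> (Suc i) := x)) \<and>
     cost_to_go (Suc i) (y(\<pi> (Suc i) := x)) \<le> cost_to_go i y"

text \<open>The number of letters found so far and their values.\<close>

primrec threshold_state :: "nat \<Rightarrow> 'a \<Rightarrow> nat \<times> (nat \<Rightarrow> real)" where
  "threshold_state 0 \<omega> = (0, \<lambda>r. if r = Suc k then 1 else 0)"
| "threshold_state (Suc t) \<omega> = (case threshold_state t \<omega> of (i, y) \<Rightarrow>
     if accepts i y (X (Suc t) \<omega>) then (Suc i, y(\<pi> (Suc i) := X (Suc t) \<omega>)) else (i, y))"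

abbreviation "cnt t \<omega> \<equiv> fst (threshold_state t \<omega>)"
abbreviation "val t \<omega> \<equiv> snd (threshold_state t \<omega>)"

lemma cnt_Suc: "cnt (Suc t) \<omega> = (if accepts (cnt t \<omega>) (val t \<omega>) (X (Suc t) \<omega>) then Suc (cnt t \<omega>) else cnt t \<omega>)"
  and val_Suc: "val (Suc t) \<omega> = (if accepts (cnt t \<omega>) (val t \<omega>) (X (Suc t) \<omega>)
     then (val t \<omega>)(\<pi> (Suc (cnt t \<omega>)) := X (Suc t) \<omega>) else val t \<omega>)"
  by (auto split: prod.splits)

lemma cnt_le: "cnt t \<omega> \<le> k"
  by (induction t) (auto simp: cnt_Suc accepts_def simp del: threshold_state.simps(2))

lemma consistent_val: "consistent (cnt t \<omega>) (val t \<omega>)"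
proof (induction t)
  case 0
  show ?case by (auto simp: consistent_def known_def picked_def monotone_on_def)
next
  case (Suc t)
  show ?case
  proof (cases "accepts (cnt t \<omega>) (val t \<omega>) (X (Suc t) \<omega>)")
    case True
    then have "consistent (Suc (cnt t \<omega>)) ((val t \<omega>)(\<pi> (Suc (cnt t \<omega>)) := X (Suc t) \<omega>))"
      by (simp only: accepts_def)
    then show ?thesis unfolding cnt_Suc val_Suc using True by (simp only: if_True)
  next
    case False
    then show ?thesis unfolding cnt_Suc val_Suc using Suc by (simp only: if_False)
  qed
qed

lemma cnt_mono: "s \<le> t \<Longrightarrow> cnt s \<omega> \<le> cnt t \<omega>"
  by (induction rule: dec_induct) (auto simp: cnt_Suc simp del: threshold_state.simps(2))

lemma threshold_state_measurable:
  "(\<forall>i. Measurable.pred (Filt (enat t)) (\<lambda>\<omega>. cnt t \<omega> = i)) \<and> (\<forall>r. (\<lambda>\<omega>. val t \<omega> r) \<in> borel_measurable (Filt (enat t)))"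
proof (induction t)
  case 0
  then show ?case by auto
next
  case (Suc t)
  let ?F = "Filt (enat (Suc t))"
  have c: "Measurable.pred ?F (\<lambda>\<omega>. cnt t \<omega> = i)" for i
    using Suc measurable_Filt_mono[of "enat t" "enat (Suc t)"] by auto
  have v: "(\<lambda>\<omega>. val t \<omega> r) \<in> borel_measurable ?F" for r
    using Suc measurable_Filt_mono[of "enat t" "enat (Suc t)"] by auto
  have x: "X (Suc t) \<in> borel_measurable ?F" by (rule X_measurable_Filt) auto
  have acc: "Measurable.pred ?F (\<lambda>\<omega>. accepts i (val t \<omega>) (X (Suc t) \<omega>))" for i
  proof -
    have u: "(\<lambda>\<omega>. ((val t \<omega>)(\<pi> (Suc i) := X (Suc t) \<omega>)) q) \<in> borel_measurable ?F" if "q \<in> known (Suc i)" for q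
      by (rule upd_measurable[OF v x that])
    have 1: "(\<lambda>\<omega>. cost_to_go i (val t \<omega>)) \<in> borel_measurable ?F" by (rule cost_to_go_measurable[OF v])
    have 2: "(\<lambda>\<omega>. cost_to_go (Suc i) ((val t \<omega>)(\<pi> (Suc i) := X (Suc t) \<omega>))) \<in> borel_measurable ?F"
      by (rule cost_to_go_measurable[OF u])
    have 3: "Measurable.pred ?F (\<lambda>\<omega>. consistent (Suc i) ((val t \<omega>)(\<pi> (Suc i) := X (Suc t) \<omega>)))"
      by (rule pred_consistent[OF u])
    show ?thesis unfolding accepts_def
    proof (intro pred_intros_logic)
      show "Measurable.pred ?F (\<lambda>\<omega>. cost_to_go (Suc i) ((val t \<omega>)(\<pi> (Suc i) := X (Suc t) \<omega>)) \<le> cost_to_go i (val t \<omega>))"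
        unfolding pred_def by (rule borel_measurable_le[OF 2 1])
    qed (use 3 in simp_all)
  qed
  have A: "Measurable.pred ?F (\<lambda>\<omega>. cnt t \<omega> = i \<and> accepts i (val t \<omega>) (X (Suc t) \<omega>))" for i
    by (intro pred_intros_logic c acc)
  show ?case
  proof (intro conjI allI)
    fix i
    have "cnt (Suc t) \<omega> = i \<longleftrightarrow> (cnt t \<omega> = i \<and> \<not> (cnt t \<omega> = i \<and> accepts i (val t \<omega>) (X (Suc t) \<omega>)))
       \<or> (\<exists>j\<in>{..<i}. i = Suc j \<and> (cnt t \<omega> = j \<and> accepts j (val t \<omega>) (X (Suc t) \<omega>)))" for \<omega>
      unfolding cnt_Suc by auto
    moreover have "Measurable.pred ?F (\<lambda>\<omega>. (cnt t \<omega> = i \<and> \<not> (cnt t \<omega> = i \<and> accepts i (val t \<omega>) (X (Suc t) \<omega>)))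
       \<or> (\<exists>j\<in>{..<i}. i = Suc j \<and> (cnt t \<omega> = j \<and> accepts j (val t \<omega>) (X (Suc t) \<omega>))))"
      by (intro pred_intros_logic pred_intros_finite c A) auto
    ultimately show "Measurable.pred ?F (\<lambda>\<omega>. cnt (Suc t) \<omega> = i)" by (simp only:)
  next
    fix r
    have e: "val (Suc t) \<omega> r = (if \<exists>i\<in>{..<k}. r = \<pi> (Suc i) \<and> (cnt t \<omega> = i \<and> accepts i (val t \<omega>) (X (Suc t) \<omega>))
       then X (Suc t) \<omega> else val t \<omega> r)" for \<omega>
      unfolding val_Suc by (auto simp: accepts_def)
    have P: "Measurable.pred ?F (\<lambda>\<omega>. \<exists>i\<in>{..<k}. r = \<pi> (Suc i) \<and> (cnt t \<omega> = i \<and> accepts i (val t \<omega>) (X (Suc t) \<omega>)))"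
      by (intro pred_intros_finite pred_intros_logic c acc) auto
    show "(\<lambda>\<omega>. val (Suc t) \<omega> r) \<in> borel_measurable ?F"
      unfolding e by (rule measurable_If[OF x v P[unfolded pred_def]])
  qed
qed

lemma pred_cnt: "Measurable.pred (Filt (enat t)) (\<lambda>\<omega>. cnt t \<omega> = i)"
  and val_measurable: "(\<lambda>\<omega>. val t \<omega> r) \<in> borel_measurable (Filt (enat t))"
  using threshold_state_measurable[of t] by auto

lemma pred_cnt_less: "Measurable.pred (Filt (enat t)) (\<lambda>\<omega>. cnt t \<omega> < i)"
proof -
  have "Measurable.pred (Filt (enat t)) (\<lambda>\<omega>. \<exists>j\<in>{..<i}. cnt t \<omega> = j)"
    by (intro pred_intros_finite pred_cnt) auto
  then show ?thesis by (simp add: Bex_def)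
qed

definition pick_time :: "nat \<Rightarrow> 'a \<Rightarrow> enat" where
  "pick_time i \<omega> = (if \<exists>t. i \<le> cnt t \<omega> then enat (LEAST t. i \<le> cnt t \<omega>) else \<infinity>)"

lemma pick_time_le: "pick_time i \<omega> \<le> enat t \<longleftrightarrow> i \<le> cnt t \<omega>"
proof
  assume "pick_time i \<omega> \<le> enat t"
  then have "\<exists>t. i \<le> cnt t \<omega>" "(LEAST t. i \<le> cnt t \<omega>) \<le> t" by (auto simp: pick_time_def split: if_splits)
  then show "i \<le> cnt t \<omega>" using LeastI_ex[of "\<lambda>t. i \<le> cnt t \<omega>"] cnt_mono order_trans by blast
next
  assume "i \<le> cnt t \<omega>"
  then show "pick_time i \<omega> \<le> enat t" by (auto simp: pick_time_def intro: Least_le)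
qed

lemma stopping_time_pick: "stopping_time (natural_filtration M X) (pick_time i)"
  unfolding stopping_time_def
proof
  fix t :: enat
  show "Measurable.pred (Filt t) (\<lambda>\<omega>. pick_time i \<omega> \<le> t)"
  proof (cases t)
    case (enat n)
    have "Measurable.pred (Filt (enat n)) (\<lambda>\<omega>. \<not> cnt n \<omega> < i)" by (intro pred_intros_logic pred_cnt_less)
    then show ?thesis by (simp add: enat pick_time_le not_less)
  qed simp
qed

text \<open>The rule accepts precisely the observations with non-negative decrease, so the truncation in \<open>gain\<close> is harmless and
the expected decrease is exactly 1 as long as letters are missing.\<close>

lemma threshold_drift:
  "(\<integral>\<^sup>+ \<omega>. ennreal (cost_to_go (cnt t \<omega>) (val t \<omega>)) \<partial>M)
   = (\<integral>\<^sup>+ \<omega>. ennreal (cost_to_go (cnt (Suc t) \<omega>) (val (Suc t) \<omega>)) \<partial>M) + (\<integral>\<^sup>+ \<omega>. indicator {\<omega>. cnt t \<omega> < k} \<omega> \<partial>M)"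
proof -
  define g where "g \<omega> = (\<Sum>i<k. indicator {\<omega>. cnt t \<omega> = i} \<omega> * gain i (val t \<omega>) (X (Suc t) \<omega>))" for \<omega>
  have pw: "ennreal (cost_to_go (cnt t \<omega>) (val t \<omega>)) = ennreal (cost_to_go (cnt (Suc t) \<omega>) (val (Suc t) \<omega>)) + g \<omega>" for \<omega>
  proof -
    let ?i = "cnt t \<omega>" and ?y = "val t \<omega>" and ?x = "X (Suc t) \<omega>"
    have g: "g \<omega> = (if ?i < k then gain ?i ?y ?x else 0)"
    proof -
      have "g \<omega> = (\<Sum>i<k. if i = ?i then gain ?i ?y ?x else 0)"
        unfolding g_def by (intro sum.cong) auto
      then show ?thesis by simp
    qed
    show ?thesis
    proof (cases "accepts ?i ?y ?x")
      case True
      then have a: "?i < k" "consistent (Suc ?i) (?y(\<pi> (Suc ?i) := ?x))" "cost_to_go (Suc ?i) (?y(\<pi> (Suc ?i) := ?x)) \<le> cost_to_go ?i ?y"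
        by (auto simp: accepts_def)
      have "ennreal (cost_to_go ?i ?y) = ennreal (cost_to_go (Suc ?i) (?y(\<pi> (Suc ?i) := ?x)) + (cost_to_go ?i ?y - cost_to_go (Suc ?i) (?y(\<pi> (Suc ?i) := ?x))))"
        by simp
      also have "\<dots> = ennreal (cost_to_go (Suc ?i) (?y(\<pi> (Suc ?i) := ?x))) + ennreal (cost_to_go ?i ?y - cost_to_go (Suc ?i) (?y(\<pi> (Suc ?i) := ?x)))"
        using a cost_to_go_nonneg[of "Suc ?i"] by (intro ennreal_plus) auto
      also have "ennreal (cost_to_go ?i ?y - cost_to_go (Suc ?i) (?y(\<pi> (Suc ?i) := ?x))) = g \<omega>"
        unfolding g gain_def using a consistent_val by simp
      finally show ?thesis unfolding cnt_Suc val_Suc using True by (simp only: if_True)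
    next
      case False
      then have "g \<omega> = 0" unfolding g gain_def by (auto simp: accepts_def ennreal_neg)
      then show ?thesis unfolding cnt_Suc val_Suc using False by (simp only: if_False add_0_right)
    qed
  qed
  have cm: "(\<lambda>\<omega>. cost_to_go i (val t \<omega>)) \<in> borel_measurable M" for i t
    by (rule cost_to_go_measurable) (rule measurable_Filt_M[OF val_measurable])
  have im: "(indicator {\<omega>. cnt t \<omega> = i} :: 'a \<Rightarrow> ennreal) \<in> borel_measurable M" for i t
    using measurable_Filt_M[OF pred_cnt[of t i]] unfolding indicator_def by measurable
  have gm: "(\<lambda>\<omega>. gain i (val t \<omega>) (X (Suc t) \<omega>)) \<in> borel_measurable M" for i
    by (intro gain_measurable measurable_Filt_M[OF val_measurable] X_measurable) auto
  have Pm: "(\<lambda>\<omega>. ennreal (cost_to_go (cnt t \<omega>) (val t \<omega>))) \<in> borel_measurable M" for t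
  proof -
    have "ennreal (cost_to_go (cnt t \<omega>) (val t \<omega>)) = (\<Sum>i\<le>k. indicator {\<omega>. cnt t \<omega> = i} \<omega> * ennreal (cost_to_go i (val t \<omega>)))" for \<omega>
    proof -
      have "(\<Sum>i\<le>k. indicator {\<omega>. cnt t \<omega> = i} \<omega> * ennreal (cost_to_go i (val t \<omega>)))
        = (\<Sum>i\<le>k. if i = cnt t \<omega> then ennreal (cost_to_go (cnt t \<omega>) (val t \<omega>)) else 0)"
        by (intro sum.cong) auto
      then show ?thesis using cnt_le[of t \<omega>] by simp
    qed
    note e = this
    have "(\<lambda>\<omega>. \<Sum>i\<le>k. indicator {\<omega>. cnt t \<omega> = i} \<omega> * ennreal (cost_to_go i (val t \<omega>))) \<in> borel_measurable M"
      by (intro borel_measurable_sum borel_measurable_times_ennreal im measurable_compose[OF cm measurable_ennreal])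
    then show ?thesis unfolding e .
  qed
  have "(\<integral>\<^sup>+ \<omega>. g \<omega> \<partial>M) = (\<Sum>i<k. \<integral>\<^sup>+ \<omega>. indicator {\<omega>. cnt t \<omega> = i} \<omega> * gain i (val t \<omega>) (X (Suc t) \<omega>) \<partial>M)"
    unfolding g_def using im gm by (intro nn_integral_sum) auto
  also have "\<dots> = (\<Sum>i<k. \<integral>\<^sup>+ \<omega>. indicator {\<omega>. cnt t \<omega> = i} \<omega> \<partial>M)"
  proof (rule sum.cong)
    fix i assume i: "i \<in> {..<k}"
    have "(\<integral>\<^sup>+ \<omega>. indicator {\<omega>. cnt t \<omega> = i} \<omega> * gain i (val t \<omega>) (X (Suc t) \<omega>) \<partial>M)
      = (\<integral>\<^sup>+ \<omega>. indicator {\<omega>. cnt t \<omega> = i} \<omega> * (\<integral>\<^sup>+ x. gain i (val t \<omega>) x * indicator {0<..<1} x \<partial>lborel) \<partial>M)"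
      by (rule gain_next) (rule pred_cnt val_measurable)+
    also have "\<dots> = (\<integral>\<^sup>+ \<omega>. indicator {\<omega>. cnt t \<omega> = i} \<omega> \<partial>M)"
    proof (rule nn_integral_cong)
      fix \<omega>
      show "indicator {\<omega>. cnt t \<omega> = i} \<omega> * (\<integral>\<^sup>+ x. gain i (val t \<omega>) x * indicator {0<..<1} x \<partial>lborel) = (indicator {\<omega>. cnt t \<omega> = i} \<omega> :: ennreal)"
        using nn_integral_gain[of i "val t \<omega>"] consistent_val[of t \<omega>] i by (cases "cnt t \<omega> = i") auto
    qed
    finally show "(\<integral>\<^sup>+ \<omega>. indicator {\<omega>. cnt t \<omega> = i} \<omega> * gain i (val t \<omega>) (X (Suc t) \<omega>) \<partial>M) = (\<integral>\<^sup>+ \<omega>. indicator {\<omega>. cnt t \<omega> = i} \<omega> \<partial>M)" .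
  qed simp
  also have "\<dots> = (\<integral>\<^sup>+ \<omega>. (\<Sum>i<k. indicator {\<omega>. cnt t \<omega> = i} \<omega>) \<partial>M)"
    using im by (intro nn_integral_sum[symmetric]) auto
  also have "\<dots> = (\<integral>\<^sup>+ \<omega>. indicator {\<omega>. cnt t \<omega> < k} \<omega> \<partial>M)"
  proof (rule nn_integral_cong)
    fix \<omega>
    have "(\<Sum>i<k. indicator {\<omega>. cnt t \<omega> = i} \<omega> :: ennreal) = (\<Sum>i<k. if i = cnt t \<omega> then 1 else 0)"
      by (intro sum.cong) auto
    then show "(\<Sum>i<k. indicator {\<omega>. cnt t \<omega> = i} \<omega> :: ennreal) = indicator {\<omega>. cnt t \<omega> < k} \<omega>"
      by (simp add: indicator_def)
  qed
  finally have gi: "(\<integral>\<^sup>+ \<omega>. g \<omega> \<partial>M) = (\<integral>\<^sup>+ \<omega>. indicator {\<omega>. cnt t \<omega> < k} \<omega> \<partial>M)" .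
  have "g \<in> borel_measurable M" unfolding g_def using im gm by measurable
  then show ?thesis unfolding pw gi[symmetric] using Pm[of "Suc t"] by (intro nn_integral_add) auto
qed

text \<open>Summing the drift: the expected number of observations before completion is the total decrease of the cost.\<close>

lemma threshold_value: "(\<integral>\<^sup>+ \<omega>. ennreal_of_enat (pick_time k \<omega>) \<partial>M) \<le> ennreal opt_value"
proof -
  have im: "(indicator {\<omega>. cnt t \<omega> < k} :: 'a \<Rightarrow> ennreal) \<in> borel_measurable M" for t
    using measurable_Filt_M[OF pred_cnt_less[of t k]] unfolding indicator_def by measurable
  have "(\<integral>\<^sup>+ \<omega>. ennreal (cost_to_go (cnt t \<omega>) (val t \<omega>)) \<partial>M) + (\<Sum>s<t. \<integral>\<^sup>+ \<omega>. indicator {\<omega>. cnt s \<omega> < k} \<omega> \<partial>M) = ennreal opt_value" for t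
  proof (induction t)
    case 0
    show ?case by (simp add: cost_to_go_0 emeasure_space_1 del: upt_Suc)
  next
    case (Suc t)
    then show ?case using threshold_drift[of t] by (simp add: add_ac del: threshold_state.simps(2))
  qed
  note tel = this
  have le: "(\<Sum>s<t. \<integral>\<^sup>+ \<omega>. indicator {\<omega>. cnt s \<omega> < k} \<omega> \<partial>M) \<le> ennreal opt_value" for t
    by (rule order_trans[OF _ eq_refl[OF tel[of t]]]) (simp add: add_increasing)
  have "ennreal_of_enat (pick_time k \<omega>) = (\<Sum>t. indicator {\<omega>. cnt t \<omega> < k} \<omega>)" for \<omega>
  proof -
    have "(\<Sum>t. indicator {\<omega>. cnt t \<omega> < k} \<omega> :: ennreal) = (\<Sum>t. indicator {t. enat t < pick_time k \<omega>} t)"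
      using pick_time_le[of k \<omega>] by (intro suminf_cong) (auto simp: indicator_def not_le[symmetric])
    then show ?thesis by (simp only: suminf_indicator_enat)
  qed
  then have "(\<integral>\<^sup>+ \<omega>. ennreal_of_enat (pick_time k \<omega>) \<partial>M) = (\<Sum>t. \<integral>\<^sup>+ \<omega>. indicator {\<omega>. cnt t \<omega> < k} \<omega> \<partial>M)"
    using im by (simp add: nn_integral_suminf)
  also have "\<dots> \<le> ennreal opt_value"
    by (rule suminf_le_const) (use le in auto)
  finally show ?thesis .
qed

text \<open>Every recorded value is the observation at the time when its letter was found.\<close>

lemma pick_record: "\<forall>i\<in>{1..cnt t \<omega>}. \<exists>m. 1 \<le> m \<and> m \<le> t \<and> cnt m \<omega> = i \<and> cnt (m - 1) \<omega> = i - 1 \<and> val t \<omega> (\<pi> i) = X m \<omega>"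
proof (induction t)
  case (Suc t)
  show ?case
  proof (cases "accepts (cnt t \<omega>) (val t \<omega>) (X (Suc t) \<omega>)")
    case True
    then have c: "cnt (Suc t) \<omega> = Suc (cnt t \<omega>)" and v: "val (Suc t) \<omega> = (val t \<omega>)(\<pi> (Suc (cnt t \<omega>)) := X (Suc t) \<omega>)"
      by (simp_all add: cnt_Suc val_Suc del: threshold_state.simps(2))
    show ?thesis
    proof
      fix i assume i: "i \<in> {1..cnt (Suc t) \<omega>}"
      show "\<exists>m. 1 \<le> m \<and> m \<le> Suc t \<and> cnt m \<omega> = i \<and> cnt (m - 1) \<omega> = i - 1 \<and> val (Suc t) \<omega> (\<pi> i) = X m \<omega>"
      proof (cases "i = Suc (cnt t \<omega>)")
        case True
        then show ?thesis using c v by (intro exI[of _ "Suc t"]) (simp del: threshold_state.simps(2))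
      next
        case False
        then have "i \<in> {1..cnt t \<omega>}" using i c by auto
        then obtain m where "1 \<le> m" "m \<le> t" "cnt m \<omega> = i" "cnt (m - 1) \<omega> = i - 1" "val t \<omega> (\<pi> i) = X m \<omega>"
          using Suc by blast
        then show ?thesis using False v by (intro exI[of _ m]) (simp add: perm_eq_iff del: threshold_state.simps(2))
      qed
    qed
  next
    case False
    then have "cnt (Suc t) \<omega> = cnt t \<omega>" "val (Suc t) \<omega> = val t \<omega>"
      by (simp_all add: cnt_Suc val_Suc del: threshold_state.simps(2))
    then show ?thesis using Suc by (metis le_SucI)
  qed
qed simp

text \<open>The expected completion time is finite by \<open>threshold_value\<close>, so all times are finite almost surely; the recorded state
is consistent, which is the required order isomorphism.\<close>

lemma pick_time_OA: "pick_time \<in> OA M X k \<pi>"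
proof -
  have im: "(\<lambda>\<omega>. ennreal_of_enat (pick_time k \<omega>)) \<in> borel_measurable M"
  proof -
    have "(indicator {\<omega>. cnt t \<omega> < k} :: 'a \<Rightarrow> ennreal) \<in> borel_measurable M" for t
      using measurable_Filt_M[OF pred_cnt_less[of t k]] unfolding indicator_def by measurable
    then have "(\<lambda>\<omega>. \<Sum>t. indicator {\<omega>. cnt t \<omega> < k} \<omega> :: ennreal) \<in> borel_measurable M"
      by (intro borel_measurable_suminf_order) auto
    moreover have "ennreal_of_enat (pick_time k \<omega>) = (\<Sum>t. indicator {\<omega>. cnt t \<omega> < k} \<omega>)" for \<omega>
    proof -
      have "(\<Sum>t. indicator {\<omega>. cnt t \<omega> < k} \<omega> :: ennreal) = (\<Sum>t. indicator {t. enat t < pick_time k \<omega>} t)"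
        using pick_time_le[of k \<omega>] by (intro suminf_cong) (auto simp: indicator_def not_le[symmetric])
      then show ?thesis by (simp only: suminf_indicator_enat)
    qed
    ultimately show ?thesis by simp
  qed
  have "(\<integral>\<^sup>+ \<omega>. ennreal_of_enat (pick_time k \<omega>) \<partial>M) \<noteq> \<infinity>"
    using threshold_value by (metis ennreal_less_top infinity_ennreal_def leD)
  then have "AE \<omega> in M. ennreal_of_enat (pick_time k \<omega>) \<noteq> \<infinity>"
    by (rule nn_integral_PInf_AE[OF im])
  then have "AE \<omega> in M. (\<forall>i\<in>{1..k}. 1 \<le> pick_time i \<omega> \<and> pick_time i \<omega> < \<infinity>) \<and>
        strict_mono_on {1..k} (\<lambda>i. pick_time i \<omega>) \<and>
        (\<forall>i\<in>{1..k}. \<forall>j\<in>{1..k}. \<pi> i < \<pi> j \<longleftrightarrow> X (the_enat (pick_time i \<omega>)) \<omega> < X (the_enat (pick_time j \<omega>)) \<omega>)"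
  proof eventually_elim
    fix \<omega> assume f: "ennreal_of_enat (pick_time k \<omega>) \<noteq> \<infinity>"
    then obtain T where T: "pick_time k \<omega> = enat T" by (cases "pick_time k \<omega>") auto
    then have k: "cnt T \<omega> = k" using pick_time_le[of k \<omega> T] cnt_le[of T \<omega>] by simp
    have m: "\<exists>m\<ge>1. pick_time i \<omega> = enat m \<and> cnt m \<omega> = i \<and> val T \<omega> (\<pi> i) = X m \<omega>" if i: "i \<in> {1..k}" for i
    proof -
      obtain m where m: "1 \<le> m" "m \<le> T" "cnt m \<omega> = i" "cnt (m - 1) \<omega> = i - 1" "val T \<omega> (\<pi> i) = X m \<omega>"
        using bspec[OF pick_record[of T \<omega>, unfolded k] i] by blast
      have "pick_time i \<omega> \<le> enat m" "\<not> pick_time i \<omega> \<le> enat (m - 1)"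
        using m i by (auto simp: pick_time_le)
      then have "pick_time i \<omega> = enat m" using m(1) by (cases "pick_time i \<omega>") auto
      then show ?thesis using m by blast
    qed
    have "pick_time i \<omega> < pick_time j \<omega>" if ij: "i \<in> {1..k}" "j \<in> {1..k}" "i < j" for i j
    proof -
      obtain mi mj where *: "pick_time i \<omega> = enat mi" "cnt mi \<omega> = i" "pick_time j \<omega> = enat mj" "cnt mj \<omega> = j"
        using m[OF ij(1)] m[OF ij(2)] by blast
      have "\<not> mj \<le> mi" using cnt_mono[of mj mi \<omega>] * ij by auto
      then show ?thesis using * by simp
    qed
    moreover have "\<pi> i < \<pi> j \<longleftrightarrow> X (the_enat (pick_time i \<omega>)) \<omega> < X (the_enat (pick_time j \<omega>)) \<omega>"
      if ij: "i \<in> {1..k}" "j \<in> {1..k}" for i j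
    proof -
      have sm: "strict_mono_on (known k) (val T \<omega>)" using consistent_val[of T \<omega>] k by (simp add: consistent_def)
      have "\<pi> i \<in> known k" "\<pi> j \<in> known k" using ij by (auto simp: known_def set_picked)
      then have "\<pi> i < \<pi> j \<longleftrightarrow> val T \<omega> (\<pi> i) < val T \<omega> (\<pi> j)"
        using strict_mono_onD[OF sm] by (metis linorder_neqE_nat order_less_asym' order_less_irrefl)
      then show ?thesis using m[OF ij(1)] m[OF ij(2)] by auto
    qed
    moreover have "1 \<le> pick_time i \<omega> \<and> pick_time i \<omega> < \<infinity>" if "i \<in> {1..k}" for i
      using m[OF that] by (auto simp: one_enat_def)
    ultimately show "(\<forall>i\<in>{1..k}. 1 \<le> pick_time i \<omega> \<and> pick_time i \<omega> < \<infinity>) \<and>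
        strict_mono_on {1..k} (\<lambda>i. pick_time i \<omega>) \<and>
        (\<forall>i\<in>{1..k}. \<forall>j\<in>{1..k}. \<pi> i < \<pi> j \<longleftrightarrow> X (the_enat (pick_time i \<omega>)) \<omega> < X (the_enat (pick_time j \<omega>)) \<omega>)"
      by (auto intro!: strict_mono_onI)
  qed
  then show ?thesis unfolding OA_def using stopping_time_pick by auto
qed

theorem beta_eq: "beta M X k \<pi> = ennreal opt_value"
  unfolding beta_def
proof (rule antisym)
  show "(INF \<tau>\<in>OA M X k \<pi>. \<integral>\<^sup>+ \<omega>. ennreal_of_enat (\<tau> k \<omega>) \<partial>M) \<le> ennreal opt_value"
  proof -
    have "(INF \<tau>\<in>OA M X k \<pi>. \<integral>\<^sup>+ \<omega>. ennreal_of_enat (\<tau> k \<omega>) \<partial>M) \<le> (\<integral>\<^sup>+ \<omega>. ennreal_of_enat (pick_time k \<omega>) \<partial>M)"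
      by (rule INF_lower[OF pick_time_OA])
    also note threshold_value
    finally show ?thesis .
  qed
  show "ennreal opt_value \<le> (INF \<tau>\<in>OA M X k \<pi>. \<integral>\<^sup>+ \<omega>. ennreal_of_enat (\<tau> k \<omega>) \<partial>M)"
    by (rule INF_greatest) (rule opt_value_le)
qed

end

section \<open>Search trees of a given size\<close>
text \<open>The values \<open>s\<close> are those of the search trees with \<open>k\<close> nodes.\<close>

inductive root_of_size :: "nat \<Rightarrow> real \<Rightarrow> bool" where
  leaf: "root_of_size 0 0"
| node: "root_of_size p s \<Longrightarrow> root_of_size q t \<Longrightarrow> root_of_size (Suc (p + q)) (join_root s t)"

lemma root_of_size_nonneg: "root_of_size k s \<Longrightarrow> 0 \<le> s"
  by (induction rule: root_of_size.induct) (auto simp: join_root_nonneg)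

lemma root_of_size_bst_root: "distinct xs \<Longrightarrow> root_of_size (length xs) (bst_root xs)"
proof (induction xs rule: bst_root.induct)
  case (2 r rs)
  have "length (filter (\<lambda>x. x < r) rs) + length (filter (\<lambda>x. \<not> x < r) rs) = length rs"
    by (rule sum_length_filter_compl)
  moreover have "filter (\<lambda>x. \<not> x < r) rs = filter (\<lambda>x. r < x) rs"
    using 2(3) by (intro filter_cong) (auto simp: not_less order.order_iff_strict)
  ultimately have "length (r # rs) = Suc (length (filter (\<lambda>x. x < r) rs) + length (filter (\<lambda>x. r < x) rs))"
    by simp
  then show ?case using root_of_size.node[OF 2(1,2)] 2(3) by simp
qed (auto intro: leaf)

lemma bij_betw_rank:
  fixes A :: "nat set"
  assumes "finite A"
  shows "bij_betw (\<lambda>x. card {y\<in>A. y < x}) A {..<card A}"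
proof -
  have less: "card {y\<in>A. y < a} < card {y\<in>A. y < b}" if "a \<in> A" "a < b" for a b
    using that assms by (intro psubset_card_mono) auto
  have inj: "inj_on (\<lambda>x. card {y\<in>A. y < x}) A"
  proof (rule linorder_inj_onI')
    fix a b assume "a \<in> A" "a < b"
    then show "card {y\<in>A. y < a} \<noteq> card {y\<in>A. y < b}" using less[of a b] by simp
  qed
  have "card {y\<in>A. y < x} < card A" if "x \<in> A" for x
    using that assms by (intro psubset_card_mono) auto
  then have "(\<lambda>x. card {y\<in>A. y < x}) ` A = {..<card A}"
    using card_image[OF inj] by (intro card_subset_eq) auto
  with inj show ?thesis by (simp add: bij_betw_def)
qed

lemma card_rank_compl:
  fixes A :: "nat set"
  assumes "finite A" "x \<in> A"
  shows "card A = Suc (card {y\<in>A. y < x} + card {y\<in>A. x < y})"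
proof -
  have "A = insert x ({y\<in>A. y < x} \<union> {y\<in>A. x < y})" using assms by auto
  then have "card A = card (insert x ({y\<in>A. y < x} \<union> {y\<in>A. x < y}))" by simp
  also have "\<dots> = Suc (card ({y\<in>A. y < x} \<union> {y\<in>A. x < y}))"
    using assms by (intro card_insert_disjoint) auto
  also have "card ({y\<in>A. y < x} \<union> {y\<in>A. x < y}) = card {y\<in>A. y < x} + card {y\<in>A. x < y}"
    using assms by (intro card_Un_disjoint) auto
  finally show ?thesis .
qed

text \<open>Put a root above the elements of the left subtree and below those of the right one; the insertion order lists the root
first.\<close>

lemma root_of_size_realized:
  assumes "root_of_size k v" "finite A" "card A = k"
  shows "\<exists>xs\<in>permutations_of_set A. bst_root xs = v"
  using assms
proof (induction arbitrary: A rule: root_of_size.induct)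
  case leaf
  then show ?case by simp
next
  case (node p s q t)
  have "p \<in> {..<card A}" using node by simp
  also have "\<dots> = (\<lambda>x. card {y\<in>A. y < x}) ` A" using bij_betw_rank[OF node.prems(1)] by (simp add: bij_betw_def)
  finally obtain r where r: "r \<in> A" "card {y\<in>A. y < r} = p" by auto
  then have "card {y\<in>A. r < y} = q" using card_rank_compl[OF node.prems(1) r(1)] node.prems by simp
  then obtain ys where ys: "ys \<in> permutations_of_set {y\<in>A. r < y}" "bst_root ys = t"
    using node.IH(2)[of "{y\<in>A. r < y}"] node.prems by auto
  obtain xs where xs: "xs \<in> permutations_of_set {y\<in>A. y < r}" "bst_root xs = s"
    using node.IH(1)[of "{y\<in>A. y < r}"] r node.prems by auto
  have set: "set xs = {y\<in>A. y < r}" "set ys = {y\<in>A. r < y}" "distinct xs" "distinct ys"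
    using xs ys by (auto simp: permutations_of_set_def)
  have "filter (\<lambda>x. x < r) (xs @ ys) = xs" "filter (\<lambda>x. r < x) (xs @ ys) = ys"
    using set by (auto intro!: filter_True filter_False)
  then have "bst_root (r # xs @ ys) = join_root s t" using xs ys by simp
  moreover have "r # xs @ ys \<in> permutations_of_set A"
  proof -
    have A: "A = insert r ({y\<in>A. y < r} \<union> {y\<in>A. r < y})" using r by auto
    have "set (r # xs @ ys) = insert r (set xs \<union> set ys)" by simp
    also have "\<dots> = A" unfolding set(1,2) by (rule A[symmetric])
    finally have "set (r # xs @ ys) = A" .
    moreover have "distinct (r # xs @ ys)"
      using set(3,4) by (simp add: set(1,2) disjoint_iff)
    ultimately show ?thesis by (simp only: permutations_of_set_def mem_Collect_eq)
  qed
  ultimately show ?case by blast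
qed

lemma bst_root_image:
  assumes "finite A"
  shows "bst_root ` permutations_of_set A = Collect (root_of_size (card A))"
proof (intro equalityI subsetI)
  fix v assume "v \<in> bst_root ` permutations_of_set A"
  then obtain xs where "v = bst_root xs" "set xs = A" "distinct xs" by (auto simp: permutations_of_set_def)
  then show "v \<in> Collect (root_of_size (card A))"
    using root_of_size_bst_root[of xs] distinct_card[of xs] by simp
next
  fix v assume "v \<in> Collect (root_of_size (card A))"
  then show "v \<in> bst_root ` permutations_of_set A"
    using root_of_size_realized[of "card A" v A] assms by auto
qed

lemma bij_betw_perms: "bij_betw (\<lambda>\<pi>. map \<pi> [1..<Suc k]) (perms k) (permutations_of_set {1..k})"
proof -
  have inj: "inj_on (\<lambda>\<pi>. map \<pi> [1..<Suc k]) (perms k)"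
  proof (rule inj_onI)
    fix \<pi> \<sigma> assume *: "\<pi> \<in> perms k" "\<sigma> \<in> perms k" and e: "map \<pi> [1..<Suc k] = map \<sigma> [1..<Suc k]"
    show "\<pi> = \<sigma>"
    proof
      fix x
      show "\<pi> x = \<sigma> x"
      proof (cases "x \<in> {1..k}")
        case True
        then have "x \<in> set [1..<Suc k]" by (auto simp del: upt_Suc)
        then show ?thesis using e by (simp del: upt_Suc)
      next
        case False then show ?thesis using * by (auto simp: perms_def permutes_def)
      qed
    qed
  qed
  have sub: "(\<lambda>\<pi>. map \<pi> [1..<Suc k]) ` perms k \<subseteq> permutations_of_set {1..k}"
  proof safe
    fix \<pi> assume "\<pi> \<in> perms k"
    then have p: "\<pi> permutes {1..k}" by (simp add: perms_def)
    have s: "set [1..<Suc k] = {1..k}" by auto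
    show "map \<pi> [1..<Suc k] \<in> permutations_of_set {1..k}"
      using permutes_image[OF p] permutes_inj_on[OF p, of "{1..k}"] s
      by (auto simp: permutations_of_set_def distinct_map simp del: upt_Suc)
  qed
  have "card ((\<lambda>\<pi>. map \<pi> [1..<Suc k]) ` perms k) = card (permutations_of_set {1..k})"
    unfolding card_image[OF inj] using card_permutations[of "{1..k}" k] by (simp add: perms_def)
  then have "(\<lambda>\<pi>. map \<pi> [1..<Suc k]) ` perms k = permutations_of_set {1..k}"
    using sub by (intro card_subset_eq) auto
  with inj show ?thesis by (simp add: bij_betw_def)
qed

lemma finite_perms: "finite (perms k)" "perms k \<noteq> {}"
  using finite_permutations[of "{1..k}"] permutes_id[of "{1..k}"] unfolding perms_def by (simp, blast)

lemma perms_image: "(\<lambda>\<pi>. bst_root (map \<pi> [1..<Suc k])) ` perms k = Collect (root_of_size k)"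
proof -
  have "(\<lambda>\<pi>. bst_root (map \<pi> [1..<Suc k])) ` perms k = bst_root ` (\<lambda>\<pi>. map \<pi> [1..<Suc k]) ` perms k"
    by (simp add: image_image)
  also have "\<dots> = Collect (root_of_size k)"
    using bij_betw_perms[of k] bst_root_image[of "{1..k}"] by (simp add: bij_betw_def)
  finally show ?thesis .
qed

lemma finite_roots: "finite (Collect (root_of_size k))" and roots_nonempty: "Collect (root_of_size k) \<noteq> {}"
  using finite_perms[of k] by (auto simp: perms_image[symmetric] simp del: Collect_empty_eq)

definition min_root :: "nat \<Rightarrow> real" where "min_root k = Min (Collect (root_of_size k))"
definition max_root :: "nat \<Rightarrow> real" where "max_root k = Max (Collect (root_of_size k))"

lemma min_root_attained: "root_of_size k (min_root k)" and max_root_attained: "root_of_size k (max_root k)"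
  using Min_in[OF finite_roots roots_nonempty] Max_in[OF finite_roots roots_nonempty]
  by (auto simp: min_root_def max_root_def)

lemma min_root_le: "root_of_size k s \<Longrightarrow> min_root k \<le> s" and max_root_ge: "root_of_size k s \<Longrightarrow> s \<le> max_root k"
  using finite_roots by (auto simp: min_root_def max_root_def)

lemma root_of_size_le: "root_of_size k s \<Longrightarrow> s \<le> real k"
proof (induction rule: root_of_size.induct)
  case (node p s q t)
  then show ?case using toll_le_1[of s t] root_of_size_nonneg[of p s] root_of_size_nonneg[of q t] by (simp add: join_root_def)
qed simp

lemma min_root_join: "min_root (Suc (p + q)) \<le> join_root (min_root p) (min_root q)"
  by (intro min_root_le root_of_size.node min_root_attained)

lemma max_root_join: "join_root (max_root p) (max_root q) \<le> max_root (Suc (p + q))"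
  by (intro max_root_ge root_of_size.node max_root_attained)

text \<open>The root of a random permutation has a uniform rank, and the relative orders of the smaller and of the larger elements
are independent and uniform.\<close>

function root_pmf :: "nat \<Rightarrow> real pmf" where
  "root_pmf 0 = return_pmf 0"
| "root_pmf (Suc n) = bind_pmf (pmf_of_set {..n})
     (\<lambda>p. map_pmf (\<lambda>(s, t). join_root s t) (pair_pmf (root_pmf p) (root_pmf (n - p))))"
  by pat_completeness auto
termination by (relation "Wellfounded.measure id") auto

declare root_pmf.simps(2) [simp del]

lemma set_root_pmf: "s \<in> set_pmf (root_pmf k) \<Longrightarrow> root_of_size k s"
proof (induction k arbitrary: s rule: less_induct)
  case (less k)
  show ?case
  proof (cases k)
    case 0
    then show ?thesis using less by (auto intro: leaf)
  next
    case (Suc n)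
    then obtain p a b where *: "p \<le> n" "a \<in> set_pmf (root_pmf p)" "b \<in> set_pmf (root_pmf (n - p))" "s = join_root a b"
      using less(2) by (auto simp: root_pmf.simps(2))
    have "root_of_size (Suc (p + (n - p))) (join_root a b)"
      using less(1)[of p a] less(1)[of "n - p" b] * Suc by (intro node) auto
    then show ?thesis using * Suc by simp
  qed
qed

lemma finite_set_root_pmf: "finite (set_pmf (root_pmf k))"
  by (rule finite_subset[OF _ finite_roots[of k]]) (auto dest: set_root_pmf)

lemma root_pmf_random_permutation:
  fixes A :: "nat set"
  assumes "finite A"
  shows "map_pmf bst_root (pmf_of_set (permutations_of_set A)) = root_pmf (card A)"
  using assms
proof (induction "card A" arbitrary: A rule: less_induct)
  case less
  show ?case
  proof (cases "A = {}")
    case True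
    then show ?thesis by (simp add: pmf_of_set_singleton)
  next
    case False
    define n where "n = card A - 1"
    have n: "card A = Suc n" using less.prems False by (simp add: n_def card_gt_0_iff)
    have inner: "map_pmf (\<lambda>xs. bst_root (x # xs)) (pmf_of_set (permutations_of_set (A - {x})))
      = map_pmf (\<lambda>(s, t). join_root s t) (pair_pmf (root_pmf (card {y\<in>A. y < x})) (root_pmf (n - card {y\<in>A. y < x})))"
      if x: "x \<in> A" for x
    proof -
      let ?B = "A - {x}"
      have fB: "finite ?B" using less.prems by simp
      have s: "{y\<in>?B. y < x} = {y\<in>A. y < x}" "{y\<in>?B. \<not> y < x} = {y\<in>A. x < y}" by auto
      have c: "card A = Suc (card {y\<in>A. y < x} + card {y\<in>A. x < y})" by (rule card_rank_compl[OF less.prems x])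
      have ih: "map_pmf bst_root (pmf_of_set (permutations_of_set {y\<in>A. y < x})) = root_pmf (card {y\<in>A. y < x})"
        "map_pmf bst_root (pmf_of_set (permutations_of_set {y\<in>A. x < y})) = root_pmf (n - card {y\<in>A. y < x})"
        using less.hyps[of "{y\<in>A. y < x}"] less.hyps[of "{y\<in>A. x < y}"] c n less.prems by auto
      have "map_pmf (\<lambda>xs. bst_root (x # xs)) (pmf_of_set (permutations_of_set ?B))
        = map_pmf (\<lambda>xs. (\<lambda>(a, b). join_root (bst_root a) (bst_root b)) (partition (\<lambda>y. y < x) xs)) (pmf_of_set (permutations_of_set ?B))"
      proof (rule map_pmf_cong)
        fix xs assume "xs \<in> set_pmf (pmf_of_set (permutations_of_set ?B))"
        then have "xs \<in> permutations_of_set ?B" using fB by (simp add: set_pmf_of_set)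
        then have "set xs = ?B" by (simp add: permutations_of_set_def)
        then have "y \<noteq> x" if "y \<in> set xs" for y using that by simp
        then have "\<not> y < x \<longleftrightarrow> x < y" if "y \<in> set xs" for y using that by (meson linorder_neqE_nat not_less_iff_gr_or_eq)
        then have "filter (\<lambda>y. \<not> y < x) xs = filter (\<lambda>y. x < y) xs" by (intro filter_cong refl)
        then show "bst_root (x # xs) = (\<lambda>(a, b). join_root (bst_root a) (bst_root b)) (partition (\<lambda>y. y < x) xs)"
          by (simp add: o_def)
      qed simp
      also have "\<dots> = map_pmf (\<lambda>(a, b). join_root (bst_root a) (bst_root b)) (map_pmf (partition (\<lambda>y. y < x)) (pmf_of_set (permutations_of_set ?B)))"
        by (simp add: pmf.map_comp o_def)
      also have "\<dots> = map_pmf (\<lambda>(s, t). join_root s t) (map_pmf (map_prod bst_root bst_root)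
          (pair_pmf (pmf_of_set (permutations_of_set {y\<in>A. y < x})) (pmf_of_set (permutations_of_set {y\<in>A. x < y}))))"
        unfolding partition_random_permutations[OF fB] s by (simp add: pmf.map_comp o_def case_prod_unfold)
      also have "\<dots> = map_pmf (\<lambda>(s, t). join_root s t) (pair_pmf (root_pmf (card {y\<in>A. y < x})) (root_pmf (n - card {y\<in>A. y < x})))"
        unfolding ih[symmetric] by (simp add: pair_map_pmf1 pair_map_pmf2 pmf.map_comp o_def case_prod_unfold)
      finally show ?thesis .
    qed
    have "map_pmf bst_root (pmf_of_set (permutations_of_set A))
       = bind_pmf (pmf_of_set A) (\<lambda>x. map_pmf (\<lambda>xs. bst_root (x # xs)) (pmf_of_set (permutations_of_set (A - {x}))))"
      by (subst random_permutation_of_set[OF less.prems False]) (simp add: map_bind_pmf map_pmf_def[symmetric] bind_return_pmf bind_assoc_pmf pmf.map_comp o_def del: bst_root.simps)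
    also have "\<dots> = bind_pmf (pmf_of_set A) (\<lambda>x. map_pmf (\<lambda>(s, t). join_root s t) (pair_pmf (root_pmf (card {y\<in>A. y < x})) (root_pmf (n - card {y\<in>A. y < x}))))"
      using less.prems False by (intro bind_pmf_cong) (auto simp: inner simp del: bst_root.simps)
    also have "\<dots> = bind_pmf (map_pmf (\<lambda>x. card {y\<in>A. y < x}) (pmf_of_set A)) (\<lambda>p. map_pmf (\<lambda>(s, t). join_root s t) (pair_pmf (root_pmf p) (root_pmf (n - p))))"
      by (simp add: bind_map_pmf)
    also have "map_pmf (\<lambda>x. card {y\<in>A. y < x}) (pmf_of_set A) = pmf_of_set {..<card A}"
      using bij_betw_rank[OF less.prems] less.prems False by (intro map_pmf_of_set_bij_betw) auto
    also have "{..<card A} = {..n}" using n by auto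
    finally show ?thesis by (simp add: n root_pmf.simps(2))
  qed
qed

lemma root_pmf_perms: "map_pmf (\<lambda>\<pi>. bst_root (map \<pi> [1..<Suc k])) (pmf_of_set (perms k)) = root_pmf k"
proof -
  have "map_pmf (\<lambda>\<pi>. bst_root (map \<pi> [1..<Suc k])) (pmf_of_set (perms k)) = map_pmf bst_root (map_pmf (\<lambda>\<pi>. map \<pi> [1..<Suc k]) (pmf_of_set (perms k)))"
    by (simp add: pmf.map_comp o_def)
  also have "map_pmf (\<lambda>\<pi>. map \<pi> [1..<Suc k]) (pmf_of_set (perms k)) = pmf_of_set (permutations_of_set {1..k})"
    by (rule map_pmf_of_set_bij_betw[OF bij_betw_perms finite_perms(2,1)])
  finally show ?thesis by (simp add: root_pmf_random_permutation)
qed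

context iid_uniform
begin

lemma beta_perm: "\<pi> \<in> perms k \<Longrightarrow> beta M X k \<pi> = ennreal ((bst_root (map \<pi> [1..<Suc k]))\<^sup>2)"
proof -
  assume "\<pi> \<in> perms k"
  then interpret online_pattern M X k \<pi> by unfold_locales (simp add: perms_def)
  show ?thesis by (rule beta_eq)
qed

lemma beta_image: "beta M X k ` perms k = (\<lambda>s. ennreal (s\<^sup>2)) ` Collect (root_of_size k)"
  unfolding perms_image[symmetric] image_image by (rule image_cong) (simp_all add: beta_perm del: upt_Suc)

lemma beta_minus_eq: "beta_minus M X k = ennreal ((min_root k)\<^sup>2)"
  unfolding beta_minus_def beta_image
proof (rule Min_eqI)
  show "ennreal ((min_root k)\<^sup>2) \<le> y" if "y \<in> (\<lambda>s. ennreal (s\<^sup>2)) ` Collect (root_of_size k)" for y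
    using that min_root_le[of k] root_of_size_nonneg[OF min_root_attained[of k]] by (auto intro!: ennreal_leI power_mono)
qed (use finite_roots min_root_attained in auto)

lemma beta_plus_eq: "beta_plus M X k = ennreal ((max_root k)\<^sup>2)"
  unfolding beta_plus_def beta_image
proof (rule Max_eqI)
  show "y \<le> ennreal ((max_root k)\<^sup>2)" if "y \<in> (\<lambda>s. ennreal (s\<^sup>2)) ` Collect (root_of_size k)" for y
    using that max_root_ge[of k] root_of_size_nonneg[of k] by (auto intro!: ennreal_leI power_mono)
qed (use finite_roots max_root_attained in auto)

lemma beta_typ_eq: "beta_typ M X k = ennreal (measure_pmf.expectation (root_pmf k) (\<lambda>s. s\<^sup>2))"
proof -
  have "beta_typ M X k = (\<integral>\<^sup>+ \<pi>. ennreal ((bst_root (map \<pi> [1..<Suc k]))\<^sup>2) \<partial>measure_pmf (pmf_of_set (perms k)))"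
    unfolding beta_typ_def
    by (intro nn_integral_cong_AE AE_pmfI) (use finite_perms in \<open>simp add: beta_perm del: upt_Suc\<close>)
  also have "\<dots> = (\<integral>\<^sup>+ s. ennreal (s\<^sup>2) \<partial>measure_pmf (root_pmf k))"
    unfolding root_pmf_perms[symmetric] by simp
  also have "\<dots> = ennreal (measure_pmf.expectation (root_pmf k) (\<lambda>s. s\<^sup>2))"
    by (intro nn_integral_eq_integral integrable_measure_pmf_finite finite_set_root_pmf) auto
  finally show ?thesis .
qed

end

section \<open>Existence of the three limits\<close>
text \<open>Fekete's lemma, with the limit as a lower bound.\<close>

lemma subadditive_limit:
  fixes u :: "nat \<Rightarrow> real"
  assumes sub: "\<And>m n. 1 \<le> m \<Longrightarrow> 1 \<le> n \<Longrightarrow> u (m + n) \<le> u m + u n" and nonneg: "\<And>n. 0 \<le> u n"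
  shows "\<exists>L. (\<lambda>n. u n / real n) \<longlonglongrightarrow> L \<and> (\<forall>n\<ge>1. L \<le> u n / real n)"
proof -
  define L where "L = Inf ((\<lambda>n. u n / real n) ` {1..})"
  have bdd: "bdd_below ((\<lambda>n. u n / real n) ` {1..})" by (rule bdd_belowI[of _ 0]) (auto simp: nonneg)
  have Lle: "L \<le> u n / real n" if "1 \<le> n" for n
    unfolding L_def using that by (intro cInf_lower bdd) auto
  have "(\<lambda>n. u n / real n) \<longlonglongrightarrow> L"
  proof (rule LIMSEQ_I)
    fix e :: real assume e: "0 < e"
    have "\<exists>x\<in>(\<lambda>n. u n / real n) ` {1..}. x < L + e / 2"
      unfolding L_def using e bdd by (intro cInf_less_iff[THEN iffD1]) auto
    then obtain m where m: "1 \<le> m" "u m / real m < L + e / 2" by auto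
    define B where "B = (\<Sum>r\<le>m. u r)"
    have B: "u r \<le> B" if "r \<le> m" for r
      unfolding B_def using that by (intro member_le_sum) (auto simp: nonneg)
    have ub: "u n \<le> real n * (u m / real m) + B" if "1 \<le> n" for n
      using that
    proof (induction n rule: less_induct)
      case (less n)
      show ?case
      proof (cases "n \<le> m")
        case True
        then show ?thesis using B[of n] nonneg[of m] by (simp add: add_increasing)
      next
        case False
        then have "u (m + (n - m)) \<le> u m + u (n - m)" using m by (intro sub) auto
        also have "u (n - m) \<le> real (n - m) * (u m / real m) + B" using False m by (intro less) auto
        finally show ?thesis using False m by (simp add: of_nat_diff field_simps)
      qed
    qed
    obtain N :: nat where N: "2 * B / e < real N" using reals_Archimedean2 by blast
    have "norm (u n / real n - L) < e" if n: "n \<ge> max 1 N" for n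
    proof -
      have n1: "1 \<le> n" "0 < real n" using n by auto
      have "u n / real n \<le> (real n * (u m / real m) + B) / real n"
        using ub[OF n1(1)] n1 by (intro divide_right_mono) auto
      also have "\<dots> = u m / real m + B / real n" using n1 by (simp add: add_divide_distrib)
      also have "B / real n \<le> e / 2"
      proof -
        have "2 * B / e \<le> real n" using N n by linarith
        then show ?thesis using e n1 by (simp add: field_simps)
      qed
      finally have "u n / real n < L + e" using m by linarith
      then show ?thesis using Lle[OF n1(1)] e by (simp add: abs_less_iff)
    qed
    then show "\<exists>no. \<forall>n\<ge>no. norm (u n / real n - L) < e" by blast
  qed
  then show ?thesis using Lle by blast
qed

text \<open>As tolls are at most 1, \<open>min_root (n - 1) + 1\<close> is subadditive.\<close>

lemma min_root_limit:
  "\<exists>L. (\<lambda>k. min_root k / real (Suc k)) \<longlonglongrightarrow> L"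
proof -
  define u where "u n = (if n = 0 then 0 else min_root (n - 1) + 1)" for n
  have nn: "0 \<le> min_root k" for k using root_of_size_nonneg[OF min_root_attained] .
  have u0: "0 \<le> u n" for n using nn[of "n - 1"] by (simp add: u_def)
  have sub: "u (m + n) \<le> u m + u n" if "1 \<le> m" "1 \<le> n" for m n
  proof -
    have "m + n - 1 = Suc ((m - 1) + (n - 1))" using that by simp
    then show ?thesis
      using min_root_join[of "m - 1" "n - 1"] toll_le_1[of "min_root (m - 1)" "min_root (n - 1)"] nn that
      by (simp add: u_def join_root_def)
  qed
  then obtain L where "(\<lambda>n. u n / real n) \<longlonglongrightarrow> L"
    using subadditive_limit[of u, OF sub u0] by blast
  then have "(\<lambda>k. u (Suc k) / real (Suc k)) \<longlonglongrightarrow> L" by (rule LIMSEQ_Suc)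
  moreover have "(\<lambda>k. 1 / real (Suc k)) \<longlonglongrightarrow> 0" by real_asymp
  ultimately have "(\<lambda>k. u (Suc k) / real (Suc k) - 1 / real (Suc k)) \<longlonglongrightarrow> L - 0" by (rule tendsto_diff)
  then show ?thesis by (auto simp: u_def diff_divide_distrib[symmetric])
qed

text \<open>As tolls are non-negative, \<open>max_root (n - 1)\<close> is superadditive; its distance to \<open>n\<close> is subadditive and
non-negative.\<close>

lemma max_root_limit:
  "\<exists>L. (\<lambda>k. max_root k / real (Suc k)) \<longlonglongrightarrow> L \<and> (\<forall>k. max_root k / real (Suc k) \<le> L)"
proof -
  define u where "u n = (if n = 0 then 0 else real n - max_root (n - 1))" for n
  have nn: "0 \<le> max_root k" for k using root_of_size_nonneg[OF max_root_attained] .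
  have le: "max_root k \<le> real k" for k using root_of_size_le[OF max_root_attained] .
  have u0: "0 \<le> u n" for n using le[of "n - 1"] by (auto simp: u_def of_nat_diff)
  have "u (m + n) \<le> u m + u n" if "1 \<le> m" "1 \<le> n" for m n
  proof -
    have "m + n - 1 = Suc ((m - 1) + (n - 1))" using that by simp
    then show ?thesis
      using max_root_join[of "m - 1" "n - 1"] toll_nonneg[of "max_root (m - 1)" "max_root (n - 1)"] nn that
      by (simp add: u_def join_root_def)
  qed
  then obtain L where L: "(\<lambda>n. u n / real n) \<longlonglongrightarrow> L" "\<forall>n\<ge>1. L \<le> u n / real n"
    using subadditive_limit[of u] u0 by auto
  have e: "max_root k / real (Suc k) = 1 - u (Suc k) / real (Suc k)" for k
    by (simp add: u_def field_simps)
  have "(\<lambda>k. 1 - u (Suc k) / real (Suc k)) \<longlonglongrightarrow> 1 - L"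
    by (intro tendsto_diff tendsto_const LIMSEQ_Suc[OF L(1)])
  moreover have "1 - u (Suc k) / real (Suc k) \<le> 1 - L" for k using L(2) by (metis diff_left_mono le_add1 plus_1_eq_Suc)
  ultimately show ?thesis unfolding e by blast
qed

text \<open>The right-hand side solves the quicksort recurrence with equality, since its partial sums have a closed form; a
solution of the inequality stays below it by induction.\<close>

lemma recurrence_bound:
  fixes x b :: "nat \<Rightarrow> real"
  assumes x0: "x 0 \<le> 0" and rec: "\<And>n. x (Suc n) \<le> 2 / real (Suc n) * (\<Sum>j\<le>n. x j) + b n"
  shows "x (Suc n) \<le> b n + 2 * real (n + 2) * (\<Sum>j<n. b j / (real (j + 2) * real (j + 3)))"
proof -
  define S where "S n = (\<Sum>j<n. b j / (real (j + 2) * real (j + 3)))" for n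
  define z where "z n = (case n of 0 \<Rightarrow> 0 | Suc m \<Rightarrow> b m + 2 * real (m + 2) * S m)" for n
  have id: "(\<Sum>j\<le>n. z j) = real (n + 1) * real (n + 2) * S n" for n
  proof (induction n)
    case (Suc n)
    have "real (n + 2) * real (n + 3) * (b n / (real (n + 2) * real (n + 3))) = b n" by simp
    then have "real (Suc n + 1) * real (Suc n + 2) * S (Suc n) = real (n + 2) * real (n + 3) * S n + b n"
      unfolding S_def by (simp add: distrib_left numeral_3_eq_3 add_ac)
    moreover have "(\<Sum>j\<le>Suc n. z j) = real (n + 1) * real (n + 2) * S n + (b n + 2 * real (n + 2) * S n)"
      using Suc by (simp add: z_def)
    moreover have "real (n + 1) * real (n + 2) * S n + (b n + 2 * real (n + 2) * S n) = real (n + 2) * real (n + 3) * S n + b n"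
      by (simp add: algebra_simps)
    ultimately show ?case by simp
  qed (simp add: z_def S_def)
  have "x n \<le> z n" for n
  proof (induction n rule: less_induct)
    case (less n)
    show ?case
    proof (cases n)
      case 0 then show ?thesis using x0 by (simp add: z_def)
    next
      case (Suc m)
      have "x (Suc m) \<le> 2 / real (Suc m) * (\<Sum>j\<le>m. x j) + b m" by (rule rec)
      also have "\<dots> \<le> 2 / real (Suc m) * (\<Sum>j\<le>m. z j) + b m"
        using less Suc by (intro add_right_mono mult_left_mono sum_mono) auto
      also have "(\<Sum>j\<le>m. z j) = real (m + 1) * real (m + 2) * S m" by (rule id)
      also have "2 / real (Suc m) * (real (m + 1) * real (m + 2) * S m) + b m = z (Suc m)"
        by (simp add: z_def)
      finally show ?thesis using Suc by simp
    qed
  qed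
  from this[of "Suc n"] show ?thesis by (simp add: z_def S_def)
qed

abbreviation "E_root k f \<equiv> measure_pmf.expectation (root_pmf k) f"

text \<open>The expectation of \<open>g\<close> over independent random trees with \<open>p\<close> and \<open>q\<close> nodes, as a finite sum.\<close>

definition pair_mean :: "nat \<Rightarrow> nat \<Rightarrow> (real \<Rightarrow> real \<Rightarrow> real) \<Rightarrow> real" where
  "pair_mean p q g = (\<Sum>s\<in>set_pmf (root_pmf p). \<Sum>t\<in>set_pmf (root_pmf q). pmf (root_pmf p) s * pmf (root_pmf q) t * g s t)"

lemma E_root_sum: "E_root k f = (\<Sum>s\<in>set_pmf (root_pmf k). pmf (root_pmf k) s * f s)"
  by (subst integral_measure_pmf[OF finite_set_root_pmf]) auto

lemma pmf_root_sum: "(\<Sum>s\<in>set_pmf (root_pmf k). pmf (root_pmf k) s) = 1"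
  by (rule sum_pmf_eq_1[OF finite_set_root_pmf]) simp

lemma E_root_Suc: "E_root (Suc n) f = (\<Sum>p\<le>n. pair_mean p (n - p) (\<lambda>s t. f (join_root s t))) / real (Suc n)"
proof -
  have "E_root (Suc n) f = (\<Sum>p\<le>n. measure_pmf.expectation (map_pmf (\<lambda>(s, t). join_root s t) (pair_pmf (root_pmf p) (root_pmf (n - p)))) f /\<^sub>R real (card {..n}))"
    unfolding root_pmf.simps(2) by (rule pmf_expectation_bind_pmf_of_set) (auto simp: finite_set_root_pmf)
  also have "\<dots> = (\<Sum>p\<le>n. pair_mean p (n - p) (\<lambda>s t. f (join_root s t)) / real (Suc n))"
  proof (rule sum.cong)
    fix p assume "p \<in> {..n}"
    have "measure_pmf.expectation (map_pmf (\<lambda>(s, t). join_root s t) (pair_pmf (root_pmf p) (root_pmf (n - p)))) f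
      = (\<Sum>z\<in>set_pmf (root_pmf p) \<times> set_pmf (root_pmf (n - p)). pmf (pair_pmf (root_pmf p) (root_pmf (n - p))) z * f (case z of (s, t) \<Rightarrow> join_root s t))"
      unfolding integral_map_pmf
      by (subst integral_measure_pmf[where A = "set_pmf (root_pmf p) \<times> set_pmf (root_pmf (n - p))"]) (auto simp: finite_set_root_pmf)
    also have "\<dots> = pair_mean p (n - p) (\<lambda>s t. f (join_root s t))"
      unfolding pair_mean_def by (subst sum.cartesian_product) (auto intro!: sum.cong simp: pmf_pair)
    finally show "measure_pmf.expectation (map_pmf (\<lambda>(s, t). join_root s t) (pair_pmf (root_pmf p) (root_pmf (n - p)))) f /\<^sub>R real (card {..n})
      = pair_mean p (n - p) (\<lambda>s t. f (join_root s t)) / real (Suc n)" by (simp add: divide_inverse mult.commute)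
  qed simp
  finally show ?thesis by (simp add: sum_divide_distrib)
qed

lemma pair_mean_mono:
  assumes "\<And>s t. root_of_size p s \<Longrightarrow> root_of_size q t \<Longrightarrow> f s t \<le> g s t"
  shows "pair_mean p q f \<le> pair_mean p q g"
  unfolding pair_mean_def using assms by (intro sum_mono mult_left_mono) (auto dest: set_root_pmf)

lemma pair_mean_add: "pair_mean p q (\<lambda>s t. f s t + g s t) = pair_mean p q f + pair_mean p q g"
  unfolding pair_mean_def by (simp add: distrib_left sum.distrib)

lemma pair_mean_prod: "pair_mean p q (\<lambda>s t. f s * g t) = E_root p f * E_root q g"
  unfolding pair_mean_def E_root_sum sum_product by (intro sum.cong) auto

lemma pair_mean_fst: "pair_mean p q (\<lambda>s t. f s) = E_root p f"
  using pair_mean_prod[of p q f "\<lambda>_. 1"] by simp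

lemma pair_mean_snd: "pair_mean p q (\<lambda>s t. f t) = E_root q f"
  using pair_mean_prod[of p q "\<lambda>_. 1" f] by simp

lemma pair_mean_const: "pair_mean p q (\<lambda>s t. c) = c"
  using pair_mean_fst[of p q "\<lambda>_. c"] by simp

lemma sum_flip: "(\<Sum>p\<le>n. f (n - p)) = (\<Sum>p\<le>n. f p)" for f :: "nat \<Rightarrow> real"
  by (rule sum.reindex_bij_witness[of _ "\<lambda>p. n - p" "\<lambda>p. n - p"]) auto

text \<open>The expected toll at the root of a random tree with \<open>n + 1\<close> nodes.\<close>

definition mean_toll :: "nat \<Rightarrow> real" where
  "mean_toll n = (\<Sum>p\<le>n. pair_mean p (n - p) toll) / real (Suc n)"

text \<open>In a random search tree, the nodes with \<open>j\<close> proper descendants have the asymptotic frequency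
\<open>2 / ((j + 2) (j + 3))\<close>.\<close>

definition typ_rate :: real where
  "typ_rate = 2 * (\<Sum>j. mean_toll j / (real (j + 2) * real (j + 3)))"

lemma mean_toll_bounds: "0 \<le> mean_toll n" "mean_toll n \<le> 1"
proof -
  have "0 \<le> pair_mean p q toll" for p q
    using pair_mean_mono[of p q "\<lambda>_ _. 0" toll] by (simp add: pair_mean_const toll_nonneg root_of_size_nonneg)
  then show "0 \<le> mean_toll n" unfolding mean_toll_def by (intro divide_nonneg_nonneg sum_nonneg) auto
  have "pair_mean p q toll \<le> 1" for p q
    using pair_mean_mono[of p q toll "\<lambda>_ _. 1"] by (simp add: pair_mean_const toll_le_1 root_of_size_nonneg)
  then have "(\<Sum>p\<le>n. pair_mean p (n - p) toll) \<le> (\<Sum>p\<le>n. 1)" by (intro sum_mono) auto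
  then show "mean_toll n \<le> 1" by (simp add: mean_toll_def)
qed

lemma mean_toll_summable: "summable (\<lambda>j. mean_toll j / (real (j + 2) * real (j + 3)))"
proof (rule summable_comparison_test_ev)
  show "\<forall>\<^sub>F j in sequentially. norm (mean_toll j / (real (j + 2) * real (j + 3))) \<le> 1 / real (Suc j) ^ 2"
    using mean_toll_bounds by (intro always_eventually allI) (auto simp: power2_eq_square intro!: frac_le mult_mono)
  show "summable (\<lambda>j. 1 / real (Suc j) ^ 2)"
    using inverse_power_summable[of 2, where 'a = real] summable_Suc_iff[of "\<lambda>j. 1 / real j ^ 2"] by (simp add: divide_inverse)
qed

lemma E_root_id_Suc: "E_root (Suc n) (\<lambda>s. s) = mean_toll n + 2 * real (n + 2) * (\<Sum>j<n. mean_toll j / (real (j + 2) * real (j + 3)))"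
proof -
  define m where "m k = E_root k (\<lambda>s. s)" for k
  have rec: "m (Suc n) = 2 / real (Suc n) * (\<Sum>j\<le>n. m j) + mean_toll n" for n
  proof -
    have "m (Suc n) = (\<Sum>p\<le>n. m p + m (n - p) + pair_mean p (n - p) toll) / real (Suc n)"
      unfolding m_def E_root_Suc join_root_def pair_mean_add pair_mean_fst pair_mean_snd ..
    also have "\<dots> = 2 / real (Suc n) * (\<Sum>j\<le>n. m j) + mean_toll n"
      by (simp add: sum.distrib sum_flip mean_toll_def add_divide_distrib)
    finally show ?thesis .
  qed
  have m0: "m 0 = 0" by (simp add: m_def)
  have "m (Suc n) \<le> mean_toll n + 2 * real (n + 2) * (\<Sum>j<n. mean_toll j / (real (j + 2) * real (j + 3)))"
    by (rule recurrence_bound) (use m0 rec in auto)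
  moreover have "- m (Suc n) \<le> - mean_toll n + 2 * real (n + 2) * (\<Sum>j<n. - mean_toll j / (real (j + 2) * real (j + 3)))"
    by (rule recurrence_bound) (use m0 rec in \<open>auto simp: sum_negf\<close>)
  ultimately show ?thesis by (simp add: m_def sum_negf)
qed

lemma E_root_id_limit: "(\<lambda>k. E_root k (\<lambda>s. s) / real (Suc k)) \<longlonglongrightarrow> typ_rate"
proof -
  have "(\<lambda>n. mean_toll n / real (n + 2) + 2 * (\<Sum>j<n. mean_toll j / (real (j + 2) * real (j + 3)))) \<longlonglongrightarrow> 0 + typ_rate"
    unfolding typ_rate_def
  proof (intro tendsto_add tendsto_mult tendsto_const summable_LIMSEQ mean_toll_summable)
    show "(\<lambda>n. mean_toll n / real (n + 2)) \<longlonglongrightarrow> 0"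
    proof (rule tendsto_sandwich[of "\<lambda>_. 0" _ _ "\<lambda>n. 1 / real (n + 2)"])
      show "(\<lambda>n. 1 / real (n + 2)) \<longlonglongrightarrow> 0" by real_asymp
    qed (use mean_toll_bounds in \<open>auto intro!: always_eventually divide_right_mono\<close>)
  qed
  moreover have "E_root (Suc n) (\<lambda>s. s) / real (Suc (Suc n)) = mean_toll n / real (n + 2) + 2 * (\<Sum>j<n. mean_toll j / (real (j + 2) * real (j + 3)))" for n
    unfolding E_root_id_Suc by (simp add: field_simps)
  ultimately have "(\<lambda>n. E_root (Suc n) (\<lambda>s. s) / real (Suc (Suc n))) \<longlonglongrightarrow> typ_rate" by simp
  then show ?thesis by (rule LIMSEQ_imp_Suc[where f = "\<lambda>k. E_root k (\<lambda>s. s) / real (Suc k)"])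
qed

lemma typ_rate_nonneg: "0 \<le> typ_rate"
  unfolding typ_rate_def using mean_toll_bounds by (intro mult_nonneg_nonneg suminf_nonneg mean_toll_summable) auto

lemma E_root_id_bounds: "0 \<le> E_root k (\<lambda>s. s)" "E_root k (\<lambda>s. s) \<le> typ_rate * real (k + 1) + 1"
proof -
  show "0 \<le> E_root k (\<lambda>s. s)"
    unfolding E_root_sum by (intro sum_nonneg mult_nonneg_nonneg) (auto dest: set_root_pmf intro: root_of_size_nonneg)
  show "E_root k (\<lambda>s. s) \<le> typ_rate * real (k + 1) + 1"
  proof (cases k)
    case 0 then show ?thesis using typ_rate_nonneg by simp
  next
    case (Suc n)
    define S where "S = (\<Sum>j<n. mean_toll j / (real (j + 2) * real (j + 3)))"
    have "2 * S \<le> typ_rate"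
      unfolding typ_rate_def S_def using mean_toll_bounds by (intro mult_left_mono sum_le_suminf mean_toll_summable) auto
    then have "real (n + 2) * (2 * S) \<le> real (n + 2) * typ_rate" by (intro mult_left_mono) auto
    moreover have "E_root k (\<lambda>s. s) = mean_toll n + real (n + 2) * (2 * S)"
      unfolding Suc E_root_id_Suc S_def by simp
    moreover have "typ_rate * real (k + 1) = real (n + 2) * typ_rate" using Suc by simp
    ultimately show ?thesis using mean_toll_bounds(2)[of n] by linarith
  qed
qed

lemma E_root_square_ge: "(E_root k (\<lambda>s. s))\<^sup>2 \<le> E_root k (\<lambda>s. s\<^sup>2)"
proof -
  define m where "m = E_root k (\<lambda>s. s)"
  have "0 \<le> (\<Sum>s\<in>set_pmf (root_pmf k). pmf (root_pmf k) s * (s - m)\<^sup>2)" by (intro sum_nonneg) auto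
  also have "\<dots> = (\<Sum>s\<in>set_pmf (root_pmf k). pmf (root_pmf k) s * s\<^sup>2 - 2 * m * (pmf (root_pmf k) s * s) + m\<^sup>2 * pmf (root_pmf k) s)"
    by (intro sum.cong) (auto simp: algebra_simps power2_eq_square)
  also have "\<dots> = E_root k (\<lambda>s. s\<^sup>2) - 2 * m * m + m\<^sup>2 * 1"
    unfolding sum.distrib sum_subtractf sum_distrib_left[symmetric] pmf_root_sum E_root_sum[symmetric] m_def ..
  finally show ?thesis by (simp add: m_def power2_eq_square)
qed

text \<open>The second moment satisfies the same recurrence as the first, once the leading term \<open>typ_rate\<^sup>2 (n + 2)\<^sup>2\<close> is
subtracted; the inhomogeneity is then only linear, so the remainder is of order \<open>n log n\<close>.\<close>

lemma E_root_square_le: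
  "E_root (Suc n) (\<lambda>s. s\<^sup>2) \<le> typ_rate\<^sup>2 * real (n + 2) ^ 2 + (4 * typ_rate + 7) * real (n + 2) * (1 + 2 * (\<Sum>j<n. 1 / real (j + 3)))"
proof -
  define \<mu> where "\<mu> = typ_rate"
  define m where "m k = E_root k (\<lambda>s. s)" for k
  define q where "q k = E_root k (\<lambda>s. s\<^sup>2)" for k
  define x where "x k = q k - \<mu>\<^sup>2 * real (k + 1) ^ 2" for k
  have \<mu>: "0 \<le> \<mu>" by (simp add: \<mu>_def typ_rate_nonneg)
  have m: "0 \<le> m k" "m k \<le> \<mu> * real (k + 1) + 1" for k using E_root_id_bounds by (auto simp: m_def \<mu>_def)
  have qrec: "q (Suc n) \<le> (\<Sum>p\<le>n. q p + q (n - p) + 2 * (m p * m (n - p)) + 2 * (m p + m (n - p)) + 1) / real (Suc n)" for n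
  proof -
    have "pair_mean p r (\<lambda>s t. (join_root s t)\<^sup>2) \<le> q p + q r + 2 * (m p * m r) + 2 * (m p + m r) + 1" for p r
    proof -
      have "pair_mean p r (\<lambda>s t. (join_root s t)\<^sup>2) \<le> pair_mean p r (\<lambda>s t. s\<^sup>2 + t\<^sup>2 + s * t + s * t + (s + t) + (s + t) + 1)"
      proof (rule pair_mean_mono)
        fix s t assume "root_of_size p s" "root_of_size r t"
        then have st: "0 \<le> s" "0 \<le> t" by (auto intro: root_of_size_nonneg)
        have "(join_root s t)\<^sup>2 \<le> (s + t + 1)\<^sup>2"
          using st toll_nonneg[OF st] toll_le_1[OF st] by (intro power_mono) (auto simp: join_root_def)
        then show "(join_root s t)\<^sup>2 \<le> s\<^sup>2 + t\<^sup>2 + s * t + s * t + (s + t) + (s + t) + 1"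
          by (simp add: power2_eq_square algebra_simps)
      qed
      also have "\<dots> = q p + q r + 2 * (m p * m r) + 2 * (m p + m r) + 1"
        unfolding pair_mean_add pair_mean_fst[where f = "\<lambda>s. s"] pair_mean_fst[where f = "\<lambda>s. s\<^sup>2"]
          pair_mean_snd[where f = "\<lambda>s. s"] pair_mean_snd[where f = "\<lambda>s. s\<^sup>2"] pair_mean_const
          pair_mean_prod[where f = "\<lambda>s. s" and g = "\<lambda>s. s"] by (simp add: q_def m_def)
      finally show ?thesis .
    qed
    then show ?thesis unfolding q_def[of "Suc n"] E_root_Suc by (intro divide_right_mono sum_mono) auto
  qed
  have xrec: "x (Suc n) \<le> 2 / real (Suc n) * (\<Sum>j\<le>n. x j) + (4 * \<mu> + 7) * real (n + 2)" for n
  proof -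
    have "(\<Sum>p\<le>n. q p + q (n - p) + 2 * (m p * m (n - p)) + 2 * (m p + m (n - p)) + 1)
       \<le> (\<Sum>p\<le>n. x p + x (n - p) + (\<mu>\<^sup>2 * real (n + 2) ^ 2 + (4 * \<mu> * real (n + 2) + 7)))"
    proof (rule sum_mono)
      fix p assume p: "p \<in> {..n}"
      then have r: "real (n - p) = real n - real p" by (simp add: of_nat_diff)
      have H1: "m p * m (n - p) \<le> (\<mu> * real (p + 1) + 1) * (\<mu> * real (n - p + 1) + 1)"
        using m \<mu> by (intro mult_mono) auto
      have H2: "m p + m (n - p) \<le> (\<mu> * real (p + 1) + 1) + (\<mu> * real (n - p + 1) + 1)"
        using m by (intro add_mono)
      have "q p + q (n - p) + 2 * (m p * m (n - p)) + 2 * (m p + m (n - p)) + 1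
        \<le> q p + q (n - p) + 2 * ((\<mu> * real (p + 1) + 1) * (\<mu> * real (n - p + 1) + 1))
          + 2 * ((\<mu> * real (p + 1) + 1) + (\<mu> * real (n - p + 1) + 1)) + 1"
        by (intro add_right_mono add_mono[OF add_left_mono[OF mult_left_mono[OF H1]] mult_left_mono[OF H2]]) auto
      also have "q p + q (n - p) + 2 * ((\<mu> * real (p + 1) + 1) * (\<mu> * real (n - p + 1) + 1))
          + 2 * ((\<mu> * real (p + 1) + 1) + (\<mu> * real (n - p + 1) + 1)) + 1
        = x p + x (n - p) + (\<mu>\<^sup>2 * real (n + 2) ^ 2 + (4 * \<mu> * real (n + 2) + 7))"
        unfolding x_def using r by (simp add: algebra_simps power2_eq_square)
      finally show "q p + q (n - p) + 2 * (m p * m (n - p)) + 2 * (m p + m (n - p)) + 1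
        \<le> x p + x (n - p) + (\<mu>\<^sup>2 * real (n + 2) ^ 2 + (4 * \<mu> * real (n + 2) + 7))" .
    qed
    also have "\<dots> = 2 * (\<Sum>j\<le>n. x j) + real (Suc n) * (\<mu>\<^sup>2 * real (n + 2) ^ 2 + (4 * \<mu> * real (n + 2) + 7))"
      by (simp add: sum.distrib sum_flip)
    finally have "q (Suc n) \<le> (2 * (\<Sum>j\<le>n. x j) + real (Suc n) * (\<mu>\<^sup>2 * real (n + 2) ^ 2 + (4 * \<mu> * real (n + 2) + 7))) / real (Suc n)"
      by (rule order_trans[OF qrec divide_right_mono]) simp
    also have "\<dots> = 2 / real (Suc n) * (\<Sum>j\<le>n. x j) + (\<mu>\<^sup>2 * real (n + 2) ^ 2 + (4 * \<mu> * real (n + 2) + 7))"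
      by (simp add: add_divide_distrib)
    finally have "x (Suc n) \<le> 2 / real (Suc n) * (\<Sum>j\<le>n. x j) + (4 * \<mu> * real (n + 2) + 7)"
      unfolding x_def[of "Suc n"] by simp
    also have "4 * \<mu> * real (n + 2) + 7 \<le> (4 * \<mu> + 7) * real (n + 2)" by (simp add: algebra_simps)
    finally show ?thesis by simp
  qed
  have "x (Suc n) \<le> (4 * \<mu> + 7) * real (n + 2) + 2 * real (n + 2) * (\<Sum>j<n. (4 * \<mu> + 7) * real (j + 2) / (real (j + 2) * real (j + 3)))"
    by (rule recurrence_bound) (use xrec in \<open>auto simp: x_def q_def\<close>)
  also have "(\<Sum>j<n. (4 * \<mu> + 7) * real (j + 2) / (real (j + 2) * real (j + 3))) = (4 * \<mu> + 7) * (\<Sum>j<n. 1 / real (j + 3))"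
    unfolding sum_distrib_left by (intro sum.cong) (auto simp del: of_nat_add)
  finally show ?thesis unfolding x_def q_def \<mu>_def by (simp add: algebra_simps)
qed

lemma harmonic_le_sqrt: "(\<Sum>j<n. 1 / real (j + 3)) \<le> 2 * sqrt (real n)"
proof (induction n)
  case (Suc n)
  have a: "(sqrt (real (Suc n)) - sqrt (real n)) * (sqrt (real (Suc n)) + sqrt (real n)) = 1"
    by (simp add: algebra_simps)
  have b: "sqrt (real (Suc n)) + sqrt (real n) \<le> 2 * real (n + 3)"
  proof -
    have "sqrt (real (Suc n)) \<le> real (n + 3)" "sqrt (real n) \<le> real (n + 3)"
      by (auto intro!: real_le_lsqrt simp: power2_eq_square algebra_simps)
    then show ?thesis by simp
  qed
  have d: "0 \<le> sqrt (real (Suc n)) - sqrt (real n)" by simp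
  have "1 \<le> (sqrt (real (Suc n)) - sqrt (real n)) * (2 * real (n + 3))"
    using mult_left_mono[OF b d] unfolding a .
  then have "1 / real (n + 3) \<le> 2 * (sqrt (real (Suc n)) - sqrt (real n))" by (simp add: field_simps)
  then show ?case using Suc by simp
qed simp

text \<open>Jensen's inequality from below and \<open>E_root_square_le\<close> from above.\<close>

lemma E_root_square_limit: "(\<lambda>k. E_root k (\<lambda>s. s\<^sup>2) / real (Suc k) ^ 2) \<longlonglongrightarrow> typ_rate\<^sup>2"
proof -
  define C where "C = 4 * typ_rate + 7"
  have C: "0 \<le> C" using typ_rate_nonneg by (simp add: C_def)
  have up: "E_root (Suc n) (\<lambda>s. s\<^sup>2) / real (Suc (Suc n)) ^ 2 \<le> typ_rate\<^sup>2 + C * (1 + 4 * sqrt (real n)) / real (n + 2)" for n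
  proof -
    have "E_root (Suc n) (\<lambda>s. s\<^sup>2) \<le> typ_rate\<^sup>2 * real (n + 2) ^ 2 + C * real (n + 2) * (1 + 2 * (\<Sum>j<n. 1 / real (j + 3)))"
      unfolding C_def by (rule E_root_square_le)
    also have "\<dots> \<le> typ_rate\<^sup>2 * real (n + 2) ^ 2 + C * real (n + 2) * (1 + 4 * sqrt (real n))"
      using harmonic_le_sqrt[of n] C by (intro add_left_mono mult_left_mono) auto
    finally have "E_root (Suc n) (\<lambda>s. s\<^sup>2) / real (n + 2) ^ 2 \<le> (typ_rate\<^sup>2 * real (n + 2) ^ 2 + C * real (n + 2) * (1 + 4 * sqrt (real n))) / real (n + 2) ^ 2"
      by (rule divide_right_mono) simp
    also have "\<dots> = typ_rate\<^sup>2 + C * (1 + 4 * sqrt (real n)) / real (n + 2)"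
      by (simp add: add_divide_distrib power2_eq_square)
    finally show ?thesis by simp
  qed
  have lo: "(E_root (Suc n) (\<lambda>s. s) / real (Suc (Suc n)))\<^sup>2 \<le> E_root (Suc n) (\<lambda>s. s\<^sup>2) / real (Suc (Suc n)) ^ 2" for n
    unfolding power_divide by (intro divide_right_mono E_root_square_ge) simp
  have "(\<lambda>n. E_root (Suc n) (\<lambda>s. s\<^sup>2) / real (Suc (Suc n)) ^ 2) \<longlonglongrightarrow> typ_rate\<^sup>2"
  proof (rule tendsto_sandwich)
    show "\<forall>\<^sub>F n in sequentially. (E_root (Suc n) (\<lambda>s. s) / real (Suc (Suc n)))\<^sup>2 \<le> E_root (Suc n) (\<lambda>s. s\<^sup>2) / real (Suc (Suc n)) ^ 2"
      using lo by simp
    show "\<forall>\<^sub>F n in sequentially. E_root (Suc n) (\<lambda>s. s\<^sup>2) / real (Suc (Suc n)) ^ 2 \<le> typ_rate\<^sup>2 + C * ((1 + 4 * sqrt (real n)) / real (n + 2))"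
      using up by simp
    show "(\<lambda>n. (E_root (Suc n) (\<lambda>s. s) / real (Suc (Suc n)))\<^sup>2) \<longlonglongrightarrow> typ_rate\<^sup>2"
      by (intro tendsto_power LIMSEQ_Suc[OF E_root_id_limit])
    have "(\<lambda>n. (1 + 4 * sqrt (real n)) / real (n + 2)) \<longlonglongrightarrow> 0" by real_asymp
    then have "(\<lambda>n. typ_rate\<^sup>2 + C * ((1 + 4 * sqrt (real n)) / real (n + 2))) \<longlonglongrightarrow> typ_rate\<^sup>2 + C * 0"
      by (intro tendsto_intros)
    then show "(\<lambda>n. typ_rate\<^sup>2 + C * ((1 + 4 * sqrt (real n)) / real (n + 2))) \<longlonglongrightarrow> typ_rate\<^sup>2" by simp
  qed
  then show ?thesis by (rule LIMSEQ_imp_Suc[where f = "\<lambda>k. E_root k (\<lambda>s. s\<^sup>2) / real (Suc k) ^ 2"])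
qed

text \<open>Passes from the natural normalisation by \<open>k + 1\<close> to the one by \<open>k\<close>.\<close>

lemma ennreal_ratio_limit:
  assumes "(\<lambda>k. f k / real (Suc k) ^ 2) \<longlonglongrightarrow> c" "\<And>k. 0 \<le> f k"
  shows "(\<lambda>k. ennreal (f k) / ennreal (real k ^ 2)) \<longlonglongrightarrow> ennreal c"
proof -
  have "(\<lambda>k. (real (Suc k) / real k) ^ 2) \<longlonglongrightarrow> 1" by real_asymp
  then have "(\<lambda>k. f k / real (Suc k) ^ 2 * (real (Suc k) / real k) ^ 2) \<longlonglongrightarrow> c * 1"
    by (rule tendsto_mult[OF assms(1)])
  moreover have "f k / real (Suc k) ^ 2 * (real (Suc k) / real k) ^ 2 = f k / real k ^ 2" for k
    by (simp add: power_divide)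
  ultimately have "(\<lambda>k. ennreal (f k / real k ^ 2)) \<longlonglongrightarrow> ennreal c" by (simp add: tendsto_ennrealI)
  then show ?thesis
  proof (rule Lim_transform_eventually)
    show "\<forall>\<^sub>F k in sequentially. ennreal (f k / real k ^ 2) = ennreal (f k) / ennreal (real k ^ 2)"
      using eventually_gt_at_top[of 0] by eventually_elim (simp add: divide_ennreal assms(2))
  qed
qed

section \<open>Estimates of the toll\<close>
text \<open>The integrals of \<open>sqrt x\<close> times a quadratic polynomial, against which the density is compared.\<close>

lemma sqrt_poly_integral:
  fixes T :: real
  assumes "0 \<le> T"
  shows "((\<lambda>x. sqrt x * (c0 + c1 * x + c2 * x\<^sup>2)) has_integral sqrt T * T * (2/3 * c0 + 2/5 * c1 * T + 2/7 * c2 * T\<^sup>2)) {0..T}"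
proof -
  have "((\<lambda>x. sqrt x * (c0 + c1 * x + c2 * x\<^sup>2)) has_integral
      (\<lambda>x. sqrt x * x * (2/3 * c0 + 2/5 * c1 * x + 2/7 * c2 * x\<^sup>2)) T - (\<lambda>x. sqrt x * x * (2/3 * c0 + 2/5 * c1 * x + 2/7 * c2 * x\<^sup>2)) 0) {0..T}"
  proof (rule fundamental_theorem_of_calculus_interior[OF assms])
    show "continuous_on {0..T} (\<lambda>x. sqrt x * x * (2/3 * c0 + 2/5 * c1 * x + 2/7 * c2 * x\<^sup>2))"
      by (intro continuous_intros)
    fix x assume "x \<in> {0<..<T}"
    then have x: "0 < x" by simp
    have i: "x * inverse (sqrt x) = sqrt x" using x real_div_sqrt[of x] by (simp add: divide_inverse)
    have "((\<lambda>x. sqrt x * x * (2/3 * c0 + 2/5 * c1 * x + 2/7 * c2 * x\<^sup>2)) has_real_derivative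
      ((inverse (sqrt x) / 2) * x + sqrt x * 1) * (2/3 * c0 + 2/5 * c1 * x + 2/7 * c2 * x\<^sup>2) + sqrt x * x * (2/5 * c1 + 2/7 * c2 * (2 * x))) (at x)"
      using x by (auto intro!: derivative_eq_intros)
    also have "((inverse (sqrt x) / 2) * x + sqrt x * 1) * (2/3 * c0 + 2/5 * c1 * x + 2/7 * c2 * x\<^sup>2) + sqrt x * x * (2/5 * c1 + 2/7 * c2 * (2 * x))
       = ((x * inverse (sqrt x)) / 2 + sqrt x) * (2/3 * c0 + 2/5 * c1 * x + 2/7 * c2 * x\<^sup>2) + sqrt x * x * (2/5 * c1 + 2/7 * c2 * (2 * x))"
      by (simp add: mult_ac)
    also have "\<dots> = sqrt x * (c0 + c1 * x + c2 * x\<^sup>2)"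
      unfolding i by (simp add: algebra_simps power2_eq_square)
    finally show "((\<lambda>x. sqrt x * x * (2/3 * c0 + 2/5 * c1 * x + 2/7 * c2 * x\<^sup>2)) has_vector_derivative sqrt x * (c0 + c1 * x + c2 * x\<^sup>2)) (at x)"
      by (simp add: has_real_derivative_iff_has_vector_derivative)
  qed
  then show ?thesis by simp
qed

text \<open>Positive arguments \<open>s\<close> and \<open>t\<close>. The density is \<open>sqrt (32 / hm)\<close> times \<open>sqrt x\<close> times \<open>sqrt (R x)\<close> with
\<open>R(0) = 1\<close>, and \<open>R x = 1 + al x - be x\<^sup>2 + \<dots>\<close>; without \<open>R\<close> the toll would be the cube root
of \<open>9/128 hm\<close>.\<close>

locale positive_pair =
  fixes s t :: real
  assumes pos: "0 < s" "0 < t"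
begin

definition "hm = 1 / s + 1 / t"
definition "al = hm / 2 - 3 / (2 * (s + t))"
definition "be = (s - t)\<^sup>2 / (2 * s * t * (s + t)\<^sup>2)"
definition "R x = (1 + x / (2 * (s + t))) * (1 + x / (2 * s)) * (1 + x / (2 * t)) / (1 + x / (s + t))\<^sup>2"

lemma hm_pos: "0 < hm" using pos by (simp add: hm_def add_pos_pos)

lemma hm_eq: "hm = (s + t) / (s * t)" using pos by (simp add: hm_def field_simps)

lemma st4: "4 * (s * t) \<le> (s + t)\<^sup>2"
  using zero_le_square[of "s - t"] by (simp add: power2_eq_square algebra_simps)

lemma al_eq: "al = ((s + t)\<^sup>2 - 3 * (s * t)) / (2 * (s * t) * (s + t))"
  unfolding al_def hm_eq using pos by (simp add: divide_simps power2_eq_square, (simp add: algebra_simps)?)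

lemma be_eq: "be = ((s + t)\<^sup>2 - 4 * (s * t)) / (2 * (s * t) * (s + t)\<^sup>2)"
  unfolding be_def by (simp add: power2_eq_square algebra_simps)

lemma al_nonneg: "0 \<le> al"
proof -
  have "0 \<le> s * t" using pos by simp
  then have "3 * (s * t) \<le> (s + t)\<^sup>2" using st4 by linarith
  then show ?thesis unfolding al_eq using pos by (intro divide_nonneg_nonneg) auto
qed

lemma be_nonneg: "0 \<le> be"
  unfolding be_eq using pos st4 by (intro divide_nonneg_nonneg) auto

lemma density_eq:
  assumes "0 \<le> x"
  shows "toll_density s t x = sqrt (32 / hm) * sqrt x * sqrt (R x)"
proof -
  have P: "0 < x + (s + t)" using assms pos by simp
  have e: "32 / hm * x * R x = (2 / (x + (s+t)))\<^sup>2 * (x * (x + 2 * s) * (x + 2 * t) * (x + 2 * (s+t)))"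
  proof -
    have "1 + x / (2 * (s + t)) = (x + 2 * (s+t)) / (2 * (s + t))" "1 + x / (2 * s) = (x + 2 * s) / (2 * s)"
      "1 + x / (2 * t) = (x + 2 * t) / (2 * t)" "1 + x / (s + t) = (x + (s+t)) / (s + t)"
      using pos by (simp_all add: field_simps)
    then have Rx: "R x = (x + 2 * (s+t)) / (2 * (s + t)) * ((x + 2 * s) / (2 * s)) * ((x + 2 * t) / (2 * t)) / ((x + (s+t)) / (s + t))\<^sup>2"
      by (simp only: R_def)
    have gen: "32 / (g / (s * t)) * x * (c / (2 * g) * (a / (2 * s)) * (b / (2 * t)) / (p / g)\<^sup>2) = (2 / p)\<^sup>2 * (x * a * b * c)"
      if "0 < g" "0 < p" for a b c g p :: real
      using that pos by (simp add: field_simps power2_eq_square)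
    show ?thesis unfolding Rx hm_eq by (rule gen) (use pos P in auto)
  qed
  have "sqrt (32 / hm) * sqrt x * sqrt (R x) = sqrt (32 / hm * x * R x)"
    by (simp only: real_sqrt_mult)
  also have "\<dots> = \<bar>2 / (x + (s+t))\<bar> * sqrt (x * (x + 2 * s) * (x + 2 * t) * (x + 2 * (s+t)))"
    unfolding e real_sqrt_mult real_sqrt_abs ..
  finally show ?thesis using P by (simp add: toll_density_def)
qed

text \<open>After division by \<open>s + t\<close>, the quotient depends on \<open>u = x / (s+t)\<close> and \<open>m = s t / (s+t)\<^sup>2 \<le> 1/4\<close> only;
the differences are polynomials in \<open>u\<close> with coefficients of one sign.\<close>

lemma R_bounds:
  assumes x: "0 \<le> x"
  shows "1 + al * x - be * x\<^sup>2 \<le> R x" "R x \<le> 1 + al * x"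
proof -
  define g where "g = s + t"
  define m where "m = s * t / g\<^sup>2"
  define u where "u = x / g"
  have g: "0 < g" using pos by (simp add: g_def)
  have m: "0 < m" "m \<le> 1/4" using pos g st4 by (simp_all add: m_def g_def[symmetric] divide_simps)
  have u: "0 \<le> u" using x g by (simp add: u_def)
  have st: "s * t = m * g\<^sup>2" "x = u * g" using g by (simp_all add: m_def u_def)
  have e1: "al * x = u * (1 / (2 * m) - 3 / 2)"
    unfolding al_eq g_def[symmetric] st using g m by (simp add: divide_simps power2_eq_square, (simp add: algebra_simps)?)
  have e2: "be * x\<^sup>2 = u\<^sup>2 * ((1 - 4 * m) / (2 * m))"
    unfolding be_eq g_def[symmetric] st using g m by (simp add: divide_simps power2_eq_square, (simp add: algebra_simps)?)
  have p: "(1 + x / (2 * s)) * (1 + x / (2 * t)) = 1 + u / (2 * m) + u\<^sup>2 / (4 * m)"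
  proof -
    have "(1 + x / (2 * s)) * (1 + x / (2 * t)) = 1 + x * g / (2 * (s * t)) + x\<^sup>2 / (4 * (s * t))"
      using pos by (simp add: g_def field_simps power2_eq_square)
    also have "\<dots> = 1 + u / (2 * m) + u\<^sup>2 / (4 * m)"
      unfolding st using g m by (simp add: power2_eq_square)
    finally show ?thesis .
  qed
  have R: "R x = (1 + u / 2) * (1 + u / (2 * m) + u\<^sup>2 / (4 * m)) / (1 + u)\<^sup>2"
  proof -
    have "x / (2 * (s + t)) = u / 2" "x / (s + t) = u" using g by (simp_all add: u_def g_def)
    then show ?thesis unfolding R_def mult.assoc p by simp
  qed
  have q: "0 < (1 + u)\<^sup>2" using u by simp
  have m4: "0 < 4 * m" using m by simp
  have L: "4 * m * ((1 + u / 2) * (1 + u / (2 * m) + u\<^sup>2 / (4 * m))) = (1 + u / 2) * (4 * m + 2 * u + u\<^sup>2)"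
    using m by (simp add: field_simps)
  have "4 * m * ((1 + al * x - be * x\<^sup>2) * (1 + u)\<^sup>2) = (4 * m + 2 * u - 6 * m * u - 2 * (1 - 4 * m) * u\<^sup>2) * (1 + u)\<^sup>2"
    unfolding e1 e2 using m by (simp add: field_simps power2_eq_square)
  also have "\<dots> = (1 + u / 2) * (4 * m + 2 * u + u\<^sup>2) - (u ^ 3 * (5/2 - 10 * m) + u ^ 4 * (2 - 8 * m))"
    by (simp add: field_simps power2_eq_square power3_eq_cube power4_eq_xxxx)
  also have "\<dots> \<le> (1 + u / 2) * (4 * m + 2 * u + u\<^sup>2)"
  proof -
    have "0 \<le> u ^ 3 * (5/2 - 10 * m)" "0 \<le> u ^ 4 * (2 - 8 * m)" using u m by auto
    then show ?thesis by linarith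
  qed
  finally have "4 * m * ((1 + al * x - be * x\<^sup>2) * (1 + u)\<^sup>2) \<le> 4 * m * ((1 + u / 2) * (1 + u / (2 * m) + u\<^sup>2 / (4 * m)))"
    unfolding L .
  then have "(1 + al * x - be * x\<^sup>2) * (1 + u)\<^sup>2 \<le> (1 + u / 2) * (1 + u / (2 * m) + u\<^sup>2 / (4 * m))"
    using m4 by (rule mult_left_le_imp_le)
  then show "1 + al * x - be * x\<^sup>2 \<le> R x" unfolding R using q by (simp add: pos_le_divide_eq)
  have "4 * m * ((1 + al * x) * (1 + u)\<^sup>2) = (4 * m + 2 * u - 6 * m * u) * (1 + u)\<^sup>2"
    unfolding e1 using m by (simp add: field_simps power2_eq_square)
  also have "\<dots> = (1 + u / 2) * (4 * m + 2 * u + u\<^sup>2) + (u\<^sup>2 * (2 - 8 * m) + u ^ 3 * (3/2 - 6 * m))"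
    by (simp add: field_simps power2_eq_square power3_eq_cube)
  also have "\<dots> \<ge> (1 + u / 2) * (4 * m + 2 * u + u\<^sup>2)"
  proof -
    have "0 \<le> u\<^sup>2 * (2 - 8 * m)" "0 \<le> u ^ 3 * (3/2 - 6 * m)" using u m by auto
    then show ?thesis by linarith
  qed
  finally have "4 * m * ((1 + u / 2) * (1 + u / (2 * m) + u\<^sup>2 / (4 * m))) \<le> 4 * m * ((1 + al * x) * (1 + u)\<^sup>2)"
    unfolding L .
  then have "(1 + u / 2) * (1 + u / (2 * m) + u\<^sup>2 / (4 * m)) \<le> (1 + al * x) * (1 + u)\<^sup>2"
    using m4 by (rule mult_left_le_imp_le)
  then show "R x \<le> 1 + al * x" unfolding R using q by (simp add: pos_divide_le_eq)
qed

lemma R_ge_1: assumes x: "0 \<le> x" shows "1 \<le> R x"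
proof -
  have "(1 + x / (s + t))\<^sup>2 \<le> (1 + x / (2 * (s + t))) * (1 + x / (2 * s)) * (1 + x / (2 * t))"
  proof -
    define u where "u = x / (s + t)"
    have u: "0 \<le> u" using x pos by (simp add: u_def)
    have a: "2 * u \<le> x / (2 * s) + x / (2 * t)"
    proof -
      have "x * (4 * (s * t)) \<le> x * (s + t)\<^sup>2" using st4 x by (rule mult_left_mono)
      then show ?thesis using pos by (simp add: u_def divide_simps power2_eq_square algebra_simps)
    qed
    have b: "u\<^sup>2 \<le> (x / (2 * s)) * (x / (2 * t))"
    proof -
      have "x\<^sup>2 * (4 * (s * t)) \<le> x\<^sup>2 * (s + t)\<^sup>2" using st4 by (rule mult_left_mono) simp
      then show ?thesis using pos by (simp add: u_def divide_simps power2_eq_square)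
    qed
    have "(1 + u)\<^sup>2 \<le> 1 + (x / (2 * s) + x / (2 * t)) + (x / (2 * s)) * (x / (2 * t))"
      using a b by (simp add: power2_eq_square algebra_simps)
    also have "\<dots> = (1 + x / (2 * s)) * (1 + x / (2 * t))" by (simp add: algebra_simps)
    also have "\<dots> \<le> (1 + u / 2) * ((1 + x / (2 * s)) * (1 + x / (2 * t)))"
    proof -
      have "0 \<le> (1 + x / (2 * s)) * (1 + x / (2 * t))" using x pos by (intro mult_nonneg_nonneg add_nonneg_nonneg) auto
      then have "1 * ((1 + x / (2 * s)) * (1 + x / (2 * t))) \<le> (1 + u / 2) * ((1 + x / (2 * s)) * (1 + x / (2 * t)))"
        using u by (intro mult_right_mono) auto
      then show ?thesis by simp
    qed
    finally have F: "(1 + u)\<^sup>2 \<le> (1 + u / 2) * ((1 + x / (2 * s)) * (1 + x / (2 * t)))" .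
    have e: "u / 2 = x / (2 * (s + t))" by (simp add: u_def)
    show ?thesis using F unfolding e unfolding u_def mult.assoc .
  qed
  moreover have "0 < 1 + x / (s + t)" using x pos by (intro add_pos_nonneg divide_nonneg_nonneg) auto
  ultimately show ?thesis unfolding R_def by (simp add: pos_le_divide_eq)
qed

text \<open>If \<open>sqrt (R x)\<close> is at least a polynomial, integrating it gives a lower bound for the integral of the density and
hence an upper bound for the toll.\<close>

lemma toll_le_poly:
  assumes T: "0 \<le> T" and M0: "0 \<le> M"
    and le: "\<And>x. 0 \<le> x \<Longrightarrow> x \<le> T \<Longrightarrow> 1 + c1 * x + c2 * x\<^sup>2 \<le> sqrt (R x)"
    and M: "M = 1 + 3/5 * c1 * T + 3/7 * c2 * T\<^sup>2" and test: "9/128 * hm \<le> T ^ 3 * M\<^sup>2"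
  shows "toll s t \<le> T"
proof (rule toll_le)
  let ?c = "sqrt (32 / hm)"
  have "((\<lambda>x. ?c * (sqrt x * (1 + c1 * x + c2 * x\<^sup>2))) has_integral ?c * (sqrt T * T * (2/3 * 1 + 2/5 * c1 * T + 2/7 * c2 * T\<^sup>2))) {0..T}"
    by (intro has_integral_mult_right sqrt_poly_integral T)
  then have "?c * (sqrt T * T * (2/3 * 1 + 2/5 * c1 * T + 2/7 * c2 * T\<^sup>2)) \<le> toll_integral s t T"
  proof (rule toll_integral_ge[rotated 3])
    fix x assume x: "0 \<le> x" "x \<le> T"
    show "?c * (sqrt x * (1 + c1 * x + c2 * x\<^sup>2)) \<le> toll_density s t x"
      unfolding density_eq[OF x(1)] mult.assoc using x hm_pos
      by (intro mult_left_mono le) auto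
  qed (use pos T in auto)
  moreover have "1 \<le> ?c * (sqrt T * T * (2/3 * 1 + 2/5 * c1 * T + 2/7 * c2 * T\<^sup>2))"
  proof -
    have e: "?c * (sqrt T * T * (2/3 * 1 + 2/5 * c1 * T + 2/7 * c2 * T\<^sup>2)) = ?c * sqrt T * T * (2/3) * M"
      unfolding M by (simp add: field_simps)
    have "1\<^sup>2 \<le> (?c * sqrt T * T * (2/3) * M)\<^sup>2"
    proof -
      have "(?c * sqrt T * T * (2/3) * M)\<^sup>2 = ?c\<^sup>2 * (sqrt T)\<^sup>2 * T\<^sup>2 * (2/3)\<^sup>2 * M\<^sup>2" by (simp only: power_mult_distrib)
      also have "\<dots> = 128 / (9 * hm) * (T ^ 3 * M\<^sup>2)" using hm_pos T by (simp add: power2_eq_square power3_eq_cube)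
      also have "\<dots> \<ge> 128 / (9 * hm) * (9/128 * hm)" using test hm_pos by (intro mult_left_mono) auto
      also have "128 / (9 * hm) * (9/128 * hm) = 1" using hm_pos by simp
      finally show ?thesis by simp
    qed
    moreover have "0 \<le> ?c * sqrt T * T * (2/3) * M"
      using M0 T less_imp_le[OF hm_pos] by (intro mult_nonneg_nonneg real_sqrt_ge_zero divide_nonneg_nonneg) simp_all
    ultimately show ?thesis unfolding e by (rule power2_le_imp_le)
  qed
  ultimately show "1 \<le> toll_integral s t T" by linarith
qed (use pos T in auto)

lemma toll_le_cube_root:
  assumes "0 \<le> T" "9/128 * hm \<le> T ^ 3"
  shows "toll s t \<le> T"
proof (rule toll_le_poly[where ?c1.0 = 0 and ?c2.0 = 0 and M = 1])
  show "1 + 0 * x + 0 * x\<^sup>2 \<le> sqrt (R x)" if "0 \<le> x" for x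
    using R_ge_1[OF that] by simp
qed (use assms in auto)

text \<open>The minorant of \<open>sqrt (R x)\<close> comes from \<open>R x \<ge> 1 + al x - be x\<^sup>2\<close> and the expansion of the square root.\<close>

lemma toll_le_test:
  assumes T: "0 \<le> T" and ba: "be * T \<le> al" and M0: "0 \<le> M"
    and M: "M = 1 + 3/10 * (al * T) - 3/14 * (be * T\<^sup>2) - 3/56 * (al * T)\<^sup>2"
    and test: "9/128 * hm \<le> T ^ 3 * M\<^sup>2"
  shows "toll s t \<le> T"
proof (rule toll_le_poly[where ?c1.0 = "al / 2" and ?c2.0 = "- (be / 2 + al\<^sup>2 / 8)", OF T M0 _ _ test])
  fix x assume x: "0 \<le> x" "x \<le> T"
  define w where "w = al * x - be * x\<^sup>2"
  have "be * x \<le> be * T" using x be_nonneg by (intro mult_left_mono)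
  then have "0 \<le> (al - be * x) * x" using ba x by (intro mult_nonneg_nonneg) auto
  then have w0: "0 \<le> w" by (simp add: w_def power2_eq_square algebra_simps)
  have wa: "w \<le> al * x" using be_nonneg by (simp add: w_def)
  have "w\<^sup>2 \<le> (al * x)\<^sup>2" using w0 wa by (intro power_mono)
  moreover have "1 + al / 2 * x + - (be / 2 + al\<^sup>2 / 8) * x\<^sup>2 = 1 + w / 2 - (al * x)\<^sup>2 / 8"
    by (simp add: w_def power_mult_distrib algebra_simps add_divide_distrib diff_divide_distrib)
  ultimately have "1 + al / 2 * x + - (be / 2 + al\<^sup>2 / 8) * x\<^sup>2 \<le> 1 + w / 2 - w\<^sup>2 / 8" by linarith
  also have "\<dots> \<le> sqrt (1 + w)"
  proof (cases "w \<le> 8")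
    case True
    have "(1 + w / 2 - w\<^sup>2 / 8)\<^sup>2 = 1 + w - w ^ 3 * (8 - w) / 64"
      by (simp add: power2_eq_square power3_eq_cube field_simps)
    also have "\<dots> \<le> 1 + w" using True w0 by simp
    finally show ?thesis by (rule real_le_rsqrt)
  next
    case False
    then have "w * 8 \<le> w * w" by (intro mult_left_mono) auto
    then have "1 + w / 2 - w\<^sup>2 / 8 \<le> 0" using False unfolding power2_eq_square by linarith
    then show ?thesis using w0 real_sqrt_ge_zero[of "1 + w"] by linarith
  qed
  also have "\<dots> \<le> sqrt (R x)" using R_bounds(1)[OF x(1)] by (simp add: w_def add_diff_eq)
  finally show "1 + al / 2 * x + - (be / 2 + al\<^sup>2 / 8) * x\<^sup>2 \<le> sqrt (R x)" .
qed (simp add: M power_mult_distrib algebra_simps)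

text \<open>Here \<open>sqrt (R x) \<le> sqrt (1 + al x)\<close>, and the square root lies below its tangent at the mean value \<open>c\<^sup>2 = 1 + 3/5 al T\<close> of
\<open>1 + al x\<close> with respect to the weight \<open>sqrt x\<close>; this choice of the point loses the least.\<close>

lemma toll_ge_test:
  assumes T: "0 \<le> T" and test: "T ^ 3 * (1 + 3/5 * (al * T)) \<le> 9/128 * hm"
  shows "T \<le> toll s t"
proof (rule toll_ge)
  let ?c = "sqrt (32 / hm)"
  define a where "a = al * T"
  define c where "c = sqrt (1 + 3/5 * a)"
  have a0: "0 \<le> a" using al_nonneg T by (simp add: a_def)
  have c2: "c\<^sup>2 = 1 + 3/5 * a" using a0 by (simp add: c_def)
  have c: "0 < c" using a0 by (simp add: c_def)
  have "((\<lambda>x. ?c * (sqrt x * ((c\<^sup>2 + 1) / (2 * c) + al / (2 * c) * x + 0 * x\<^sup>2))) has_integral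
     ?c * (sqrt T * T * (2/3 * ((c\<^sup>2 + 1) / (2 * c)) + 2/5 * (al / (2 * c)) * T + 2/7 * 0 * T\<^sup>2))) {0..T}"
    by (intro has_integral_mult_right sqrt_poly_integral T)
  then have "toll_integral s t T \<le> ?c * (sqrt T * T * (2/3 * ((c\<^sup>2 + 1) / (2 * c)) + 2/5 * (al / (2 * c)) * T + 2/7 * 0 * T\<^sup>2))"
  proof (rule toll_integral_le[rotated 3])
    have d: "toll_density s t x \<le> ?c * (sqrt x * ((c\<^sup>2 + 1) / (2 * c) + al / (2 * c) * x + 0 * x\<^sup>2))" if x: "0 \<le> x" for x
    proof -
      have "sqrt (R x) \<le> sqrt (1 + al * x)" using R_bounds(2)[OF x] by simp
      also have "\<dots> \<le> (c\<^sup>2 + (1 + al * x)) / (2 * c)"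
      proof -
        have z: "0 \<le> 1 + al * x" using al_nonneg x by simp
        have "2 * c * sqrt (1 + al * x) \<le> c\<^sup>2 + (sqrt (1 + al * x))\<^sup>2"
          using zero_le_power2[of "c - sqrt (1 + al * x)"] by (simp add: power2_diff)
        then show ?thesis using c z by (simp add: pos_le_divide_eq mult.commute)
      qed
      also have "\<dots> = (c\<^sup>2 + 1) / (2 * c) + al / (2 * c) * x + 0 * x\<^sup>2" by (simp add: add_divide_distrib)
      finally show ?thesis unfolding density_eq[OF x] mult.assoc using hm_pos x by (intro mult_left_mono) auto
    qed
    then show "\<And>x. 0 < x \<Longrightarrow> x \<le> T \<Longrightarrow> toll_density s t x \<le> ?c * (sqrt x * ((c\<^sup>2 + 1) / (2 * c) + al / (2 * c) * x + 0 * x\<^sup>2))" by simp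
    show "toll_density s t 0 \<le> ?c * (sqrt 0 * ((c\<^sup>2 + 1) / (2 * c) + al / (2 * c) * 0 + 0 * 0\<^sup>2))" using d[of 0] by simp
  qed (use pos T in auto)
  also have "\<dots> = ?c * sqrt T * T * (2/3) * c"
  proof -
    have "2/3 * ((c\<^sup>2 + 1) / (2 * c)) + 2/5 * (al / (2 * c)) * T + 2/7 * 0 * T\<^sup>2 = (2/3) * ((c\<^sup>2 + (1 + 3/5 * a)) / (2 * c))"
      using c by (simp add: a_def divide_simps)
    also have "(c\<^sup>2 + (1 + 3/5 * a)) / (2 * c) = c" unfolding c2[symmetric] using c by (simp add: power2_eq_square)
    finally show ?thesis by (simp add: mult.assoc)
  qed
  also have "\<dots> \<le> 1"
  proof -
    have "(?c * sqrt T * T * (2/3) * c)\<^sup>2 = ?c\<^sup>2 * (sqrt T)\<^sup>2 * T\<^sup>2 * (2/3)\<^sup>2 * c\<^sup>2" by (simp only: power_mult_distrib)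
    also have "\<dots> = 128 / (9 * hm) * (T ^ 3 * (1 + 3/5 * a))" unfolding c2 using hm_pos T by (simp add: power2_eq_square power3_eq_cube mult_ac)
    also have "\<dots> \<le> 128 / (9 * hm) * (9/128 * hm)" using test hm_pos by (intro mult_left_mono) (auto simp: a_def)
    also have "\<dots> = 1\<^sup>2" using hm_pos by simp
    finally show ?thesis by (rule power2_le_imp_le) simp
  qed
  finally show "toll_integral s t T \<le> 1" .
qed (use pos in auto)

end

text \<open>For a leaf the root in the density can be extracted, so the integral is elementary.\<close>

lemma toll_density_0: "0 < t \<Longrightarrow> 0 \<le> x \<Longrightarrow> toll_density 0 t x = 2 * x + 2 * t - 2 * t\<^sup>2 / (x + t)"
proof -
  assume *: "0 < t" "0 \<le> x"
  have "x * (x + 2 * 0) * (x + 2 * t) * (x + 2 * (0 + t)) = (x * (x + 2 * t))\<^sup>2" by (simp add: power2_eq_square)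
  then have "toll_density 0 t x = 2 * (x * (x + 2 * t)) / (x + t)"
    using * unfolding toll_density_def by (simp only: real_sqrt_abs) simp
  also have "\<dots> = 2 * x + 2 * t - 2 * t\<^sup>2 / (x + t)" using * by (simp add: field_simps power2_eq_square)
  finally show ?thesis .
qed

lemma toll_integral_0_eq:
  assumes "0 < t" "0 \<le> T"
  shows "toll_integral 0 t T = T\<^sup>2 + 2 * t * T - 2 * t\<^sup>2 * ln (1 + T / t)"
proof -
  have "((\<lambda>x. 2 * x + 2 * t - 2 * t\<^sup>2 / (x + t)) has_integral
     (\<lambda>x. x\<^sup>2 + 2 * t * x - 2 * t\<^sup>2 * ln (x + t)) T - (\<lambda>x. x\<^sup>2 + 2 * t * x - 2 * t\<^sup>2 * ln (x + t)) 0) {0..T}"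
    using assms by (intro fundamental_theorem_of_calculus)
      (auto intro!: derivative_eq_intros simp: has_real_derivative_iff_has_vector_derivative[symmetric])
  moreover have "(\<lambda>x. x\<^sup>2 + 2 * t * x - 2 * t\<^sup>2 * ln (x + t)) T - (\<lambda>x. x\<^sup>2 + 2 * t * x - 2 * t\<^sup>2 * ln (x + t)) 0
     = T\<^sup>2 + 2 * t * T - 2 * t\<^sup>2 * (ln (T + t) - ln t)" by (simp add: algebra_simps)
  moreover have "ln (T + t) - ln t = ln (1 + T / t)"
  proof -
    have "1 + T / t = (T + t) / t" using assms by (simp add: field_simps)
    then show ?thesis using assms by (simp add: ln_div)
  qed
  ultimately have "((\<lambda>x. 2 * x + 2 * t - 2 * t\<^sup>2 / (x + t)) has_integral (T\<^sup>2 + 2 * t * T - 2 * t\<^sup>2 * ln (1 + T / t))) {0..T}"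
    by (simp only:)
  then have "(toll_density 0 t has_integral (T\<^sup>2 + 2 * t * T - 2 * t\<^sup>2 * ln (1 + T / t))) {0..T}"
    by (rule has_integral_eq[rotated]) (use assms in \<open>auto simp: toll_density_0\<close>)
  then show ?thesis unfolding toll_integral_def by (rule integral_unique)
qed

section \<open>Integer tests for tolls\<close>
text \<open>Tables hold integers in units of \<open>10\<^sup>-\<^sup>5\<close>.\<close>

definition milli :: "int \<Rightarrow> real" where "milli S = real_of_int S / 10^5"

lemma milli_pos: "0 < S \<Longrightarrow> 0 < milli S" and milli_nonneg: "0 \<le> S \<Longrightarrow> 0 \<le> milli S"
  and milli_mono: "S \<le> T \<Longrightarrow> milli S \<le> milli T" and milli_add: "milli (S + T) = milli S + milli T"
  and milli_diff: "milli (S - T) = milli S - milli T"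
  by (auto simp: milli_def add_divide_distrib diff_divide_distrib divide_right_mono)

text \<open>In units of \<open>10\<^sup>-\<^sup>5\<close>, this is \<open>9/128 (1/s + 1/t) \<le> v\<^sup>3\<close>; the big constant is \<open>9 * 10\<^sup>2\<^sup>0\<close>.\<close>

definition cube_ok :: "int \<Rightarrow> int \<Rightarrow> int \<Rightarrow> bool" where
  "cube_ok S T V \<longleftrightarrow> 0 < S \<and> 0 < T \<and> 0 \<le> V \<and> 900000000000000000000 * (S + T) \<le> 128 * (V * V * V) * (S * T)"

text \<open>The condition of \<open>toll_ge_test\<close>, cleared of denominators.\<close>

definition lower_ok :: "int \<Rightarrow> int \<Rightarrow> int \<Rightarrow> bool" where
  "lower_ok S T V \<longleftrightarrow> 0 < S \<and> 0 < T \<and> 0 \<le> V \<and>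
    (let G = S + T; p = S * T; q = G * G in
      128 * (V * V * V) * (10 * p * G + 3 * V * (q - 3 * p)) \<le> 9000000000000000000000 * q)"

text \<open>A version of \<open>lower_ok\<close> that is uniform in the second argument \<open>t\<close>: as long as \<open>s \<le> 2 t\<close>, the coefficient
\<open>al\<close> is at most \<open>1 / (2 s)\<close>.\<close>

definition lower_inf_ok :: "int \<Rightarrow> int \<Rightarrow> bool" where
  "lower_inf_ok S V \<longleftrightarrow> 0 < S \<and> 0 \<le> V \<and> 128 * (V * V * V) * (10 * S + 3 * V) \<le> 9000000000000000000000"

text \<open>The condition of \<open>toll_le_test\<close>, cleared of denominators. The square of the polynomial is replaced by the lower
bound from \<open>square_poly_bound\<close>, and one factor of \<open>a = al v\<close> in its quadratic term by the upper bound \<open>e / 325\<close>, which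
keeps the numbers short.\<close>

definition upper_ok :: "int \<Rightarrow> int \<Rightarrow> int \<Rightarrow> bool" where
  "upper_ok S T V \<longleftrightarrow> 0 < S \<and> 0 < T \<and> 0 \<le> V \<and>
    (let G = S + T; p = S * T; q = G * G; a = V * (q - 3 * p); d = 2 * p * G; e = 325 * a div d + 1 in
      V \<le> G \<and> e \<le> 78 \<and>
      1462500000000000000000000 * (q * G) \<le> 8 * (V * V * V) * (13000 * d * G + (7800 - e) * a * G - 6000 * (V * V) * (q - 4 * p)))"

lemma scaled:
  assumes S: "0 < S" "0 < T"
  shows "positive_pair.hm (milli S) (milli T) = (real_of_int S + real_of_int T) * 10^5 / (real_of_int S * real_of_int T)"
    and "positive_pair.al (milli S) (milli T) * milli V = real_of_int V * ((real_of_int S + real_of_int T)\<^sup>2 - 3 * (real_of_int S * real_of_int T))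
       / (2 * (real_of_int S * real_of_int T) * (real_of_int S + real_of_int T))"
    and "positive_pair.be (milli S) (milli T) * (milli V)\<^sup>2 = (real_of_int V)\<^sup>2 * ((real_of_int S + real_of_int T)\<^sup>2 - 4 * (real_of_int S * real_of_int T))
       / (2 * (real_of_int S * real_of_int T) * (real_of_int S + real_of_int T)\<^sup>2)"
proof -
  interpret positive_pair "milli S" "milli T" by unfold_locales (use S in \<open>auto intro: milli_pos\<close>)
  define x y v where "x = real_of_int S" and "y = real_of_int T" and "v = real_of_int V"
  have xy: "0 < x" "0 < y" using S by (auto simp: x_def y_def)
  have m: "milli S = x / 10^5" "milli T = y / 10^5" "milli V = v / 10^5" by (simp_all add: milli_def x_def y_def v_def)
  have sm: "x / 10^5 + y / 10^5 = (x + y) / 10^5" by (simp add: add_divide_distrib)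
  define p where "p = x * y"
  define g where "g = x + y"
  have pg: "0 < p" "0 < g" using xy by (simp_all add: p_def g_def)
  have pm: "x / 10^5 * (y / 10^5) = p / 10^10" by (simp add: p_def)
  show "hm = (real_of_int S + real_of_int T) * 10^5 / (real_of_int S * real_of_int T)"
  proof -
    have "hm = ((x + y) / 10^5) / (p / 10^10)" unfolding hm_eq unfolding m sm pm ..
    also have "\<dots> = (x + y) * 10^5 / p"
    proof -
      have "(z / 10^5) / (p / 10^10) = z * 10^5 / p" for z :: real using pg by simp
      then show ?thesis .
    qed
    finally show ?thesis by (simp add: p_def x_def y_def)
  qed
  have "al * milli V = ((g / 10^5)\<^sup>2 - 3 * (p / 10^10)) / (2 * (p / 10^10) * (g / 10^5)) * (v / 10^5)"
    unfolding al_eq unfolding m sm pm g_def ..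
  also have "\<dots> = v * (g\<^sup>2 - 3 * p) / (2 * p * g)" using pg by (simp add: power2_eq_square field_simps)
  finally show "al * milli V = real_of_int V * ((real_of_int S + real_of_int T)\<^sup>2 - 3 * (real_of_int S * real_of_int T))
       / (2 * (real_of_int S * real_of_int T) * (real_of_int S + real_of_int T))"
    by (simp add: p_def g_def x_def y_def v_def)
  have "be * (milli V)\<^sup>2 = ((g / 10^5)\<^sup>2 - 4 * (p / 10^10)) / (2 * (p / 10^10) * (g / 10^5)\<^sup>2) * (v / 10^5)\<^sup>2"
    unfolding be_eq unfolding m sm pm g_def ..
  also have "\<dots> = v\<^sup>2 * (g\<^sup>2 - 4 * p) / (2 * p * g\<^sup>2)" using pg by (simp add: power2_eq_square field_simps)
  finally show "be * (milli V)\<^sup>2 = (real_of_int V)\<^sup>2 * ((real_of_int S + real_of_int T)\<^sup>2 - 4 * (real_of_int S * real_of_int T))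
       / (2 * (real_of_int S * real_of_int T) * (real_of_int S + real_of_int T)\<^sup>2)"
    by (simp add: p_def g_def x_def y_def v_def)
qed

lemma cube_ok: assumes "cube_ok S T V" shows "toll (milli S) (milli T) \<le> milli V"
proof -
  have S: "0 < S" "0 < T" "0 \<le> V" and t: "900000000000000000000 * (S + T) \<le> 128 * (V * V * V) * (S * T)"
    using assms by (auto simp: cube_ok_def)
  interpret positive_pair "milli S" "milli T" by unfold_locales (use S in \<open>auto intro: milli_pos\<close>)
  define x y v where "x = real_of_int S" and "y = real_of_int T" and "v = real_of_int V"
  have xy: "0 < x" "0 < y" using S by (auto simp: x_def y_def)
  have "900000000000000000000 * (x + y) \<le> 128 * (v * v * v) * (x * y)"
    using of_int_le_iff[where 'a = real, THEN iffD2, OF t] by (simp add: x_def y_def v_def)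
  then have "9/128 * ((x + y) * 10^5 / (x * y)) \<le> v ^ 3 / 10^15"
    using xy by (simp add: field_simps power3_eq_cube)
  note le = this
  have A: "hm = (x + y) * 10^5 / (x * y)" unfolding scaled(1)[OF S(1,2)] by (simp add: x_def y_def)
  have B: "milli V ^ 3 = v ^ 3 / 10^15" by (simp add: milli_def v_def power_divide)
  have "9/128 * hm \<le> milli V ^ 3" unfolding A B by (rule le)
  then show ?thesis using S by (intro toll_le_cube_root milli_nonneg) auto
qed

lemma lower_ok: assumes "lower_ok S T V" shows "milli V \<le> toll (milli S) (milli T)"
proof -
  have S: "0 < S" "0 < T" "0 \<le> V" and t: "128 * (V * V * V) * (10 * (S * T) * (S + T) + 3 * V * ((S + T) * (S + T) - 3 * (S * T))) \<le> 9000000000000000000000 * ((S + T) * (S + T))"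
    using assms by (auto simp: lower_ok_def Let_def)
  interpret positive_pair "milli S" "milli T" by unfold_locales (use S in \<open>auto intro: milli_pos\<close>)
  define p g v where "p = real_of_int S * real_of_int T" and "g = real_of_int S + real_of_int T" and "v = real_of_int V"
  have pg: "0 < p" "0 < g" using S by (auto simp: p_def g_def)
  have t': "128 * (v * v * v) * (10 * p * g + 3 * v * (g * g - 3 * p)) \<le> 9000000000000000000000 * (g * g)"
    using of_int_le_iff[where 'a = real, THEN iffD2, OF t] by (simp add: p_def g_def v_def)
  have "(milli V) ^ 3 * (1 + 3/5 * (al * milli V)) = 128 * (v * v * v) * (10 * p * g + 3 * v * (g * g - 3 * p)) / (1280 * 10^15 * p * g)"
    unfolding scaled(2)[OF S(1,2)] p_def[symmetric] g_def[symmetric] unfolding milli_def v_def[symmetric]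
    using pg by (simp add: field_simps power3_eq_cube power2_eq_square)
  also have "\<dots> \<le> 9000000000000000000000 * (g * g) / (1280 * 10^15 * p * g)"
    using t' pg by (intro divide_right_mono) auto
  also have "\<dots> = 9/128 * hm"
    unfolding scaled(1)[OF S(1,2)] p_def[symmetric] g_def[symmetric] using pg by (simp add: field_simps)
  finally show ?thesis using S by (intro toll_ge_test milli_nonneg)
qed

lemma lower_inf_ok:
  assumes "lower_inf_ok S V" "milli S \<le> 2 * t"
  shows "milli V \<le> toll (milli S) t"
proof -
  have S: "0 < S" "0 \<le> V" and t: "128 * (V * V * V) * (10 * S + 3 * V) \<le> 9000000000000000000000"
    using assms by (auto simp: lower_inf_ok_def)
  define x v where "x = milli S" and "v = milli V"
  have x: "0 < x" "0 \<le> v" using S by (auto simp: x_def v_def intro: milli_pos milli_nonneg)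
  have t0: "0 < t" using x assms(2) by (simp add: x_def[symmetric])
  interpret positive_pair x t by unfold_locales (use x t0 in auto)
  have xS: "real_of_int S = 10^5 * x" "real_of_int V = 10^5 * v" by (simp_all add: x_def v_def milli_def)
  have "128 * (real_of_int V * real_of_int V * real_of_int V) * (10 * real_of_int S + 3 * real_of_int V) \<le> 9000000000000000000000"
    using of_int_le_iff[where 'a = real, THEN iffD2, OF t] by simp
  then have "128 * (v * v * v) * (10 * x + 3 * v) \<le> 90" unfolding xS by (simp add: field_simps)
  then have h: "128 * (v * v * v) * (10 * x + 3 * v) / (1280 * x) \<le> 90 / (1280 * x)"
    using x by (intro divide_right_mono) auto
  have "v ^ 3 * (1 + 3 * v / (10 * x)) = 128 * (v * v * v) * (10 * x + 3 * v) / (1280 * x)"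
    using x by (simp add: field_simps power3_eq_cube)
  also note h
  also have "90 / (1280 * x) = 9 / (128 * x)" using x by simp
  finally have "v ^ 3 * (1 + 3 * v / (10 * x)) \<le> 9 / (128 * x)" .
  moreover have "al \<le> 1 / (2 * x)"
  proof -
    have "1 / (2 * t) \<le> 3 / (2 * (x + t))" using x t0 assms(2) by (simp add: x_def[symmetric] divide_simps)
    then show ?thesis by (simp add: al_def hm_def add_divide_distrib)
  qed
  then have "3/5 * (al * v) \<le> 3 * v / (10 * x)"
    using mult_right_mono[of al "1 / (2 * x)" v] x by (simp add: field_simps)
  then have "v ^ 3 * (1 + 3/5 * (al * v)) \<le> v ^ 3 * (1 + 3 * v / (10 * x))"
    using x by (intro mult_left_mono) auto
  moreover have "9 / (128 * x) \<le> 9/128 * hm" using t0 by (simp add: hm_def)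
  ultimately have "v ^ 3 * (1 + 3/5 * (al * v)) \<le> 9/128 * hm" by linarith
  then show ?thesis unfolding x_def[symmetric] v_def[symmetric] using x by (intro toll_ge_test)
qed

text \<open>The cubic and quartic terms of the square are absorbed into the linear and quadratic ones, which is possible as
\<open>a \<le> 6/25\<close>.\<close>

lemma square_poly_bound:
  fixes a b :: real
  assumes "0 \<le> a" "a \<le> 6/25" "0 \<le> b" "b \<le> a"
  shows "0 \<le> 1 + 3/10 * a - 3/14 * b - 3/56 * a\<^sup>2"
    "1 + 3/5 * a - 1/40 * a\<^sup>2 - 6/13 * b \<le> (1 + 3/10 * a - 3/14 * b - 3/56 * a\<^sup>2)\<^sup>2"
proof -
  have a2: "a\<^sup>2 \<le> 6/25 * a" using mult_right_mono[OF assms(2,1)] by (simp add: power2_eq_square)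
  then show "0 \<le> 1 + 3/10 * a - 3/14 * b - 3/56 * a\<^sup>2" using assms by linarith
  define r where "r = 3/14 * b + 3/56 * a\<^sup>2"
  have "(1 + 3/10 * a - 3/14 * b - 3/56 * a\<^sup>2)\<^sup>2 = 1 + 3/5 * a + 9/100 * a\<^sup>2 - 2 * r - 3/5 * (a * r) + r\<^sup>2"
    by (simp add: r_def power2_eq_square algebra_simps)
  moreover have "a * r \<le> 6/25 * r" using assms by (intro mult_right_mono) (auto simp: r_def)
  moreover have "0 \<le> r\<^sup>2" by simp
  ultimately have "1 + 3/5 * a + 9/100 * a\<^sup>2 - 2 * r - 3/5 * (6/25 * r) \<le> (1 + 3/10 * a - 3/14 * b - 3/56 * a\<^sup>2)\<^sup>2" by linarith
  moreover have "2 * r + 3/5 * (6/25 * r) = 804/1750 * b + 201/1750 * a\<^sup>2" by (simp add: r_def field_simps)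
  moreover have "804/1750 * b \<le> 6/13 * b" using assms by (intro mult_right_mono) auto
  moreover have "0 \<le> a\<^sup>2" by simp
  ultimately show "1 + 3/5 * a - 1/40 * a\<^sup>2 - 6/13 * b \<le> (1 + 3/10 * a - 3/14 * b - 3/56 * a\<^sup>2)\<^sup>2" by linarith
qed

lemma upper_ok: assumes "upper_ok S T V" shows "toll (milli S) (milli T) \<le> milli V"
proof -
  define e where "e = 325 * (V * ((S + T) * (S + T) - 3 * (S * T))) div (2 * (S * T) * (S + T)) + 1"
  have S: "0 < S" "0 < T" "0 \<le> V" and VG: "V \<le> S + T" and e78: "e \<le> 78"
    and t: "1462500000000000000000000 * ((S + T) * (S + T) * (S + T)) \<le> 8 * (V * V * V) * (13000 * (2 * (S * T) * (S + T)) * (S + T)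
      + (7800 - e) * (V * ((S + T) * (S + T) - 3 * (S * T))) * (S + T) - 6000 * (V * V) * ((S + T) * (S + T) - 4 * (S * T)))"
    using assms unfolding upper_ok_def Let_def e_def by blast+
  interpret positive_pair "milli S" "milli T" by unfold_locales (use S in \<open>auto intro: milli_pos\<close>)
  define p g v where "p = real_of_int S * real_of_int T" and "g = real_of_int S + real_of_int T" and "v = real_of_int V"
  define a b where "a = al * milli V" and "b = be * (milli V)\<^sup>2"
  have pg: "0 < p" "0 < g" "0 \<le> v" "v \<le> g" using S VG by (auto simp: p_def g_def v_def)
  have a_eq: "a = v * (g\<^sup>2 - 3 * p) / (2 * p * g)" and b_eq: "b = v\<^sup>2 * (g\<^sup>2 - 4 * p) / (2 * p * g\<^sup>2)"
    unfolding a_def b_def scaled(2,3)[OF S(1,2)] by (simp_all add: p_def g_def v_def)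
  have g4: "4 * p \<le> g\<^sup>2" unfolding p_def g_def using zero_le_square[of "real_of_int S - real_of_int T"]
    by (simp add: power2_eq_square algebra_simps)
  have a0: "0 \<le> a" and b0: "0 \<le> b" using al_nonneg be_nonneg S by (simp_all add: a_def b_def milli_nonneg)
  have bT: "be * milli V \<le> al"
  proof -
    have "milli V \<le> milli S + milli T" using milli_mono[OF VG] by (simp add: milli_add)
    then have "be * milli V \<le> be * (milli S + milli T)" using be_nonneg by (rule mult_left_mono)
    also have "\<dots> = ((milli S + milli T)\<^sup>2 - 4 * (milli S * milli T)) / (2 * (milli S * milli T) * (milli S + milli T))"
      unfolding be_eq using pos by (simp add: power2_eq_square)
    also have "\<dots> \<le> al" unfolding al_eq using pos by (intro divide_right_mono diff_left_mono mult_right_mono) auto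
    finally show ?thesis .
  qed
  have ba: "b \<le> a"
    using mult_right_mono[OF bT, of "milli V"] S by (simp add: a_def b_def power2_eq_square milli_nonneg mult.assoc)
  have ae: "325 * a \<le> real_of_int e"
  proof -
    have d: "0 < 2 * (S * T) * (S + T)" using S by simp
    have "325 * (V * ((S + T) * (S + T) - 3 * (S * T))) < e * (2 * (S * T) * (S + T))"
    proof -
      have "n < (n div d + 1) * d" if "0 < d" for n d :: int
      proof -
        have "n mod d < d" using that by simp
        moreover have "n = n div d * d + n mod d" by simp
        moreover have "(n div d + 1) * d = n div d * d + d" by (simp add: distrib_right)
        ultimately show ?thesis by linarith
      qed
      then show ?thesis unfolding e_def using d by blast
    qed
    then have "real_of_int (325 * (V * ((S + T) * (S + T) - 3 * (S * T)))) < real_of_int (e * (2 * (S * T) * (S + T)))"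
      by (rule of_int_less_iff[THEN iffD2])
    then have "325 * (v * (g\<^sup>2 - 3 * p)) < real_of_int e * (2 * p * g)"
      by (simp add: p_def g_def v_def power2_eq_square)
    then show ?thesis unfolding a_eq using pg by (simp add: pos_divide_le_eq)
  qed
  have a6: "a \<le> 6/25"
  proof -
    have "real_of_int e \<le> 78" using e78 by simp
    then show ?thesis using ae by linarith
  qed
  note M = square_poly_bound[OF a0 a6 b0 ba]
  have t': "1462500000000000000000000 * (g * g * g) \<le> 8 * (v * v * v) * (13000 * (2 * p * g) * g
      + (7800 - real_of_int e) * (v * (g * g - 3 * p)) * g - 6000 * (v * v) * (g * g - 4 * p))"
    using of_int_le_iff[where 'a = real, THEN iffD2, OF t] by (simp add: p_def g_def v_def)
  have "9/128 * hm = 1462500000000000000000000 * (g * g * g) / (208000 * 10^15 * (p * g\<^sup>2))"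
    unfolding scaled(1)[OF S(1,2)] p_def[symmetric] g_def[symmetric] using pg by (simp add: field_simps power2_eq_square)
  also have "\<dots> \<le> 8 * (v * v * v) * (13000 * (2 * p * g) * g
      + (7800 - real_of_int e) * (v * (g * g - 3 * p)) * g - 6000 * (v * v) * (g * g - 4 * p)) / (208000 * 10^15 * (p * g\<^sup>2))"
    using t' pg by (intro divide_right_mono) auto
  also have "\<dots> = milli V ^ 3 * (1 + (7800 - real_of_int e) / 13000 * a - 6/13 * b)"
    unfolding a_eq b_eq milli_def v_def[symmetric] using pg by (simp add: field_simps power2_eq_square power3_eq_cube)
  also have "\<dots> \<le> milli V ^ 3 * (1 + 3/5 * a - 1/40 * a\<^sup>2 - 6/13 * b)"
  proof (intro mult_left_mono)
    have "325 * a * a \<le> real_of_int e * a" using ae a0 by (rule mult_right_mono)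
    then show "1 + (7800 - real_of_int e) / 13000 * a - 6/13 * b \<le> 1 + 3/5 * a - 1/40 * a\<^sup>2 - 6/13 * b"
      by (simp add: field_simps power2_eq_square)
  qed (use S in \<open>simp add: milli_nonneg\<close>)
  also have "\<dots> \<le> milli V ^ 3 * (1 + 3/10 * a - 3/14 * b - 3/56 * a\<^sup>2)\<^sup>2"
    using M(2) S by (intro mult_left_mono) (auto simp: milli_nonneg)
  finally show ?thesis
    using S bT M(1) by (intro toll_le_test[where M = "1 + 3/10 * a - 3/14 * b - 3/56 * a\<^sup>2"]) (auto simp: a_def b_def milli_nonneg)
qed

text \<open>For a leaf the integral contains \<open>ln (1 + v/s) = 2 artanh (v / (2 s + v))\<close>; the test truncates the series of
\<open>artanh\<close> after the seventh power.\<close>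

definition lower0_ok :: "int \<Rightarrow> int \<Rightarrow> bool" where
  "lower0_ok S V \<longleftrightarrow> 0 < S \<and> 0 < V \<and>
    (let W = 2 * S + V; w = W * W; v = V * V in
      (V * W - 10000000000) * 105 * W * (w * w * w) \<le> 4 * (S * S) * V * (105 * (w * w * w) + v * (35 * (w * w) + v * (21 * w + v * 15))))"

text \<open>As in \<open>lower0_ok\<close>, with the remainder of the series bounded by \<open>y\<^sup>9 / 8\<close>; this needs \<open>v \<le> s\<close>.\<close>

definition upper0_ok :: "int \<Rightarrow> int \<Rightarrow> bool" where
  "upper0_ok S V \<longleftrightarrow> 0 < S \<and> 0 < V \<and> V \<le> S \<and>
    (let W = 2 * S + V; w = W * W; v = V * V in
      4 * (S * S) * V * (840 * (w * w * w * w) + v * (280 * (w * w * w) + v * (168 * (w * w) + v * (120 * w + v * 105)))) \<le> (V * W - 10000000000) * 840 * W * (w * w * w * w))"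

lemma ln_bounds:
  fixes S V :: real
  assumes "0 < S" "0 < V"
  defines "y \<equiv> V / (2 * S + V)"
  shows "2 * (y + y^3 / 3 + y^5 / 5 + y^7 / 7) \<le> ln (1 + V / S)"
    and "V \<le> S \<Longrightarrow> ln (1 + V / S) \<le> 2 * (y + y^3 / 3 + y^5 / 5 + y^7 / 7 + y^9 / 8)"
proof -
  have x: "1 < 1 + V / S" using assms by simp
  have y: "(1 + V / S - 1) / (1 + V / S + 1) = y" unfolding y_def using assms by (simp add: field_simps)
  note b = ln_approx_bounds[OF x, of 4, unfolded y]
  have s: "(\<Sum>k<4. 2 * y ^ (2 * k + 1) / real (2 * k + 1)) = 2 * (y + y^3 / 3 + y^5 / 5 + y^7 / 7)"
    by (simp add: eval_nat_numeral lessThan_Suc)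
  show "2 * (y + y^3 / 3 + y^5 / 5 + y^7 / 7) \<le> ln (1 + V / S)" using b unfolding s by simp
  assume VS: "V \<le> S"
  have y0: "0 \<le> y" "y \<le> 1/3" unfolding y_def using assms VS by (simp_all add: divide_simps)
  have "y\<^sup>2 \<le> (1/3)\<^sup>2" using y0 by (intro power_mono)
  define d where "d = y ^ (2 * 4 + 1) / (1 - y\<^sup>2) / real (2 * 4 + 1)"
  have "d \<le> y ^ 9 / 8" unfolding d_def
    using \<open>y\<^sup>2 \<le> (1/3)\<^sup>2\<close> y0 by (simp add: divide_simps power2_eq_square) (simp add: mult_left_mono)
  then have "2 * (y + y^3 / 3 + y^5 / 5 + y^7 / 7) + 2 * d \<le> 2 * (y + y^3 / 3 + y^5 / 5 + y^7 / 7) + 2 * (y ^ 9 / 8)"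
    by simp
  also have "\<dots> = 2 * (y + y^3 / 3 + y^5 / 5 + y^7 / 7 + y^9 / 8)" by (simp only: distrib_left)
  finally show "ln (1 + V / S) \<le> 2 * (y + y^3 / 3 + y^5 / 5 + y^7 / 7 + y^9 / 8)"
    using b unfolding s d_def by simp
qed

lemma lower0_ok: assumes "lower0_ok S V" shows "milli V \<le> toll 0 (milli S)"
proof -
  define s v W where "s = real_of_int S" and "v = real_of_int V" and "W = 2 * s + v"
  have S: "0 < S" "0 < V" using assms by (auto simp: lower0_ok_def)
  have sv: "0 < s" "0 < v" "0 < W" using S by (auto simp: s_def v_def W_def)
  define w u where "w = W * W" and "u = v * v"
  have "real_of_int ((V * (2 * S + V) - 10000000000) * 105 * (2 * S + V) * (((2 * S + V) * (2 * S + V)) * ((2 * S + V) * (2 * S + V)) * ((2 * S + V) * (2 * S + V))))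
     \<le> real_of_int (4 * (S * S) * V * (105 * (((2 * S + V) * (2 * S + V)) * ((2 * S + V) * (2 * S + V)) * ((2 * S + V) * (2 * S + V))) + V * V * (35 * (((2 * S + V) * (2 * S + V)) * ((2 * S + V) * (2 * S + V))) + V * V * (21 * ((2 * S + V) * (2 * S + V)) + V * V * 15))))"
    using assms unfolding lower0_ok_def Let_def by (intro of_int_le_iff[THEN iffD2]) simp
  then have t: "(v * W - 10000000000) * 105 * W * (w * w * w) \<le> 4 * (s * s) * v * (105 * (w * w * w) + u * (35 * (w * w) + u * (21 * w + u * 15)))"
    unfolding of_int_mult of_int_add of_int_diff of_int_numeral of_int_power s_def[symmetric] v_def[symmetric] W_def[symmetric] w_def[symmetric] u_def[symmetric] .
  define y where "y = v / W"
  have "v * W - 10000000000 \<le> 4 * (s * s) * (y + y^3 / 3 + y^5 / 5 + y^7 / 7)"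
  proof -
    have "105 * W * (w * w * w) * (v * W - 10000000000) \<le> 105 * W * (w * w * w) * (4 * (s * s) * (y + y^3 / 3 + y^5 / 5 + y^7 / 7))"
    proof -
      have "105 * W * (w * w * w) * (y + y^3 / 3 + y^5 / 5 + y^7 / 7) = v * (105 * (w * w * w) + u * (35 * (w * w) + u * (21 * w + u * 15)))"
        unfolding y_def w_def u_def using sv(3) by (simp add: field_simps power_divide eval_nat_numeral)
      moreover have "105 * W * (w * w * w) * (4 * (s * s) * (y + y^3 / 3 + y^5 / 5 + y^7 / 7)) = 4 * (s * s) * (105 * W * (w * w * w) * (y + y^3 / 3 + y^5 / 5 + y^7 / 7))"
        by (simp only: mult_ac)
      ultimately have E: "105 * W * (w * w * w) * (4 * (s * s) * (y + y^3 / 3 + y^5 / 5 + y^7 / 7)) = 4 * (s * s) * (v * (105 * (w * w * w) + u * (35 * (w * w) + u * (21 * w + u * 15))))" by (simp only:)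
      show ?thesis unfolding E using t by (simp only: mult_ac)
    qed
    moreover have "0 < 105 * W * (w * w * w)" using sv by (simp add: w_def)
    ultimately show ?thesis by (rule mult_left_le_imp_le)
  qed
  moreover have "2 * (y + y^3 / 3 + y^5 / 5 + y^7 / 7) \<le> ln (1 + v / s)"
    unfolding y_def W_def by (rule ln_bounds(1)[OF sv(1,2)])
  then have "2 * (s * s) * (2 * (y + y^3 / 3 + y^5 / 5 + y^7 / 7)) \<le> 2 * (s * s) * ln (1 + v / s)"
    by (intro mult_left_mono) auto
  ultimately have "v * W - 2 * (s * s) * ln (1 + v / s) \<le> 10000000000" by linarith
  moreover have "toll_integral 0 (milli S) (milli V) = (v * W - 2 * (s * s) * ln (1 + v / s)) / 10000000000"
    using S by (subst toll_integral_0_eq) (auto simp: milli_pos milli_nonneg, simp add: milli_def s_def v_def W_def field_simps power2_eq_square)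
  ultimately have "toll_integral 0 (milli S) (milli V) \<le> 1" by simp
  then show ?thesis using S by (intro toll_ge) (auto simp: milli_nonneg)
qed

lemma upper0_ok: assumes "upper0_ok S V" shows "toll 0 (milli S) \<le> milli V"
proof -
  define s v W where "s = real_of_int S" and "v = real_of_int V" and "W = 2 * s + v"
  have S: "0 < S" "0 < V" "V \<le> S" using assms by (auto simp: upper0_ok_def)
  have sv: "0 < s" "0 < v" "0 < W" "v \<le> s" using S by (auto simp: s_def v_def W_def)
  define w u where "w = W * W" and "u = v * v"
  have "real_of_int (4 * (S * S) * V * (840 * (((2 * S + V) * (2 * S + V)) * ((2 * S + V) * (2 * S + V)) * ((2 * S + V) * (2 * S + V)) * ((2 * S + V) * (2 * S + V)))
      + V * V * (280 * (((2 * S + V) * (2 * S + V)) * ((2 * S + V) * (2 * S + V)) * ((2 * S + V) * (2 * S + V))) + V * V * (168 * (((2 * S + V) * (2 * S + V)) * ((2 * S + V) * (2 * S + V))) + V * V * (120 * ((2 * S + V) * (2 * S + V)) + V * V * 105)))))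
     \<le> real_of_int ((V * (2 * S + V) - 10000000000) * 840 * (2 * S + V) * (((2 * S + V) * (2 * S + V)) * ((2 * S + V) * (2 * S + V)) * ((2 * S + V) * (2 * S + V)) * ((2 * S + V) * (2 * S + V))))"
    using assms unfolding upper0_ok_def Let_def by (intro of_int_le_iff[THEN iffD2]) simp
  then have t: "4 * (s * s) * v * (840 * (w * w * w * w) + u * (280 * (w * w * w) + u * (168 * (w * w) + u * (120 * w + u * 105)))) \<le> (v * W - 10000000000) * 840 * W * (w * w * w * w)"
    unfolding of_int_mult of_int_add of_int_diff of_int_numeral of_int_power s_def[symmetric] v_def[symmetric] W_def[symmetric] w_def[symmetric] u_def[symmetric] .
  define y where "y = v / W"
  have "4 * (s * s) * (y + y^3 / 3 + y^5 / 5 + y^7 / 7 + y^9 / 8) \<le> v * W - 10000000000"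
  proof -
    have "840 * W * (w * w * w * w) * (4 * (s * s) * (y + y^3 / 3 + y^5 / 5 + y^7 / 7 + y^9 / 8)) \<le> 840 * W * (w * w * w * w) * (v * W - 10000000000)"
    proof -
      have "840 * W * (w * w * w * w) * (y + y^3 / 3 + y^5 / 5 + y^7 / 7 + y^9 / 8) = v * (840 * (w * w * w * w) + u * (280 * (w * w * w) + u * (168 * (w * w) + u * (120 * w + u * 105))))"
        unfolding y_def w_def u_def using sv(3) by (simp add: field_simps power_divide eval_nat_numeral)
      moreover have "840 * W * (w * w * w * w) * (4 * (s * s) * (y + y^3 / 3 + y^5 / 5 + y^7 / 7 + y^9 / 8)) = 4 * (s * s) * (840 * W * (w * w * w * w) * (y + y^3 / 3 + y^5 / 5 + y^7 / 7 + y^9 / 8))"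
        by (simp only: mult_ac)
      ultimately have E: "840 * W * (w * w * w * w) * (4 * (s * s) * (y + y^3 / 3 + y^5 / 5 + y^7 / 7 + y^9 / 8)) = 4 * (s * s) * (v * (840 * (w * w * w * w) + u * (280 * (w * w * w) + u * (168 * (w * w) + u * (120 * w + u * 105)))))" by (simp only:)
      show ?thesis unfolding E using t by (simp only: mult_ac)
    qed
    moreover have "0 < 840 * W * (w * w * w * w)" using sv by (simp add: w_def)
    ultimately show ?thesis by (rule mult_left_le_imp_le)
  qed
  moreover have "ln (1 + v / s) \<le> 2 * (y + y^3 / 3 + y^5 / 5 + y^7 / 7 + y^9 / 8)"
    unfolding y_def W_def by (rule ln_bounds(2)[OF sv(1,2,4)])
  then have "2 * (s * s) * ln (1 + v / s) \<le> 2 * (s * s) * (2 * (y + y^3 / 3 + y^5 / 5 + y^7 / 7 + y^9 / 8))"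
    by (intro mult_left_mono) auto
  ultimately have "10000000000 \<le> v * W - 2 * (s * s) * ln (1 + v / s)" by linarith
  moreover have "toll_integral 0 (milli S) (milli V) = (v * W - 2 * (s * s) * ln (1 + v / s)) / 10000000000"
    using S by (subst toll_integral_0_eq) (auto simp: milli_pos milli_nonneg, simp add: milli_def s_def v_def W_def field_simps power2_eq_square)
  ultimately have "1 \<le> toll_integral 0 (milli S) (milli V)" by simp
  then show ?thesis using S by (intro toll_le) (auto simp: milli_nonneg)
qed

text \<open>The pairs \<open>(L ! p, L ! (n - p))\<close> for \<open>1 \<le> p \<le> n div 2\<close>; these are, up to order, all ways to distribute
\<open>n\<close> nodes to two non-empty subtrees.\<close>

definition table_pairs :: "int list \<Rightarrow> nat \<Rightarrow> (int \<times> int) list" where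
  "table_pairs L n = zip (take (n div 2) (tl L)) (tl (rev (take (Suc n) L)))"

text \<open>The inductive step for lower bounds of roots: every tree with \<open>n + 1\<close> nodes has root at least \<open>L ! (n + 1)\<close> if
this is true for its subtrees. A test of the toll is only needed where the sum of the subtrees is too small.\<close>

definition lower_row :: "int list \<Rightarrow> nat \<Rightarrow> bool" where
  "lower_row L n \<longleftrightarrow> (let c = L ! Suc n in lower0_ok (L ! n) (c - L ! n) \<and>
     list_all (\<lambda>(S, T). c \<le> S + T \<or> lower_ok S T (c - S - T)) (table_pairs L n))"

text \<open>A row \<open>(n, v, vs)\<close> claims upper bounds for the tolls between the entries of \<open>L\<close> at \<open>p\<close> and \<open>n - p\<close>:
\<open>v\<close> for \<open>p = 0\<close> and the members of \<open>vs\<close> for \<open>p = 1, \<dots>, n div 2\<close>.\<close>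

definition upper_row :: "int list \<Rightarrow> nat \<times> int \<times> int list \<Rightarrow> bool" where
  "upper_row L = (\<lambda>(n, v, vs). upper0_ok (L ! n) v \<and> length vs = n div 2 \<and>
     list_all (\<lambda>((S, T), V). upper_ok S T V) (zip (table_pairs L n) vs))"

section \<open>From rows of tests to trees\<close>
lemma toll_0_0: "toll 0 0 = 1"
proof (rule antisym)
  show "toll 0 0 \<le> 1" by (rule toll_le_1) auto
  have e: "toll_density 0 0 x = 2 * x" if "0 \<le> x" for x
  proof -
    have "sqrt (x * x * x * x) = x * x" using that real_sqrt_abs[of "x * x"] by (simp add: power2_eq_square mult.assoc)
    then show ?thesis by (simp add: toll_density_def)
  qed
  have "((\<lambda>x. 2 * x) has_integral (1\<^sup>2 - 0\<^sup>2)) {0..1::real}"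
    by (intro fundamental_theorem_of_calculus)
      (auto intro!: derivative_eq_intros simp: has_real_derivative_iff_has_vector_derivative[symmetric])
  then have "toll_integral 0 0 1 \<le> 1\<^sup>2 - 0\<^sup>2"
    by (rule toll_integral_le[rotated 3]) (auto simp: e)
  then show "1 \<le> toll 0 0" by (intro toll_ge) auto
qed

lemma length_table_pairs: "n < length L \<Longrightarrow> length (table_pairs L n) = n div 2"
  by (simp add: table_pairs_def)

lemma table_pairs_nth:
  assumes "n < length L" "1 \<le> p" "p \<le> n div 2"
  shows "table_pairs L n ! (p - 1) = (L ! p, L ! (n - p))"
proof -
  have "p - 1 < n div 2" "p - 1 < length (tl L)" "p - 1 < length (tl (rev (take (Suc n) L)))" using assms by auto
  then have "table_pairs L n ! (p - 1) = (tl L ! (p - 1), tl (rev (take (Suc n) L)) ! (p - 1))"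
    by (simp add: table_pairs_def)
  moreover have "tl L ! (p - 1) = L ! p" using assms by (subst nth_tl) auto
  moreover have "tl (rev (take (Suc n) L)) ! (p - 1) = L ! (n - p)"
    using assms by (subst nth_tl) (auto simp: rev_nth)
  ultimately show ?thesis by simp
qed

lemma list_all_table_pairs:
  assumes "list_all (\<lambda>(S, T). P S T) (table_pairs L n)" "n < length L" "1 \<le> p" "p \<le> n div 2"
  shows "P (L ! p) (L ! (n - p))"
proof -
  have "p - 1 < length (table_pairs L n)" using assms by (simp add: length_table_pairs)
  then show ?thesis using assms(1) table_pairs_nth[OF assms(2-4)] unfolding list_all_length by (metis case_prod_conv)
qed

text \<open>Since tolls are symmetric, it suffices to consider a smaller left subtree.\<close>

lemma node_cases:
  assumes sym: "\<And>p q s t. P p q s t \<Longrightarrow> P q p t s"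
    and le: "\<And>p q s t. p \<le> q \<Longrightarrow> root_of_size p s \<Longrightarrow> root_of_size q t \<Longrightarrow> P p q s t"
    and "root_of_size p s" "root_of_size q t"
  shows "P p q s t"
  using assms by (cases "p \<le> q") auto

lemma root_of_size_0: "root_of_size 0 s \<Longrightarrow> s = 0"
  by (cases rule: root_of_size.cases) auto

text \<open>Induction over the tree: \<open>join_root\<close> is monotone, so the subtrees may be replaced by their table entries.\<close>

lemma lower_table_sound:
  assumes L: "L ! 0 = 0" "L ! 1 = 100000" and rows: "\<And>n. 1 \<le> n \<Longrightarrow> Suc n < length L \<Longrightarrow> lower_row L n"
    and r: "root_of_size k s" and k: "k < length L"
  shows "milli (L ! k) \<le> s"
  using r k
proof (induction rule: root_of_size.induct)
  case leaf
  then show ?case using L by (simp add: milli_def)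
next
  case (node p s q t)
  have "Suc (p + q) < length L \<longrightarrow> milli (L ! p) \<le> s \<longrightarrow> milli (L ! q) \<le> t \<longrightarrow> milli (L ! Suc (p + q)) \<le> join_root s t"
  proof (rule node_cases[of "\<lambda>p q s t. Suc (p + q) < length L \<longrightarrow> milli (L ! p) \<le> s \<longrightarrow> milli (L ! q) \<le> t \<longrightarrow> milli (L ! Suc (p + q)) \<le> join_root s t"])
    fix p q s t assume pq: "p \<le> q" and st: "root_of_size p s" "root_of_size q t"
    show "Suc (p + q) < length L \<longrightarrow> milli (L ! p) \<le> s \<longrightarrow> milli (L ! q) \<le> t \<longrightarrow> milli (L ! Suc (p + q)) \<le> join_root s t"
    proof (intro impI)
      assume len: "Suc (p + q) < length L" and ls: "milli (L ! p) \<le> s" and lt: "milli (L ! q) \<le> t"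
      have st0: "0 \<le> s" "0 \<le> t" using st by (auto intro: root_of_size_nonneg)
      show "milli (L ! Suc (p + q)) \<le> join_root s t"
      proof (cases "p + q = 0")
        case True
        then have "s = 0" "t = 0" using st root_of_size_0 by auto
        then show ?thesis using L True by (simp add: join_root_def toll_0_0 milli_def)
      next
        case False
        then have "1 \<le> p + q" by linarith
        then have row: "lower_row L (p + q)" using len by (rule rows)
        show ?thesis
        proof (cases "p = 0")
          case True
          then have "lower0_ok (L ! q) (L ! Suc q - L ! q)" using row by (simp add: lower_row_def Let_def)
          then have q0: "0 < L ! q" and "milli (L ! Suc q - L ! q) \<le> toll 0 (milli (L ! q))"
            using lower0_ok by (auto simp: lower0_ok_def)
          then have "milli (L ! Suc q) \<le> join_root 0 (milli (L ! q))" by (simp add: join_root_def milli_diff)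
          also have "\<dots> \<le> join_root s t" using q0 st0 lt by (intro join_root_mono) (auto simp: milli_nonneg)
          finally show ?thesis using True by simp
        next
          case False
          let ?S = "L ! p" and ?T = "L ! q" and ?c = "L ! Suc (p + q)"
          have "?c \<le> ?S + L ! (p + q - p) \<or> lower_ok ?S (L ! (p + q - p)) (?c - ?S - L ! (p + q - p))"
            using row False pq len unfolding lower_row_def Let_def
            by (intro list_all_table_pairs[where P = "\<lambda>S T. L ! Suc (p + q) \<le> S + T \<or> lower_ok S T (L ! Suc (p + q) - S - T)" and L = L and n = "p + q" and p = p]) auto
          then consider "?c \<le> ?S + ?T" | "lower_ok ?S ?T (?c - ?S - ?T)" by auto
          then show ?thesis
          proof cases
            case 1
            then have "milli ?c \<le> milli ?S + milli ?T" using milli_mono milli_add by metis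
            also have "\<dots> \<le> s + t" using ls lt by simp
            also have "\<dots> \<le> join_root s t" using st0 by (simp add: join_root_def toll_nonneg)
            finally show ?thesis .
          next
            case 2
            then have pos: "0 < ?S" "0 < ?T" by (auto simp: lower_ok_def)
            have "milli (?c - ?S - ?T) \<le> toll (milli ?S) (milli ?T)" by (rule lower_ok[OF 2])
            then have "milli ?c \<le> join_root (milli ?S) (milli ?T)" by (simp add: join_root_def milli_diff)
            also have "\<dots> \<le> join_root s t" using pos ls lt by (intro join_root_mono) (auto simp: milli_nonneg)
            finally show ?thesis .
          qed
        qed
      qed
    qed
  qed (use node in \<open>auto simp: join_root_commute add.commute\<close>)
  then show ?case using node by auto
qed

text \<open>The counterpart of \<open>lower_row\<close> for upper bounds of roots. The crude test \<open>cube_ok\<close> suffices, except at leaves.\<close>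

definition high_row :: "int list \<Rightarrow> nat \<Rightarrow> bool" where
  "high_row L n \<longleftrightarrow> (let c = L ! Suc n in upper0_ok (L ! n) (c - L ! n) \<and>
     list_all (\<lambda>(S, T). cube_ok S T (c - S - T)) (table_pairs L n))"

lemma high_table_sound:
  assumes L: "L ! 0 = 0" "L ! 1 = 100000" and rows: "\<And>n. 1 \<le> n \<Longrightarrow> Suc n < length L \<Longrightarrow> high_row L n"
    and r: "root_of_size k s" and k: "k < length L"
  shows "s \<le> milli (L ! k)"
  using r k
proof (induction rule: root_of_size.induct)
  case leaf
  then show ?case using L by (simp add: milli_def)
next
  case (node p s q t)
  have "Suc (p + q) < length L \<longrightarrow> s \<le> milli (L ! p) \<longrightarrow> t \<le> milli (L ! q) \<longrightarrow> join_root s t \<le> milli (L ! Suc (p + q))"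
  proof (rule node_cases[of "\<lambda>p q s t. Suc (p + q) < length L \<longrightarrow> s \<le> milli (L ! p) \<longrightarrow> t \<le> milli (L ! q) \<longrightarrow> join_root s t \<le> milli (L ! Suc (p + q))"])
    fix p q s t assume pq: "p \<le> q" and st: "root_of_size p s" "root_of_size q t"
    show "Suc (p + q) < length L \<longrightarrow> s \<le> milli (L ! p) \<longrightarrow> t \<le> milli (L ! q) \<longrightarrow> join_root s t \<le> milli (L ! Suc (p + q))"
    proof (intro impI)
      assume len: "Suc (p + q) < length L" and ls: "s \<le> milli (L ! p)" and lt: "t \<le> milli (L ! q)"
      have st0: "0 \<le> s" "0 \<le> t" using st by (auto intro: root_of_size_nonneg)
      show "join_root s t \<le> milli (L ! Suc (p + q))"
      proof (cases "p + q = 0")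
        case True
        then have "s = 0" "t = 0" using st root_of_size_0 by auto
        then show ?thesis using L True by (simp add: join_root_def toll_0_0 milli_def)
      next
        case False
        then have "1 \<le> p + q" by linarith
        then have row: "high_row L (p + q)" using len by (rule rows)
        show ?thesis
        proof (cases "p = 0")
          case True
          then have s: "s = 0" using st root_of_size_0 by simp
          have "upper0_ok (L ! q) (L ! Suc q - L ! q)" using row True by (simp add: high_row_def Let_def)
          then have "toll 0 (milli (L ! q)) \<le> milli (L ! Suc q - L ! q)" by (rule upper0_ok)
          then have "join_root 0 (milli (L ! q)) \<le> milli (L ! Suc q)" by (simp add: join_root_def milli_diff)
          moreover have "join_root s t \<le> join_root 0 (milli (L ! q))" using s st0 lt by (intro join_root_mono) auto
          ultimately show ?thesis using True by simp
        next
          case False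
          let ?S = "L ! p" and ?T = "L ! q" and ?c = "L ! Suc (p + q)"
          have "cube_ok ?S (L ! (p + q - p)) (?c - ?S - L ! (p + q - p))"
            using row False pq len unfolding high_row_def Let_def
            by (intro list_all_table_pairs[where P = "\<lambda>S T. cube_ok S T (L ! Suc (p + q) - S - T)" and L = L and n = "p + q" and p = p]) auto
          then have "cube_ok ?S ?T (?c - ?S - ?T)" by simp
          then have "toll (milli ?S) (milli ?T) \<le> milli (?c - ?S - ?T)" by (rule cube_ok)
          then have "join_root (milli ?S) (milli ?T) \<le> milli ?c" by (simp add: join_root_def milli_diff)
          moreover have "join_root s t \<le> join_root (milli ?S) (milli ?T)" using st0 ls lt by (intro join_root_mono) auto
          ultimately show ?thesis by simp
        qed
      qed
    qed
  qed (use node in \<open>auto simp: join_root_commute add.commute\<close>)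
  then show ?case using node by auto
qed

text \<open>Tolls decrease, so lower bounds for the roots of the subtrees give upper bounds for tolls.\<close>

lemma mean_toll_le:
  assumes "\<And>k s. k \<le> n \<Longrightarrow> root_of_size k s \<Longrightarrow> lo k \<le> s" "\<And>k. k \<le> n \<Longrightarrow> 0 \<le> lo k"
  shows "real (Suc n) * mean_toll n \<le> (\<Sum>p\<le>n. toll (lo p) (lo (n - p)))"
proof -
  have "pair_mean p (n - p) toll \<le> toll (lo p) (lo (n - p))" if "p \<le> n" for p
    using pair_mean_mono[of p "n - p" toll "\<lambda>_ _. toll (lo p) (lo (n - p))"] assms that
    by (simp add: pair_mean_const toll_antimono)
  then show ?thesis unfolding mean_toll_def by (auto intro!: sum_mono)
qed

lemma mean_toll_ge:
  assumes "\<And>k s. k \<le> n \<Longrightarrow> root_of_size k s \<Longrightarrow> s \<le> hi k"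
  shows "(\<Sum>p\<le>n. toll (hi p) (hi (n - p))) \<le> real (Suc n) * mean_toll n"
proof -
  have "toll (hi p) (hi (n - p)) \<le> pair_mean p (n - p) toll" if "p \<le> n" for p
    using pair_mean_mono[of p "n - p" "\<lambda>_ _. toll (hi p) (hi (n - p))" toll] assms that
    by (simp add: pair_mean_const toll_antimono root_of_size_nonneg)
  then show ?thesis unfolding mean_toll_def by (auto intro!: sum_mono)
qed

text \<open>For odd \<open>n\<close> all terms pair up; for even \<open>n\<close> the term at \<open>n div 2\<close> remains, which is the second sum.\<close>

lemma sum_symmetric:
  fixes f :: "nat \<Rightarrow> real"
  assumes sym: "\<And>p. p \<le> n \<Longrightarrow> f (n - p) = f p"
  shows "(\<Sum>p\<le>n. f p) = 2 * (\<Sum>p<(n+1) div 2. f p) + (\<Sum>p\<in>{(n+1) div 2..n div 2}. f p)"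
proof -
  define h where "h = (n + 1) div 2"
  have "{..n} = {..<h} \<union> ({h..n div 2} \<union> {n div 2<..n})" by (auto simp: h_def)
  then have "(\<Sum>p\<le>n. f p) = (\<Sum>p<h. f p) + ((\<Sum>p\<in>{h..n div 2}. f p) + (\<Sum>p\<in>{n div 2<..n}. f p))"
    by (simp, subst sum.union_disjoint, simp, simp, force simp: h_def, subst sum.union_disjoint) auto
  moreover have "(\<Sum>p\<in>{n div 2<..n}. f p) = (\<Sum>p<h. f p)"
    by (rule sum.reindex_bij_witness[of _ "\<lambda>p. n - p" "\<lambda>p. n - p"]) (auto simp: h_def sym)
  ultimately show ?thesis by (simp add: h_def)
qed

text \<open>Completes a row by symmetry to the sum over all \<open>p \<le> n\<close>.\<close>

definition fold_row :: "nat \<times> int \<times> int list \<Rightarrow> int" where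
  "fold_row = (\<lambda>(n, v, vs). 2 * sum_list (take ((n + 1) div 2) (v # vs)) + sum_list (drop ((n + 1) div 2) (v # vs)))"

lemma fold_row_eq:
  assumes len: "length vs = n div 2"
  shows "milli (fold_row (n, v, vs)) = 2 * (\<Sum>p<(n+1) div 2. milli ((v # vs) ! p)) + (\<Sum>p\<in>{(n+1) div 2..n div 2}. milli ((v # vs) ! p))"
proof -
  define V where "V = v # vs"
  have lV: "length V = Suc (n div 2)" by (simp add: V_def len)
  have hm: "(n + 1) div 2 \<le> Suc (n div 2)" by simp
  have m: "milli (sum_list xs) = (\<Sum>p<length xs. milli (xs ! p))" for xs
    by (induction xs) (auto simp: milli_def add_divide_distrib sum.lessThan_Suc_shift simp del: sum.lessThan_Suc)
  have "milli (sum_list (take ((n + 1) div 2) V)) = (\<Sum>p<(n+1) div 2. milli (V ! p))"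
    unfolding m using lV hm by (intro sum.cong) auto
  moreover have "milli (sum_list (drop ((n + 1) div 2) V)) = (\<Sum>p\<in>{(n+1) div 2..n div 2}. milli (V ! p))"
    unfolding m using lV hm
    by (intro sum.reindex_bij_witness[of _ "\<lambda>p. p - (n+1) div 2" "\<lambda>p. p + (n+1) div 2"]) (auto simp: add.commute)
  ultimately show ?thesis by (simp add: fold_row_def V_def[symmetric] milli_def add_divide_distrib)
qed

lemma fold_row_upper:
  assumes "length vs = n div 2" "\<And>p. p \<le> n div 2 \<Longrightarrow> f p \<le> milli ((v # vs) ! p)" "\<And>p. p \<le> n \<Longrightarrow> f (n - p) = f p"
  shows "(\<Sum>p\<le>n. f p) \<le> milli (fold_row (n, v, vs))"
proof -
  have e: "(\<Sum>p\<le>n. f p) = 2 * (\<Sum>p<(n+1) div 2. f p) + (\<Sum>p\<in>{(n+1) div 2..n div 2}. f p)"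
    by (rule sum_symmetric) (rule assms(3))
  show ?thesis unfolding fold_row_eq[OF assms(1)] e
    using assms(2) by (intro add_mono mult_left_mono sum_mono) auto
qed

lemma fold_row_lower:
  assumes "length vs = n div 2" "\<And>p. p \<le> n div 2 \<Longrightarrow> milli ((v # vs) ! p) \<le> f p" "\<And>p. p \<le> n \<Longrightarrow> f (n - p) = f p"
  shows "milli (fold_row (n, v, vs)) \<le> (\<Sum>p\<le>n. f p)"
proof -
  have e: "(\<Sum>p\<le>n. f p) = 2 * (\<Sum>p<(n+1) div 2. f p) + (\<Sum>p\<in>{(n+1) div 2..n div 2}. f p)"
    by (rule sum_symmetric) (rule assms(3))
  show ?thesis unfolding fold_row_eq[OF assms(1)] e
    using assms(2) by (intro add_mono mult_left_mono sum_mono) auto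
qed

lemma upper_row_sound:
  assumes row: "upper_row L (n, v, vs)" and n: "n < length L" and L0: "L ! 0 = 0"
  shows "(\<Sum>p\<le>n. toll (milli (L ! p)) (milli (L ! (n - p)))) \<le> milli (fold_row (n, v, vs))"
proof (rule fold_row_upper)
  show len: "length vs = n div 2" using row by (simp add: upper_row_def)
  fix p assume p: "p \<le> n div 2"
  show "toll (milli (L ! p)) (milli (L ! (n - p))) \<le> milli ((v # vs) ! p)"
  proof (cases p)
    case 0
    have "upper0_ok (L ! n) v" using row by (simp add: upper_row_def)
    then show ?thesis using 0 L0 upper0_ok[of "L ! n" v] by (simp add: milli_def)
  next
    case (Suc i)
    have "i < length (zip (table_pairs L n) vs)" using p Suc n len by (simp add: length_table_pairs)
    then have "(\<lambda>((S, T), V). upper_ok S T V) (zip (table_pairs L n) vs ! i)"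
      using row by (simp add: upper_row_def list_all_length)
    then have "upper_ok (L ! p) (L ! (n - p)) (vs ! i)"
      using table_pairs_nth[of n L p] p Suc n len by (simp add: length_table_pairs)
    then show ?thesis using upper_ok Suc by simp
  qed
qed (auto simp: toll_commute)

text \<open>The counterpart of \<open>upper_row\<close> for lower bounds of tolls.\<close>

definition low_mean_row :: "int list \<Rightarrow> nat \<times> int \<times> int list \<Rightarrow> bool" where
  "low_mean_row L = (\<lambda>(n, v, vs). lower0_ok (L ! n) v \<and> length vs = n div 2 \<and>
     list_all (\<lambda>((S, T), V). lower_ok S T V) (zip (table_pairs L n) vs))"

lemma low_mean_row_sound:
  assumes row: "low_mean_row L (n, v, vs)" and n: "n < length L" and L0: "L ! 0 = 0"
  shows "milli (fold_row (n, v, vs)) \<le> (\<Sum>p\<le>n. toll (milli (L ! p)) (milli (L ! (n - p))))"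
proof (rule fold_row_lower)
  show len: "length vs = n div 2" using row by (simp add: low_mean_row_def)
  fix p assume p: "p \<le> n div 2"
  show "milli ((v # vs) ! p) \<le> toll (milli (L ! p)) (milli (L ! (n - p)))"
  proof (cases p)
    case 0
    have "lower0_ok (L ! n) v" using row by (simp add: low_mean_row_def)
    then show ?thesis using 0 L0 lower0_ok[of "L ! n" v] by (simp add: milli_def)
  next
    case (Suc i)
    have "i < length (zip (table_pairs L n) vs)" using p Suc n len by (simp add: length_table_pairs)
    then have "(\<lambda>((S, T), V). lower_ok S T V) (zip (table_pairs L n) vs ! i)"
      using row by (simp add: low_mean_row_def list_all_length)
    then have "lower_ok (L ! p) (L ! (n - p)) (vs ! i)"
      using table_pairs_nth[of n L p] p Suc n len by (simp add: length_table_pairs)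
    then show ?thesis using lower_ok Suc by simp
  qed
qed (auto simp: toll_commute)

section \<open>Numerical tables\<close>
text \<open>Upper bounds for the roots of trees with 0, 1, 2, ... nodes.\<close>

definition high_table :: "int list" where
  "high_table = [0,100000,177376,252215,325940,399032,471713,544105,616283,688296,760177,831951,903636,
      975246,1046791,1118281,1189722,1261120,1332480,1403930,1475373]"
text \<open>Lower bounds for the roots of trees with 0, 1, 2, ... nodes. They are nearly sharp: the extremal trees are computed by dynamic
programming.\<close>

definition low_table :: "int list" where
  "low_table = [0,100000,177374,250745,324245,395826,468253,539136,611056,681566,753191,823468,894899,
      965017,1036311,1106313,1177505,1247419,1318532,1388377,1459426,1529216,1600213,1669957,1740911,
      1810617,1881535,1951208,2022095,2091740,2162600,2232220,2303057,2372655,2443472,2513051,2583849,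
      2653411,2724193,2793739,2864507,2934039,3004794,3074313,3145056,3214564,3285296,3354793,3425515,
      3495002,3565715,3635193,3705898,3775368,3846065,3915527,3986217,4055672,4126355,4195803,4266480,
      4335922,4406593,4476029,4546694,4616125,4686785,4756211,4826866,4896287,4966937]"
text \<open>For each \<open>n\<close>, upper bounds for the tolls between entries of \<open>low_table\<close>; split into five parts that can be
checked independently.\<close>

definition toll_rows_1 :: "(nat \<times> int \<times> int list) list" where
  "toll_rows_1 = [
    (1,77376,[]),
    (2,74839,[50753]),
    (3,73741,[46908]),
    (4,73103,[45134,42459]),
    (5,72696,[44066,40336]),
    (6,72404,[43368,39030,37993]),
    (7,72191,[42860,38164,36529]),
    (8,72024,[42485,37526,35547,34948]),
    (9,71893,[42187,37051,34818,33878]),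
    (10,71784,[41952,36671,34271,33077,32740]),
    (11,71695,[41756,36370,33831,32473,31884]),
    (12,71618,[41595,36117,33480,31985,31235,30982]),
    (13,71554,[41456,35909,33185,31595,30708,30295]),
    (14,71497,[41339,35729,32941,31265,30285,29735,29576]),
    (15,71449,[41235,35576,32729,30991,29927,29285,28990]),
    (16,71405,[41146,35440,32548,30752,29629,28902,28516,28379]),
    (17,71367,[41065,35323,32388,30549,29368,28583,28112,27885]),
    (18,71332,[40995,35218,32250,30368,29146,28303,27775,27463,27373]),
    (19,71301,[40931,35126,32125,30211,28948,28064,27479,27110,26935]),
    (20,71273,[40874,35041,32015,30070,28776,27851,27226,26799,26568,26483]),
    (21,71248,[40822,34966,31914,29945,28620,27666,27000,26533,26245,26103]),
    (22,71224,[40775,34897,31825,29831,28483,27497,26803,26295,25968,25769,25712]),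
    (23,71203,[40731,34835,31743,29729,28357,27349,26623,26087,25719,25481,25367]),
    (24,71183,[40692,34777,31669,29635,28245,27212,26465,25898,25502,25223,25071,25013]),
    (25,71165,[40655,34725,31600,29551,28141,27091,26320,25731,25304,24997,24804,24708]),
    (26,71149,[40622,34677,31537,29472,28048,26978,26190,25577,25129,24791,24571,24433,24395]),
    (27,71133,[40590,34632,31479,29400,27960,26877,26070,25440,24968,24609,24358,24193,24113]),
    (28,71119,[40561,34590,31425,29333,27881,26782,25961,25313,24824,24441,24169,23973,23867,23825]),
    (29,71105,[40534,34552,31375,29272,27807,26696,25860,25198,24690,24291,23995,23779,23641,23572])]"
definition toll_rows_2 :: "(nat \<times> int \<times> int list) list" where
  "toll_rows_2 = [
    (30,71092,[40509,34515,31329,29215,27740,26615,25768,25090,24570,24151,23839,23599,23441,23341,23314]),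
    (31,71081,[40485,34482,31285,29162,27676,26542,25681,24992,24457,24025,23694,23438,23256,23136,23077]),
    (32,71069,[40463,34450,31245,29112,27617,26472,25602,24900,24354,23907,23563,23288,23090,22946,22867,
      22836]),
    (33,71059,[40442,34421,31207,29066,27561,26408,25527,24816,24257,23800,23440,23152,22935,22775,22673,
      22622]),
    (34,71049,[40423,34393,31172,29022,27510,26347,25458,24737,24169,23698,23328,23025,22796,22616,22498,
      22423,22403]),
    (35,71040,[40404,34367,31138,28981,27461,26291,25393,24664,24085,23606,23223,22909,22664,22473,22336,
      22245,22200]),
    (36,71031,[40386,34342,31106,28942,27416,26238,25333,24594,24008,23518,23127,22800,22545,22338,22188,
      22078,22018,21994]),
    (37,71022,[40370,34318,31076,28906,27372,26188,25275,24530,23934,23437,23035,22700,22432,22215,22050,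
      21927,21848,21809]),
    (38,71014,[40354,34296,31048,28871,27332,26141,25222,24469,23867,23360,22951,22605,22329,22098,21924,
      21785,21694,21635,21620]),
    (39,71007,[40339,34275,31021,28839,27293,26097,25171,24412,23802,23289,22871,22517,22231,21992,21804,
      21656,21549,21478,21444]),
    (40,71000,[40325,34255,30996,28808,27257,26054,25124,24358,23742,23221,22797,22434,22140,21891,21695,
      21534,21417,21331,21284,21264]),
    (41,70993,[40311,34236,30971,28779,27223,26015,25078,24307,23684,23158,22726,22357,22054,21798,21591,
      21422,21292,21196,21133,21102])]"
definition toll_rows_3 :: "(nat \<times> int \<times> int list) list" where
  "toll_rows_3 = [
    (42,70986,[40299,34218,30949,28751,27190,25977,25036,24258,23631,23098,22660,22283,21975,21709,21495,
      21315,21178,21068,20996,20949,20937]),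
    (43,70980,[40286,34201,30927,28724,27159,25941,24994,24213,23580,23042,22597,22215,21898,21627,21404,
      21217,21069,20951,20866,20809,20781]),
    (44,70974,[40275,34184,30906,28699,27130,25907,24956,24169,23532,22987,22538,22150,21828,21548,21320,
      21123,20968,20840,20747,20677,20639,20623]),
    (45,70969,[40263,34169,30886,28675,27101,25875,24919,24128,23485,22937,22482,22089,21760,21475,21239,
      21037,20872,20737,20633,20555,20505,20479]),
    (46,70963,[40253,34154,30867,28652,27074,25844,24884,24089,23442,22888,22429,22030,21696,21405,21163,
      20953,20783,20639,20528,20439,20381,20342,20333]),
    (47,70958,[40242,34139,30849,28630,27048,25814,24851,24051,23400,22843,22378,21975,21635,21340,21091,
      20876,20698,20548,20428,20333,20263,20217,20194]),
    (48,70953,[40233,34125,30831,28609,27024,25786,24819,24015,23361,22798,22330,21922,21579,21277,21024,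
      20802,20619,20461,20335,20230,20155,20097,20067,20053]),
    (49,70948,[40223,34112,30815,28589,27000,25759,24788,23982,23322,22757,22284,21872,21523,21218,20959,
      20733,20543,20380,20246,20136,20051,19987,19945,19924]),
    (50,70943,[40214,34099,30799,28570,26978,25733,24759,23949,23287,22717,22241,21824,21472,21161,20898,
      20666,20472,20302,20164,20045,19955,19881,19833,19801,19793]),
    (51,70939,[40205,34087,30783,28551,26956,25709,24731,23918,23252,22679,22199,21779,21422,21108,20840,
      20604,20404,20229,20084,19961,19862,19783,19726,19687,19668])]"
definition toll_rows_4 :: "(nat \<times> int \<times> int list) list" where
  "toll_rows_4 = [
    (52,70935,[40197,34075,30768,28533,26936,25685,24705,23888,23219,22642,22159,21735,21375,21056,20785,
      20543,20340,20159,20010,19880,19776,19689,19626,19578,19553,19542]),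
    (53,70931,[40189,34064,30754,28516,26916,25662,24679,23859,23187,22608,22121,21694,21330,21007,20731,
      20487,20278,20094,19938,19804,19693,19602,19531,19477,19443,19425]),
    (54,70927,[40181,34053,30741,28500,26897,25640,24654,23832,23157,22574,22085,21654,21287,20960,20682,
      20432,20220,20030,19871,19731,19616,19518,19442,19380,19340,19313,19307]),
    (55,70923,[40174,34043,30727,28484,26878,25619,24631,23805,23128,22542,22050,21616,21245,20916,20633,
      20381,20164,19971,19806,19662,19542,19439,19356,19290,19242,19210,19194]),
    (56,70919,[40166,34033,30715,28469,26860,25599,24608,23780,23100,22511,22016,21579,21206,20873,20587,
      20331,20111,19913,19746,19596,19472,19363,19277,19203,19151,19110,19089,19079]),
    (57,70915,[40159,34023,30702,28454,26843,25579,24586,23756,23073,22482,21984,21544,21168,20832,20543,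
      20283,20059,19859,19687,19534,19405,19292,19199,19122,19062,19017,18988,18973]),
    (58,70912,[40153,34014,30691,28440,26827,25560,24565,23732,23047,22453,21953,21510,21132,20793,20501,
      20238,20011,19806,19631,19474,19341,19223,19127,19044,18980,18928,18894,18871,18865]),
    (59,70909,[40146,34005,30679,28426,26811,25542,24544,23709,23022,22426,21923,21478,21097,20755,20460,
      20194,19964,19757,19577,19417,19280,19159,19057,18970,18900,18844,18803,18776,18762]),
    (60,70905,[40140,33996,30668,28413,26796,25525,24525,23687,22998,22400,21895,21447,21063,20719,20421,
      20152,19920,19709,19527,19362,19222,19096,18992,18899,18826,18763,18719,18684,18666,18657])]"
definition toll_rows_5 :: "(nat \<times> int \<times> int list) list" where
  "toll_rows_5 = [
    (61,70902,[40134,33987,30657,28400,26781,25508,24506,23667,22975,22375,21867,21417,21031,20684,20384,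
      20113,19876,19663,19477,19310,19166,19037,18928,18832,18754,18688,18637,18598,18573,18560]),
    (62,70899,[40128,33979,30647,28388,26767,25492,24488,23646,22952,22350,21840,21388,21000,20651,20348,
      20074,19835,19619,19431,19260,19113,18980,18868,18768,18686,18614,18560,18515,18486,18466,18462]),
    (63,70896,[40122,33971,30637,28376,26753,25476,24470,23627,22931,22327,21815,21361,20970,20619,20313,
      20037,19795,19577,19385,19212,19061,18926,18810,18707,18620,18546,18486,18437,18402,18378,18367]),
    (64,70894,[40117,33963,30628,28364,26739,25461,24453,23608,22910,22304,21790,21334,20941,20587,20280,
      20001,19758,19536,19342,19166,19013,18873,18755,18647,18558,18479,18416,18362,18324,18294,18278,
      18271]),
    (65,70891,[40111,33956,30618,28353,26726,25446,24436,23589,22890,22282,21766,21308,20913,20557,20248,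
      19967,19721,19497,19300,19122,18965,18824,18701,18591,18498,18416,18348,18291,18247,18214,18192,
      18181]),
    (66,70888,[40106,33949,30609,28342,26714,25431,24420,23571,22870,22260,21743,21283,20886,20528,20217,
      19933,19686,19459,19260,19079,18920,18775,18651,18537,18441,18355,18284,18223,18176,18137,18112,18094,
      18091]),
    (67,70886,[40101,33942,30600,28332,26701,25418,24405,23554,22851,22240,21720,21259,20860,20501,20187,
      19902,19651,19423,19221,19038,18876,18730,18601,18486,18386,18297,18222,18158,18106,18064,18034,18013,
      18003]),
    (68,70883,[40096,33935,30592,28321,26690,25404,24390,23538,22833,22220,21699,21235,20835,20473,20158,
      19871,19619,19387,19185,18998,18835,18685,18555,18435,18333,18241,18164,18095,18041,17994,17960,17934,
      17921,17915]),
    (69,70881,[40091,33928,30583,28312,26678,25391,24375,23522,22815,22201,21678,21213,20810,20447,20130,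
      19841,19587,19354,19148,18960,18794,18642,18509,18388,18282,18188,18107,18036,17977,17928,17889,17860,
      17841,17832])]"
text \<open>For each \<open>n\<close>, lower bounds for the tolls between entries of \<open>high_table\<close>.\<close>

definition high_toll_rows :: "(nat \<times> int \<times> int list) list" where
  "high_toll_rows = [
    (1,77374,[]),
    (2,74838,[50745]),
    (3,73724,[46871]),
    (4,73091,[45054,42457]),
    (5,72680,[43988,40299]),
    (6,72391,[43284,38997,37920]),
    (7,72177,[42783,38121,36461]),
    (8,72012,[42407,37488,35466,34887]),
    (9,71880,[42116,37010,34742,33804]),
    (10,71773,[41882,36635,34189,33010,32652]),
    (11,71684,[41691,36332,33753,32400,31802]),
    (12,71609,[41531,36083,33400,31916,31146,30906]),
    (13,71544,[41396,35874,33108,31523,30624,30212]),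
    (14,71489,[41280,35697,32862,31196,30197,29657,29486]),
    (15,71440,[41180,35544,32652,30920,29842,29203,28904]),
    (16,71397,[41092,35411,32471,30684,29541,28824,28426,28298]),
    (17,71359,[41014,35294,32313,30480,29284,28502,28026,27800]),
    (18,71325,[40945,35190,32174,30302,29060,28225,27686,27382,27283]),
    (19,71294,[40883,35098,32051,30144,28864,27985,27393,27026,26849])]"
text \<open>A triple \<open>(a, b, V)\<close> bounds all mean tolls with index in \<open>{a..<b}\<close> from below by \<open>V\<close>.\<close>

definition toll_blocks :: "(nat \<times> nat \<times> int) list" where
  "toll_blocks = [(20, 24, 25068),(24, 29, 23597),(29, 36, 22009),(36, 45, 20473),(45, 57, 18954),(57, 75,
       17323),(75, 100, 15758),(100, 140, 14100),(140, 210, 12328),(210, 350, 10405),(350, 700, 8262)]"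
text \<open>Lower bounds for the roots of the paths with 1 to 13 nodes.\<close>

definition chain_table :: "int list" where
  "chain_table = [100000,177374,252212,325936,399027,471707,544098,616275,688287,760167,831940,903624,975233]"
text \<open>Lower bounds for the roots after repeatedly joining two copies of the same tree, starting from the path with 13 nodes.\<close>

definition double_table :: "int list" where
  "double_table = [975233,1974775,3968779,7952800,15917691,31844977,63697568,127401179,254807154,509618115,
      1019239251]"

lemma high_rows: "list_all (high_row high_table) [1..<20]" by code_simp
lemma low_rows_1: "list_all (lower_row low_table) [1..<35]" by code_simp
lemma low_rows_2: "list_all (lower_row low_table) [35..<50]" by code_simp
lemma low_rows_3: "list_all (lower_row low_table) [50..<61]" by code_simp
lemma low_rows_4: "list_all (lower_row low_table) [61..<70]" by code_simp
lemma toll_rows_1_ok: "list_all (upper_row low_table) toll_rows_1" by code_simp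
lemma toll_rows_2_ok: "list_all (upper_row low_table) toll_rows_2" by code_simp
lemma toll_rows_3_ok: "list_all (upper_row low_table) toll_rows_3" by code_simp
lemma toll_rows_4_ok: "list_all (upper_row low_table) toll_rows_4" by code_simp
lemma toll_rows_5_ok: "list_all (upper_row low_table) toll_rows_5" by code_simp

lemma high_toll_rows_ok: "list_all (low_mean_row high_table) high_toll_rows" by code_simp

section \<open>Bounds for the extreme rates\<close>
lemma root3_cube: "root 3 x ^ 3 = (x::real)"
  by (simp add: odd_real_root_pow)

lemma cube_le_iff: "0 \<le> a \<Longrightarrow> 0 \<le> b \<Longrightarrow> a ^ 3 \<le> b ^ 3 \<longleftrightarrow> a \<le> (b::real)"
  by (rule power_mono_iff) auto

lemma cube_leD: "a ^ 3 \<le> b ^ 3 \<Longrightarrow> 0 \<le> b \<Longrightarrow> a \<le> (b::real)"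
  using power_strict_mono[of b a 3] by (cases "a \<le> b") auto

text \<open>The density \<open>toll_density 0 t\<close> is at most \<open>4 x\<close>, whose integral up to \<open>7/10\<close> is \<open>98/100\<close>.\<close>

lemma toll_0_ge: assumes "0 \<le> t" shows "7/10 \<le> toll 0 t"
proof (rule toll_ge)
  have "((\<lambda>x. 4 * x) has_integral (2 * (7/10)\<^sup>2 - 2 * 0\<^sup>2)) {0..7/10::real}"
    by (intro fundamental_theorem_of_calculus)
      (auto intro!: derivative_eq_intros simp: has_real_derivative_iff_has_vector_derivative[symmetric])
  then have "toll_integral 0 t (7/10) \<le> 2 * (7/10)\<^sup>2 - 2 * 0\<^sup>2"
  proof (rule toll_integral_le[rotated 3])
    have le: "toll_density 0 t x \<le> 4 * x" if "0 < x" for x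
    proof -
      have "x * (x + 2 * 0) * (x + 2 * t) * (x + 2 * (0 + t)) = (x * (x + 2 * t))\<^sup>2" by (simp add: power2_eq_square)
      then have "toll_density 0 t x = 2 * (x * (x + 2 * t)) / (x + t)"
        using that assms unfolding toll_density_def by (simp only: real_sqrt_abs) simp
      also have "\<dots> \<le> 4 * x" using that assms by (simp add: divide_simps, (simp add: algebra_simps)?)
      finally show ?thesis .
    qed
    then show "\<And>x. 0 < x \<Longrightarrow> x \<le> 7/10 \<Longrightarrow> toll_density 0 t x \<le> 4 * x" by blast
    show "toll_density 0 t 0 \<le> 4 * 0" by (simp add: toll_density_def)
  qed (use assms in auto)
  also have "\<dots> \<le> 1" by (simp add: power2_eq_square)
  finally show "toll_integral 0 t (7/10) \<le> 1" .
qed (use assms in auto)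

text \<open>A subtree without nodes lacks the share 1/2 that it is charged with, but then the toll of at least \<open>7/10\<close> makes up for
it.\<close>

lemma root_of_size_ge_half:
  assumes "root_of_size k s" "1 \<le> k"
  shows "real (k + 1) / 2 \<le> s"
  using assms
proof (induction rule: root_of_size.induct)
  case (node p s q t)
  have st: "0 \<le> s" "0 \<le> t" using node by (auto intro: root_of_size_nonneg)
  consider "p = 0" "q = 0" | "p = 0" "1 \<le> q" | "1 \<le> p" "q = 0" | "1 \<le> p" "1 \<le> q" by linarith
  then show ?case
  proof cases
    case 1
    then have "s = 0" "t = 0" using node root_of_size_0 by auto
    then show ?thesis using 1 by (simp add: join_root_def toll_0_0)
  next
    case 2
    then have "s = 0" using node root_of_size_0 by auto
    then show ?thesis using 2 node toll_0_ge[OF st(2)] by (simp add: join_root_def)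
  next
    case 3
    then have "t = 0" using node root_of_size_0 by auto
    then show ?thesis using 3 node toll_0_ge[OF st(1)] by (simp add: join_root_def toll_commute)
  next
    case 4
    then show ?thesis using node toll_nonneg[OF st] by (simp add: join_root_def)
  qed
qed simp

lemma min_root_ge_half: "1 \<le> k \<Longrightarrow> real (k + 1) / 2 \<le> min_root k"
  by (rule root_of_size_ge_half[OF min_root_attained])

subsection \<open>The smallest trees\<close>

text \<open>Two nodes at a time are added to a large tree: the new root has the old tree and a single node as subtrees. Once the old root
exceeds 1000, the toll is at most .39809, so two nodes cost 1.39809.\<close>

lemma min_root_rate_le:
  assumes L: "(\<lambda>k. min_root k / real (Suc k)) \<longlonglongrightarrow> L"
  shows "L \<le> 139809/200000"
proof -
  define a where "a = min_root 2001"
  have "upper_ok 100000 100000000 39809" by code_simp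
  then have t: "toll 1 1000 \<le> 39809/100000" using upper_ok[of 100000 100000000 39809] by (simp add: milli_def)
  have bound: "min_root (2001 + 2 * i) \<le> a + real i * (139809/100000)" for i
  proof (induction i)
    case (Suc i)
    have m: "1000 \<le> min_root (2001 + 2 * i)" using min_root_ge_half[of "2001 + 2 * i"] by simp
    have 1: "min_root 1 = 1"
    proof -
      have "root_of_size (Suc (0 + 0)) (join_root 0 0)" by (intro node leaf)
      then have "min_root 1 \<le> 1" using min_root_le[of 1 1] by (simp add: join_root_def toll_0_0)
      then show ?thesis using min_root_ge_half[of 1] by simp
    qed
    have "min_root (Suc (1 + (2001 + 2 * i))) \<le> join_root 1 (min_root (2001 + 2 * i))"
      using min_root_join[of 1 "2001 + 2 * i"] 1 by simp
    also have "\<dots> \<le> 1 + min_root (2001 + 2 * i) + 39809/100000"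
      using toll_antimono[of 1 1 1000 "min_root (2001 + 2 * i)"] m t by (simp add: join_root_def)
    finally show ?case using Suc by (simp add: add_divide_distrib ring_distribs)
  qed (simp add: a_def)
  have "(\<lambda>i. min_root (2001 + 2 * i) / real (Suc (2001 + 2 * i))) \<longlonglongrightarrow> L"
    using LIMSEQ_subseq_LIMSEQ[OF L, of "\<lambda>i. 2001 + 2 * i"] by (simp add: strict_mono_def o_def)
  moreover have "(\<lambda>i. (a + real i * (139809/100000)) / real (Suc (2001 + 2 * i))) \<longlonglongrightarrow> 139809/200000"
    by real_asymp
  ultimately show ?thesis
    by (rule LIMSEQ_le) (intro exI[of _ 0] allI impI divide_right_mono bound, simp)
qed

subsection \<open>Large trees\<close>

text \<open>A path grows by one node at a time, with an empty left subtree.\<close>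

fun chain_ok :: "int list \<Rightarrow> bool" where
  "chain_ok (a # b # xs) \<longleftrightarrow> lower0_ok a (b - a) \<and> chain_ok (b # xs)"
| "chain_ok _ \<longleftrightarrow> True"

text \<open>The balanced tree over two copies has \<open>2 k + 1\<close> nodes.\<close>

fun double_ok :: "int list \<Rightarrow> bool" where
  "double_ok (a # b # xs) \<longleftrightarrow> lower_ok a a (b - 2 * a) \<and> double_ok (b # xs)"
| "double_ok _ \<longleftrightarrow> True"

lemma chain_ok: "chain_ok (a # xs) \<Longrightarrow> milli a \<le> max_root k \<Longrightarrow> milli (last (a # xs)) \<le> max_root (k + length xs)"
proof (induction xs arbitrary: a k)
  case (Cons b xs)
  then have ok: "lower0_ok a (b - a)" by simp
  then have a: "0 < a" by (simp add: lower0_ok_def)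
  have "milli b \<le> join_root 0 (milli a)" using lower0_ok[OF ok] by (simp add: join_root_def milli_diff)
  also have "\<dots> \<le> join_root (max_root 0) (max_root k)"
    using Cons.prems a max_root_ge[OF leaf] by (intro join_root_mono) (auto simp: milli_nonneg)
  also have "\<dots> \<le> max_root (Suc k)" using max_root_join[of 0 k] by simp
  finally show ?case using Cons.IH[of b "Suc k"] Cons.prems by simp
qed simp

lemma double_ok: "double_ok (a # xs) \<Longrightarrow> milli a \<le> max_root k \<Longrightarrow> milli (last (a # xs)) \<le> max_root ((k + 1) * 2 ^ length xs - 1)"
proof (induction xs arbitrary: a k)
  case (Cons b xs)
  then have ok: "lower_ok a a (b - 2 * a)" by simp
  then have a: "0 < a" by (simp add: lower_ok_def)
  have "milli b \<le> join_root (milli a) (milli a)" using lower_ok[OF ok] milli_add[of a a] by (simp add: join_root_def milli_diff)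
  also have "\<dots> \<le> join_root (max_root k) (max_root k)"
    using Cons.prems a by (intro join_root_mono) (auto simp: milli_nonneg)
  also have "\<dots> \<le> max_root (Suc (k + k))" by (rule max_root_join)
  finally have "milli (last (b # xs)) \<le> max_root ((Suc (k + k) + 1) * 2 ^ length xs - 1)"
    using Cons.prems by (intro Cons.IH) auto
  moreover have "(Suc (k + k) + 1) * 2 ^ length xs = (k + 1) * 2 ^ length (b # xs)" by simp
  ultimately show ?case by (simp only: last.simps list.distinct if_False)
qed simp

lemma chain_double_ok: "chain_ok chain_table" "double_ok double_table" by code_simp+

lemma max_root_14335: "71096487/100000000 * 14336 \<le> max_root 14335"
proof -
  have "root_of_size (Suc (0 + 0)) (join_root 0 0)" by (intro node leaf)
  then have "milli 100000 \<le> max_root 1" using max_root_ge[of 1 1] by (simp add: join_root_def toll_0_0 milli_def)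
  then have c: "milli (last chain_table) \<le> max_root 13"
    using chain_ok[of 100000 "tl chain_table" 1] chain_double_ok(1)
    by (simp add: chain_table_def eval_nat_numeral del: chain_ok.simps)
  have "hd double_table = last chain_table" by (simp add: chain_table_def double_table_def)
  then have "milli (last double_table) \<le> max_root ((13 + 1) * 2 ^ length (tl double_table) - 1)"
    using double_ok[of "hd double_table" "tl double_table" 13] chain_double_ok(2) c by (simp add: double_table_def)
  then show ?thesis by (simp add: double_table_def milli_def)
qed

subsection \<open>A potential for the largest trees\<close>

text \<open>The toll is at most \<open>\<kappa> z\<close> with \<open>\<kappa> < .41275\<close> and \<open>z\<^sup>3 = 1/s + 1/t\<close>. In terms of \<open>x = s\<^sup>-\<^sup>1\<^sup>/\<^sup>3\<close>,
\<open>y = t\<^sup>-\<^sup>1\<^sup>/\<^sup>3\<close> one has \<open>(s+t)\<^sup>-\<^sup>1\<^sup>/\<^sup>3 = x y / z\<close>, so this is what makes the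
potential below subadditive. Up to the constants, both sides are homogeneous of degree 1.\<close>

lemma potential_inequality:
  fixes x y z :: real
  assumes "0 < x" "0 < y" "0 < z" and z: "z ^ 3 = x ^ 3 + y ^ 3"
  shows "41275/100000 * z \<le> 4318/10000 * (x + y - x * y / z)"
proof -
  define p where "p = x + y"
  have p: "0 < p" using assms by (simp add: p_def)
  have zp: "z ^ 3 = p ^ 3 - 3 * p * (x * y)" unfolding z p_def by (simp add: power3_eq_cube algebra_simps)
  have q: "4 * (x * y) \<le> p\<^sup>2" unfolding p_def using zero_le_square[of "x - y"] by (simp add: power2_eq_square algebra_simps)
  have "p * (4 * (x * y)) \<le> p * p\<^sup>2" using q p by (intro mult_left_mono) auto
  then have "p ^ 3 / 4 \<le> z ^ 3" unfolding zp by (simp add: power3_eq_cube power2_eq_square)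
  moreover have "(6299/10000 * p) ^ 3 \<le> p ^ 3 / 4" using p by (simp add: power_mult_distrib power_divide)
  ultimately have "(6299/10000 * p) ^ 3 \<le> z ^ 3" by linarith
  \<comment> \<open>The extreme case is x = y, where z / p is the inverse cube root of 4, just above 6299/10000.\<close>
  then have lo: "6299/10000 * p \<le> z" by (rule cube_leD[OF _ less_imp_le[OF assms(3)]])
  \<comment> \<open>The ratio l is just above 41275/43180.\<close>
  define l :: real where "l = 4775/4995"
  define e where "e = z - 6299/10000 * p"
  have e: "0 \<le> e" using lo by (simp add: e_def)
  have g: "0 \<le> z ^ 3 - 3 * l * p * z\<^sup>2 + 3 * p\<^sup>2 * z - p ^ 3"
  proof -
    have "(e + c * p) ^ 3 - 3 * l * p * (e + c * p)\<^sup>2 + 3 * p\<^sup>2 * (e + c * p) - p ^ 3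
      = e * (e\<^sup>2 + (3 * c - 3 * l) * p * e + (3 * c\<^sup>2 - 6 * l * c + 3) * p\<^sup>2)
        + (c ^ 3 - 3 * l * c\<^sup>2 + 3 * c - 1) * p ^ 3" for c
      by (simp add: power2_eq_square power3_eq_cube algebra_simps)
    moreover have "z = e + 6299/10000 * p" by (simp add: e_def)
    ultimately have "z ^ 3 - 3 * l * p * z\<^sup>2 + 3 * p\<^sup>2 * z - p ^ 3
      = e * (e\<^sup>2 + (3 * (6299/10000) - 3 * l) * p * e + (3 * (6299/10000)\<^sup>2 - 6 * l * (6299/10000) + 3) * p\<^sup>2)
        + ((6299/10000) ^ 3 - 3 * l * (6299/10000)\<^sup>2 + 3 * (6299/10000) - 1) * p ^ 3"
      by (simp only:)
    moreover have "0 \<le> e\<^sup>2 + (3 * (6299/10000) - 3 * l) * p * e + (3 * (6299/10000)\<^sup>2 - 6 * l * (6299/10000) + 3) * p\<^sup>2"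
    proof -
      have "0 \<le> 3 * (6299/10000) - 3 * l + 98/100" by (simp add: l_def)
      then have "0 \<le> (3 * (6299/10000) - 3 * l + 98/100) * p * e" using e p by simp
      then have "0 \<le> (e - 49/100 * p)\<^sup>2 + 1/3 * p\<^sup>2 + (3 * (6299/10000) - 3 * l + 98/100) * p * e"
        by (intro add_nonneg_nonneg[of "_ + _"]) auto
      also have "\<dots> \<le> e\<^sup>2 + (3 * (6299/10000) - 3 * l) * p * e + (3 * (6299/10000)\<^sup>2 - 6 * l * (6299/10000) + 3) * p\<^sup>2"
        using p by (simp add: l_def power2_eq_square algebra_simps)
      finally show ?thesis .
    qed
    moreover have "0 \<le> ((6299/10000) ^ 3 - 3 * l * (6299/10000)\<^sup>2 + 3 * (6299/10000) - 1)"
      by (simp add: l_def power2_eq_square power3_eq_cube)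
    ultimately show ?thesis using e p by simp
  qed
  have "3 * p * (x * y) = p ^ 3 - z ^ 3" using zp by simp
  then have "3 * p * (l * z\<^sup>2) \<le> 3 * p * (p * z - x * y)" using g by (simp add: power2_eq_square power3_eq_cube algebra_simps)
  then have "l * z\<^sup>2 \<le> p * z - x * y" using p by (simp add: mult_le_cancel_left_pos)
  then have "l * z\<^sup>2 / z \<le> (p * z - x * y) / z" using assms by (intro divide_right_mono) auto
  then have "l * z \<le> x + y - x * y / z" using assms by (simp add: p_def diff_divide_distrib power2_eq_square)
  moreover have "41275/100000 \<le> 4318/10000 * l" by (simp add: l_def)
  then have "41275/100000 * z \<le> (4318/10000 * l) * z" using assms by (intro mult_right_mono) auto
  then have a: "41275/100000 * z \<le> 4318/10000 * (l * z)" by (simp only: mult.assoc)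
  from \<open>l * z \<le> x + y - x * y / z\<close>
  have b: "4318/10000 * (l * z) \<le> 4318/10000 * (x + y - x * y / z)" by (rule mult_left_mono) simp
  show ?thesis by (rule order_trans[OF a b])
qed

text \<open>The inverse cube root \<open>s\<^sup>-\<^sup>1\<^sup>/\<^sup>3\<close>.\<close>

definition crt :: "real \<Rightarrow> real" where "crt s = root 3 (1 / s)"

lemma crt_pos: "0 < s \<Longrightarrow> 0 < crt s" by (simp add: crt_def)
lemma crt_cube: "crt s ^ 3 = 1 / s" unfolding crt_def by (rule root3_cube)
lemma crt_antimono: "0 < s \<Longrightarrow> s \<le> t \<Longrightarrow> crt t \<le> crt s"
  unfolding crt_def by (simp add: frac_le)
lemma crt_unique: "0 < x \<Longrightarrow> x ^ 3 = 1 / s \<Longrightarrow> x = crt s"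
  unfolding crt_def by (metis less_imp_le odd_numeral odd_real_root_power_cancel numeral_3_eq_3 odd_real_root_unique)

lemma toll_le_crt:
  assumes "0 < s" "0 < t" "0 \<le> T" "(41275/100000 * z) ^ 3 \<le> T ^ 3" "z ^ 3 = 1 / s + 1 / t" "0 \<le> z"
  shows "toll s t \<le> T"
proof -
  interpret positive_pair s t by unfold_locales (use assms in auto)
  have "9/128 * hm = 9/128 * z ^ 3" by (simp add: hm_def assms(5))
  also have "\<dots> \<le> (41275/100000) ^ 3 * z ^ 3" using assms by (intro mult_right_mono) (auto simp: power_divide)
  also have "\<dots> \<le> T ^ 3" using assms(4) by (simp only: power_mult_distrib)
  finally show ?thesis by (rule toll_le_cube_root[OF assms(3)])
qed

lemma crt_add:
  assumes "0 < s" "0 < t"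
  shows "crt (s + t) = crt s * crt t / root 3 (1 / s + 1 / t)"
proof (rule crt_unique[symmetric])
  have z: "0 < root 3 (1 / s + 1 / t)" using assms by (simp add: add_pos_pos)
  show "0 < crt s * crt t / root 3 (1 / s + 1 / t)" using assms z by (simp add: crt_pos)
  show "(crt s * crt t / root 3 (1 / s + 1 / t)) ^ 3 = 1 / (s + t)"
    unfolding power_divide power_mult_distrib crt_cube root3_cube using assms by (simp add: field_simps)
qed

lemma toll_le_potential:
  assumes "0 < s" "0 < t"
  shows "toll s t \<le> 4318/10000 * (crt s + crt t - crt (s + t))"
proof -
  define z where "z = root 3 (1 / s + 1 / t)"
  have z: "0 < z" "z ^ 3 = 1 / s + 1 / t" unfolding z_def using assms by (auto simp: add_pos_pos root3_cube)
  have le: "41275/100000 * z \<le> 4318/10000 * (crt s + crt t - crt s * crt t / z)"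
    by (rule potential_inequality) (use assms z in \<open>auto simp: crt_pos crt_cube\<close>)
  show ?thesis unfolding crt_add[OF assms] z_def[symmetric]
  proof (rule toll_le_crt[OF assms _ _ z(2)])
    show "0 \<le> 4318/10000 * (crt s + crt t - crt s * crt t / z)" using le z by linarith
    show "(41275/100000 * z) ^ 3 \<le> (4318/10000 * (crt s + crt t - crt s * crt t / z)) ^ 3"
      using le z by (intro power_mono) auto
  qed (use z in auto)
qed

text \<open>A potential that is subadditive under \<open>join_root\<close> for positive arguments. The coefficient exceeds \<open>\<kappa>\<close> by about 4.6 percent, slightly more
than the balanced case requires.\<close>

definition pot :: "real \<Rightarrow> real" where "pot s = s + 4318/10000 * crt s"

lemma crt_diff:
  assumes "0 < s" "0 < t"
  shows "(crt s - crt t) * ((crt s)\<^sup>2 + crt s * crt t + (crt t)\<^sup>2) = (t - s) / (s * t)"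
proof -
  have "(crt s - crt t) * ((crt s)\<^sup>2 + crt s * crt t + (crt t)\<^sup>2) = crt s ^ 3 - crt t ^ 3"
    by (simp add: power2_eq_square power3_eq_cube algebra_simps)
  also have "\<dots> = (t - s) / (s * t)" unfolding crt_cube using assms by (simp add: field_simps)
  finally show ?thesis .
qed

lemma crt_le_1: "1 \<le> s \<Longrightarrow> crt s \<le> 1"
  by (simp add: crt_def)

lemma pot_mono:
  assumes "1 \<le> s" "s \<le> t"
  shows "pot s \<le> pot t"
proof -
  define a b where "a = crt s" and "b = crt t"
  have ab: "0 < a" "0 < b" "a \<le> 1" "b \<le> a" using assms by (auto simp: a_def b_def crt_pos crt_le_1 crt_antimono)
  have st: "1 / s = a ^ 3" "1 / t = b ^ 3" using crt_cube by (auto simp: a_def b_def)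
  have eq: "(a - b) * (a\<^sup>2 + a * b + b\<^sup>2) = (t - s) * (a ^ 3 * b ^ 3)"
    using crt_diff[of s t] assms unfolding a_def[symmetric] b_def[symmetric] st[symmetric] by (simp add: field_simps)
  have "(a - b) * a\<^sup>2 \<le> (a - b) * (a\<^sup>2 + a * b + b\<^sup>2)" using ab by (intro mult_left_mono) auto
  also have "\<dots> = (t - s) * (a * b ^ 3) * a\<^sup>2" unfolding eq by (simp add: power2_eq_square power3_eq_cube)
  finally have "a - b \<le> (t - s) * (a * b ^ 3)" using ab by (simp add: mult_le_cancel_right_pos)
  also have "\<dots> \<le> (t - s) * 1"
    using ab assms by (intro mult_left_mono mult_le_one power_le_one) auto
  finally have "a - b \<le> t - s" by simp
  moreover have "0 \<le> a - b" using ab by simp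
  ultimately show ?thesis unfolding pot_def a_def[symmetric] b_def[symmetric] by simp
qed

lemma pot_join_le:
  assumes "0 < s" "0 < t"
  shows "pot (join_root s t) \<le> pot s + pot t"
proof -
  have "crt (join_root s t) \<le> crt (s + t)"
    using assms toll_nonneg[of s t] by (intro crt_antimono) (auto simp: join_root_def)
  then show ?thesis using toll_le_potential[OF assms] by (simp add: pot_def join_root_def algebra_simps)
qed

text \<open>The potential 1.4318 of a tree with one node exceeds the linear bound \<open>2 * .71111\<close>, so subadditivity is not enough; the
slack of \<open>toll_le_potential\<close> for very different arguments makes up for the difference.\<close>

lemma pot_join_1_le:
  assumes "17/2 \<le> t"
  shows "pot (join_root 1 t) \<le> 2 * (71111/100000) + pot t"
proof -
  have t: "0 < t" using assms by simp
  define y where "y = crt t"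
  define z where "z = root 3 (1 / 1 + 1 / t)"
  have y: "0 < y" using t by (simp add: y_def crt_pos)
  have z3: "z ^ 3 = 1 + y ^ 3" unfolding z_def root3_cube y_def crt_cube by simp
  have z1: "1 \<le> z"
  proof -
    have "1 ^ 3 \<le> z ^ 3" using z3 y by simp
    moreover have "0 \<le> z" unfolding z_def using t by simp
    ultimately show ?thesis by (intro cube_leD[of 1 z]) auto
  qed
  have zu: "z \<le> 1038/1000"
  proof -
    have "1 / t \<le> 2/17" using assms t by (simp add: divide_simps)
    then have "z ^ 3 \<le> (1038/1000) ^ 3" unfolding z_def root3_cube by (simp add: power3_eq_cube)
    then show ?thesis using z1 by (subst (asm) cube_le_iff) auto
  qed
  have w: "crt (1 + t) = y / z" using crt_add[of 1 t] t by (simp add: y_def z_def crt_def)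
  \<comment> \<open>From z^3 = 1 + y^3 it follows that 3 (z - 1) is at most y^3; replacing y by v leaves a polynomial in v.\<close>
  define v where "v = root 3 (3 * (z - 1))"
  have v3: "v ^ 3 = 3 * (z - 1)" unfolding v_def by (rule root3_cube)
  have v0: "0 \<le> v" unfolding v_def using z1 by simp
  have vu: "v \<le> 4851/10000"
  proof -
    have "v ^ 3 \<le> (4851/10000) ^ 3" unfolding v3 using zu by (simp add: power3_eq_cube)
    then show ?thesis using v0 by (subst (asm) cube_le_iff) auto
  qed
  have vy: "v \<le> y"
  proof -
    have "v ^ 3 \<le> y ^ 3"
    proof -
      have "0 \<le> (z - 1)\<^sup>2 * (z + 2)" using z1 by simp
      then have "3 * (z - 1) \<le> z ^ 3 - 1" by (simp add: power2_eq_square power3_eq_cube algebra_simps)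
      then show ?thesis unfolding v3 using z3 by simp
    qed
    then show ?thesis using v0 y by (subst (asm) cube_le_iff) auto
  qed
  define T where "T = 42222/100000 + 4318/10000 * (y - y / z)"
  have main: "41275/100000 * z \<le> T"
  proof -
    have "v * (v ^ 3 / 3) / (1038/1000) \<le> y * (z - 1) / z"
    proof -
      have "v * (v ^ 3 / 3) / (1038/1000) = v * (z - 1) / (1038/1000)" unfolding v3 by simp
      also have "\<dots> \<le> y * (z - 1) / z" using vy v0 y z1 zu by (intro frac_le mult_right_mono mult_nonneg_nonneg) auto
      finally show ?thesis .
    qed
    moreover have "y * (z - 1) / z = y - y / z" using z1 by (simp add: field_simps)
    ultimately have a: "42222/100000 + 4318/10000 * (v * (v ^ 3 / 3) / (1038/1000)) \<le> T" by (simp add: T_def)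
    have zv: "z = 1 + v ^ 3 / 3" unfolding v3 by (simp add: diff_divide_distrib)
    have b: "41275/100000 * z \<le> 42222/100000 + 4318/10000 * (v * (v ^ 3 / 3) / (1038/1000))"
    proof -
      define c where "c = 4851/10000 - v"
      have c: "0 \<le> c" using vu by (simp add: c_def)
      have "v ^ 3 * (41275/300000 - 4318/31140 * v) \<le> 947/100000"
      proof -
        have d: "0 \<le> 41275/300000 - 4318/31140 * v" using vu by simp
        have "v ^ 3 \<le> v * (4851/10000)\<^sup>2"
        proof -
          have "v\<^sup>2 \<le> (4851/10000)\<^sup>2" using v0 vu by (intro power_mono)
          then have "v * v\<^sup>2 \<le> v * (4851/10000)\<^sup>2" using v0 by (rule mult_left_mono)
          then show ?thesis by (simp add: power2_eq_square power3_eq_cube)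
        qed
        then have "v ^ 3 * (41275/300000 - 4318/31140 * v) \<le> (v * (4851/10000)\<^sup>2) * (41275/300000 - 4318/31140 * v)"
          using d by (rule mult_right_mono)
        also have "\<dots> \<le> 947/100000"
        proof -
          have "(v * (4851/10000)\<^sup>2) * (41275/300000 - 4318/31140 * v) = (4851/10000)\<^sup>2 * (41275/300000 * v - 4318/31140 * (v * v))"
            by (simp only: algebra_simps)
          moreover have "0 \<le> (v - 4961/10000)\<^sup>2" by simp
          then have "2 * (4961/10000) * v - (4961/10000)\<^sup>2 \<le> v * v" by (simp only: power2_eq_square algebra_simps)
          ultimately show ?thesis using vu by (simp add: power2_eq_square)
        qed
        finally show ?thesis .
      qed
      then show ?thesis unfolding zv by (simp add: algebra_simps)
    qed
    show ?thesis using a b by linarith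
  qed
  have "toll 1 t \<le> T"
  proof (rule toll_le_crt[OF _ t _ _ _])
    show "z ^ 3 = 1 / 1 + 1 / t" unfolding z_def by (rule root3_cube)
    show "0 \<le> T" using main z1 by linarith
    show "(41275/100000 * z) ^ 3 \<le> T ^ 3" using main z1 by (intro power_mono) auto
  qed (use z1 in auto)
  moreover have "crt (join_root 1 t) \<le> y / z"
    unfolding w[symmetric] using t toll_nonneg[of 1 t] by (intro crt_antimono) (auto simp: join_root_def)
  moreover have "pot (join_root 1 t) = 1 + t + toll 1 t + 4318/10000 * crt (join_root 1 t)" "pot t = t + 4318/10000 * y"
    by (simp_all add: pot_def join_root_def y_def)
  moreover define d where "d = y / z"
  ultimately show ?thesis unfolding T_def d_def[symmetric] right_diff_distrib by linarith
qed

lemma crt_le: "0 \<le> w \<Longrightarrow> 1 / s \<le> w ^ 3 \<Longrightarrow> crt s \<le> w"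
  using cube_leD[of "crt s" w] by (simp add: crt_cube)

text \<open>The derivative of the difference is \<open>x\<^sup>3 / (1 + x)\<close>.\<close>

lemma ln_add_one_le_cubic:
  fixes z :: real
  assumes "0 \<le> z"
  shows "ln (1 + z) \<le> z - z\<^sup>2 / 2 + z ^ 3 / 3"
proof -
  define f where "f x = x - x\<^sup>2 / 2 + x ^ 3 / 3 - ln (1 + x)" for x :: real
  have "f 0 \<le> f z"
  proof (rule DERIV_nonneg_imp_nondecreasing[OF assms])
    fix x :: real assume x: "0 \<le> x" "x \<le> z"
    have "(f has_real_derivative 1 - x + x\<^sup>2 - 1 / (1 + x)) (at x)"
      unfolding f_def using x by (auto intro!: derivative_eq_intros simp: power2_eq_square)
    moreover have "1 - x + x\<^sup>2 - 1 / (1 + x) = x ^ 3 / (1 + x)"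
      using x by (simp add: field_simps power2_eq_square power3_eq_cube)
    ultimately show "\<exists>y. (f has_real_derivative y) (at x) \<and> 0 \<le> y" using x by auto
  qed
  then show ?thesis by (simp add: f_def)
qed

text \<open>Expanding the logarithm, the integral for a leaf is \<open>2 T\<^sup>2 - 2 T\<^sup>3 / (3 t) + \<dots>\<close>, so the toll tends to
\<open>1 / sqrt 2 < .7073\<close>.\<close>

lemma toll_0_le:
  assumes "12 \<le> t"
  shows "toll 0 t \<le> 7073/10000 + 1 / (12 * t)"
proof -
  have t: "0 < t" using assms by simp
  define u where "u = 1 / t"
  have u: "0 < u" "u \<le> 1/12" using assms t by (auto simp: u_def divide_simps)
  define T where "T = 7073/10000 + u / 12"
  have T: "0 < T" "T \<le> 714245/1000000" using u by (auto simp: T_def)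
  have "ln (1 + T / t) \<le> T / t - (T / t)\<^sup>2 / 2 + (T / t) ^ 3 / 3"
    by (rule ln_add_one_le_cubic) (use T t in auto)
  then have "2 * t\<^sup>2 * ln (1 + T / t) \<le> 2 * t\<^sup>2 * (T / t - (T / t)\<^sup>2 / 2 + (T / t) ^ 3 / 3)"
    by (intro mult_left_mono) auto
  also have "\<dots> = 2 * t * T - T\<^sup>2 + 2/3 * T ^ 3 * u"
    using t by (simp add: u_def field_simps power2_eq_square power3_eq_cube)
  finally have J: "2 * T\<^sup>2 - 2/3 * T ^ 3 * u \<le> toll_integral 0 t T"
    using t T by (subst toll_integral_0_eq) auto
  have "T ^ 3 \<le> (714245/1000000) ^ 3" using T by (intro power_mono) auto
  then have "T ^ 3 \<le> 36438/100000" by (simp add: power3_eq_cube)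
  then have "T ^ 3 * u \<le> 36438/100000 * u" using u by (intro mult_right_mono) auto
  moreover have "2 * T\<^sup>2 = 2 * (7073/10000)\<^sup>2 + 7073/30000 * u + u\<^sup>2 / 72"
    by (simp add: T_def power2_eq_square algebra_simps)
  moreover have "u\<^sup>2 \<ge> u / 6 - 1/144"
    using zero_le_power2[of "u - 1/12"] by (simp add: power2_eq_square algebra_simps)
  moreover have "2/3 * T ^ 3 * u = 2/3 * (T ^ 3 * u)" by simp
  moreover have "(7073/10000)\<^sup>2 = (50027329/100000000 :: real)" by (simp add: power2_eq_square)
  ultimately have "1 \<le> 2 * T\<^sup>2 - 2/3 * T ^ 3 * u" using u by linarith
  then have "toll 0 t \<le> T" using J t T by (intro toll_le) auto
  then show ?thesis by (simp add: T_def u_def)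
qed

text \<open>The toll of a leaf may exceed \<open>.71111\<close> a little, but the decrease of the second summand of the potential compensates
this as soon as \<open>t \<ge> 12\<close>.\<close>

lemma pot_join_0_le:
  assumes "12 \<le> t"
  shows "pot (join_root 0 t) \<le> 71111/100000 + pot t"
proof -
  have t: "0 < t" using assms by simp
  define V where "V = 7073/10000 + 1 / (12 * t)"
  have "0 < 1 / (12 * t)" using t by simp
  then have V: "7/10 \<le> V" "0 < V" unfolding V_def by linarith+
  define a b where "a = crt t" and "b = crt (t + V)"
  have ab: "0 < a" "0 < b" "b \<le> a" using t V by (auto simp: a_def b_def crt_pos crt_antimono)
  have a_le: "a \<le> 4368/10000"
    unfolding a_def by (rule crt_le) (use assms t in \<open>auto simp: power3_eq_cube divide_simps\<close>)
  have "a\<^sup>2 + a * b + b\<^sup>2 \<le> a\<^sup>2 + a * a + a\<^sup>2" using ab by (intro add_mono mult_left_mono power_mono) auto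
  also have "\<dots> \<le> 5724/10000"
  proof -
    have "a * a \<le> 4368/10000 * (4368/10000)" using a_le ab by (intro mult_mono) auto
    then show ?thesis by (simp add: power2_eq_square)
  qed
  \<comment> \<open>The constant 4368/10000 is an upper bound for the inverse cube root of 12.\<close>
  finally have w: "a\<^sup>2 + a * b + b\<^sup>2 \<le> 5724/10000" .
  have "7/10 / (t * (t + 7/10)) \<le> V / (t * (t + V))"
  proof -
    have "7/10 * (t * (t + V)) \<le> V * (t * (t + 7/10))"
      using mult_right_mono[OF V(1), of "t * t"] by (simp add: algebra_simps)
    then show ?thesis
      using t V by (subst pos_divide_le_eq, simp, subst times_divide_eq_left, subst pos_le_divide_eq) auto
  qed
  also have "\<dots> = (a - b) * (a\<^sup>2 + a * b + b\<^sup>2)"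
    using crt_diff[of t "t + V"] t V by (simp add: a_def b_def)
  also have "\<dots> \<le> (a - b) * (5724/10000)" using w ab by (intro mult_left_mono) auto
  finally have d: "7/10 / (t * (t + 7/10)) \<le> (a - b) * (5724/10000)" .
  have "V - 71111/100000 \<le> 528/1000 * (1 / (t * (t + 7/10)))"
  proof -
    have "0 \<le> (t - 12) * (t - 12)" by simp
    then have h: "24 * t - 144 \<le> t * t" by (simp add: algebra_simps)
    define u w where "u = t * t" and "w = t * (t + 7/10)"
    have "w = u + 7/10 * t" by (simp add: w_def u_def algebra_simps)
    then have "t / 12 + 7/120 - 381/100000 * w \<le> 528/1000" using assms h[folded u_def] by linarith
    then have "(t + 7/10) / 12 - 381/100000 * w \<le> 528/1000" by (simp add: add_divide_distrib)
    then have "(t + 7/10) / 12 - 381/100000 * (t * (t + 7/10)) \<le> 528/1000" by (simp only: w_def)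
    then have "((t + 7/10) / 12 - 381/100000 * (t * (t + 7/10))) / (t * (t + 7/10)) \<le> 528/1000 / (t * (t + 7/10))"
      using t by (intro divide_right_mono) auto
    moreover have "((t + 7/10) / 12 - 381/100000 * (t * (t + 7/10))) / (t * (t + 7/10)) = 1 / (12 * t) - 381/100000"
      using t by (simp add: diff_divide_distrib)
    ultimately show ?thesis by (simp add: V_def)
  qed
  moreover have "528/1000 * (1 / (t * (t + 7/10))) \<le> 4318/10000 * (a - b)"
  proof -
    define r e where "r = 1 / (t * (t + 7/10))" and "e = a - b"
    have "7/10 * r \<le> e * (5724/10000)" "0 \<le> e" using d ab by (simp_all add: r_def e_def)
    then show ?thesis unfolding r_def[symmetric] e_def[symmetric] by linarith
  qed
  ultimately have "V - 71111/100000 \<le> 4318/10000 * (a - b)" by (rule order_trans)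
  then have "V + 4318/10000 * b \<le> 71111/100000 + 4318/10000 * a" unfolding right_diff_distrib by linarith
  then have le: "pot (t + V) \<le> 71111/100000 + pot t" by (simp add: pot_def a_def b_def)
  have "join_root 0 t \<le> t + V" using toll_0_le[OF assms] by (simp add: join_root_def V_def)
  moreover have "1 \<le> join_root 0 t" using assms toll_nonneg[of 0 t] by (simp add: join_root_def)
  ultimately have "pot (join_root 0 t) \<le> pot (t + V)" by (intro pot_mono)
  then show ?thesis using le by simp
qed

text \<open>In units of \<open>10\<^sup>-\<^sup>5\<close>: the potential of the table entry is at most \<open>.71111 (k + 1)\<close>. The constant is
\<open>43180\<^sup>3 * 10\<^sup>5\<close>.\<close>

definition pot_ok :: "int list \<Rightarrow> nat \<Rightarrow> bool" where
  "pot_ok L k \<longleftrightarrow> 0 < L ! k \<and> (let a = 71111 * int (k + 1) - L ! k in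
     0 \<le> a \<and> 8050964543200000000 \<le> a * a * a * (L ! k))"

lemma pot_table_ok: "list_all (pot_ok high_table) [2..<18]" by code_simp

lemma pot_ok: assumes "pot_ok L k" shows "pot (milli (L ! k)) \<le> 71111/100000 * real (k + 1)"
proof -
  define u a where "u = L ! k" and "a = 71111 * int (k + 1) - L ! k"
  have ua: "0 < u" "0 \<le> a" and t: "8050964543200000000 \<le> a * a * a * u"
    using assms by (auto simp: pot_ok_def Let_def u_def a_def)
  have t': "8050964543200000000 \<le> real_of_int a * real_of_int a * real_of_int a * real_of_int u"
    using of_int_le_iff[where 'a = real, THEN iffD2, OF t] by simp
  have u0: "0 < real_of_int u" using ua by simp
  have "crt (milli u) \<le> real_of_int a / 43180"
  proof (rule crt_le)
    show "1 / milli u \<le> (real_of_int a / 43180) ^ 3"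
      using t' u0 by (simp add: milli_def power3_eq_cube field_simps)
  qed (use ua in auto)
  then have "4318/10000 * crt (milli u) \<le> real_of_int a / 100000" by simp
  moreover have "milli u = real_of_int u / 100000" by (simp add: milli_def)
  moreover have "real_of_int a = 71111 * real (k + 1) - real_of_int u" by (simp add: a_def u_def)
  ultimately show ?thesis unfolding pot_def u_def[symmetric] by linarith
qed

lemma root_le_high_table: "root_of_size k s \<Longrightarrow> k \<le> 20 \<Longrightarrow> s \<le> milli (high_table ! k)"
proof (rule high_table_sound)
  show "high_row high_table n" if "1 \<le> n" "Suc n < length high_table" for n
    using high_rows that by (simp add: list_all_iff high_table_def[THEN arg_cong[where f = length]])
qed (auto simp: high_table_def)

lemma root_of_size_1: "root_of_size 1 s \<Longrightarrow> s = 1"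
  by (cases rule: root_of_size.cases) (auto dest!: root_of_size_0 simp: join_root_def toll_0_0)

text \<open>Trees with at most 17 nodes are covered by the table. Larger ones fall under one of the three cases of a smaller subtree
with none, one, or more nodes.\<close>

lemma pot_root_le:
  "root_of_size k s \<Longrightarrow> 2 \<le> k \<Longrightarrow> pot s \<le> 71111/100000 * real (k + 1)"
proof (induction rule: root_of_size.induct)
  case (node p s q t)
  have small: "pot (join_root s t) \<le> 71111/100000 * real (Suc (p + q) + 1)"
    if "2 \<le> Suc (p + q)" "Suc (p + q) \<le> 17" "root_of_size p s" "root_of_size q t" for p q s t
  proof -
    define k where "k = Suc (p + q)"
    have r: "root_of_size k (join_root s t)" unfolding k_def using that by (intro root_of_size.node)
    have "pot (join_root s t) \<le> pot (milli (high_table ! k))"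
    proof (rule pot_mono)
      show "1 \<le> join_root s t" using root_of_size_ge_half[OF r] that by (simp add: k_def)
      show "join_root s t \<le> milli (high_table ! k)" using r that by (intro root_le_high_table) (auto simp: k_def)
    qed
    also have "\<dots> \<le> 71111/100000 * real (k + 1)"
      proof (rule pot_ok)
      have "k \<in> set [2..<18]" unfolding set_upt atLeastLessThan_iff k_def using that by linarith
      then show "pot_ok high_table k" using pot_table_ok unfolding list_all_iff by blast
    qed
    finally show ?thesis by (simp add: k_def)
  qed
  let ?P = "\<lambda>p q s t. 2 \<le> Suc (p + q) \<longrightarrow> (2 \<le> p \<longrightarrow> pot s \<le> 71111/100000 * real (p + 1))
    \<longrightarrow> (2 \<le> q \<longrightarrow> pot t \<le> 71111/100000 * real (q + 1)) \<longrightarrow> pot (join_root s t) \<le> 71111/100000 * real (Suc (p + q) + 1)"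
  have "?P p q s t"
  proof (rule node_cases[of ?P])
    fix p q s t assume pq: "p \<le> q" and st: "root_of_size p s" "root_of_size q t"
    show "?P p q s t"
    proof (intro impI)
      assume k2: "2 \<le> Suc (p + q)" and IHs: "2 \<le> p \<longrightarrow> pot s \<le> 71111/100000 * real (p + 1)"
        and IHt: "2 \<le> q \<longrightarrow> pot t \<le> 71111/100000 * real (q + 1)"
      show "pot (join_root s t) \<le> 71111/100000 * real (Suc (p + q) + 1)"
      proof (cases "Suc (p + q) \<le> 17")
        case True
        then show ?thesis using small k2 st by blast
      next
        case False
        then have q: "9 \<le> q" using pq by linarith
        have t_ge: "(real q + 1) / 2 \<le> t" using root_of_size_ge_half[OF st(2)] q by simp
        have IHt': "pot t \<le> 71111/100000 * real (q + 1)" using IHt q by simp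
        consider "p = 0" | "p = 1" | "2 \<le> p" by linarith
        then show ?thesis
        proof cases
          case 1
          then have s: "s = 0" using st root_of_size_0 by simp
          have q17: "17 \<le> q" using False 1 by simp
          show ?thesis
          proof (cases "12 \<le> t")
            case True
            then show ?thesis using pot_join_0_le[OF True] IHt' 1 s by simp
          next
            case False
            have "pot (join_root s t) \<le> pot (join_root 0 12)" unfolding s
            proof (rule pot_mono)
              show "1 \<le> join_root 0 t" using t_ge q17 toll_nonneg[of 0 t] by (simp add: join_root_def)
              show "join_root 0 t \<le> join_root 0 12" using False t_ge q17 by (intro join_root_mono) auto
            qed
            also have "\<dots> \<le> 71111/100000 + pot 12" by (rule pot_join_0_le) simp
            also have "\<dots> \<le> 71111/100000 * 19"
              using crt_le[of 1 12] by (simp add: pot_def)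
            also have "\<dots> \<le> 71111/100000 * real (Suc (p + q) + 1)" using q17 by (intro mult_left_mono) auto
            finally show ?thesis .
          qed
        next
          case 2
          then have s: "s = 1" using st root_of_size_1 by simp
          have "17/2 \<le> t" using t_ge False 2 by simp
          then show ?thesis using pot_join_1_le[of t] IHt' 2 s by simp
        next
          case 3
          have "0 < s" "0 < t" using root_of_size_ge_half[OF st(1)] t_ge 3 by auto
          then have "pot (join_root s t) \<le> pot s + pot t" by (rule pot_join_le)
          then show ?thesis using IHs IHt' 3 by simp
        qed
      qed
    qed
  qed (use node in \<open>auto simp: join_root_commute add.commute\<close>)
  then show ?case using node by auto
qed simp

lemma root_le_linear: "root_of_size k s \<Longrightarrow> 2 \<le> k \<Longrightarrow> s \<le> 71111/100000 * real (k + 1)"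
  using pot_root_le[of k s] crt_pos[of s] root_of_size_ge_half[of k s] by (simp add: pot_def)

section \<open>Bounds for the typical rate\<close>
subsection \<open>From below\<close>

text \<open>The contribution \<open>2 \<Sigma> / ((n+1) (n+2) (n+3))\<close> of a row, rounded down to a multiple of \<open>10\<^sup>-\<^sup>1\<^sup>1\<close>.\<close>

definition row_weight :: "nat \<times> int \<times> int list \<Rightarrow> int" where
  "row_weight r = (2000000 * fold_row r) div (int (fst r + 1) * int (fst r + 2) * int (fst r + 3))"

text \<open>The contribution to the typical rate of the nodes with \<open>n\<close> proper descendants.\<close>

abbreviation level_share :: "nat \<Rightarrow> real" where
  "level_share n \<equiv> 2 * (mean_toll n / (real (n + 2) * real (n + 3)))"

lemma row_weight_bounds:
  defines "N \<equiv> \<lambda>n. real (n + 1) * real (n + 2) * real (n + 3)"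
  shows "real_of_int (row_weight (n, v, vs)) / 10^11 \<le> 2 * milli (fold_row (n, v, vs)) / N n"
    "2 * milli (fold_row (n, v, vs)) / N n \<le> real_of_int (row_weight (n, v, vs) + 1) / 10^11"
proof -
  define d where "d = int (n + 1) * int (n + 2) * int (n + 3)"
  define m where "m = 2000000 * fold_row (n, v, vs)"
  have w: "row_weight (n, v, vs) = m div d" by (simp add: row_weight_def m_def d_def)
  have dN: "real_of_int d = N n" by (simp add: d_def N_def)
  have d0: "0 < d" by (simp add: d_def)
  have M: "2 * milli (fold_row (n, v, vs)) = real_of_int m / 10^11" by (simp add: m_def milli_def)
  have e: "2 * milli (fold_row (n, v, vs)) / N n = real_of_int m / real_of_int d / 10^11"
    unfolding M dN by simp
  have "real_of_int (m div d) \<le> real_of_int m / real_of_int d" by (rule real_of_int_div4)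
  then show "real_of_int (row_weight (n, v, vs)) / 10^11 \<le> 2 * milli (fold_row (n, v, vs)) / N n"
    unfolding w e by (intro divide_right_mono) auto
  have "real_of_int m / real_of_int d \<le> real_of_int (m div d + 1)"
    using real_of_int_div2[of m d] real_of_int_div3[of m d] by simp
  then show "2 * milli (fold_row (n, v, vs)) / N n \<le> real_of_int (row_weight (n, v, vs) + 1) / 10^11"
    unfolding w e by (intro divide_right_mono) auto
qed

lemma level_share_eq:
  "level_share n = 2 * (real (Suc n) * mean_toll n) / (real (n + 1) * real (n + 2) * real (n + 3))"
proof -
  have "2 * (m / (x * y)) = 2 * (c * m) / (c * x * y)" if "0 < c" for m x y c :: real using that by simp
  from this[of "real (n + 1)" "mean_toll n"] show ?thesis by (simp only: Suc_eq_plus1)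
qed

lemma share_lower_row:
  assumes row: "low_mean_row high_table (n, v, vs)" and n: "n \<le> 19"
  shows "real_of_int (row_weight (n, v, vs)) / 10^11 \<le> level_share n"
proof -
  have len: "length high_table = 21" by (simp add: high_table_def)
  have "milli (fold_row (n, v, vs)) \<le> (\<Sum>p\<le>n. toll (milli (high_table ! p)) (milli (high_table ! (n - p))))"
    by (rule low_mean_row_sound[OF row]) (use n in \<open>auto simp: len high_table_def[THEN arg_cong[where f = "\<lambda>L. L ! 0"]]\<close>)
  also have "\<dots> \<le> real (Suc n) * mean_toll n"
    using n by (intro mean_toll_ge root_le_high_table) auto
  finally have le: "milli (fold_row (n, v, vs)) \<le> real (Suc n) * mean_toll n" .
  have "real_of_int (row_weight (n, v, vs)) / 10^11 \<le> 2 * milli (fold_row (n, v, vs)) / (real (n + 1) * real (n + 2) * real (n + 3))"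
    by (rule row_weight_bounds(1))
  also have "\<dots> \<le> level_share n" unfolding level_share_eq using le by (intro divide_right_mono mult_left_mono) auto
  finally show ?thesis .
qed

lemma sum_rows_lower:
  assumes "list_all (low_mean_row high_table) rs" "map fst rs = [a..<b]" "b \<le> 20"
  shows "real_of_int (sum_list (map row_weight rs)) / 10^11 \<le> (\<Sum>n\<in>{a..<b}. level_share n)"
proof -
  have "(\<Sum>n\<in>{a..<b}. level_share n) = sum_list (map level_share (map fst rs))"
    unfolding assms(2) by (simp only: sum_set_upt_conv_sum_list_nat[symmetric] set_upt)
  also have "\<dots> = sum_list (map (\<lambda>r. level_share (fst r)) rs)" by (simp add: o_def)
  finally have e: "(\<Sum>n\<in>{a..<b}. level_share n) = sum_list (map (\<lambda>r. level_share (fst r)) rs)" .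
  have "sum_list (map (\<lambda>r. real_of_int (row_weight r) / 10^11) rs) \<le> sum_list (map (\<lambda>r. level_share (fst r)) rs)"
  proof (rule sum_list_mono)
    fix r assume r: "r \<in> set rs"
    obtain n v vs where nv: "r = (n, v, vs)" by (cases r)
    have "n \<in> set (map fst rs)" using r nv by force
    then have "n < b" unfolding assms(2) by simp
    moreover have "low_mean_row high_table r" using assms(1) r by (simp add: list_all_iff)
    ultimately show "real_of_int (row_weight r) / 10^11 \<le> level_share (fst r)"
      unfolding nv fst_conv using assms(3) by (intro share_lower_row) auto
  qed
  moreover have "sum_list (map (\<lambda>r. real_of_int (row_weight r) / 10^11) rs) = real_of_int (sum_list (map row_weight rs)) / 10^11"
    by (induction rs) (auto simp: add_divide_distrib)
  ultimately show ?thesis unfolding e by simp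
qed

definition block_ok :: "nat \<times> nat \<times> int \<Rightarrow> bool" where
  "block_ok = (\<lambda>(a, b, V). lower_ok (35556 * int (b + 1)) (35556 * int (b + 1)) V)"

lemma blocks_ok: "list_all block_ok toll_blocks" by code_simp

lemma root_le_linear_all: assumes "root_of_size k s" shows "s \<le> 71111/100000 * real (k + 1)"
proof -
  consider "k = 0" | "k = 1" | "2 \<le> k" by linarith
  then show ?thesis
    using assms root_of_size_0[of s] root_of_size_1[of s] root_le_linear[of k s] by cases auto
qed

text \<open>Roots of the two subtrees add up to at most \<open>.71111 (j + 2)\<close>, and for a given sum the toll is smallest in the
balanced case.\<close>

lemma block_mean_toll:
  assumes ok: "block_ok (a, b, V)" and j: "j < b"
  shows "milli V \<le> mean_toll j"
proof -
  define S where "S = 35556 * int (b + 1)"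
  have l: "lower_ok S S V" using ok by (simp add: block_ok_def S_def)
  then have S0: "0 < S" by (simp add: lower_ok_def)
  have V: "milli V \<le> toll s t" if st: "root_of_size p s" "root_of_size (j - p) t" and p: "p \<le> j" for p s t
  proof -
    have st0: "0 \<le> s" "0 \<le> t" using st by (auto intro: root_of_size_nonneg)
    have "s + t \<le> 71111/100000 * real (p + 1) + 71111/100000 * real (j - p + 1)"
      using root_le_linear_all[OF st(1)] root_le_linear_all[OF st(2)] by linarith
    also have "\<dots> = 71111/100000 * real (j + 2)"
    proof -
      have "real (p + 1) + real (j - p + 1) = real (j + 2)" using p by simp
      then show ?thesis by (simp only: distrib_left[symmetric])
    qed
    also have "\<dots> \<le> 71112/100000 * real (b + 1)" using j by (intro mult_mono) auto
    also have "\<dots> = 2 * milli S" by (simp add: S_def milli_def)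
    finally have h: "(s + t) / 2 \<le> milli S" by simp
    have "milli V \<le> toll (milli S) (milli S)" by (rule lower_ok[OF l])
    also have "\<dots> \<le> toll ((s + t) / 2) ((s + t) / 2)" using h st0 by (intro toll_antimono) auto
    also have "\<dots> \<le> toll s t" using st0 by (rule toll_balanced_le)
    finally show ?thesis .
  qed
  have "milli V = (\<Sum>p\<le>j. milli V) / real (Suc j)" by simp
  also have "\<dots> \<le> mean_toll j" unfolding mean_toll_def
  proof (intro divide_right_mono sum_mono)
    fix p assume "p \<in> {..j}"
    then have "pair_mean p (j - p) (\<lambda>_ _. milli V) \<le> pair_mean p (j - p) toll" by (intro pair_mean_mono V) auto
    then show "milli V \<le> pair_mean p (j - p) toll" by (simp add: pair_mean_const)
  qed simp
  finally show ?thesis .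
qed

text \<open>Since \<open>1 / ((j + 2) (j + 3)) = 1 / (j + 2) - 1 / (j + 3)\<close>.\<close>

lemma telescope_share:
  assumes "a \<le> b"
  shows "(\<Sum>j\<in>{a..<b}. 2 * (c / (real (j + 2) * real (j + 3)))) = 2 * c * (1 / real (a + 2) - 1 / real (b + 2))"
  using assms
proof (induction b rule: dec_induct)
  case (step n)
  have "c / (real (n + 2) * real (n + 3)) = c * (1 / real (n + 2) - 1 / real (Suc n + 2))" by (simp add: field_simps)
  moreover have "2 * c * (x - y) + 2 * (c * (y - z)) = 2 * c * (x - z)" for x y z by (simp add: algebra_simps)
  ultimately show ?case using step by (simp only: sum.atLeastLessThan_Suc)
qed simp

fun blocks_cover :: "nat \<Rightarrow> (nat \<times> nat \<times> int) list \<Rightarrow> bool" where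
  "blocks_cover a ((a', b, V) # bs) \<longleftrightarrow> a = a' \<and> a \<le> b \<and> blocks_cover b bs"
| "blocks_cover a [] \<longleftrightarrow> True"

lemma sum_blocks_lower:
  assumes "list_all block_ok bs" "blocks_cover a bs"
  shows "(\<Sum>(a, b, V)\<leftarrow>bs. 2 * milli V * (1 / real (a + 2) - 1 / real (b + 2)))
    \<le> (\<Sum>j\<in>{a..<a + (\<Sum>(a, b, V)\<leftarrow>bs. b - a)}. level_share j)"
  using assms
proof (induction a bs rule: blocks_cover.induct)
  case (1 a a' b V bs)
  then have ab: "a \<le> b" "a' = a" by auto
  define e where "e = (\<Sum>(a, b, V)\<leftarrow>bs. b - a)"
  have "(\<Sum>j\<in>{a..<b + e}. level_share j) = (\<Sum>j\<in>{a..<b}. level_share j) + (\<Sum>j\<in>{b..<b + e}. level_share j)"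
    using ab by (simp add: sum.atLeastLessThan_concat)
  moreover have "2 * milli V * (1 / real (a + 2) - 1 / real (b + 2)) \<le> (\<Sum>j\<in>{a..<b}. level_share j)"
    unfolding telescope_share[OF ab(1), symmetric]
    using 1 ab by (intro sum_mono mult_left_mono divide_right_mono block_mean_toll) auto
  moreover have "(\<Sum>(a, b, V)\<leftarrow>bs. 2 * milli V * (1 / real (a + 2) - 1 / real (b + 2))) \<le> (\<Sum>j\<in>{b..<b + e}. level_share j)"
    using 1 unfolding e_def by simp
  moreover have "a + (\<Sum>(a, b, V)\<leftarrow>(a', b, V) # bs. b - a) = b + e" using ab by (simp add: e_def)
  ultimately show ?case using ab by (simp only: list.map sum_list.Cons split: prod.split) simp
qed simp

lemma mean_toll_0: "mean_toll 0 = 1"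
  by (simp add: mean_toll_def pair_mean_def toll_0_0)

lemma high_toll_rows_total: "map fst high_toll_rows = [1..<20]" "35000000000 \<le> sum_list (map row_weight high_toll_rows)"
  by code_simp+

text \<open>The terms up to 19 come from the table, those up to 699 from the blocks, the others are non-negative.\<close>

lemma typ_rate_ge: "69953/100000 \<le> typ_rate"
proof -
  have r: "350/1000 \<le> (\<Sum>n\<in>{1..<20}. level_share n)"
  proof -
    have "35000000000 / 10^11 \<le> real_of_int (sum_list (map row_weight high_toll_rows)) / 10^11"
      using of_int_le_iff[where 'a = real, THEN iffD2, OF high_toll_rows_total(2)] by (intro divide_right_mono) auto
    also have "\<dots> \<le> (\<Sum>n\<in>{1..<20}. level_share n)"
      by (rule sum_rows_lower[OF high_toll_rows_ok high_toll_rows_total(1)]) simp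
    finally show ?thesis by simp
  qed
  have b: "17/1000 \<le> (\<Sum>n\<in>{20..<700}. level_share n)"
  proof -
    have c: "blocks_cover 20 toll_blocks" "(\<Sum>(a, b, V)\<leftarrow>toll_blocks. b - a) = 680" by code_simp+
    have "17/1000 \<le> (\<Sum>(a, b, V)\<leftarrow>toll_blocks. 2 * milli V * (1 / real (a + 2) - 1 / real (b + 2)))"
      by (simp add: toll_blocks_def milli_def)
    also have "\<dots> \<le> (\<Sum>n\<in>{20..<700}. level_share n)" using sum_blocks_lower[OF blocks_ok c(1)] c(2) by simp
    finally show ?thesis .
  qed
  have "(\<Sum>n<700. level_share n) = level_share 0 + ((\<Sum>n\<in>{1..<20}. level_share n) + (\<Sum>n\<in>{20..<700}. level_share n))"
    by (subst sum.atLeastLessThan_concat, simp, simp, subst lessThan_atLeast0, subst sum.atLeast_Suc_lessThan, simp, simp only: One_nat_def)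
  then have "1/3 + (350/1000 + 17/1000) \<le> (\<Sum>n<700. level_share n)" using r b by (simp add: mean_toll_0)
  also have "\<dots> \<le> typ_rate"
  proof -
    have "(\<Sum>n<700. level_share n) = 2 * (\<Sum>n<700. mean_toll n / (real (n + 2) * real (n + 3)))" by (rule sum_distrib_left[symmetric])
    also have "\<dots> \<le> typ_rate" unfolding typ_rate_def
      using mean_toll_bounds by (intro mult_left_mono sum_le_suminf mean_toll_summable) auto
    finally show ?thesis .
  qed
  finally show ?thesis by simp
qed

subsection \<open>From above\<close>

lemma length_low_table: "length low_table = 71"
  by (simp add: low_table_def)

lemma low_rows: assumes "1 \<le> n" "n < 70" shows "lower_row low_table n"
proof -
  have "[1..<70] = [1..<35] @ [35..<50] @ [50..<61] @ [61..<70]" by code_simp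
  then have "list_all (lower_row low_table) [1..<70]"
    using low_rows_1 low_rows_2 low_rows_3 low_rows_4 by (simp only: list_all_append)
  moreover have "n \<in> set [1..<70]" unfolding set_upt atLeastLessThan_iff using assms by blast
  ultimately show ?thesis unfolding list_all_iff by blast
qed

lemma low_table_le_root: "root_of_size k s \<Longrightarrow> k \<le> 70 \<Longrightarrow> milli (low_table ! k) \<le> s"
proof (rule lower_table_sound)
  show "lower_row low_table n" if "1 \<le> n" "Suc n < length low_table" for n
    using that by (intro low_rows) (auto simp: length_low_table)
qed (auto simp: low_table_def)

lemma share_upper_row:
  assumes row: "upper_row low_table (n, v, vs)" and n: "n < 70"
  shows "level_share n \<le> real_of_int (row_weight (n, v, vs) + 1) / 10^11"
proof -
  have nn: "0 \<le> milli (low_table ! k)" if "k \<le> 70" for k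
  proof (cases "k = 0")
    case True
    then show ?thesis by (simp add: low_table_def milli_def)
  next
    case False
    have "list_all (\<lambda>S. 0 \<le> S) low_table" by code_simp
    then show ?thesis using that by (intro milli_nonneg) (simp add: list_all_length length_low_table)
  qed
  have "real (Suc n) * mean_toll n \<le> (\<Sum>p\<le>n. toll (milli (low_table ! p)) (milli (low_table ! (n - p))))"
    using n by (intro mean_toll_le low_table_le_root nn) auto
  also have "\<dots> \<le> milli (fold_row (n, v, vs))"
    by (rule upper_row_sound[OF row]) (use n in \<open>auto simp: length_low_table low_table_def[THEN arg_cong[where f = "\<lambda>L. L ! 0"]]\<close>)
  finally have "level_share n \<le> 2 * milli (fold_row (n, v, vs)) / (real (n + 1) * real (n + 2) * real (n + 3))"
    unfolding level_share_eq by (intro divide_right_mono mult_left_mono) auto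
  also have "\<dots> \<le> real_of_int (row_weight (n, v, vs) + 1) / 10^11" by (rule row_weight_bounds(2))
  finally show ?thesis .
qed

lemma sum_rows_upper:
  assumes "list_all (upper_row low_table) rs" "map fst rs = [a..<b]" "b \<le> 70"
  shows "(\<Sum>n\<in>{a..<b}. level_share n) \<le> real_of_int (sum_list (map (\<lambda>r. row_weight r + 1) rs)) / 10^11"
proof -
  have "(\<Sum>n\<in>{a..<b}. level_share n) = sum_list (map level_share (map fst rs))"
    unfolding assms(2) by (simp only: sum_set_upt_conv_sum_list_nat[symmetric] set_upt)
  also have "\<dots> = sum_list (map (\<lambda>r. level_share (fst r)) rs)" by (simp add: o_def)
  also have "\<dots> \<le> sum_list (map (\<lambda>r. real_of_int (row_weight r + 1) / 10^11) rs)"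
  proof (rule sum_list_mono)
    fix r assume r: "r \<in> set rs"
    obtain n v vs where nv: "r = (n, v, vs)" by (cases r)
    have "n \<in> set (map fst rs)" using r nv by force
    then have "n < b" unfolding assms(2) by simp
    moreover have "upper_row low_table r" using assms(1) r by (simp add: list_all_iff)
    ultimately show "level_share (fst r) \<le> real_of_int (row_weight r + 1) / 10^11"
      unfolding nv fst_conv using assms(3) by (intro share_upper_row) auto
  qed
  also have "\<dots> = real_of_int (sum_list (map (\<lambda>r. row_weight r + 1) rs)) / 10^11"
    by (induction rs) (auto simp: add_divide_distrib)
  finally show ?thesis .
qed

lemma toll_rows_ok: "list_all (upper_row low_table) (toll_rows_1 @ toll_rows_2 @ toll_rows_3 @ toll_rows_4 @ toll_rows_5)"
  by (simp only: list_all_append toll_rows_1_ok toll_rows_2_ok toll_rows_3_ok toll_rows_4_ok toll_rows_5_ok)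

lemma toll_rows_total:
  "map fst (toll_rows_1 @ toll_rows_2 @ toll_rows_3 @ toll_rows_4 @ toll_rows_5) = [1..<70]"
  "sum_list (map (\<lambda>r. row_weight r + 1) (toll_rows_1 @ toll_rows_2 @ toll_rows_3 @ toll_rows_4 @ toll_rows_5)) \<le> 36871410000"
  by code_simp+

lemma head_upper: "(\<Sum>n<70. level_share n) \<le> 1/3 + 36871410000 / 10^11"
proof -
  have "(\<Sum>n\<in>{1..<70}. level_share n) \<le> real_of_int (sum_list (map (\<lambda>r. row_weight r + 1)
      (toll_rows_1 @ toll_rows_2 @ toll_rows_3 @ toll_rows_4 @ toll_rows_5))) / 10^11"
    by (rule sum_rows_upper[OF toll_rows_ok toll_rows_total(1)]) simp
  also have "\<dots> \<le> 36871410000 / 10^11"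
    using of_int_le_iff[where 'a = real, THEN iffD2, OF toll_rows_total(2)] by (intro divide_right_mono) auto
  finally have le: "(\<Sum>n\<in>{1..<70}. level_share n) \<le> 36871410000 / 10^11" .
  have "(\<Sum>n<70. level_share n) = level_share 0 + (\<Sum>n\<in>{1..<70}. level_share n)"
    by (simp only: lessThan_atLeast0 sum.atLeast_Suc_lessThan[of 0 70] One_nat_def)
  then show ?thesis using le by (simp add: mean_toll_0)
qed

text \<open>The excess over the linear bound \<open>.6975 (a + 1)\<close> that a subtree with fewer than 30 nodes lacks is supplied by its toll
with any large tree.\<close>

lemma caterpillar_ok: "list_all (\<lambda>a. lower_inf_ok (low_table ! a) (69750 * int (a + 1) - low_table ! a) \<and> low_table ! a \<le> 5000000) [1..<30]"
  by code_simp

lemma low_table_linear: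
  "list_all (\<lambda>k. 69750 * int (k + 1) \<le> low_table ! k) [30..<71]"
  "list_all (\<lambda>k. 69750 * int k + 34875 \<le> low_table ! k) [3..<30]"
  "list_all (\<lambda>k. low_table ! 68 \<le> low_table ! k) [68..<71]"
  by code_simp+

lemma list_all_upt: "list_all P [a..<b] \<Longrightarrow> a \<le> k \<Longrightarrow> k < b \<Longrightarrow> P k"
  by (simp add: list_all_iff)

text \<open>Up to 70 nodes by the table. In a larger tree, a smaller subtree with at least 30 nodes is covered by induction, one with
1 to 29 nodes by \<open>caterpillar_ok\<close>, and an empty one by its toll of at least \<open>7/10\<close>.\<close>

lemma root_ge_linear:
  "root_of_size k s \<Longrightarrow> 30 \<le> k \<Longrightarrow> 6975/10000 * real (k + 1) \<le> s"
proof (induction rule: root_of_size.induct)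
  case (node p s q t)
  let ?c = "6975/10000 :: real"
  let ?P = "\<lambda>p q s t. (30 \<le> p \<longrightarrow> ?c * real (p + 1) \<le> s) \<longrightarrow> (30 \<le> q \<longrightarrow> ?c * real (q + 1) \<le> t) \<longrightarrow>
    30 \<le> Suc (p + q) \<longrightarrow> ?c * real (Suc (p + q) + 1) \<le> join_root s t"
  have "?P p q s t"
  proof (rule node_cases[of ?P])
    fix p q s t assume pq: "p \<le> q" and st: "root_of_size p s" "root_of_size q t"
    show "?P p q s t"
    proof (intro impI)
      assume IHs: "30 \<le> p \<longrightarrow> ?c * real (p + 1) \<le> s" and IHt: "30 \<le> q \<longrightarrow> ?c * real (q + 1) \<le> t"
        and k: "30 \<le> Suc (p + q)"
      have st0: "0 \<le> s" "0 \<le> t" using st by (auto intro: root_of_size_nonneg)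
      show "?c * real (Suc (p + q) + 1) \<le> join_root s t"
      proof (cases "Suc (p + q) \<le> 70")
        case True
        have "69750 * int (Suc (p + q) + 1) \<le> low_table ! Suc (p + q)"
          by (rule list_all_upt[OF low_table_linear(1)]) (use True k in auto)
        then have "milli (69750 * int (Suc (p + q) + 1)) \<le> milli (low_table ! Suc (p + q))" by (rule milli_mono)
        also have "\<dots> \<le> join_root s t" using True st by (intro low_table_le_root root_of_size.node)
        finally show ?thesis by (simp add: milli_def)
      next
        case False
        then have q: "35 \<le> q" using pq by linarith
        have t: "?c * real (q + 1) \<le> t" using IHt q by simp
        have t36: "?c * 36 \<le> t" using t q by (intro order_trans[OF _ t] mult_left_mono) auto
        have main: "?c * real (p + 1) \<le> s + toll s t"
        proof -
          consider "p = 0" | "1 \<le> p" "p < 30" | "30 \<le> p" by linarith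
          then show ?thesis
          proof cases
            case 1
            then have "s = 0" using st root_of_size_0 by simp
            then show ?thesis using 1 toll_0_ge[OF st0(2)] by simp
          next
            case 2
            define l where "l = low_table ! p"
            have ok: "lower_inf_ok l (69750 * int (p + 1) - l)" "l \<le> 5000000"
              using list_all_upt[OF caterpillar_ok 2] by (simp_all add: l_def)
            then have l0: "0 < l" by (simp add: lower_inf_ok_def)
            have ls: "milli l \<le> s" unfolding l_def using 2 st by (intro low_table_le_root) auto
            have "milli l \<le> milli 5000000" using ok by (intro milli_mono)
            then have l2: "milli l \<le> 2 * t" using t36 by (simp add: milli_def)
            have "milli (69750 * int (p + 1) - l) \<le> toll (milli l) t" by (rule lower_inf_ok[OF ok(1) l2])
            then have "milli (69750 * int (p + 1)) + t \<le> join_root (milli l) t" by (simp add: join_root_def milli_diff)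
            also have "\<dots> \<le> join_root s t" using ls l0 st0 by (intro join_root_mono) (auto simp: milli_nonneg)
            finally show ?thesis by (simp add: join_root_def milli_def)
          next
            case 3
            then show ?thesis using IHs toll_nonneg[OF st0] by simp
          qed
        qed
        have "real (Suc (p + q) + 1) = real (p + 1) + real (q + 1)" by simp
        then have "?c * real (Suc (p + q) + 1) = ?c * real (p + 1) + ?c * real (q + 1)" by (simp only: distrib_left)
        then show ?thesis using main t by (simp add: join_root_def)
      qed
    qed
  qed (use node in \<open>auto simp: join_root_commute add.commute\<close>)
  then show ?case using node by auto
qed simp

text \<open>Using \<open>k + 1/2\<close> in place of \<open>k + 1\<close> extends the linear bound from 30 down to 3 nodes, and makes the points at
which the cube root is evaluated the midpoints of unit intervals.\<close>

definition low_root :: "nat \<Rightarrow> real" where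
  "low_root k = (if k \<le> 2 then milli (low_table ! k) else 6975/10000 * (real k + 1/2))"

lemma low_root_le: "root_of_size k s \<Longrightarrow> low_root k \<le> s"
proof -
  assume r: "root_of_size k s"
  consider "k \<le> 2" | "3 \<le> k" "k < 30" | "30 \<le> k" by linarith
  then show ?thesis
  proof cases
    case 1
    then show ?thesis using r low_table_le_root[of k s] by (simp add: low_root_def)
  next
    case 2
    have "69750 * int k + 34875 \<le> low_table ! k" by (rule list_all_upt[OF low_table_linear(2) 2])
    then have "milli (69750 * int k + 34875) \<le> milli (low_table ! k)" by (rule milli_mono)
    also have "\<dots> \<le> s" using r 2 by (intro low_table_le_root) auto
    finally show ?thesis using 2 by (simp add: low_root_def milli_def)
  next
    case 3
    then show ?thesis using root_ge_linear[OF r] by (simp add: low_root_def)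
  qed
qed

lemma low_root_small: "low_root 0 = 0" "low_root 1 = 1" "low_root 2 = 177374/100000"
  by (simp_all add: low_root_def low_table_def milli_def)

lemma low_root_nonneg: "0 \<le> low_root k"
proof -
  consider "k = 0" | "k = 1" | "k = 2" | "3 \<le> k" by linarith
  then show ?thesis
  proof cases
    case 4
    then show ?thesis by (simp add: low_root_def)
  qed (simp_all add: low_root_def low_table_def milli_def)
qed

lemma end_tolls_ok: "upper0_ok 4826866 70883 \<and> upper_ok 100000 4826866 40092 \<and> upper_ok 177374 4826866 33935"
  by code_simp

text \<open>For the smallest subtrees the cube root is a poor approximation, so they are treated separately.\<close>

lemma end_toll_le:
  assumes "68 \<le> q" "root_of_size q t"
  shows "toll 0 t \<le> 70883/100000" "toll 1 t \<le> 40092/100000" "toll (177374/100000) t \<le> 33935/100000"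
proof -
  have l: "low_table ! 68 = 4826866" by (simp add: low_table_def)
  have t: "milli 4826866 \<le> t"
  proof (cases "q \<le> 70")
    case True
    have "low_table ! 68 \<le> low_table ! q" by (rule list_all_upt[OF low_table_linear(3)]) (use assms True in auto)
    then have "milli 4826866 \<le> milli (low_table ! q)" unfolding l by (rule milli_mono)
    also have "\<dots> \<le> t" using assms True by (intro low_table_le_root)
    finally show ?thesis .
  next
    case False
    have "6975/10000 * 72 \<le> 6975/10000 * real (q + 1)" using False by (intro mult_left_mono) auto
    also have "\<dots> \<le> t" using assms False by (intro root_ge_linear) auto
    finally show ?thesis by (simp add: milli_def)
  qed
  have "toll 0 t \<le> toll 0 (milli 4826866)" "toll 1 t \<le> toll 1 (milli 4826866)"
    "toll (177374/100000) t \<le> toll (177374/100000) (milli 4826866)"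
    using t by (auto intro!: toll_antimono simp: milli_nonneg)
  moreover have "toll 0 (milli 4826866) \<le> milli 70883" "toll (milli 100000) (milli 4826866) \<le> milli 40092"
    "toll (milli 177374) (milli 4826866) \<le> milli 33935"
    using end_tolls_ok by (auto intro: upper0_ok upper_ok)
  ultimately show "toll 0 t \<le> 70883/100000" "toll 1 t \<le> 40092/100000" "toll (177374/100000) t \<le> 33935/100000"
    by (simp_all add: milli_def)
qed

text \<open>With \<open>x = X\<^sup>3\<close> and \<open>y = Y\<^sup>3 = 1 - x\<close>, this separates the density \<open>(x y)\<^sup>-\<^sup>1\<^sup>/\<^sup>3\<close> into functions
that are easily summed. Numerically, .968 is slightly less than the best constant that the last term with the coefficient .16 admits. In terms of \<open>e = X + Y\<close> and \<open>w = X Y\<close>, which satisfy \<open>e\<^sup>3 = 1 + 3 w e\<close>, it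
becomes an inequality in the single variable \<open>d = e - 1\<close>.\<close>

lemma beta_density_bound:
  fixes X Y :: real
  assumes XY: "0 < X" "0 < Y" "X ^ 3 + Y ^ 3 = 1"
  shows "1 / (X * Y) \<le> 1 / X + 1 / Y - 968/1000 + 16/100 * (X * Y) ^ 3"
proof -
  define e w where "e = X + Y" and "w = X * Y"
  have w: "0 < w" using XY by (simp add: w_def)
  have rel: "e ^ 3 = 1 + 3 * w * e"
    using XY(3) by (simp add: e_def w_def power3_eq_cube algebra_simps)
  have e0: "0 < e" using XY by (simp add: e_def)
  have "0 < w * e" using w e0 by simp
  then have "1 ^ 3 < e ^ 3" unfolding rel by (simp add: mult.assoc)
  then have e1: "1 < e" using e0 power_le_one[of e 3] by (cases "e \<le> 1") auto
  define d where "d = e - 1"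
  have d: "0 < d" "e = 1 + d" using e1 by (simp_all add: d_def)
  define m where "m = d\<^sup>2 / e"
  have m: "0 \<le> m" using e0 by (simp add: m_def)
  have wd: "w = d * (1 + m / 3)"
  proof -
    have "3 * e * w = 3 * e * (d * (1 + m / 3))"
    proof -
      have "3 * e * w = e ^ 3 - 1" using rel by simp
      also have "\<dots> = d * (3 * e + d\<^sup>2)" unfolding d(2) by (simp add: power2_eq_square power3_eq_cube algebra_simps)
      also have "\<dots> = 3 * e * (d * (1 + m / 3))" using e0 by (simp add: m_def field_simps)
      finally show ?thesis .
    qed
    then show ?thesis using e0 by simp
  qed
  have "0 \<le> 32/1000 - 968/3000 * m + 16/100 * d ^ 3 * (1 + 4 * (m / 3))"
  proof -
    \<comment> \<open>The minimum of the polynomial in d lies near 52/100. The first three squares estimate the higher powers of d by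
      their tangents there, and the last one the remaining quadratic polynomial.\<close>
    have a: "0 \<le> d * (d - 52/100)\<^sup>2" "0 \<le> (d\<^sup>2 - 2704/10000)\<^sup>2" "0 \<le> d * (d\<^sup>2 - 2704/10000)\<^sup>2"
      "0 \<le> (d - 58/100)\<^sup>2" using d by auto
    have "0 \<le> 32/1000 * (1 + d) - 968/3000 * d\<^sup>2 + 16/100 * d ^ 3 * (1 + d) + 64/300 * d ^ 5"
    proof -
      define d2 d3 d4 d5 where "d2 = d * d" and "d3 = d * d2" and "d4 = d * d3" and "d5 = d * d4"
      have "0 \<le> d3 - 104/100 * d2 + 2704/10000 * d"
        using a(1) by (simp add: d2_def d3_def power2_eq_square algebra_simps)
      moreover have "0 \<le> d4 - 5408/10000 * d2 + 7311616/100000000"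
        using a(2) by (simp add: d2_def d3_def d4_def power2_eq_square algebra_simps)
      moreover have "0 \<le> d5 - 5408/10000 * d3 + 7311616/100000000 * d"
        using a(3) by (simp add: d2_def d3_def d4_def d5_def power2_eq_square algebra_simps)
      moreover have "0 \<le> d2 - 116/100 * d + 3364/10000"
        using a(4) by (simp add: d2_def power2_eq_square algebra_simps)
      ultimately have "0 \<le> 32/1000 + 32/1000 * d - 968/3000 * d2 + 16/100 * d3 + 16/100 * d4 + 64/300 * d5"
        using d(1) by linarith
      also have "\<dots> = 32/1000 * (1 + d) - 968/3000 * d\<^sup>2 + 16/100 * d ^ 3 * (1 + d) + 64/300 * d ^ 5"
        by (simp add: d2_def d3_def d4_def d5_def eval_nat_numeral algebra_simps add_divide_distrib)
      finally show ?thesis .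
    qed
    also have "\<dots> = e * (32/1000 - 968/3000 * m + 16/100 * d ^ 3 * (1 + 4 * (m / 3)))"
    proof -
      have em: "e * m = d\<^sup>2" using e0 by (simp add: m_def)
      have "e * (32/1000 - 968/3000 * m + 16/100 * d ^ 3 * (1 + 4 * (m / 3)))
        = 32/1000 * e - 968/3000 * (e * m) + 16/100 * d ^ 3 * e + 64/300 * d ^ 3 * (e * m)"
        by (simp add: algebra_simps)
      then show ?thesis unfolding em unfolding d(2) by (simp add: power2_eq_square eval_nat_numeral)
    qed
    finally show ?thesis using e0 by (simp add: zero_le_mult_iff)
  qed
  moreover have "1 + 4 * (m / 3) \<le> (1 + m / 3) ^ 4" using Bernoulli_inequality[of "m / 3" 4] m by simp
  then have "16/100 * d ^ 3 * (1 + 4 * (m / 3)) \<le> 16/100 * d ^ 3 * (1 + m / 3) ^ 4"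
    using d by (intro mult_left_mono) auto
  ultimately have "0 \<le> 32/1000 - 968/3000 * m + 16/100 * d ^ 3 * (1 + m / 3) ^ 4" by linarith
  then have "0 \<le> d * (32/1000 - 968/3000 * m + 16/100 * d ^ 3 * (1 + m / 3) ^ 4)" using d by simp
  also have "\<dots> = e - 1 - 968/1000 * w + 16/100 * w ^ 4"
  proof -
    have "d * (32/1000 - 968/3000 * m + 16/100 * d ^ 3 * k) = 1 + d - 1 - 968/1000 * (d * (1 + m / 3)) + 16/100 * (d ^ 4 * k)" for k
      by (simp add: eval_nat_numeral algebra_simps add_divide_distrib)
    then show ?thesis unfolding wd power_mult_distrib unfolding d(2) .
  qed
  finally have "1 \<le> e - 968/1000 * w + 16/100 * w ^ 4" by simp
  then have "1 / w \<le> (e - 968/1000 * w + 16/100 * w ^ 4) / w" using w by (intro divide_right_mono) auto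
  also have "\<dots> = e / w - 968/1000 + 16/100 * w ^ 3"
    using w by (simp add: add_divide_distrib diff_divide_distrib eval_nat_numeral)
  also have "e / w = 1 / X + 1 / Y" using XY by (simp add: e_def w_def field_simps)
  finally show ?thesis by (simp add: w_def)
qed

text \<open>The midpoint rule for the convex function \<open>x\<^sup>-\<^sup>1\<^sup>/\<^sup>3\<close>, in terms of the half sum \<open>m\<close> and the half difference
\<open>h\<close> of the cube roots at the ends.\<close>

lemma midpoint_third:
  assumes "0 \<le> x"
  shows "1 / root 3 (x + 1/2) \<le> 3/2 * ((root 3 (x + 1))\<^sup>2 - (root 3 x)\<^sup>2)"
proof -
  define A B M where "A = root 3 (x + 1)" and "B = root 3 x" and "M = root 3 (x + 1/2)"
  have c: "A ^ 3 = x + 1" "B ^ 3 = x" "M ^ 3 = x + 1/2" by (simp_all add: A_def B_def M_def root3_cube)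
  have p: "0 < A" "0 \<le> B" "0 < M" "B < A" using assms by (auto simp: A_def B_def M_def)
  define m h where "m = (A + B) / 2" and "h = (A - B) / 2"
  have mh: "0 < m" "0 \<le> h" "h \<le> m" using p by (auto simp: m_def h_def)
  have M3: "M ^ 3 = m ^ 3 + 3 * m * h\<^sup>2"
    using c unfolding m_def h_def by (simp add: power2_eq_square power3_eq_cube field_simps)
  have one: "1 = 2 * h * (3 * m\<^sup>2 + h\<^sup>2)"
    using c unfolding m_def h_def by (simp add: power2_eq_square power3_eq_cube field_simps)
  have h0: "0 < h" using one mh by (cases "h = 0") auto
  have le: "3 * m\<^sup>2 + h\<^sup>2 \<le> 3 * m * M"
  proof (rule cube_leD)
    define u where "u = h\<^sup>2"
    have u: "0 \<le> u" "u \<le> m\<^sup>2" using mh by (auto simp: u_def intro: power_mono)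
    have "u ^ 3 \<le> m\<^sup>2 * m\<^sup>2 * u" "u\<^sup>2 \<le> m\<^sup>2 * u"
      using u by (auto simp: power3_eq_cube power2_eq_square intro!: mult_mono)
    then have "9 * m\<^sup>2 * u\<^sup>2 \<le> 9 * m\<^sup>2 * (m\<^sup>2 * u)" by (intro mult_left_mono) auto
    have "(3 * m\<^sup>2 + u) ^ 3 = 27 * (m\<^sup>2 * m\<^sup>2 * m\<^sup>2) + 27 * (m\<^sup>2 * m\<^sup>2 * u) + 9 * m\<^sup>2 * u\<^sup>2 + u ^ 3"
      by (simp add: power2_eq_square power3_eq_cube algebra_simps)
    also have "\<dots> \<le> 27 * (m\<^sup>2 * m\<^sup>2 * m\<^sup>2) + 81 * (m\<^sup>2 * m\<^sup>2 * u)"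
    proof -
      define v where "v = m\<^sup>2 * m\<^sup>2 * u"
      have "9 * m\<^sup>2 * u\<^sup>2 \<le> 9 * v" using \<open>9 * m\<^sup>2 * u\<^sup>2 \<le> 9 * m\<^sup>2 * (m\<^sup>2 * u)\<close> by (simp add: v_def mult.assoc)
      moreover have "u ^ 3 \<le> v" "0 \<le> v" using \<open>u ^ 3 \<le> m\<^sup>2 * m\<^sup>2 * u\<close> u by (simp_all add: v_def)
      ultimately show ?thesis unfolding v_def[symmetric] by linarith
    qed
    also have "\<dots> = (3 * m * M) ^ 3"
      unfolding power_mult_distrib M3 u_def by (simp add: power2_eq_square power3_eq_cube algebra_simps)
    finally show "(3 * m\<^sup>2 + h\<^sup>2) ^ 3 \<le> (3 * m * M) ^ 3" by (simp add: u_def)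
  qed (use mh p in auto)
  have "2 * h * (3 * m\<^sup>2 + h\<^sup>2) \<le> 2 * h * (3 * m * M)" using le mh by (intro mult_left_mono) auto
  then have "1 \<le> 3/2 * (4 * m * h) * M" using one by simp
  moreover have "4 * m * h = A\<^sup>2 - B\<^sup>2" by (simp add: m_def h_def power2_eq_square field_simps)
  ultimately have "1 \<le> 3/2 * (A\<^sup>2 - B\<^sup>2) * M" by simp
  then show ?thesis using p unfolding A_def[symmetric] B_def[symmetric] M_def[symmetric] by (simp add: pos_divide_le_eq)
qed

lemma sum_midpoint_third:
  assumes "a \<le> b"
  shows "(\<Sum>p\<in>{a..<b}. 1 / root 3 (real p + 1/2)) \<le> 3/2 * ((root 3 (real b))\<^sup>2 - (root 3 (real a))\<^sup>2)"
  using assms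
proof (induction b rule: dec_induct)
  case (step n)
  then show ?case using midpoint_third[of "real n"] by (simp add: add.commute right_diff_distrib)
qed simp

text \<open>The tangent of the concave function \<open>x\<^sup>2\<^sup>/\<^sup>3\<close>.\<close>

lemma two_thirds_power_shift:
  assumes "3 \<le> x"
  shows "(root 3 (x - 3))\<^sup>2 \<le> (root 3 x)\<^sup>2 - 2 / root 3 x"
proof -
  define A B where "A = root 3 x" and "B = root 3 (x - 3)"
  have c: "A ^ 3 = x" "B ^ 3 = x - 3" by (simp_all add: A_def B_def root3_cube)
  have p: "0 < A" "0 \<le> B" using assms by (auto simp: A_def B_def)
  have "0 \<le> (A - B)\<^sup>2 * (A + 2 * B)" using p by simp
  then have "3 * (B\<^sup>2 * A) \<le> A ^ 3 + 2 * B ^ 3" by (simp add: power2_eq_square power3_eq_cube algebra_simps)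
  then have "B\<^sup>2 * A \<le> A ^ 3 - 2" unfolding c by simp
  also have "A ^ 3 - 2 = (A\<^sup>2 - 2 / A) * A" using p by (simp add: power2_eq_square power3_eq_cube left_diff_distrib)
  finally show ?thesis using p unfolding A_def[symmetric] B_def[symmetric] by (simp add: mult_le_cancel_right_pos)
qed

lemma sum_half_products:
  "(\<Sum>p<m. (real p + 1/2) * (c - (real p + 1/2))) = c * real m ^ 2 / 2 - real m ^ 3 / 3 + real m / 12"
proof (induction m)
  case (Suc m)
  then show ?case by (simp add: power2_eq_square power3_eq_cube field_simps)
qed simp

text \<open>The midpoint rule for \<open>x\<^sup>-\<^sup>7\<^sup>/\<^sup>3\<close>; it makes the tail telescope.\<close>

lemma midpoint_four_thirds:
  assumes "1/2 < x"
  shows "4/3 / root 3 x ^ 7 \<le> 1 / root 3 (x - 1/2) ^ 4 - 1 / root 3 (x + 1/2) ^ 4"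
proof -
  define a b c where "a = root 3 (x - 1/2)" and "b = root 3 (x + 1/2)" and "c = root 3 x"
  have cu: "a ^ 3 = x - 1/2" "b ^ 3 = x + 1/2" "c ^ 3 = x" by (simp_all add: a_def b_def c_def root3_cube)
  have p: "0 < a" "a < b" "0 < c" using assms by (auto simp: a_def b_def c_def)
  define m h where "m = (a + b) / 2" and "h = (b - a) / 2"
  have ab: "a = m - h" "b = m + h" by (simp_all add: m_def h_def field_simps)
  have mh: "0 < h" "h < m" "0 < m" using p by (simp_all add: m_def h_def)
  have one: "2 * h * (3 * m\<^sup>2 + h\<^sup>2) = 1"
  proof -
    have "b ^ 3 - a ^ 3 = 2 * h * (3 * m\<^sup>2 + h\<^sup>2)" unfolding ab by (simp add: power2_eq_square power3_eq_cube algebra_simps)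
    then show ?thesis using cu by simp
  qed
  have mc: "m \<le> c"
  proof (rule cube_leD)
    have "a ^ 3 + b ^ 3 = 2 * (m ^ 3 + 3 * m * h\<^sup>2)" unfolding ab by (simp add: power2_eq_square power3_eq_cube algebra_simps)
    then have "c ^ 3 = m ^ 3 + 3 * m * h\<^sup>2" using cu by simp
    then show "m ^ 3 \<le> c ^ 3" using mh by simp
  qed (use p in simp)
  have ab0: "0 < a * b" using p by simp
  have v: "a * b \<le> m\<^sup>2" unfolding ab by (simp add: power2_eq_square algebra_simps)
  have "4/3 / c ^ 7 \<le> 4/3 / m ^ 7" using mc mh by (intro divide_left_mono power_mono mult_pos_pos) auto
  also have "\<dots> = (4/3 * m) / (m\<^sup>2) ^ 4" using mh by (simp add: eval_nat_numeral)
  also have "\<dots> \<le> (4/3 * m) / (a * b) ^ 4" using v ab0 mh by (intro divide_left_mono power_mono mult_pos_pos) auto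
  also have "\<dots> \<le> (b ^ 4 - a ^ 4) / (a * b) ^ 4"
  proof (rule divide_right_mono)
    have "b ^ 4 - a ^ 4 = 8 * m * h * (m\<^sup>2 + h\<^sup>2)" unfolding ab by (simp add: eval_nat_numeral algebra_simps)
    moreover have "4/3 * m * (2 * h * (3 * m\<^sup>2 + h\<^sup>2)) \<le> 8 * m * h * (m\<^sup>2 + h\<^sup>2)"
    proof -
      have "4/3 * m * (2 * h * (3 * m\<^sup>2 + h\<^sup>2)) = 8 * m * h * (m\<^sup>2 + h\<^sup>2 / 3)" by (simp add: algebra_simps)
      also have "\<dots> \<le> 8 * m * h * (m\<^sup>2 + h\<^sup>2)" using mh by (intro mult_left_mono) auto
      finally show ?thesis .
    qed
    ultimately show "4/3 * m \<le> b ^ 4 - a ^ 4" unfolding one by simp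
  qed (use ab0 in simp)
  also have "\<dots> = 1 / a ^ 4 - 1 / b ^ 4" using p by (simp add: diff_divide_distrib power_mult_distrib)
  finally show ?thesis by (simp add: a_def b_def c_def)
qed

text \<open>With the shift \<open>128/100\<close>, slightly less than the mean 9/7 of the shifts 0, 1, 1, 1, 2, 2, 2, the seventh power
of \<open>j + 128/100\<close> is at most \<open>j (j + 1)\<^sup>3 (j + 2)\<^sup>3\<close>.\<close>

lemma tail_weight:
  assumes "71 \<le> j"
  shows "1 / (root 3 j * ((j + 1) * (j + 2))) \<le> 3/4 * (1 / root 3 (j + 78/100) ^ 4 - 1 / root 3 (j + 178/100) ^ 4)"
proof -
  define c where "c = root 3 (j + 128/100)"
  have c0: "0 < c" using assms by (simp add: c_def)
  have c3: "c ^ 3 = j + 128/100" by (simp add: c_def root3_cube)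
  have "c ^ 7 \<le> root 3 j * ((j + 1) * (j + 2))"
  proof (rule cube_leD)
    \<comment> \<open>As a polynomial in u, the difference has positive coefficients only.\<close>
    define u where "u = j - 71"
    have u: "0 \<le> u" "j = 71 + u" using assms by (simp_all add: u_def)
    have "(c ^ 7) ^ 3 = (c ^ 3) ^ 7" by (simp add: power_mult[symmetric])
    also have "\<dots> = (j + 128/100) ^ 7" unfolding c3 ..
    also have "\<dots> \<le> j * ((j + 1) * (j + 2)) ^ 3"
    proof -
      have "25 ^ 7 * ((71 + u) * ((72 + u) * (73 + u)) ^ 3) - (25 * u + 1807) ^ 7
        = 14111726229848519057 + u * (1458756509834181425 + u * (60380799551908125 + u * (1296695145937500 + u * (15349900390625 + u * (95419921875 + u * (244140625))))))"
        by (simp add: eval_nat_numeral algebra_simps)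
      moreover have "0 \<le> 14111726229848519057 + u * (1458756509834181425 + u * (60380799551908125 + u * (1296695145937500 + u * (15349900390625 + u * (95419921875 + u * (244140625))))))"
        using u(1) by (intro add_nonneg_nonneg mult_nonneg_nonneg) auto
      ultimately have "(25 * u + 1807) ^ 7 \<le> 25 ^ 7 * ((71 + u) * ((72 + u) * (73 + u)) ^ 3)" by linarith
      moreover have "25 * u + 1807 = 25 * (j + 128/100)" "71 + u = j" "72 + u = j + 1" "73 + u = j + 2" using u(2) by simp_all
      ultimately have "25 ^ 7 * (j + 128/100) ^ 7 \<le> 25 ^ 7 * (j * ((j + 1) * (j + 2)) ^ 3)" by (simp only: power_mult_distrib)
      then show ?thesis by (simp only: mult_le_cancel_left_pos zero_less_power zero_less_numeral)
    qed
    also have "\<dots> = (root 3 j * ((j + 1) * (j + 2))) ^ 3" by (simp add: power_mult_distrib root3_cube)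
    finally show "(c ^ 7) ^ 3 \<le> (root 3 j * ((j + 1) * (j + 2))) ^ 3" .
  qed (use assms in simp)
  then have "1 / (root 3 j * ((j + 1) * (j + 2))) \<le> 1 / c ^ 7" using c0 by (intro divide_left_mono mult_pos_pos) (use assms in auto)
  also have "\<dots> = 3/4 * (4/3 / c ^ 7)" by simp
  also have "\<dots> \<le> 3/4 * (1 / root 3 (j + 78/100) ^ 4 - 1 / root 3 (j + 178/100) ^ 4)"
  proof (rule mult_left_mono)
    have E: "j + 128/100 - 1/2 = j + 78/100" "j + 128/100 + 1/2 = j + 178/100" by simp_all
    have "1/2 < j + 128/100" using assms by simp
    from midpoint_four_thirds[OF this]
    show "4/3 / c ^ 7 \<le> 1 / root 3 (j + 78/100) ^ 4 - 1 / root 3 (j + 178/100) ^ 4"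
      unfolding E c_def .
  qed simp
  finally show ?thesis .
qed

text \<open>Here 46541/100000 is just above \<open>(9/128 / .6975)\<^sup>1\<^sup>/\<^sup>3\<close>.\<close>

lemma toll_low_root_le:
  fixes p q :: nat
  assumes pq: "3 \<le> p" "3 \<le> q" and st: "root_of_size p s" "root_of_size q t"
  defines "j \<equiv> real p + real q + 1"
  shows "toll s t \<le> 46541/100000 * (1 / root 3 (real p + 1/2) + 1 / root 3 (real q + 1/2) - 968/1000 / root 3 j
    + 16/100 * ((real p + 1/2) * (real q + 1/2)) / (j\<^sup>2 * root 3 j))"
proof -
  define x y where "x = real p + 1/2" and "y = real q + 1/2"
  have xy: "0 < x" "0 < y" "x + y = j" using pq by (simp_all add: x_def y_def j_def)
  then have j0: "0 < j" by linarith
  define r X Y where "r = root 3 j" and "X = root 3 (x / j)" and "Y = root 3 (y / j)"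
  have cu: "r ^ 3 = j" "X ^ 3 = x / j" "Y ^ 3 = y / j" by (simp_all add: r_def X_def Y_def root3_cube)
  have p: "0 < r" "0 < X" "0 < Y" using xy j0 by (auto simp: r_def X_def Y_def)
  interpret positive_pair "low_root p" "low_root q" by unfold_locales (use pq in \<open>auto simp: low_root_def\<close>)
  have lo: "low_root p = 6975/10000 * x" "low_root q = 6975/10000 * y" using pq by (simp_all add: low_root_def x_def y_def)
  have XY: "X ^ 3 + Y ^ 3 = 1" unfolding cu using xy j0 by (simp add: add_divide_distrib[symmetric])
  have "toll s t \<le> toll (low_root p) (low_root q)"
    using st by (intro toll_antimono low_root_le low_root_nonneg)
  also have "\<dots> \<le> 46541/100000 * (1 / (X * Y) / r)"
  proof (rule toll_le_cube_root)
    have "hm = 10000/6975 * (j / (x * y))" unfolding hm_eq unfolding lo distrib_left[symmetric] xy(3) using xy by simp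
    moreover have "(46541/100000 * (1 / (X * Y) / r)) ^ 3 = (46541/100000) ^ 3 * (j / (x * y))"
      unfolding power_mult_distrib power_divide cu using xy j0 by (simp add: field_simps)
    moreover have "9/128 * (10000/6975 * (j / (x * y))) \<le> (46541/100000) ^ 3 * (j / (x * y))"
    proof -
      have "(9/128 * (10000/6975)) * (j / (x * y)) \<le> (46541/100000) ^ 3 * (j / (x * y))"
        using xy j0 by (intro mult_right_mono) (auto simp: power3_eq_cube)
      then show ?thesis by (simp only: mult.assoc)
    qed
    ultimately show "9/128 * hm \<le> (46541/100000 * (1 / (X * Y) / r)) ^ 3" by (simp only:)
  qed (use p in simp)
  also have "\<dots> \<le> 46541/100000 * ((1 / X + 1 / Y - 968/1000 + 16/100 * (X * Y) ^ 3) / r)"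
    using beta_density_bound[OF p(2,3) XY] p by (intro mult_left_mono divide_right_mono) auto
  also have "(1 / X + 1 / Y - 968/1000 + 16/100 * (X * Y) ^ 3) / r
    = 1 / root 3 x + 1 / root 3 y - 968/1000 / r + 16/100 * (x * y) / (j\<^sup>2 * r)"
  proof -
    have "X = root 3 x / r" "Y = root 3 y / r" by (simp_all add: X_def Y_def r_def real_root_divide)
    then have "1 / X / r = 1 / root 3 x" "1 / Y / r = 1 / root 3 y" using p by simp_all
    moreover have "16/100 * (X * Y) ^ 3 / r = 16/100 * (x * y) / (j\<^sup>2 * r)"
      unfolding power_mult_distrib cu by (simp add: power2_eq_square)
    ultimately show ?thesis unfolding add_divide_distrib diff_divide_distrib by (simp only:)
  qed
  finally show ?thesis by (simp only: x_def y_def r_def)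
qed

lemma sum_reverse_middle: "(\<Sum>p\<in>{3..<n - 2}. f (n - p)) = (\<Sum>p\<in>{3..<n - 2}. f p)" for f :: "nat \<Rightarrow> real"
  by (rule sum.reindex_bij_witness[of _ "\<lambda>p. n - p" "\<lambda>p. n - p"]) auto

text \<open>The sum over \<open>p\<close> of \<open>toll_low_root_le\<close>, a Riemann sum for a Beta integral. The gain of shortening the range by three terms at
either end outweighs the terms \<open>.968\<close> that are lost with them.\<close>

lemma mean_toll_middle:
  assumes n: "70 \<le> n"
  defines "j \<equiv> real n + 1"
  shows "(\<Sum>p\<in>{3..<n - 2}. pair_mean p (n - p) toll)
    \<le> 46541/100000 * ((3 - 968/1000 + 16/600) * (root 3 j)\<^sup>2 - 3 * (root 3 3)\<^sup>2)"
proof -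
  define r where "r = root 3 j"
  have j: "71 \<le> j" using n by (simp add: j_def)
  have r0: "0 < r" "r ^ 3 = j" using j by (simp_all add: r_def root3_cube)
  let ?K = "46541/100000 :: real"
  let ?x = "\<lambda>p. real p + 1/2"
  define A B where "A = (\<Sum>p\<in>{3..<n - 2}. 1 / root 3 (?x p))" and "B = (\<Sum>p\<in>{3..<n - 2}. ?x p * (j - ?x p))"
  have "(\<Sum>p\<in>{3..<n - 2}. pair_mean p (n - p) toll)
    \<le> (\<Sum>p\<in>{3..<n - 2}. ?K * (1 / root 3 (?x p) + 1 / root 3 (?x (n - p)) - 968/1000 / r + 16/100 / (j\<^sup>2 * r) * (?x p * (j - ?x p))))"
  proof (rule sum_mono)
    fix p assume p: "p \<in> {3..<n - 2}"
    then have jp: "real p + real (n - p) + 1 = j" "?x (n - p) = j - ?x p" by (auto simp: j_def of_nat_diff)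
    have "pair_mean p (n - p) toll \<le> pair_mean p (n - p) (\<lambda>_ _. ?K * (1 / root 3 (?x p) + 1 / root 3 (?x (n - p)) - 968/1000 / root 3 j
      + 16/100 * (?x p * ?x (n - p)) / (j\<^sup>2 * root 3 j)))"
    proof (rule pair_mean_mono)
      fix s t assume "root_of_size p s" "root_of_size (n - p) t"
      then show "toll s t \<le> ?K * (1 / root 3 (?x p) + 1 / root 3 (?x (n - p)) - 968/1000 / root 3 j
      + 16/100 * (?x p * ?x (n - p)) / (j\<^sup>2 * root 3 j))"
        using toll_low_root_le[of p "n - p" s t] p unfolding jp(1) by auto
    qed
    then show "pair_mean p (n - p) toll \<le> ?K * (1 / root 3 (?x p) + 1 / root 3 (?x (n - p)) - 968/1000 / r + 16/100 / (j\<^sup>2 * r) * (?x p * (j - ?x p)))"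
      unfolding pair_mean_const jp(2) r_def by simp
  qed
  also have "\<dots> = ?K * (A + A - (real n - 5) * (968/1000 / r) + 16/100 / (j\<^sup>2 * r) * B)"
    unfolding sum_distrib_left[symmetric] sum.distrib sum_subtractf sum_reverse_middle[of "\<lambda>p. 1 / root 3 (?x p)"] A_def B_def
    using n by (simp add: of_nat_diff)
  also have "\<dots> \<le> ?K * ((3 - 968/1000 + 16/600) * r\<^sup>2 - 3 * (root 3 3)\<^sup>2)"
  proof (rule mult_left_mono)
    have A1: "A \<le> 3/2 * ((root 3 (j - 3))\<^sup>2 - (root 3 3)\<^sup>2)"
      using sum_midpoint_third[of 3 "n - 2"] n unfolding A_def j_def by (simp add: of_nat_diff add.commute)
    have A2: "(root 3 (j - 3))\<^sup>2 \<le> r\<^sup>2 - 2 / r" using two_thirds_power_shift[of j] j by (simp add: r_def)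
    have B1: "B \<le> j ^ 3 / 6"
    proof -
      have "{3..<n - 2} \<subseteq> {..<n - 2}" by auto
      then have "B \<le> (\<Sum>p<n - 2. ?x p * (j - ?x p))" unfolding B_def
        by (intro sum_mono2 mult_nonneg_nonneg) (auto simp: j_def)
      also have "\<dots> = j * (j - 3)\<^sup>2 / 2 - (j - 3) ^ 3 / 3 + (j - 3) / 12"
        unfolding sum_half_products using n by (simp add: j_def of_nat_diff)
      also have "\<dots> \<le> j ^ 3 / 6" using j by (simp add: power2_eq_square power3_eq_cube field_simps)
      finally show ?thesis .
    qed
    have "16/100 / (j\<^sup>2 * r) * B \<le> 16/100 / (j\<^sup>2 * r) * (j ^ 3 / 6)" using B1 r0 by (intro mult_left_mono) auto
    also have "\<dots> = 16/600 * (j / r)" using j r0(1) by (simp add: power2_eq_square power3_eq_cube)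
    finally have B2: "16/100 / (j\<^sup>2 * r) * B \<le> 16/600 * (j / r)" .
    have jr: "j / r = r\<^sup>2" unfolding r0(2)[symmetric] using r0(1) by (simp add: power2_eq_square power3_eq_cube)
    have n5: "(real n - 5) * (968/1000 / r) = 968/1000 * (j / r) - 6 * 968/1000 * (1 / r)"
      using r0(1) by (simp add: j_def field_simps)
    \<comment> \<open>All terms are multiples of R, R3 and w; the coefficient of w is 6 * .968 - 6 < 0.\<close>
    define w where "w = 1 / r"
    have w: "0 < w" "2 / r = 2 * w" using r0 by (simp_all add: w_def)
    show "A + A - (real n - 5) * (968/1000 / r) + 16/100 / (j\<^sup>2 * r) * B \<le> (3 - 968/1000 + 16/600) * r\<^sup>2 - 3 * (root 3 3)\<^sup>2"
    proof -
      define R R3 Q where "R = r\<^sup>2" and "R3 = (root 3 3 :: real)\<^sup>2" and "Q = (root 3 (j - 3))\<^sup>2"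
      have "A \<le> 3/2 * Q - 3/2 * R3" "Q \<le> R - 2 * w" using A1 A2 w unfolding R_def R3_def Q_def by simp_all
      moreover have "16/100 / (j\<^sup>2 * r) * B \<le> 16/600 * R" using B2 unfolding jr R_def .
      moreover have "(real n - 5) * (968/1000 / r) = 968/1000 * R - 6 * 968/1000 * w" unfolding n5 jr R_def w_def ..
      moreover have "(3 - 968/1000 + 16/600) * R = 3 * R - 968/1000 * R + 16/600 * R" by (simp only: algebra_simps)
      ultimately show ?thesis unfolding R_def[symmetric] R3_def[symmetric] using w(1) by linarith
    qed
  qed simp
  finally show ?thesis by (simp only: r_def)
qed

lemma pair_mean_le: "(\<And>s t. root_of_size p s \<Longrightarrow> root_of_size q t \<Longrightarrow> toll s t \<le> c) \<Longrightarrow> pair_mean p q toll \<le> c"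
  using pair_mean_mono[of p q toll "\<lambda>_ _. c"] by (simp add: pair_mean_const)

text \<open>The three end terms on either side contribute \<open>2.8982\<close>, less than the constant \<open>3 * .46541 * 3\<^sup>2\<^sup>/\<^sup>3\<close> subtracted in
\<open>mean_toll_middle\<close>, so that only the multiple of \<open>(n + 1)\<^sup>2\<^sup>/\<^sup>3\<close> remains.\<close>

lemma mean_toll_tail:
  assumes n: "70 \<le> n"
  shows "mean_toll n \<le> 9582/10000 / root 3 (real n + 1)"
proof -
  define j r where "j = real n + 1" and "r = root 3 j"
  have r0: "0 < r" "r ^ 3 = j" using n by (simp_all add: r_def j_def root3_cube)
  define h where "h p = pair_mean p (n - p) toll" for p
  have e: "toll s t \<le> 70883/100000" if "root_of_size 0 s" "root_of_size q t" "68 \<le> q" for q s t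
    using end_toll_le(1)[OF that(3,2)] root_of_size_0[OF that(1)] by simp
  have e1: "toll s t \<le> 40092/100000" if "root_of_size 1 s" "root_of_size q t" "68 \<le> q" for q s t
    using end_toll_le(2)[OF that(3,2)] root_of_size_1[OF that(1)] by simp
  have e2: "toll s t \<le> 33935/100000" if "root_of_size 2 s" "root_of_size q t" "68 \<le> q" for q s t
  proof -
    have "toll s t \<le> toll (177374/100000) t"
      using low_root_le[OF that(1)] root_of_size_nonneg[OF that(2)] unfolding low_root_small by (intro toll_antimono) auto
    then show ?thesis using end_toll_le(3)[OF that(3,2)] by simp
  qed
  have ends: "h 0 \<le> 70883/100000" "h 1 \<le> 40092/100000" "h 2 \<le> 33935/100000"
    unfolding h_def by (rule pair_mean_le, rule e e1 e2, assumption, assumption, use n in simp)+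
  have ends': "h n \<le> 70883/100000" "h (n - 1) \<le> 40092/100000" "h (n - 2) \<le> 33935/100000"
  proof -
    have "n - n = 0" "n - (n - 1) = 1" "n - (n - 2) = 2" using n by auto
    then show "h n \<le> 70883/100000" "h (n - 1) \<le> 40092/100000" "h (n - 2) \<le> 33935/100000"
      unfolding h_def
      by (simp_all only:) (rule pair_mean_le, subst toll_commute, rule e e1 e2, assumption, assumption, use n in simp)+
  qed
  have "{..n} = {0, 1, 2, n - 2, n - 1, n} \<union> {3..<n - 2}" using n by auto
  then have "(\<Sum>p\<le>n. h p) = (\<Sum>p\<in>{0, 1, 2, n - 2, n - 1, n}. h p) + (\<Sum>p\<in>{3..<n - 2}. h p)"
    using n by (simp only:, subst sum.union_disjoint) auto
  also have "(\<Sum>p\<in>{0, 1, 2, n - 2, n - 1, n}. h p) = h 0 + (h 1 + (h 2 + (h (n - 2) + (h (n - 1) + h n))))"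
  proof -
    have "0 \<notin> {1, 2, n - 2, n - 1, n}" "1 \<notin> {2, n - 2, n - 1, n}" "2 \<notin> {n - 2, n - 1, n}" "n - 2 \<notin> {n - 1, n}" "n - 1 \<notin> {n}"
      using n by auto
    then show ?thesis by (simp only: sum.insert finite_insert finite.emptyI sum.empty add_0_right simp_thms empty_iff)
  qed
  finally have "(\<Sum>p\<le>n. h p) \<le> 289820/100000 + (\<Sum>p\<in>{3..<n - 2}. h p)" using ends ends' by linarith
  also have "\<dots> \<le> 289820/100000 + 46541/100000 * ((3 - 968/1000 + 16/600) * r\<^sup>2 - 3 * (root 3 3)\<^sup>2)"
    using mean_toll_middle[OF n] unfolding h_def r_def j_def by simp
  also have "\<dots> \<le> 9582/10000 * r\<^sup>2"
  proof -
    have "1442/1000 \<le> root 3 (3::real)" by (rule cube_leD, unfold root3_cube) (simp_all add: power3_eq_cube)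
    then have "(1442/1000)\<^sup>2 \<le> (root 3 (3::real))\<^sup>2" by (intro power_mono) auto
    then have "20793/10000 \<le> (root 3 (3::real))\<^sup>2" by (simp add: power2_eq_square)
    moreover have "0 \<le> r\<^sup>2" by simp
    moreover have "46541/100000 * ((3 - 968/1000 + 16/600) * x - 3 * y) = 71859304/75000000 * x - 139623/100000 * y" for x y :: real
      by (simp add: algebra_simps diff_divide_distrib)
    ultimately show ?thesis by (simp only:)
  qed
  finally have le: "(\<Sum>p\<le>n. h p) \<le> 9582/10000 * r\<^sup>2" .
  have "mean_toll n = (\<Sum>p\<le>n. h p) / j" by (simp add: mean_toll_def h_def j_def add.commute)
  also have "\<dots> \<le> 9582/10000 * r\<^sup>2 / j" using le by (intro divide_right_mono) (auto simp: j_def)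
  also have "\<dots> = 9582/10000 / r" unfolding r0(2)[symmetric] using r0(1) by (simp add: power2_eq_square power3_eq_cube)
  finally show ?thesis by (simp only: r_def j_def)
qed

lemma share_tail:
  assumes n: "70 \<le> n"
  defines "D \<equiv> \<lambda>x. 1 / root 3 (x + 178/100) ^ 4"
  shows "level_share n \<le> 14373/10000 * (D (real n) - D (real (Suc n)))"
proof -
  define j where "j = real n + 1"
  have j: "71 \<le> j" using n by (simp add: j_def)
  have "level_share n = 2 * (mean_toll n / ((j + 1) * (j + 2)))" by (simp add: j_def add.commute)
  also have "\<dots> \<le> 2 * (9582/10000 / root 3 j / ((j + 1) * (j + 2)))"
    using mean_toll_tail[OF n] j by (intro mult_left_mono divide_right_mono) (auto simp: j_def)
  also have "\<dots> = 19164/10000 * (1 / (root 3 j * ((j + 1) * (j + 2))))" by simp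
  also have "\<dots> \<le> 19164/10000 * (3/4 * (1 / root 3 (j + 78/100) ^ 4 - 1 / root 3 (j + 178/100) ^ 4))"
    using tail_weight[OF j] by (rule mult_left_mono) simp
  also have "\<dots> = 14373/10000 * (D (real n) - D (real (Suc n)))"
    by (simp add: D_def j_def add.commute add.left_commute)
  finally show ?thesis .
qed

text \<open>The first 70 terms come from the tables, and the tail telescopes by \<open>share_tail\<close>.\<close>

lemma typ_rate_le: "typ_rate \<le> 706873/1000000"
proof -
  define D where "D x = 1 / root 3 (x + 178/100) ^ 4" for x :: real
  have D0: "0 \<le> D (real n)" for n unfolding D_def by simp
  have tail: "(\<Sum>n\<in>{70..<70 + m}. level_share n) \<le> 14373/10000 * (D 70 - D (real (70 + m)))" for m
  proof (induction m)
    case (Suc m)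
    have "level_share (70 + m) \<le> 14373/10000 * (D (real (70 + m)) - D (real (Suc (70 + m))))"
      unfolding D_def by (rule share_tail) simp
    moreover have "(\<Sum>n\<in>{70..<70 + Suc m}. level_share n) = (\<Sum>n\<in>{70..<70 + m}. level_share n) + level_share (70 + m)"
      by (simp only: add_Suc_right sum.atLeastLessThan_Suc le_add1)
    ultimately show ?case using Suc unfolding right_diff_distrib add_Suc_right by linarith
  qed simp
  have D70: "D 70 \<le> 1/2983 * 10"
  proof -
    have "41559/10000 \<le> root 3 (7178/100 :: real)"
      by (rule cube_leD, unfold root3_cube) (simp_all add: power3_eq_cube)
    then have "(41559/10000) ^ 4 \<le> root 3 (7178/100 :: real) ^ 4" by (intro power_mono) auto
    then have "2983/10 \<le> root 3 (7178/100 :: real) ^ 4" by (simp add: eval_nat_numeral)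
    then have "1 / root 3 (7178/100 :: real) ^ 4 \<le> 1 / (2983/10)" by (intro divide_left_mono) auto
    then show ?thesis by (simp add: D_def)
  qed
  have part: "(\<Sum>n<m. level_share n) \<le> 706873/1000000" for m
  proof -
    have "(\<Sum>n<m. level_share n) \<le> (\<Sum>n<70 + m. level_share n)"
      by (rule sum_mono2) (auto simp: mean_toll_bounds)
    also have "\<dots> = (\<Sum>n<70. level_share n) + (\<Sum>n\<in>{70..<70 + m}. level_share n)"
      by (simp only: lessThan_atLeast0 sum.atLeastLessThan_concat)
    also have "\<dots> \<le> 1/3 + 36871410000 / 10^11 + 14373/10000 * (1/2983 * 10)"
      using head_upper tail[of m, unfolded right_diff_distrib] D70 D0[of "70 + m"] by linarith
    finally show ?thesis by simp
  qed
  have "typ_rate = (\<Sum>n. level_share n)" unfolding typ_rate_def by (rule suminf_mult[OF mean_toll_summable, symmetric])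
  also have "\<dots> \<le> 706873/1000000"
    by (rule suminf_le_const[OF summable_mult[OF mean_toll_summable] part])
  finally show ?thesis .
qed

section \<open>The three constants\<close>
theorem theorem1p5:
  fixes M :: "'a measure" and X :: "nat \<Rightarrow> 'a \<Rightarrow> real"
  assumes "prob_space M"
    and "prob_space.indep_vars M (\<lambda>_. borel) X {1..}"
    and "\<And>i. 1 \<le> i \<Longrightarrow> distr M borel (X i) = uniform_measure lborel {0..1}"
  shows "\<exists>c_minus c_typ c_plus :: real.
    ((\<lambda>k. beta_minus M X k / ennreal (real k ^ 2)) \<longlonglongrightarrow> ennreal c_minus) \<and>
    ((\<lambda>k. beta_typ M X k / ennreal (real k ^ 2)) \<longlonglongrightarrow> ennreal c_typ) \<and>
    ((\<lambda>k. beta_plus M X k / ennreal (real k ^ 2)) \<longlonglongrightarrow> ennreal c_plus) \<and>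
    c_minus < c_typ \<and> c_typ < 1/2 \<and> 1/2 < c_plus \<and>
    1/4 \<le> c_minus \<and> c_minus \<le> 0.48867 \<and>
    0.48934 \<le> c_typ \<and> c_typ \<le> 0.49967 \<and>
    0.50547 \<le> c_plus \<and> c_plus \<le> 0.50568"
proof -
  interpret iid_uniform M X by (intro iid_uniform.intro iid_uniform_axioms.intro assms)
  obtain a where a: "(\<lambda>k. min_root k / real (Suc k)) \<longlonglongrightarrow> a" using min_root_limit by blast
  obtain b where b: "(\<lambda>k. max_root k / real (Suc k)) \<longlonglongrightarrow> b" "\<And>k. max_root k / real (Suc k) \<le> b"
    using max_root_limit by blast
  have sq: "(\<lambda>k. ennreal ((f k)\<^sup>2) / ennreal (real k ^ 2)) \<longlonglongrightarrow> ennreal (c\<^sup>2)"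
    if "(\<lambda>k. f k / real (Suc k)) \<longlonglongrightarrow> c" for f :: "nat \<Rightarrow> real" and c
    by (rule ennreal_ratio_limit) (use tendsto_power[OF that, of 2] in \<open>simp_all add: power_divide\<close>)
  have a_ge: "1/2 \<le> a"
  proof (rule LIMSEQ_le_const[OF a])
    show "\<exists>N. \<forall>k\<ge>N. 1/2 \<le> min_root k / real (Suc k)"
      using min_root_ge_half by (intro exI[of _ 1] allI impI) (simp add: pos_le_divide_eq)
  qed
  have a_le: "a \<le> 139809/200000" by (rule min_root_rate_le[OF a])
  have b_ge: "71096487/100000000 \<le> b"
    using max_root_14335 b(2)[of 14335] by simp
  have b_le: "b \<le> 71111/100000"
  proof (rule LIMSEQ_le_const2[OF b(1)])
    show "\<exists>N. \<forall>k\<ge>N. max_root k / real (Suc k) \<le> 71111/100000"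
      using root_le_linear[OF max_root_attained] by (intro exI[of _ 2] allI impI) (simp add: pos_divide_le_eq)
  qed
  have rate: "69953/100000 \<le> typ_rate" "typ_rate \<le> 706873/1000000" by (rule typ_rate_ge, rule typ_rate_le)
  have sqs: "(1/2)\<^sup>2 \<le> a\<^sup>2" "a\<^sup>2 \<le> (139809/200000)\<^sup>2" "(71096487/100000000)\<^sup>2 \<le> b\<^sup>2" "b\<^sup>2 \<le> (71111/100000)\<^sup>2"
    "(69953/100000)\<^sup>2 \<le> typ_rate\<^sup>2" "typ_rate\<^sup>2 \<le> (706873/1000000)\<^sup>2"
    using a_ge a_le b_ge b_le rate by (intro power_mono; linarith)+
  have bounds: "1/4 \<le> a\<^sup>2" "a\<^sup>2 \<le> 0.48867" "0.50547 \<le> b\<^sup>2" "b\<^sup>2 \<le> 0.50568"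
    "0.48934 \<le> typ_rate\<^sup>2" "typ_rate\<^sup>2 \<le> 0.49967"
    by (rule order_trans[OF _ sqs(1)] order_trans[OF sqs(2)] order_trans[OF _ sqs(3)] order_trans[OF sqs(4)]
      order_trans[OF _ sqs(5)] order_trans[OF sqs(6)], simp add: power2_eq_square)+
  have lims: "(\<lambda>k. beta_minus M X k / ennreal (real k ^ 2)) \<longlonglongrightarrow> ennreal (a\<^sup>2)"
    "(\<lambda>k. beta_typ M X k / ennreal (real k ^ 2)) \<longlonglongrightarrow> ennreal (typ_rate\<^sup>2)"
    "(\<lambda>k. beta_plus M X k / ennreal (real k ^ 2)) \<longlonglongrightarrow> ennreal (b\<^sup>2)"
    unfolding beta_minus_eq beta_typ_eq beta_plus_eq
    by (rule sq[OF a], rule ennreal_ratio_limit[OF E_root_square_limit], simp, rule sq[OF b(1)])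
  show ?thesis
    by (intro exI[of _ "a\<^sup>2"] exI[of _ "typ_rate\<^sup>2"] exI[of _ "b\<^sup>2"] conjI lims bounds) (use bounds in simp_all)
qed

end
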